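(* Let $U\subset\mathbb{R}^n$ be an open neighbourhood of $0$, write $x=(x_1,x')\in\mathbb{R}\times\mathbb{R}^{n-1}$, $D=\frac1i\partial$, and let $$P:=x_1D_{x_1}^2+a(x)D_{x_1}+Q(x,D_{x'}),\qquad x\in U,$$ where $a\in C^\omega(U)$ and $Q(x,D_{x'})=\sum_{|\beta|\le 2}q_\beta(x)D_{x'}^\beta$ is a second order differential operator in the $x'$ variables with coefficients $q_\beta\in C^\omega(U)$ (depending on all of $x$), whose principal symbol $\sum_{|\beta|=2}q_\beta(x)\xi'^\beta$ is real valued and elliptic in $\xi'$ (i.e. nonvanishing for $\xi'\neq0$) for $x\in U$. Then there exists a neighbourhood $U'\subset U$ of $0$ such that $$u\in C^\infty(U),\quad Pu\in C^\omega(U)\ \Longrightarrow\ u\in C^\omega(U').$$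
   Context: $C^\omega$ denotes real analytic functions. No assumption is made on the lower order terms of $P$. *)

theory Defs
  imports "HOL-Analysis.Analysis"
begin

definition pd :: "'n::finite \<Rightarrow> (real^'n \<Rightarrow> complex) \<Rightarrow> real^'n \<Rightarrow> complex" where
  "pd i f x = vector_derivative (\<lambda>t. f (x + t *\<^sub>R axis i 1)) (at 0)"

fun pds :: "'n::finite list \<Rightarrow> (real^'n \<Rightarrow> complex) \<Rightarrow> real^'n \<Rightarrow> complex" where
  "pds [] f = f"
| "pds (i # is) f = pd i (pds is f)"

definition smooth_on :: "(real^'n::finite) set \<Rightarrow> (real^'n \<Rightarrow> complex) \<Rightarrow> bool" where
  "smooth_on U f \<longleftrightarrow>
     (\<forall>is. continuous_on U (pds is f) \<and>
        (\<forall>i. \<forall>x\<in>U. (\<lambda>t. pds is f (x + t *\<^sub>R axis i 1)) differentiable (at 0)))"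

definition real_analytic_on :: "(real^'n::finite) set \<Rightarrow> (real^'n \<Rightarrow> complex) \<Rightarrow> bool" where
  "real_analytic_on U f \<longleftrightarrow>
     (\<forall>x0\<in>U. \<exists>r>0. \<exists>c :: ('n \<Rightarrow> nat) \<Rightarrow> complex.
        \<forall>x\<in>ball x0 r.
          ((\<lambda>\<alpha>. c \<alpha> * (\<Prod>i\<in>UNIV. complex_of_real ((x$i - x0$i) ^ \<alpha> i))) has_sum f x) UNIV)"

definition Dop :: "'n::finite \<Rightarrow> (real^'n \<Rightarrow> complex) \<Rightarrow> real^'n \<Rightarrow> complex" where
  "Dop i f x = (1 / \<i>) * pd i f x"

text \<open>The operator P = x_1 D_1^2 + a D_1 + Q(x, D_x'), where the distinguished coordinate
  x_1 is k0 and Q = sum_{j,k <> k0} q_jk D_j D_k + sum_{j <> k0} b_j D_j + c.\<close>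
definition Pop ::
  "'n::finite \<Rightarrow> (real^'n \<Rightarrow> complex) \<Rightarrow> ('n \<Rightarrow> 'n \<Rightarrow> real^'n \<Rightarrow> complex) \<Rightarrow>
   ('n \<Rightarrow> real^'n \<Rightarrow> complex) \<Rightarrow> (real^'n \<Rightarrow> complex) \<Rightarrow>
   (real^'n \<Rightarrow> complex) \<Rightarrow> real^'n \<Rightarrow> complex" where
  "Pop k0 a q b c u x =
     complex_of_real (x$k0) * Dop k0 (Dop k0 u) x + a x * Dop k0 u x
     + (\<Sum>j\<in>UNIV-{k0}. \<Sum>k\<in>UNIV-{k0}. q j k x * Dop j (Dop k u) x)
     + (\<Sum>j\<in>UNIV-{k0}. b j x * Dop j u x)
     + c x * u x"

definition prin_symbol ::
  "'n::finite \<Rightarrow> ('n \<Rightarrow> 'n \<Rightarrow> real^'n \<Rightarrow> complex) \<Rightarrow> real^'n \<Rightarrow> real^'n \<Rightarrow> complex" where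
  "prin_symbol k0 q x \<xi> = (\<Sum>j\<in>UNIV-{k0}. \<Sum>k\<in>UNIV-{k0}. q j k x * complex_of_real (\<xi>$j * \<xi>$k))"

end

theory Submission
  imports Defs
begin

text \<open>By connectedness of segments the real form \<open>Q\<close> has a constant sign \<open>\<sigma>\<close> near \<open>0\<close>. Let
  \<open>X\<close> be the positive part of \<open>(r\<^sup>2 - \<bar>x'\<bar>\<^sup>2)\<^sup>2 + \<sigma> x\<^sub>1 - 2\<bar>x\<^sub>1\<bar>\<close> on a small lens around \<open>0\<close>.
  Pairing the equation with a first order multiplier weighted by powers of \<open>X\<close> gives an energy
  estimate that controls the tangential derivatives and \<open>\<bar>x\<^sub>1\<bar>\<^sup>1\<^sup>/\<^sup>2 \<partial>\<^sub>1 u\<close> on both sides of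
  \<open>x\<^sub>1 = 0\<close>, whatever the type of the operator there, because the kink makes
  \<open>\<partial>\<^sub>1 X\<close> change sign together with \<open>x\<^sub>1\<close>. Applying \<open>\<partial>\<^sub>1\<^sup>k\<close> to \<open>x\<^sub>1 \<partial>\<^sub>1\<^sup>2\<close> produces the extra term \<open>k \<partial>\<^sub>1\<close>, which for large
  \<open>k\<close> dominates the arbitrary coefficient \<open>a\<close>; derivatives of high order containing a tangential
  one are already controlled. Induction on the order \<open>m\<close> of the derivative yields
  \<open>\<parallel>X\<^sup>m\<^sup>+\<^sup>1 \<partial>\<^sup>\<alpha> u\<parallel> \<le> D K\<^sup>m m!\<close> in \<open>L\<^sup>2\<close>, and a Sobolev inequality turns this into Cauchy estimates on
  \<open>{X > 0}\<close>.\<close>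

text \<open>Across the hyperplane \<open>x $ k0 = 0\<close> the operator passes from elliptic to
  hyperbolic and its normal part degenerates, so no estimate of a single type covers a neighbourhood
  of 0. Pairing with \<open>\<partial>\<^sub>1 v\<close> alone leads to the indefinite form
  \<open>x\<^sub>1 |\<partial>\<^sub>1 v|\<^sup>2 - Q(v)\<close>. Pairing with \<open>v\<close> as
  well contributes \<open>x\<^sub>1 |\<partial>\<^sub>1 v|\<^sup>2 + Q(v)\<close>, and the sum is
  positive if the slope of the weight lies beyond 2 on one side of the hyperplane and between -2 and
  2 on the other; the kink realises 3 and -1. The second obstacle is that the commutator of
  \<open>N\<close> derivatives with \<open>Q\<close> contains \<open>N\<close> terms of the very
  order that is being estimated. They come with a spare power of the weight, which is at most
  \<open>r\<^sup>4\<close>, so a small lens absorbs them. The exponent of the weight grows with the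
  order because differentiating \<open>X\<^sup>2\<^sup>N\<close> produces a factor \<open>N\<close>
  and loses a power of \<open>X\<close>. In the squared estimate \<open>N\<^sup>3\<close> stands
  against \<open>N\<close>: one factor \<open>N\<close> per derivative, hence the factorial.\<close>

section \<open>Partial derivatives along the coordinate axes\<close>

definition hpd :: "'n::finite \<Rightarrow> (real^'n \<Rightarrow> complex) \<Rightarrow> real^'n \<Rightarrow> complex \<Rightarrow> bool" where
  "hpd i f x D \<longleftrightarrow> ((\<lambda>t. f (x + t *\<^sub>R axis i 1)) has_vector_derivative D) (at 0)"

lemma hpd_pd: "(\<lambda>t. f (x + t *\<^sub>R axis i 1)) differentiable (at 0) \<Longrightarrow> hpd i f x (pd i f x)"
  unfolding hpd_def pd_def by (simp add: vector_derivative_works)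

text \<open>\<open>pd\<close> is a total function with an unspecified value where no derivative
  exists. The relation \<open>hpd\<close> carries existence, so the calculus rules are chained
  through it and \<open>pd\<close> is read off only at the end.\<close>

lemma hpd_imp_pd: "hpd i f x D \<Longrightarrow> pd i f x = D"
  unfolding hpd_def pd_def by (rule vector_derivative_at)

lemma hpd_imp_differentiable: "hpd i f x D \<Longrightarrow> (\<lambda>t. f (x + t *\<^sub>R axis i 1)) differentiable (at 0)"
  unfolding hpd_def by (rule differentiableI_vector)

text \<open>Converts a partial derivative at a point of a line into an ordinary derivative of the
  restriction to that line, the form in which the mean value inequality applies.\<close>

lemma hpd_shift:
  assumes "hpd i f (x + s *\<^sub>R axis i 1) D"
  shows "((\<lambda>t. f (x + t *\<^sub>R axis i 1)) has_vector_derivative D) (at s)"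
proof -
  define g where "g = (\<lambda>t. f ((x + s *\<^sub>R axis i 1) + t *\<^sub>R axis i 1))"
  have 1: "((\<lambda>t. t - s) has_vector_derivative 1) (at s)"
    by (auto intro!: derivative_eq_intros)
  have 2: "(g has_vector_derivative D) (at (s - s))"
    using assms unfolding hpd_def g_def by simp
  have "(g \<circ> (\<lambda>t. t - s) has_vector_derivative (1 *\<^sub>R D)) (at s)"
    by (rule vector_diff_chain_at[OF 1 2])
  moreover have "g \<circ> (\<lambda>t. t - s) = (\<lambda>t. f (x + t *\<^sub>R axis i 1))"
    by (rule ext) (simp add: g_def scaleR_diff_left)
  ultimately show ?thesis by simp
qed

lemma hpd_cong:
  assumes "open U" "x \<in> U" "\<And>y. y \<in> U \<Longrightarrow> f y = g y" "hpd i f x D"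
  shows "hpd i g x D"
proof -
  have o: "open ((\<lambda>t::real. x + t *\<^sub>R axis i 1) -` U)"
    by (intro open_vimage assms continuous_intros)
  show ?thesis
    unfolding hpd_def
    by (rule has_vector_derivative_transform_within_open[OF assms(4)[unfolded hpd_def] o])
      (use assms in auto)
qed

text \<open>Valid even at points without a derivative: \<open>vector_derivative\<close> chooses from
  the set of derivatives, and that set depends only on the values near \<open>x\<close>.\<close>

lemma pd_cong:
  assumes "open U" "x \<in> U" "\<And>y. y \<in> U \<Longrightarrow> f y = g y"
  shows "pd i f x = pd i g x"
proof -
  have "((\<lambda>t. f (x + t *\<^sub>R axis i 1)) has_vector_derivative D) (at 0) \<longleftrightarrow>
      ((\<lambda>t. g (x + t *\<^sub>R axis i 1)) has_vector_derivative D) (at 0)" for D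
    using hpd_cong[OF assms(1,2), of f g i D] hpd_cong[OF assms(1,2), of g f i D] assms(3)
    unfolding hpd_def by auto
  then show ?thesis unfolding pd_def vector_derivative_def by simp
qed

lemma pds_cong:
  assumes "open U" "\<And>y. y \<in> U \<Longrightarrow> f y = g y"
  shows "x \<in> U \<Longrightarrow> pds is f x = pds is g x"
proof (induction "is" arbitrary: x)
  case (Cons i "is")
  then show ?case unfolding pds.simps by (intro pd_cong[OF assms(1)])
qed (use assms in simp)

lemma pds_append: "pds (is @ js) f = pds is (pds js f)"
  by (induction "is") auto

lemma hpd_const: "hpd i (\<lambda>x. c) x 0"
  unfolding hpd_def by (auto intro!: derivative_eq_intros)

lemma hpd_add: "hpd i f x D \<Longrightarrow> hpd i g x E \<Longrightarrow> hpd i (\<lambda>x. f x + g x) x (D + E)"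
  unfolding hpd_def by (rule has_vector_derivative_add)

lemma hpd_mult: "hpd i f x D \<Longrightarrow> hpd i g x E \<Longrightarrow> hpd i (\<lambda>x. f x * g x) x (D * g x + f x * E)"
  unfolding hpd_def by (drule (1) has_vector_derivative_mult) (simp add: add.commute)

lemma hpd_cnj: "hpd i f x D \<Longrightarrow> hpd i (\<lambda>x. cnj (f x)) x (cnj D)"
  unfolding hpd_def by (rule has_vector_derivative_cnj)

lemma hpd_sum: "(\<And>p. p \<in> A \<Longrightarrow> hpd i (F p) x (D p)) \<Longrightarrow> hpd i (\<lambda>x. \<Sum>p\<in>A. F p x) x (\<Sum>p\<in>A. D p)"
  unfolding hpd_def by (rule has_vector_derivative_sum)

lemma hpd_sum_list:
  "(\<And>p. p \<in> set L \<Longrightarrow> hpd i (F p) x (D p)) \<Longrightarrow> hpd i (\<lambda>x. \<Sum>p\<leftarrow>L. F p x) x (\<Sum>p\<leftarrow>L. D p)"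
  by (induction L) (auto intro: hpd_const hpd_add)

lemma hpd_coord: "hpd i (\<lambda>x. complex_of_real (x $ k)) x (if i = k then 1 else 0)"
proof -
  have "((\<lambda>t. complex_of_real ((x + t *\<^sub>R axis i 1) $ k)) has_vector_derivative of_real (if i = k then 1 else 0)) (at 0)"
    by (rule has_vector_derivative_of_real) (auto simp: axis_def intro!: derivative_eq_intros)
  then show ?thesis unfolding hpd_def by (auto split: if_splits)
qed

lemma pd_const: "pd i (\<lambda>x. c) = (\<lambda>x. 0)"
  by (rule ext) (rule hpd_imp_pd[OF hpd_const])

lemma pd_coord: "pd i (\<lambda>x. complex_of_real (x $ k)) = (\<lambda>x. if i = k then 1 else 0)"
  by (rule ext) (rule hpd_imp_pd[OF hpd_coord])

subsection \<open>Smooth functions\<close>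

text \<open>Smoothness is the largest class that is closed under \<open>pd\<close> and consists of
  continuous functions with partial derivatives in \<open>U\<close>. Later instances only have to
  name a closed class \<open>P\<close> containing \<open>f\<close>, instead of repeating an
  induction over index lists.\<close>

lemma smooth_on_coinduct:
  assumes P: "P f"
    and cont: "\<And>f. P f \<Longrightarrow> continuous_on U f"
    and diff: "\<And>f i x. P f \<Longrightarrow> x \<in> U \<Longrightarrow> (\<lambda>t. f (x + t *\<^sub>R axis i 1)) differentiable (at 0)"
    and step: "\<And>f i. P f \<Longrightarrow> P (pd i f)"
  shows "smooth_on U f"
proof -
  have "P (pds is f)" for "is"
    by (induction "is") (auto intro: P step)
  then show ?thesis unfolding smooth_on_def by (auto intro: cont diff)
qed

lemma smooth_on_cont: "smooth_on U f \<Longrightarrow> continuous_on U (pds is f)"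
  unfolding smooth_on_def by auto

lemma smooth_on_hpd: "smooth_on U f \<Longrightarrow> x \<in> U \<Longrightarrow> hpd i (pds is f) x (pds (i # is) f x)"
  unfolding smooth_on_def by (auto intro!: hpd_pd)

lemma smooth_on_hpd0: "smooth_on U f \<Longrightarrow> x \<in> U \<Longrightarrow> hpd i f x (pd i f x)"
  using smooth_on_hpd[of U f x i "[]"] by simp

lemma smooth_on_pds: "smooth_on U f \<Longrightarrow> smooth_on U (pds is f)"
  unfolding smooth_on_def by (metis pds_append)

lemma smooth_on_pd: "smooth_on U f \<Longrightarrow> smooth_on U (pd i f)"
  using smooth_on_pds[of U f "[i]"] by simp

lemma smooth_on_cong:
  assumes U: "open U" and f: "smooth_on U f" and eq: "\<And>x. x \<in> U \<Longrightarrow> f x = g x"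
  shows "smooth_on U g"
proof (rule smooth_on_coinduct[where P = "\<lambda>g. \<exists>f. smooth_on U f \<and> (\<forall>x\<in>U. f x = g x)"])
  show "\<exists>f. smooth_on U f \<and> (\<forall>x\<in>U. f x = g x)" using f eq by auto
next
  fix g assume "\<exists>f. smooth_on U f \<and> (\<forall>x\<in>U. f x = g x)"
  then obtain f where f: "smooth_on U f" and eq: "\<And>x. x \<in> U \<Longrightarrow> f x = g x" by auto
  show "continuous_on U g"
    using smooth_on_cont[OF f, of "[]"] eq by (simp cong: continuous_on_cong)
  show "(\<lambda>t. g (x + t *\<^sub>R axis i 1)) differentiable (at 0)" if "x \<in> U" for i x
    by (rule hpd_imp_differentiable[OF hpd_cong[OF U that eq smooth_on_hpd0[OF f that]]])
  show "\<exists>f. smooth_on U f \<and> (\<forall>x\<in>U. f x = pd i g x)" for i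
    by (intro exI[of _ "pd i f"] conjI smooth_on_pd f ballI pd_cong[OF U] eq)
qed

lemma continuous_on_sum_list:
  "(\<And>p. p \<in> set L \<Longrightarrow> continuous_on U (F p)) \<Longrightarrow> continuous_on U (\<lambda>x. \<Sum>p\<leftarrow>L. F p x :: complex)"
  by (induction L) (auto intro: continuous_intros)

text \<open>Products are not closed under differentiation, but finite sums of products are; that
  makes such sums the invariant for the coinduction. Plain products and sums are the cases of one
  and two pairs.\<close>

lemma smooth_on_sum_mult:
  assumes U: "open U"
    and L: "\<And>f g. (f, g) \<in> set L \<Longrightarrow> smooth_on U f \<and> smooth_on U g"
  shows "smooth_on U (\<lambda>x. \<Sum>(f, g)\<leftarrow>L. f x * g x)"
proof (rule smooth_on_coinduct[where
      P = "\<lambda>h. \<exists>L. (\<forall>(f, g)\<in>set L. smooth_on U f \<and> smooth_on U g) \<and> (\<forall>x\<in>U. h x = (\<Sum>(f, g)\<leftarrow>L. f x * g x))"])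
  show "\<exists>L'. (\<forall>(f, g)\<in>set L'. smooth_on U f \<and> smooth_on U g) \<and>
      (\<forall>x\<in>U. (\<Sum>(f, g)\<leftarrow>L. f x * g x) = (\<Sum>(f, g)\<leftarrow>L'. f x * g x))" using L by auto
next
  fix h assume "\<exists>L. (\<forall>(f, g)\<in>set L. smooth_on U f \<and> smooth_on U g) \<and> (\<forall>x\<in>U. h x = (\<Sum>(f, g)\<leftarrow>L. f x * g x))"
  then obtain L where L: "\<And>f g. (f, g) \<in> set L \<Longrightarrow> smooth_on U f \<and> smooth_on U g"
    and h: "\<And>x. x \<in> U \<Longrightarrow> (\<Sum>(f, g)\<leftarrow>L. f x * g x) = h x" by force
  have sm: "smooth_on U (fst p)" "smooth_on U (snd p)" if "p \<in> set L" for p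
    using L[of "fst p" "snd p"] that by auto
  have "continuous_on U (\<lambda>x. \<Sum>p\<leftarrow>L. fst p x * snd p x)"
    using smooth_on_cont[OF sm(1), of _ "[]"] smooth_on_cont[OF sm(2), of _ "[]"]
    by (intro continuous_on_sum_list continuous_on_mult) auto
  then show "continuous_on U h" using h by (simp add: case_prod_unfold cong: continuous_on_cong)
  have *: "hpd i h x (\<Sum>p\<leftarrow>L. pd i (fst p) x * snd p x + fst p x * pd i (snd p) x)" if x: "x \<in> U" for i x
  proof (rule hpd_cong[OF U x h[unfolded case_prod_unfold]])
    show "hpd i (\<lambda>x. \<Sum>p\<leftarrow>L. fst p x * snd p x) x (\<Sum>p\<leftarrow>L. pd i (fst p) x * snd p x + fst p x * pd i (snd p) x)"
      by (intro hpd_sum_list hpd_mult smooth_on_hpd0[OF _ x] sm)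
  qed
  show "(\<lambda>t. h (x + t *\<^sub>R axis i 1)) differentiable (at 0)" if "x \<in> U" for i x
    by (rule hpd_imp_differentiable[OF *[OF that]])
  fix i
  let ?L = "map (\<lambda>p. (pd i (fst p), snd p)) L @ map (\<lambda>p. (fst p, pd i (snd p))) L"
  have "\<forall>x\<in>U. pd i h x = (\<Sum>(f, g)\<leftarrow>?L. f x * g x)"
    by (simp add: hpd_imp_pd[OF *] case_prod_unfold o_def sum_list_addf)
  moreover have "\<forall>(f, g)\<in>set ?L. smooth_on U f \<and> smooth_on U g"
    using sm by (auto intro: smooth_on_pd)
  ultimately show "\<exists>L'. (\<forall>(f, g)\<in>set L'. smooth_on U f \<and> smooth_on U g) \<and> (\<forall>x\<in>U. pd i h x = (\<Sum>(f, g)\<leftarrow>L'. f x * g x))"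
    by blast
qed

lemma smooth_on_const: "smooth_on U (\<lambda>x. c)"
  by (rule smooth_on_coinduct[where P = "\<lambda>f. \<exists>c. f = (\<lambda>x. c)"])
    (auto simp: pd_const intro: hpd_imp_differentiable[OF hpd_const])

lemma smooth_on_mult:
  "open U \<Longrightarrow> smooth_on U f \<Longrightarrow> smooth_on U g \<Longrightarrow> smooth_on U (\<lambda>x. f x * g x)"
  using smooth_on_sum_mult[of U "[(f, g)]"] by auto

lemma smooth_on_add:
  "open U \<Longrightarrow> smooth_on U f \<Longrightarrow> smooth_on U g \<Longrightarrow> smooth_on U (\<lambda>x. f x + g x)"
  using smooth_on_sum_mult[of U "[(f, \<lambda>x. 1), (g, \<lambda>x. 1)]"] smooth_on_const[of U 1] by auto

lemma smooth_on_sum: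
  "open U \<Longrightarrow> (\<And>p. p \<in> A \<Longrightarrow> smooth_on U (F p)) \<Longrightarrow> smooth_on U (\<lambda>x. \<Sum>p\<in>A. F p x)"
  by (induction A rule: infinite_finite_induct) (auto intro: smooth_on_const smooth_on_add)

lemma smooth_on_coord: "smooth_on U (\<lambda>x. complex_of_real (x $ k))"
proof (rule smooth_on_coinduct[where P = "\<lambda>f. (f = (\<lambda>x. complex_of_real (x $ k))) \<or> (\<exists>c. f = (\<lambda>x. c))"])
  show "((\<lambda>x. complex_of_real (x $ k)) = (\<lambda>x. complex_of_real (x $ k))) \<or> (\<exists>c. (\<lambda>x::real^'a. complex_of_real (x $ k)) = (\<lambda>x. c))"
    by simp
next
  fix f :: "real^'a \<Rightarrow> complex" and i
  assume *: "(f = (\<lambda>x. complex_of_real (x $ k))) \<or> (\<exists>c. f = (\<lambda>x. c))"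
  have **: "hpd i (\<lambda>x. complex_of_real (x $ k)) x (if i = k then 1 else 0)" for i x by (rule hpd_coord)
  show "continuous_on U f" using * by (auto intro!: continuous_intros)
  show "(\<lambda>t. f (x + t *\<^sub>R axis i 1)) differentiable (at 0)" for x i
    using * hpd_imp_differentiable[OF **] by auto
  show "(pd i f = (\<lambda>x. complex_of_real (x $ k))) \<or> (\<exists>c. pd i f = (\<lambda>x. c))"
    using * by (auto simp: pd_const pd_coord)
qed

lemma pds_add:
  assumes "open U" "smooth_on U f" "smooth_on U g"
  shows "x \<in> U \<Longrightarrow> pds is (\<lambda>x. f x + g x) x = pds is f x + pds is g x"
proof (induction "is" arbitrary: x)
  case (Cons i "is")
  have "pd i (pds is (\<lambda>x. f x + g x)) x = pd i (\<lambda>x. pds is f x + pds is g x) x"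
    by (rule pd_cong[OF assms(1) Cons.prems]) (rule Cons.IH)
  also have "\<dots> = pds (i # is) f x + pds (i # is) g x"
    by (intro hpd_imp_pd hpd_add smooth_on_hpd[OF assms(2) Cons.prems] smooth_on_hpd[OF assms(3) Cons.prems])
  finally show ?case by simp
qed auto

lemma pds_const: "pds is (\<lambda>x. c) x = (if is = [] then c else 0)"
proof -
  have "pds is (\<lambda>x. c) = (\<lambda>x. if is = [] then c else 0)"
    by (induction "is") (auto simp: pd_const)
  then show ?thesis by simp
qed

lemma pds_sum:
  assumes U: "open U" and F: "\<And>p. p \<in> A \<Longrightarrow> smooth_on U (F p)" and x: "x \<in> U"
  shows "pds is (\<lambda>x. \<Sum>p\<in>A. F p x) x = (\<Sum>p\<in>A. pds is (F p) x)"
  using F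
proof (induction A rule: infinite_finite_induct)
  case (insert a A)
  then show ?case using pds_add[OF U _ _ x, of "F a" "\<lambda>x. \<Sum>p\<in>A. F p x"] smooth_on_sum[OF U, of A F] by auto
qed (auto simp: pds_const)

section \<open>The Leibniz rule over index lists\<close>

text \<open>Distributes positions, not values, over two sublists. Repeated indices are therefore
  listed with multiplicity, and the Leibniz rule holds without multi-index binomial
  coefficients.\<close>

fun splits :: "'a list \<Rightarrow> ('a list \<times> 'a list) list" where
  "splits [] = [([], [])]"
| "splits (i # is) = map (\<lambda>(A, B). (i # A, B)) (splits is) @ map (\<lambda>(A, B). (A, i # B)) (splits is)"

lemma splits_length: "(A, B) \<in> set (splits is) \<Longrightarrow> length A + length B = length is"
  by (induction "is" arbitrary: A B) auto

text \<open>Pascal's rule in list form. It recovers the binomial weights for Leibniz terms that are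
  bounded through the number of derivatives on the first factor alone.\<close>

lemma sum_list_splits:
  "(\<Sum>(A, B)\<leftarrow>splits is. c (length A) :: real) = (\<Sum>j\<le>length is. of_nat (length is choose j) * c j)"
proof (induction "is" arbitrary: c)
  case (Cons i "is")
  let ?N = "length is"
  have "(\<Sum>(A, B)\<leftarrow>splits (i # is). c (length A))
      = (\<Sum>(A, B)\<leftarrow>splits is. c (Suc (length A))) + (\<Sum>(A, B)\<leftarrow>splits is. c (length A))"
    by (simp add: o_def case_prod_unfold)
  also have "\<dots> = (\<Sum>j\<le>?N. of_nat (?N choose j) * c (Suc j)) + (\<Sum>j\<le>?N. of_nat (?N choose j) * c j)"
    using Cons.IH[of "\<lambda>j. c (Suc j)"] Cons.IH[of c] by simp
  also have "(\<Sum>j\<le>?N. of_nat (?N choose j) * c j) = c 0 + (\<Sum>j\<le>?N. of_nat (?N choose Suc j) * c (Suc j))"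
    by (subst sum.atMost_Suc_shift[of "\<lambda>j. of_nat (?N choose j) * c j", symmetric, simplified]) simp
  also have "(\<Sum>j\<le>?N. of_nat (?N choose j) * c (Suc j)) + (c 0 + (\<Sum>j\<le>?N. of_nat (?N choose Suc j) * c (Suc j)))
     = c 0 + (\<Sum>j\<le>?N. of_nat (Suc ?N choose Suc j) * c (Suc j))"
    by (simp add: sum.distrib[symmetric] algebra_simps)
  also have "\<dots> = (\<Sum>j\<le>Suc ?N. of_nat (Suc ?N choose j) * c j)"
    by (subst sum.atMost_Suc_shift) simp
  finally show ?case by simp
qed auto

lemma pds_mult:
  assumes U: "open U" and f: "smooth_on U f" and g: "smooth_on U g"
  shows "x \<in> U \<Longrightarrow> pds is (\<lambda>x. f x * g x) x = (\<Sum>(A, B)\<leftarrow>splits is. pds A f x * pds B g x)"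
proof (induction "is" arbitrary: x)
  case (Cons i "is")
  have "pd i (pds is (\<lambda>x. f x * g x)) x = pd i (\<lambda>x. \<Sum>p\<leftarrow>splits is. pds (fst p) f x * pds (snd p) g x) x"
    by (rule pd_cong[OF U Cons.prems]) (use Cons.IH in \<open>simp add: case_prod_unfold\<close>)
  also have "\<dots> = (\<Sum>p\<leftarrow>splits is. pds (i # fst p) f x * pds (snd p) g x + pds (fst p) f x * pds (i # snd p) g x)"
    by (intro hpd_imp_pd hpd_sum_list hpd_mult smooth_on_hpd[OF f Cons.prems] smooth_on_hpd[OF g Cons.prems])
  finally show ?case by (simp add: o_def case_prod_unfold sum_list_addf)
qed auto

subsection \<open>Symmetry of derivatives and the chain rule\<close>

text \<open>Mean value inequality for the restriction to the axis after its linear part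
  \<open>s *\<^sub>R D\<close> has been subtracted.\<close>

lemma pd_linearization:
  assumes h: "\<And>s. \<bar>s\<bar> \<le> \<bar>t\<bar> \<Longrightarrow> hpd i g (y + s *\<^sub>R axis i 1) (g' s)"
    and b: "\<And>s. \<bar>s\<bar> \<le> \<bar>t\<bar> \<Longrightarrow> norm (g' s - D) \<le> e"
  shows "norm (g (y + t *\<^sub>R axis i 1) - g y - t *\<^sub>R D) \<le> e * \<bar>t\<bar>"
proof -
  define p where "p = (\<lambda>s. g (y + s *\<^sub>R axis i 1) - s *\<^sub>R D)"
  have "norm (p t - p 0) \<le> e * norm (t - 0)"
  proof (rule differentiable_bound[where S = "{- \<bar>t\<bar>..\<bar>t\<bar>}" and f' = "\<lambda>s h. h *\<^sub>R (g' s - D)"])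
    fix s assume s: "s \<in> {- \<bar>t\<bar>..\<bar>t\<bar>}"
    have "(p has_vector_derivative (g' s - 1 *\<^sub>R D)) (at s)"
      unfolding p_def by (intro has_vector_derivative_diff hpd_shift h has_vector_derivative_scaleR
          derivative_eq_intros) (use s in auto)
    then show "(p has_derivative (\<lambda>h. h *\<^sub>R (g' s - D))) (at s within {- \<bar>t\<bar>..\<bar>t\<bar>})"
      by (simp add: has_vector_derivative_def has_derivative_at_withinI)
    show "onorm (\<lambda>h. h *\<^sub>R (g' s - D)) \<le> e"
    proof (rule onorm_le)
      have "norm (g' s - D) \<le> e" using b[of s] s by auto
      then show "norm (h *\<^sub>R (g' s - D)) \<le> e * norm h" for h
        by (simp add: mult.commute[of e] mult_left_mono)
    qed
  qed auto
  then show ?thesis by (simp add: p_def algebra_simps)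
qed

lemma pd_commute:
  assumes U: "open U" and f: "smooth_on U f" and x: "x \<in> U"
  shows "pd i (pd j f) x = pd j (pd i f) x"
proof (rule ccontr)
  assume ne: "pd i (pd j f) x \<noteq> pd j (pd i f) x"
  \<comment> \<open>A third of the gap: both mixed partials approximate the same second difference
    over a square of side \<open>s\<close> within \<open>e * s * s\<close>, which bounds the gap by
    \<open>2 * e\<close> while it equals \<open>3 * e\<close>.\<close>
  define e where "e = norm (pd i (pd j f) x - pd j (pd i f) x) / 3"
  have e: "e > 0" using ne by (simp add: e_def)
  have near: "\<exists>d>0. \<forall>y. dist y x < d \<longrightarrow> y \<in> U \<and> norm (pd i (pd j f) y - pd i (pd j f) x) \<le> e" for i j
  proof -
    have "continuous_on U (pd i (pd j f))" using smooth_on_cont[OF f, of "[i, j]"] by simp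
    then have "isCont (pd i (pd j f)) x" using U x by (simp add: continuous_on_eq_continuous_at)
    then obtain d1 where d1: "d1 > 0" "\<And>y. dist y x < d1 \<Longrightarrow> dist (pd i (pd j f) y) (pd i (pd j f) x) < e"
      using e unfolding continuous_at_eps_delta by blast
    obtain d2 where d2: "d2 > 0" "\<And>y. dist y x < d2 \<Longrightarrow> y \<in> U" using U x open_dist by blast
    show ?thesis using d1 d2 by (intro exI[of _ "min d1 d2"]) (auto simp: dist_norm less_imp_le)
  qed
  have main: "\<exists>d>0. \<forall>s t. \<bar>s\<bar> + \<bar>t\<bar> < d \<longrightarrow>
     norm (f (x + s *\<^sub>R axis i 1 + t *\<^sub>R axis j 1) - f (x + s *\<^sub>R axis i 1) - f (x + t *\<^sub>R axis j 1) + f x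
        - (s * t) *\<^sub>R pd j (pd i f) x) \<le> e * \<bar>s\<bar> * \<bar>t\<bar>" for i j
  proof -
    obtain d where d: "d > 0" "\<And>y. dist y x < d \<Longrightarrow> y \<in> U"
      "\<And>y. dist y x < d \<Longrightarrow> norm (pd j (pd i f) y - pd j (pd i f) x) \<le> e" using near[of j i] by blast
    have in_d: "dist (x + s' *\<^sub>R axis i 1 + t' *\<^sub>R axis j 1) x < d"
      if "\<bar>s\<bar> + \<bar>t\<bar> < d" "\<bar>s'\<bar> \<le> \<bar>s\<bar>" "\<bar>t'\<bar> \<le> \<bar>t\<bar>" for s t s' t'
    proof -
      have "norm (s' *\<^sub>R axis i 1 + t' *\<^sub>R axis j 1 :: real^'a) \<le> \<bar>s'\<bar> + \<bar>t'\<bar>"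
        by (rule order_trans[OF norm_triangle_ineq]) (simp add: norm_axis_1)
      then show ?thesis using that by (simp add: dist_norm add.assoc)
    qed
    have "norm (f (x + s *\<^sub>R axis i 1 + t *\<^sub>R axis j 1) - f (x + s *\<^sub>R axis i 1) - f (x + t *\<^sub>R axis j 1) + f x
        - (s * t) *\<^sub>R pd j (pd i f) x) \<le> e * \<bar>s\<bar> * \<bar>t\<bar>" if st: "\<bar>s\<bar> + \<bar>t\<bar> < d" for s t
    proof -
      \<comment> \<open>The second difference is read as the first difference in direction
        \<open>i\<close> of the increment in direction \<open>j\<close>, so the mean value
        inequality is used once in each direction.\<close>
      let ?g = "\<lambda>y. f (y + t *\<^sub>R axis j 1) - f y"
      let ?g' = "\<lambda>s. pd i f (x + s *\<^sub>R axis i 1 + t *\<^sub>R axis j 1) - pd i f (x + s *\<^sub>R axis i 1)"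
      have "norm (?g (x + s *\<^sub>R axis i 1) - ?g x - s *\<^sub>R (t *\<^sub>R pd j (pd i f) x)) \<le> (e * \<bar>t\<bar>) * \<bar>s\<bar>"
      proof (rule pd_linearization[where g' = ?g'])
        fix s' assume s': "\<bar>s'\<bar> \<le> \<bar>s\<bar>"
        have "hpd i f (x + s' *\<^sub>R axis i 1 + t *\<^sub>R axis j 1) (pd i f (x + s' *\<^sub>R axis i 1 + t *\<^sub>R axis j 1))"
          by (rule smooth_on_hpd0[OF f d(2)[OF in_d[OF st s']]]) simp
        then have 1: "hpd i (\<lambda>y. f (y + t *\<^sub>R axis j 1)) (x + s' *\<^sub>R axis i 1) (pd i f (x + s' *\<^sub>R axis i 1 + t *\<^sub>R axis j 1))"
          unfolding hpd_def by (simp add: algebra_simps)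
        have 2: "hpd i f (x + s' *\<^sub>R axis i 1) (pd i f (x + s' *\<^sub>R axis i 1))"
          using smooth_on_hpd0[OF f d(2)[OF in_d[OF st s', of 0]]] by simp
        show "hpd i ?g (x + s' *\<^sub>R axis i 1) (?g' s')"
          using 1 2 unfolding hpd_def by (rule has_vector_derivative_diff)
        show "norm (?g' s' - t *\<^sub>R pd j (pd i f) x) \<le> e * \<bar>t\<bar>"
        proof (rule pd_linearization[where g' = "\<lambda>t. pd j (pd i f) (x + s' *\<^sub>R axis i 1 + t *\<^sub>R axis j 1)"])
          fix t' assume t': "\<bar>t'\<bar> \<le> \<bar>t\<bar>"
          show "hpd j (pd i f) (x + s' *\<^sub>R axis i 1 + t' *\<^sub>R axis j 1) (pd j (pd i f) (x + s' *\<^sub>R axis i 1 + t' *\<^sub>R axis j 1))"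
            by (rule smooth_on_hpd0[OF smooth_on_pd[OF f] d(2)[OF in_d[OF st s' t']]])
          show "norm (pd j (pd i f) (x + s' *\<^sub>R axis i 1 + t' *\<^sub>R axis j 1) - pd j (pd i f) x) \<le> e"
            by (rule d(3)[OF in_d[OF st s' t']])
        qed
      qed
      then show ?thesis by (simp add: algebra_simps)
    qed
    then show ?thesis using d(1) by blast
  qed
  obtain d1 where d1: "d1 > 0" "\<And>s t. \<bar>s\<bar> + \<bar>t\<bar> < d1 \<Longrightarrow>
     norm (f (x + s *\<^sub>R axis i 1 + t *\<^sub>R axis j 1) - f (x + s *\<^sub>R axis i 1) - f (x + t *\<^sub>R axis j 1) + f x
        - (s * t) *\<^sub>R pd j (pd i f) x) \<le> e * \<bar>s\<bar> * \<bar>t\<bar>" using main[of i j] by blast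
  obtain d2 where d2: "d2 > 0" "\<And>s t. \<bar>s\<bar> + \<bar>t\<bar> < d2 \<Longrightarrow>
     norm (f (x + s *\<^sub>R axis j 1 + t *\<^sub>R axis i 1) - f (x + s *\<^sub>R axis j 1) - f (x + t *\<^sub>R axis i 1) + f x
        - (s * t) *\<^sub>R pd i (pd j f) x) \<le> e * \<bar>s\<bar> * \<bar>t\<bar>" using main[of j i] by blast
  define s where "s = min d1 d2 / 3"
  have s: "s > 0" "\<bar>s\<bar> + \<bar>s\<bar> < d1" "\<bar>s\<bar> + \<bar>s\<bar> < d2" using d1 d2 by (auto simp: s_def)
  define X where "X = f (x + s *\<^sub>R axis i 1 + s *\<^sub>R axis j 1) - f (x + s *\<^sub>R axis i 1) - f (x + s *\<^sub>R axis j 1) + f x"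
  have a: "norm (X - (s * s) *\<^sub>R pd j (pd i f) x) \<le> e * s * s"
    using d1(2)[OF s(2)] s(1) by (simp add: X_def)
  have b: "norm (X - (s * s) *\<^sub>R pd i (pd j f) x) \<le> e * s * s"
    using d2(2)[OF s(3)] s(1) by (simp add: X_def algebra_simps)
  have "norm ((s * s) *\<^sub>R pd i (pd j f) x - (s * s) *\<^sub>R pd j (pd i f) x) \<le> e * s * s + e * s * s"
    using norm_triangle_le_diff[OF add_mono[OF a b]] by (simp add: algebra_simps norm_minus_commute)
  then have "(s * s) * (3 * e) \<le> (s * s) * (2 * e)"
    by (simp add: scaleR_diff_right[symmetric] e_def abs_mult)
  then show False using s e by (simp add: mult_le_cancel_left_pos)
qed

lemma pds_swap:
  assumes U: "open U" and f: "smooth_on U f" and x: "x \<in> U"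
  shows "pds (i # j # is) f x = pds (j # i # is) f x"
  using pd_commute[OF U smooth_on_pds[OF f] x] by simp

text \<open>Strong induction on the length: permuted lists share a head only after it has been
  carried to the front by adjacent swaps.\<close>

lemma pds_perm:
  assumes U: "open U" and f: "smooth_on U f" and m: "mset is = mset js"
  shows "x \<in> U \<Longrightarrow> pds is f x = pds js f x"
  using m
proof (induction "length is" arbitrary: "is" js x rule: less_induct)
  case less
  show ?case
  proof (cases "is")
    case Nil then show ?thesis using less by simp
  next
    case (Cons i is')
    have "i \<in> set js" using Cons less(3) by (metis list.set_intros(1) mset_eq_setD)
    then obtain A B where js: "js = A @ i # B" by (meson split_list)
    have 1: "pds is f x = pds (i # A @ B) f x"
    proof -
      have "mset is' = mset (A @ B)" using less(3) Cons js by simp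
      then have "pds is' f y = pds (A @ B) f y" if "y \<in> U" for y
        using less(1)[OF _ that, of is' "A @ B"] Cons by simp
      then show ?thesis unfolding Cons pds.simps by (intro pd_cong[OF U less(2)])
    qed
    have "y \<in> U \<Longrightarrow> pds (i # A @ B) f y = pds (A @ i # B) f y" for y
    proof (induction A arbitrary: y)
      case (Cons a A)
      have "pds (i # (a # A) @ B) f y = pds (a # i # A @ B) f y"
        using pds_swap[OF U f Cons.prems] by simp
      also have "\<dots> = pds ((a # A) @ i # B) f y"
        unfolding append_Cons pds.simps(2)[of a] by (intro pd_cong[OF U Cons.prems] Cons.IH)
      finally show ?case .
    qed simp
    then show ?thesis using 1 js less(2) by simp
  qed
qed

lemma vec_eq_sum_axis: "h = (\<Sum>i\<in>UNIV. (h $ i) *\<^sub>R axis i 1)" for h :: "real^'n::finite"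
  by (simp add: vec_eq_iff axis_def if_distrib cong: if_cong)

text \<open>Continuous partial derivatives give total differentiability: \<open>x + h\<close> is
  reached from \<open>x\<close> one axis at a time, and each leg deviates from linearity by at most
  \<open>e / c\<close> times its length. The induction set consists of the coordinates already
  moved.\<close>

lemma pd_chain:
  assumes U: "open U" and f: "smooth_on U f" and x: "x \<in> U"
  shows "(f has_derivative (\<lambda>h. \<Sum>i\<in>UNIV. (h $ i) *\<^sub>R pd i f x)) (at x)"
proof -
  have bl: "bounded_linear (\<lambda>h::real^'a. \<Sum>i\<in>UNIV. (h $ i) *\<^sub>R pd i f x)"
    by (intro bounded_linear_sum bounded_linear_scaleR_const[OF bounded_linear_vec_nth])
  have "\<exists>d>0. \<forall>h. norm h < d \<longrightarrow> norm (f (x + h) - f x - (\<Sum>i\<in>UNIV. (h $ i) *\<^sub>R pd i f x)) \<le> e * norm h"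
    if e: "e > 0" for e
  proof -
    define c where "c = real CARD('a)"
    have c: "c > 0" by (simp add: c_def)
    have near: "\<exists>d>0. \<forall>y. dist y x < d \<longrightarrow> y \<in> U \<and> norm (pd i f y - pd i f x) \<le> e / c" for i
    proof -
      have "continuous_on U (pd i f)" using smooth_on_cont[OF f, of "[i]"] by simp
      then have "isCont (pd i f) x" using U x by (simp add: continuous_on_eq_continuous_at)
      then obtain d1 where d1: "d1 > 0" "\<And>y. dist y x < d1 \<Longrightarrow> dist (pd i f y) (pd i f x) < e / c"
        using e c unfolding continuous_at_eps_delta by (metis divide_pos_pos)
      obtain d2 where d2: "d2 > 0" "\<And>y. dist y x < d2 \<Longrightarrow> y \<in> U" using U x open_dist by blast
      show ?thesis using d1 d2 by (intro exI[of _ "min d1 d2"]) (auto simp: dist_norm less_imp_le)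
    qed
    then obtain dd where dd: "\<And>i. dd i > 0" "\<And>i y. dist y x < dd i \<Longrightarrow> y \<in> U \<and> norm (pd i f y - pd i f x) \<le> e / c"
      by metis
    define d where "d = Min (range dd)"
    have d: "d > 0" "\<And>i. d \<le> dd i" using dd(1) by (auto simp: d_def)
    have "norm (f (x + h) - f x - (\<Sum>i\<in>UNIV. (h $ i) *\<^sub>R pd i f x)) \<le> e * norm h" if h: "norm h < d / c" for h
    proof -
      have hi: "\<bar>h $ i\<bar> \<le> norm h" for i using component_le_norm_cart[of h i] by simp
      have small: "norm (\<Sum>i\<in>S. (g i) *\<^sub>R axis i 1 :: real^'a) < d" if "\<And>i. \<bar>g i\<bar> \<le> \<bar>h $ i\<bar>" for S and g :: "'a \<Rightarrow> real"
      proof -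
        have "norm (\<Sum>i\<in>S. (g i) *\<^sub>R axis i 1 :: real^'a) \<le> (\<Sum>i\<in>S. norm (g i *\<^sub>R axis i 1 :: real^'a))"
          by (rule norm_sum)
        also have "\<dots> \<le> (\<Sum>i\<in>S. norm h)"
          using that hi by (intro sum_mono) (auto simp: norm_axis_1 intro: order_trans)
        also have "\<dots> \<le> c * norm h" by (auto simp: c_def intro!: mult_right_mono card_mono)
        finally show ?thesis using h c by (simp add: field_simps)
      qed
      have "norm (f (x + (\<Sum>i\<in>S. (h $ i) *\<^sub>R axis i 1)) - f x - (\<Sum>i\<in>S. (h $ i) *\<^sub>R pd i f x)) \<le> (\<Sum>i\<in>S. e / c * \<bar>h $ i\<bar>)" for S
      proof (induction S rule: infinite_finite_induct)
        case (insert k S)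
        let ?y = "x + (\<Sum>i\<in>S. (h $ i) *\<^sub>R axis i 1)"
        have in_d: "dist (?y + s *\<^sub>R axis k 1) x < d" if "\<bar>s\<bar> \<le> \<bar>h $ k\<bar>" for s
        proof -
          have "(\<Sum>i\<in>S. (if i = k then s else h $ i) *\<^sub>R axis i 1 :: real^'a) = (\<Sum>i\<in>S. (h $ i) *\<^sub>R axis i 1)"
            using insert(2) by (intro sum.cong) auto
          then show ?thesis
            using small[of "\<lambda>i. if i = k then s else h $ i" "insert k S"] that insert(1,2)
            by (simp add: dist_norm add.commute)
        qed
        have "norm (f (?y + (h $ k) *\<^sub>R axis k 1) - f ?y - (h $ k) *\<^sub>R pd k f x) \<le> e / c * \<bar>h $ k\<bar>"
        proof (rule pd_linearization[where g' = "\<lambda>s. pd k f (?y + s *\<^sub>R axis k 1)"])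
          fix s assume s: "\<bar>s\<bar> \<le> \<bar>h $ k\<bar>"
          have "dist (?y + s *\<^sub>R axis k 1) x < dd k" using in_d[OF s] d(2)[of k] by simp
          then show "hpd k f (?y + s *\<^sub>R axis k 1) (pd k f (?y + s *\<^sub>R axis k 1))"
            "norm (pd k f (?y + s *\<^sub>R axis k 1) - pd k f x) \<le> e / c"
            using dd(2) by (auto intro: smooth_on_hpd0[OF f])
        qed
        then have "norm ((f (?y + (h $ k) *\<^sub>R axis k 1) - f ?y - (h $ k) *\<^sub>R pd k f x)
            + (f ?y - f x - (\<Sum>i\<in>S. (h $ i) *\<^sub>R pd i f x))) \<le> e / c * \<bar>h $ k\<bar> + (\<Sum>i\<in>S. e / c * \<bar>h $ i\<bar>)"
          by (intro norm_triangle_le add_mono insert.IH)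
        then show ?case using insert(1,2) by (simp add: algebra_simps)
      qed auto
      from this[of UNIV] have "norm (f (x + h) - f x - (\<Sum>i\<in>UNIV. (h $ i) *\<^sub>R pd i f x)) \<le> (\<Sum>i\<in>(UNIV::'a set). e / c * \<bar>h $ i\<bar>)"
        by (simp only: vec_eq_sum_axis[symmetric])
      also have "\<dots> \<le> (\<Sum>i\<in>(UNIV::'a set). e / c * norm h)"
        using hi e c by (intro sum_mono mult_left_mono) auto
      also have "\<dots> = e * norm h" using c by (simp add: c_def)
      finally show ?thesis .
    qed
    then show ?thesis using d c by (intro exI[of _ "d / c"]) auto
  qed
  note main = this
  show ?thesis
    unfolding has_derivative_at_alt
  proof (intro conjI bl allI impI)
    fix e :: real assume "e > 0"
    then obtain d where d: "d > 0" "\<And>h. norm h < d \<Longrightarrow> norm (f (x + h) - f x - (\<Sum>i\<in>UNIV. (h $ i) *\<^sub>R pd i f x)) \<le> e * norm h"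
      using main by blast
    show "\<exists>d>0. \<forall>y. norm (y - x) < d \<longrightarrow> norm (f y - f x - (\<Sum>i\<in>UNIV. ((y - x) $ i) *\<^sub>R pd i f x)) \<le> e * norm (y - x)"
      using d(1) d(2)[of "_ - x"] by (intro exI[of _ d]) auto
  qed
qed

subsection \<open>Derivative bounds imply analyticity\<close>

text \<open>Used twice for the Taylor series over index lists: grouping by length compares it with
  the Taylor polynomials, grouping by multiplicities turns it into a power series in
  monomials.\<close>

lemma has_sum_fibres:
  fixes t :: "'a \<Rightarrow> complex"
  assumes fin: "\<And>b. finite (p -` {b})" and t: "(t has_sum S) UNIV"
  shows "((\<lambda>b. sum t (p -` {b})) has_sum S) UNIV"
proof -
  have "(t has_sum S) UNIV = ((\<lambda>(b, a). t a) has_sum S) (Sigma UNIV (\<lambda>b. p -` {b}))"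
    by (rule has_sum_reindex_bij_witness[of _ snd "\<lambda>a. (p a, a)"]) auto
  then have "((\<lambda>(b, a). t a) has_sum S) (Sigma UNIV (\<lambda>b. p -` {b}))" using t by simp
  then show ?thesis
    by (rule has_sum_SigmaD) (use fin in auto)
qed

lemma finite_lists_length: "finite {is :: 'n::finite list. length is = m}"
  using finite_lists_length_eq[of "UNIV :: 'n set" m] by simp

lemma sum_lists_Suc:
  fixes F :: "'n::finite list \<Rightarrow> 'b::comm_monoid_add"
  shows "(\<Sum>is | length is = Suc m. F is) = (\<Sum>is | length is = m. \<Sum>i\<in>UNIV. F (i # is))"
proof -
  have "(\<Sum>is | length is = Suc m. F is) = (\<Sum>(is, i)\<in>{is. length is = m} \<times> UNIV. F (i # is))"
    by (rule sum.reindex_bij_witness[of _ "\<lambda>(is, i). i # is" "\<lambda>is. (tl is, hd is)"])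
      (auto simp: length_Suc_conv)
  then show ?thesis by (simp add: sum.cartesian_product)
qed

lemma sum_lists_prod:
  fixes h :: "'n::finite \<Rightarrow> real"
  shows "(\<Sum>is | length is = m. (\<Prod>i\<leftarrow>is. h i)) = (\<Sum>i\<in>UNIV. h i) ^ m"
proof (induction m)
  case (Suc m)
  have "(\<Sum>is | length is = Suc m. (\<Prod>i\<leftarrow>is. h i))
      = (\<Sum>is | length is = m. (\<Sum>i\<in>UNIV. h i) * (\<Prod>i\<leftarrow>is. h i))"
    by (simp add: sum_lists_Suc sum_distrib_right)
  then show ?case by (simp add: sum_distrib_left[symmetric] Suc)
qed simp

lemma prod_list_count:
  fixes h :: "'n::finite \<Rightarrow> real"
  shows "(\<Prod>i\<leftarrow>is. h i) = (\<Prod>i\<in>UNIV. h i ^ count (mset is) i)"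
proof (induction "is")
  case (Cons a "is")
  have "(\<Prod>i\<in>UNIV. h i ^ count (mset (a # is)) i) = (\<Prod>i\<in>UNIV. (if i = a then h a else 1) * h i ^ count (mset is) i)"
    by (intro prod.cong) auto
  also have "\<dots> = h a * (\<Prod>i\<in>UNIV. h i ^ count (mset is) i)"
    by (simp add: prod.distrib)
  finally show ?case using Cons by simp
qed simp

text \<open>A sum over lists of length \<open>m\<close> with weight \<open>1 / fact m\<close> hides
  the multinomial coefficients: a monomial occurs once per arrangement. The derivatives
  \<open>G m\<close> of the restriction to the segment are then again sums of the same
  shape.\<close>

lemma Taylor_lists:
  assumes U: "open U" and f: "smooth_on U f" and seg: "\<And>t. 0 \<le> t \<Longrightarrow> t \<le> 1 \<Longrightarrow> x0 + t *\<^sub>R h \<in> U"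
    and bd: "\<And>is t. 0 \<le> t \<Longrightarrow> t \<le> 1 \<Longrightarrow> cmod (pds is f (x0 + t *\<^sub>R h)) \<le> C * K ^ length is * fact (length is)"
    and n: "n > 0"
  shows "cmod (f (x0 + h) - (\<Sum>m<n. \<Sum>is | length is = m. (\<Prod>i\<leftarrow>is. h $ i) *\<^sub>R pds is f x0 / fact (length is)))
    \<le> 2 * C * (K * (\<Sum>i\<in>UNIV. \<bar>h $ i\<bar>)) ^ n"
proof -
  define G where "G m t = (\<Sum>is | length is = m. (\<Prod>i\<leftarrow>is. h $ i) *\<^sub>R pds is f (x0 + t *\<^sub>R h))" for m t
  have deriv: "(G m has_vector_derivative G (Suc m) t) (at t)" if t: "0 \<le> t" "t \<le> 1" for m t
  proof -
    have "((\<lambda>t. pds is f (x0 + t *\<^sub>R h)) has_vector_derivative (\<Sum>i\<in>UNIV. (h $ i) *\<^sub>R pds (i # is) f (x0 + t *\<^sub>R h))) (at t)" for "is"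
    proof -
      have "(pds is f has_derivative (\<lambda>k. \<Sum>i\<in>UNIV. (k $ i) *\<^sub>R pd i (pds is f) (x0 + t *\<^sub>R h))) (at (x0 + t *\<^sub>R h))"
        by (rule pd_chain[OF U smooth_on_pds[OF f] seg[OF t]])
      moreover have "((\<lambda>t. x0 + t *\<^sub>R h) has_derivative (\<lambda>s. s *\<^sub>R h)) (at t)"
        by (auto intro!: derivative_eq_intros)
      ultimately have "((\<lambda>t. pds is f (x0 + t *\<^sub>R h)) has_derivative
          (\<lambda>s. \<Sum>i\<in>UNIV. ((s *\<^sub>R h) $ i) *\<^sub>R pd i (pds is f) (x0 + t *\<^sub>R h))) (at t)"
        by (rule has_derivative_compose[rotated])
      then show ?thesis by (simp add: has_vector_derivative_def scaleR_sum_right)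
    qed
    then have "((\<lambda>t. G m t) has_vector_derivative
        (\<Sum>is | length is = m. (\<Prod>i\<leftarrow>is. h $ i) *\<^sub>R (\<Sum>i\<in>UNIV. (h $ i) *\<^sub>R pds (i # is) f (x0 + t *\<^sub>R h)))) (at t)"
      unfolding G_def
      by (intro has_vector_derivative_sum)
        (auto intro!: derivative_eq_intros simp: has_vector_derivative_def)
    moreover have "(\<Sum>is | length is = m. (\<Prod>i\<leftarrow>is. h $ i) *\<^sub>R (\<Sum>i\<in>UNIV. (h $ i) *\<^sub>R pds (i # is) f (x0 + t *\<^sub>R h))) = G (Suc m) t"
      unfolding G_def by (simp add: sum_lists_Suc scaleR_sum_right mult.commute)
    ultimately show ?thesis by simp
  qed
  have Gbd: "cmod (G n t) / fact n \<le> C * (K * (\<Sum>i\<in>UNIV. \<bar>h $ i\<bar>)) ^ n" if t: "0 \<le> t" "t \<le> 1" for t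
  proof -
    have "cmod (G n t) \<le> (\<Sum>is | length is = n. cmod ((\<Prod>i\<leftarrow>is. h $ i) *\<^sub>R pds is f (x0 + t *\<^sub>R h)))"
      unfolding G_def by (rule norm_sum)
    also have "\<dots> \<le> (\<Sum>is | length is = n. (\<Prod>i\<leftarrow>is. \<bar>h $ i\<bar>) * (C * K ^ n * fact n))"
    proof (rule sum_mono)
      fix "is" :: "'a list" assume "is \<in> {is. length is = n}"
      moreover have "\<bar>\<Prod>i\<leftarrow>is. h $ i\<bar> = (\<Prod>i\<leftarrow>is. \<bar>h $ i\<bar>)" for "is" :: "'a list"
        by (induction "is") (auto simp: abs_mult)
      moreover have "0 \<le> (\<Prod>i\<leftarrow>is. \<bar>h $ i\<bar>)" by (induction "is") auto
      ultimately show "cmod ((\<Prod>i\<leftarrow>is. h $ i) *\<^sub>R pds is f (x0 + t *\<^sub>R h)) \<le> (\<Prod>i\<leftarrow>is. \<bar>h $ i\<bar>) * (C * K ^ n * fact n)"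
        using bd[OF t, of "is"] by (auto intro!: mult_left_mono)
    qed
    also have "\<dots> = (\<Sum>i\<in>UNIV. \<bar>h $ i\<bar>) ^ n * (C * K ^ n * fact n)"
      by (simp add: sum_distrib_right[symmetric] sum_lists_prod)
    finally show ?thesis by (simp add: field_simps power_mult_distrib)
  qed
  let ?S = "\<Sum>m<n. G m 0 / fact m"
  have G0: "G 0 1 = f (x0 + h)" by (simp add: G_def)
  \<comment> \<open>The Lagrange remainder exists for real functions only, at a point depending on
    the function. Real and imaginary parts are treated separately, whence the factor 2 in the
    conclusion.\<close>
  have R: "\<bar>L (f (x0 + h) - ?S)\<bar> \<le> C * (K * (\<Sum>i\<in>UNIV. \<bar>h $ i\<bar>)) ^ n" if L: "L = Re \<or> L = Im" for L
  proof -
    have bl: "bounded_linear L" using L bounded_linear_Re bounded_linear_Im by auto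
    have "\<exists>t. 0 < t \<and> t < 1 \<and> L (G 0 1) = (\<Sum>m<n. L (G m 0) / fact m * 1 ^ m) + L (G n t) / fact n * 1 ^ n"
    proof (rule Maclaurin[where diff = "\<lambda>m t. L (G m t)" and f = "\<lambda>t. L (G 0 t)"])
      show "\<forall>m t. m < n \<and> 0 \<le> t \<and> t \<le> 1 \<longrightarrow> DERIV (\<lambda>t. L (G m t)) t :> L (G (Suc m) t)"
        using bounded_linear.has_vector_derivative[OF bl deriv]
        by (auto simp: has_real_derivative_iff_has_vector_derivative)
    qed (use n in auto)
    then obtain t where t: "0 < t" "t < 1" "L (G 0 1) = (\<Sum>m<n. L (G m 0) / fact m) + L (G n t) / fact n" by auto
    have Lr: "L (z / fact m) = L z / fact m" for z m
      using linear_scale[OF bounded_linear.linear[OF bl], of "1 / fact m" z]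
      by (simp add: scaleR_conv_of_real divide_inverse mult.commute)
    have "L (f (x0 + h) - ?S) = L (G n t) / fact n"
      using t(3) by (simp add: G0 linear_diff[OF bounded_linear.linear[OF bl]] linear_sum[OF bounded_linear.linear[OF bl]] Lr)
    moreover have "\<bar>L (G n t)\<bar> \<le> cmod (G n t)" using L abs_Re_le_cmod abs_Im_le_cmod by auto
    ultimately have "\<bar>L (f (x0 + h) - ?S)\<bar> \<le> cmod (G n t) / fact n" by (simp add: divide_right_mono)
    then show ?thesis using Gbd[of t] t by simp
  qed
  have "cmod (f (x0 + h) - ?S) \<le> \<bar>Re (f (x0 + h) - ?S)\<bar> + \<bar>Im (f (x0 + h) - ?S)\<bar>" by (rule cmod_le)
  also have "\<dots> \<le> 2 * C * (K * (\<Sum>i\<in>UNIV. \<bar>h $ i\<bar>)) ^ n" using R[of Re] R[of Im] by simp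
  also have "?S = (\<Sum>m<n. \<Sum>is | length is = m. (\<Prod>i\<leftarrow>is. h $ i) *\<^sub>R pds is f x0 / fact (length is))"
    unfolding G_def by (intro sum.cong refl) (simp add: sum_divide_distrib)
  finally show ?thesis .
qed

text \<open>The list-indexed Taylor series converges absolutely where \<open>K\<close> times the l1
  norm of the increment is at most 1/2. Its sum is identified with \<open>f\<close> through the
  remainder bound, and only then regrouped into a power series.\<close>

lemma real_analytic_onI_bounds:
  fixes U :: "(real^'n::finite) set"
  assumes U: "open U" and f: "smooth_on U f"
    and bd: "\<And>x0. x0 \<in> V \<Longrightarrow> \<exists>r>0. \<exists>C K. ball x0 r \<subseteq> U \<and>
      (\<forall>is. \<forall>x\<in>ball x0 r. cmod (pds is f x) \<le> C * K ^ length is * fact (length is))"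
  shows "real_analytic_on V f"
  unfolding real_analytic_on_def
proof
  fix x0 assume "x0 \<in> V"
  then obtain r C K0 where r: "r > 0" "ball x0 r \<subseteq> U"
    and bd0: "\<And>is x. x \<in> ball x0 r \<Longrightarrow> cmod (pds is f x) \<le> C * K0 ^ length is * fact (length is)"
    using bd by metis
  define K where "K = \<bar>K0\<bar> + 1"
  have K: "K > 0" by (simp add: K_def)
  have C: "C \<ge> 0" using bd0[of x0 "[]"] r by (simp add: order_trans[OF norm_ge_zero])
  have bd: "cmod (pds is f x) \<le> C * K ^ length is * fact (length is)" if "x \<in> ball x0 r" for "is" x
  proof -
    have "K0 ^ length is \<le> K ^ length is"
      using power_mono[of "\<bar>K0\<bar>" K "length is"] K by (simp add: K_def) (metis abs_ge_self order_trans power_abs)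
    then show ?thesis using bd0[OF that, of "is"] C
      by (meson fact_ge_zero mult_left_mono mult_right_mono order_trans)
  qed
  define c where "c \<alpha> = (\<Sum>is\<in>(\<lambda>is. count (mset is)) -` {\<alpha>}. pds is f x0 / fact (length is))" for \<alpha> :: "'n \<Rightarrow> nat"
  \<comment> \<open>The l1 norm is at most \<open>CARD('n)\<close> times the euclidean one, so this
    radius makes level \<open>m\<close> of the series at most \<open>C * (1/2) ^ m\<close>.\<close>
  define r' where "r' = min r (1 / (2 * K * real CARD('n)))"
  have r': "r' > 0" "r' \<le> r" "K * (real CARD('n) * r') \<le> 1/2" using r K by (auto simp: r'_def min_def field_simps)
  have "((\<lambda>\<alpha>. c \<alpha> * (\<Prod>i\<in>UNIV. complex_of_real ((x$i - x0$i) ^ \<alpha> i))) has_sum f x) UNIV" if x: "x \<in> ball x0 r'" for x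
  proof -
    define h where "h = x - x0"
    define s where "s = (\<Sum>i\<in>UNIV. \<bar>h $ i\<bar>)"
    have hr: "norm h < r'" using x by (simp add: h_def dist_norm norm_minus_commute)
    have "s \<le> (\<Sum>i\<in>(UNIV::'n set). r')"
      unfolding s_def by (intro sum_mono) (use component_le_norm_cart[of h] hr in \<open>auto intro: order_trans less_imp_le\<close>)
    then have "K * s \<le> K * (real CARD('n) * r')" using K by simp
    then have "K * s \<le> 1/2" using r'(3) by linarith
    moreover have "0 \<le> K * s" using K by (simp add: s_def sum_nonneg)
    ultimately have Ks: "0 \<le> K * s" "K * s \<le> 1/2" by auto
    have seg: "x0 + t *\<^sub>R h \<in> ball x0 r" if "0 \<le> t" "t \<le> 1" for t
    proof -
      have "norm (t *\<^sub>R h) \<le> norm h" using that by (simp add: mult_left_le_one_le)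
      then show ?thesis using hr r' by (simp add: dist_norm)
    qed
    define t where "t is = (\<Prod>i\<leftarrow>is. h $ i) *\<^sub>R pds is f x0 / fact (length is)" for "is"
    have tb: "cmod (t is) \<le> C * ((\<Prod>i\<leftarrow>is. \<bar>h $ i\<bar>) * K ^ length is)" for "is"
    proof -
      have "\<bar>\<Prod>i\<leftarrow>is. h $ i\<bar> = (\<Prod>i\<leftarrow>is. \<bar>h $ i\<bar>)" for "is" :: "'n list"
        by (induction "is") (auto simp: abs_mult)
      moreover have "0 \<le> (\<Prod>i\<leftarrow>is. \<bar>h $ i\<bar>)" by (induction "is") auto
      moreover have "cmod (pds is f x0) / fact (length is) \<le> C * K ^ length is"
        using bd[of x0 "is"] r by (simp add: divide_le_eq)
      ultimately show ?thesis
        using mult_left_mono[of "cmod (pds is f x0) / fact (length is)" "C * K ^ length is" "\<Prod>i\<leftarrow>is. \<bar>h $ i\<bar>"]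
        by (simp add: t_def norm_divide algebra_simps)
    qed
    have lvl: "(\<Sum>is | length is = m. cmod (t is)) \<le> C * (1/2) ^ m" for m
    proof -
      have "(\<Sum>is | length is = m. cmod (t is)) \<le> (\<Sum>is | length is = m. C * ((\<Prod>i\<leftarrow>is. \<bar>h $ i\<bar>) * K ^ m))"
        by (intro sum_mono) (use tb in auto)
      also have "\<dots> = C * (K * s) ^ m"
        by (simp add: sum_distrib_left[symmetric] sum_distrib_right[symmetric] sum_lists_prod s_def power_mult_distrib mult.commute)
      also have "\<dots> \<le> C * (1/2) ^ m" using C Ks by (intro mult_left_mono power_mono) auto
      finally show ?thesis .
    qed
    have "t summable_on UNIV"
    proof (rule abs_summable_summable, subst abs_summable_iff_bdd_above, rule bdd_aboveI2)
      fix F :: "'n list set" assume F: "F \<in> {F. F \<subseteq> UNIV \<and> finite F}"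
      define M where "M = Suc (Max (length ` F \<union> {0}))"
      have "sum (\<lambda>x. cmod (t x)) F \<le> sum (\<lambda>x. cmod (t x)) (\<Union>m<M. {is. length is = m})"
        using F by (intro sum_mono2) (auto simp: finite_lists_length M_def less_Suc_eq_le intro!: Max_ge)
      also have "\<dots> = (\<Sum>m<M. \<Sum>is | length is = m. cmod (t is))"
        by (rule sum.UNION_disjoint) (auto simp: finite_lists_length)
      also have "\<dots> \<le> (\<Sum>m<M. C * (1/2) ^ m)" by (intro sum_mono lvl)
      also have "\<dots> \<le> C * 2"
      proof -
        have "(\<Sum>m<M. (1/2::real) ^ m) \<le> 2" by (simp add: sum_gp_strict)
        then show ?thesis using C by (simp add: sum_distrib_left[symmetric] mult_left_mono)
      qed
      finally show "sum (\<lambda>x. cmod (t x)) F \<le> C * 2" .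
    qed
    then obtain S where S: "(t has_sum S) UNIV" by (auto simp: summable_on_def)
    have "((\<lambda>m. sum t (length -` {m})) has_sum S) UNIV"
      by (rule has_sum_fibres[OF _ S]) (use finite_lists_length in \<open>auto simp: vimage_def\<close>)
    then have "(\<lambda>m. sum t (length -` {m})) sums S" by (rule has_sum_imp_sums)
    then have lim: "(\<lambda>n. \<Sum>m<n. \<Sum>is | length is = m. t is) \<longlonglongrightarrow> S"
      by (simp add: sums_def vimage_def)
    have "(\<lambda>n. \<Sum>m<n. \<Sum>is | length is = m. t is) \<longlonglongrightarrow> f x"
    proof (rule LIM_zero_cancel, rule Lim_null_comparison)
      show "\<forall>\<^sub>F n in sequentially. cmod ((\<Sum>m<n. \<Sum>is | length is = m. t is) - f x) \<le> 2 * C * (1/2) ^ n"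
      proof (rule eventually_sequentiallyI[of 1])
        fix n :: nat assume "n \<ge> 1"
        then have "cmod (f (x0 + h) - (\<Sum>m<n. \<Sum>is | length is = m. t is)) \<le> 2 * C * (K * s) ^ n"
          unfolding t_def s_def
          using seg r(2) by (intro Taylor_lists[OF U f]) (auto intro!: bd)
        also have "\<dots> \<le> 2 * C * (1/2) ^ n" using C Ks by (intro mult_left_mono power_mono) auto
        finally show "cmod ((\<Sum>m<n. \<Sum>is | length is = m. t is) - f x) \<le> 2 * C * (1/2) ^ n"
          by (simp add: h_def norm_minus_commute)
      qed
      show "(\<lambda>n. 2 * C * (1/2) ^ n) \<longlonglongrightarrow> 0"
        by (intro tendsto_mult_right_zero LIMSEQ_power_zero) auto
    qed
    then have Sf: "S = f x" using lim LIMSEQ_unique by blast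
    have "((\<lambda>\<alpha>. sum t ((\<lambda>is. count (mset is)) -` {\<alpha>})) has_sum f x) UNIV"
    proof (rule has_sum_fibres)
      fix \<alpha> :: "'n \<Rightarrow> nat"
      have "length is = (\<Sum>i\<in>UNIV. \<alpha> i)" if "count (mset is) = \<alpha>" for "is"
        using that size_multiset_overloaded_eq[of "mset is"]
        by (auto simp: count_eq_zero_iff intro!: sum.mono_neutral_left)
      then show "finite ((\<lambda>is. count (mset is)) -` {\<alpha>})"
        by (intro finite_subset[OF _ finite_lists_length[of "\<Sum>i\<in>UNIV. \<alpha> i"]]) auto
    qed (use S Sf in simp)
    moreover have "sum t ((\<lambda>is. count (mset is)) -` {\<alpha>}) = c \<alpha> * (\<Prod>i\<in>UNIV. complex_of_real ((x$i - x0$i) ^ \<alpha> i))" for \<alpha>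
      unfolding c_def sum_distrib_right
    proof (rule sum.cong)
      fix "is" :: "'n list" assume "is \<in> (\<lambda>is. count (mset is)) -` {\<alpha>}"
      then have "\<alpha> = count (mset is)" by simp
      then show "t is = pds is f x0 / fact (length is) * (\<Prod>i\<in>UNIV. complex_of_real ((x$i - x0$i) ^ \<alpha> i))"
        by (simp add: t_def prod_list_count h_def scaleR_conv_of_real)
    qed simp
    ultimately show ?thesis by simp
  qed
  then show "\<exists>r>0. \<exists>c :: ('n \<Rightarrow> nat) \<Rightarrow> complex. \<forall>x\<in>ball x0 r.
      ((\<lambda>\<alpha>. c \<alpha> * (\<Prod>i\<in>UNIV. complex_of_real ((x$i - x0$i) ^ \<alpha> i))) has_sum f x) UNIV"
    using r'(1) by blast
qed

subsection \<open>Analytic functions are smooth, with Cauchy estimates\<close>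

definition mono_at :: "real^'n::finite \<Rightarrow> ('n \<Rightarrow> nat) \<Rightarrow> real" where
  "mono_at h \<alpha> = (\<Prod>i\<in>UNIV. (h $ i) ^ \<alpha> i)"

definition mdeg :: "('n::finite \<Rightarrow> nat) \<Rightarrow> nat" where
  "mdeg \<alpha> = (\<Sum>i\<in>UNIV. \<alpha> i)"

definition mseries :: "(('n::finite \<Rightarrow> nat) \<Rightarrow> complex) \<Rightarrow> real^'n \<Rightarrow> complex" where
  "mseries c h = (\<Sum>\<^sub>\<infinity>\<alpha>. c \<alpha> * mono_at h \<alpha>)"

text \<open>Absolute convergence at polyradius \<open>s\<close> with total at most \<open>M\<close>,
  phrased through finite sums so that differentiated families inherit it by termwise
  comparison.\<close>

definition mbounded :: "(('n::finite \<Rightarrow> nat) \<Rightarrow> complex) \<Rightarrow> real \<Rightarrow> real \<Rightarrow> bool" where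
  "mbounded c s M \<longleftrightarrow> (\<forall>F. finite F \<longrightarrow> (\<Sum>\<alpha>\<in>F. cmod (c \<alpha>) * s ^ mdeg \<alpha>) \<le> M)"

definition mderiv :: "'n::finite \<Rightarrow> (('n \<Rightarrow> nat) \<Rightarrow> complex) \<Rightarrow> ('n \<Rightarrow> nat) \<Rightarrow> complex" where
  "mderiv i c \<alpha> = of_nat (\<alpha> i + 1) * c (\<alpha>(i := \<alpha> i + 1))"

text \<open>Sup-norm boxes rather than balls, to match convergence at a common polyradius.\<close>

definition obox :: "real^'n::finite \<Rightarrow> real \<Rightarrow> (real^'n) set" where
  "obox x0 s = {x. \<forall>i. \<bar>x $ i - x0 $ i\<bar> < s}"

lemma open_obox: "open (obox x0 s)"
proof -
  have "obox x0 s = (\<Inter>i\<in>UNIV. {x. \<bar>x $ i - x0 $ i\<bar> < s})" by (auto simp: obox_def)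
  then show ?thesis by (auto intro!: open_INT open_Collect_less continuous_intros)
qed

lemma obox_mono: "x \<in> obox x0 t \<Longrightarrow> t \<le> s \<Longrightarrow> x \<in> obox x0 s"
  by (auto simp: obox_def intro: less_le_trans)

lemma summable_bounded:
  fixes f :: "'a \<Rightarrow> complex"
  assumes "\<And>F. finite F \<Longrightarrow> (\<Sum>a\<in>F. cmod (f a)) \<le> M"
  shows "f summable_on UNIV" "(\<lambda>a. cmod (f a)) summable_on UNIV" "cmod (infsum f UNIV) \<le> M"
proof -
  show 1: "(\<lambda>a. cmod (f a)) summable_on UNIV"
    using assms by (subst abs_summable_iff_bdd_above) (auto simp: bdd_above_def)
  then show "f summable_on UNIV" by (rule abs_summable_summable)
  have "infsum (\<lambda>a. cmod (f a)) UNIV \<le> M"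
    by (rule has_sum_le_finite_sums[OF has_sum_infsum[OF 1]]) (use assms in auto)
  then show "cmod (infsum f UNIV) \<le> M" using norm_infsum_bound[OF 1] by linarith
qed

lemma mdeg_add: "mdeg (\<alpha>(i := \<alpha> i + k)) = mdeg \<alpha> + k"
proof -
  have "mdeg (\<alpha>(i := \<alpha> i + k)) = (\<Sum>j\<in>UNIV. \<alpha> j + (if j = i then k else 0))"
    unfolding mdeg_def by (intro sum.cong) auto
  then show ?thesis by (simp add: sum.distrib mdeg_def)
qed

lemma mdeg_ge: "\<alpha> i \<le> mdeg \<alpha>"
  unfolding mdeg_def by (rule member_le_sum) auto

lemma mono_at_bound:
  assumes "\<And>i. \<bar>h $ i\<bar> \<le> s"
  shows "\<bar>mono_at h \<alpha>\<bar> \<le> s ^ mdeg \<alpha>"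
proof -
  have "\<bar>mono_at h \<alpha>\<bar> = (\<Prod>i\<in>UNIV. \<bar>h $ i\<bar> ^ \<alpha> i)"
    by (simp add: mono_at_def abs_prod power_abs)
  also have "\<dots> \<le> (\<Prod>i\<in>UNIV. s ^ \<alpha> i)"
    using assms by (intro prod_mono) (auto intro: power_mono)
  also have "\<dots> = s ^ mdeg \<alpha>" by (simp add: mdeg_def power_sum)
  finally show ?thesis .
qed

text \<open>Pays for the factor that differentiation puts in front of a monomial with a gap between
  radii: the quotient \<open>(s ^ Suc m - t ^ Suc m) / (s - t)\<close> is a sum of
  \<open>Suc m\<close> products, each at least \<open>t ^ m\<close>.\<close>

lemma power_gap:
  fixes s t :: real
  assumes "0 \<le> t" "t < s"
  shows "real (Suc m) * t ^ m \<le> s ^ Suc m / (s - t)"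
proof -
  have "real (Suc m) * t ^ m = (\<Sum>i<Suc m. t ^ m)" by simp
  also have "\<dots> \<le> (\<Sum>i<Suc m. s ^ (m - i) * t ^ i)"
  proof (intro sum_mono)
    fix i assume i: "i \<in> {..<Suc m}"
    have "t ^ m = t ^ (m - i) * t ^ i" using i by (simp add: power_add[symmetric])
    also have "\<dots> \<le> s ^ (m - i) * t ^ i" using assms by (intro mult_right_mono power_mono) auto
    finally show "t ^ m \<le> s ^ (m - i) * t ^ i" .
  qed
  also have "\<dots> = (s ^ Suc m - t ^ Suc m) / (s - t)"
  proof -
    have "t ^ Suc m - s ^ Suc m = (t - s) * (\<Sum>i<Suc m. s ^ (m - i) * t ^ i)"
      using power_diff_sumr2[of t "Suc m" s] by (simp only: diff_Suc_Suc)
    then have "s ^ Suc m - t ^ Suc m = (\<Sum>i<Suc m. s ^ (m - i) * t ^ i) * (s - t)" by (simp only: algebra_simps)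
    then show ?thesis using assms by (simp add: eq_divide_eq)
  qed
  also have "\<dots> \<le> s ^ Suc m / (s - t)" using assms by (intro divide_right_mono) auto
  finally show ?thesis .
qed

lemma mbounded_mderiv:
  assumes c: "mbounded c s M" and t: "0 \<le> t" "t < s"
  shows "mbounded (mderiv i c) t (M / (s - t))"
  unfolding mbounded_def
proof (intro allI impI)
  fix F :: "('a \<Rightarrow> nat) set" assume F: "finite F"
  define up where "up \<alpha> = \<alpha>(i := \<alpha> i + 1)" for \<alpha> :: "'a \<Rightarrow> nat"
  have inj: "inj_on up F"
  proof (rule inj_onI, rule ext)
    fix \<alpha> \<beta> :: "'a \<Rightarrow> nat" and j assume "up \<alpha> = up \<beta>"
    from fun_cong[OF this, of j] show "\<alpha> j = \<beta> j" by (cases "j = i") (auto simp: up_def)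
  qed
  have "(\<Sum>\<alpha>\<in>F. cmod (mderiv i c \<alpha>) * t ^ mdeg \<alpha>) \<le> (\<Sum>\<alpha>\<in>F. cmod (c (up \<alpha>)) * s ^ mdeg (up \<alpha>) / (s - t))"
  proof (rule sum_mono)
    fix \<alpha> assume "\<alpha> \<in> F"
    have "cmod (mderiv i c \<alpha>) * t ^ mdeg \<alpha> = cmod (c (up \<alpha>)) * (real (\<alpha> i + 1) * t ^ mdeg \<alpha>)"
      by (simp add: mderiv_def norm_mult up_def del: of_nat_add of_nat_Suc)
    also have "\<dots> \<le> cmod (c (up \<alpha>)) * (real (Suc (mdeg \<alpha>)) * t ^ mdeg \<alpha>)"
      using mdeg_ge[of \<alpha> i] t by (intro mult_left_mono mult_right_mono) auto
    also have "\<dots> \<le> cmod (c (up \<alpha>)) * (s ^ Suc (mdeg \<alpha>) / (s - t))"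
      by (intro mult_left_mono power_gap t) auto
    finally show "cmod (mderiv i c \<alpha>) * t ^ mdeg \<alpha> \<le> cmod (c (up \<alpha>)) * s ^ mdeg (up \<alpha>) / (s - t)"
      unfolding up_def mdeg_add by (simp add: algebra_simps)
  qed
  also have "\<dots> = (\<Sum>\<alpha>\<in>up ` F. cmod (c \<alpha>) * s ^ mdeg \<alpha>) / (s - t)"
    by (simp add: sum.reindex[OF inj] sum_divide_distrib)
  also have "\<dots> \<le> M / (s - t)"
    using c F t unfolding mbounded_def by (intro divide_right_mono) auto
  finally show "(\<Sum>\<alpha>\<in>F. cmod (mderiv i c \<alpha>) * t ^ mdeg \<alpha>) \<le> M / (s - t)" .
qed

lemma mseries_terms:
  assumes c: "mbounded c s M" and h: "\<And>i. \<bar>h $ i\<bar> \<le> s"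
  shows "((\<lambda>\<alpha>. c \<alpha> * mono_at h \<alpha>) has_sum mseries c h) UNIV" "cmod (mseries c h) \<le> M"
proof -
  have *: "(\<Sum>\<alpha>\<in>F. cmod (c \<alpha> * mono_at h \<alpha>)) \<le> M" if "finite F" for F
  proof -
    have "(\<Sum>\<alpha>\<in>F. cmod (c \<alpha> * mono_at h \<alpha>)) \<le> (\<Sum>\<alpha>\<in>F. cmod (c \<alpha>) * s ^ mdeg \<alpha>)"
      using mono_at_bound[OF h] by (intro sum_mono) (auto simp: norm_mult intro!: mult_left_mono)
    also have "\<dots> \<le> M" using c that unfolding mbounded_def by blast
    finally show ?thesis .
  qed
  show "((\<lambda>\<alpha>. c \<alpha> * mono_at h \<alpha>) has_sum mseries c h) UNIV"
    unfolding mseries_def by (rule has_sum_infsum) (rule summable_bounded[OF *])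
  show "cmod (mseries c h) \<le> M"
    unfolding mseries_def by (rule summable_bounded[OF *])
qed

lemma mbounded_summable:
  assumes c: "mbounded c s M" and s: "0 \<le> s"
  shows "(\<lambda>\<alpha>. cmod (c \<alpha>) * s ^ mdeg \<alpha>) summable_on UNIV"
  by (rule nonneg_bdd_above_summable_on) (use c s in \<open>auto simp: mbounded_def bdd_above_def\<close>)

lemma mseries_cont:
  assumes c: "mbounded c s M" and s: "0 \<le> s"
  shows "continuous_on {h. \<forall>i. \<bar>h $ i\<bar> \<le> s} (mseries c)"
proof -
  let ?Y = "{h :: real^'a. \<forall>i. \<bar>h $ i\<bar> \<le> s}"
  have "uniform_limit ?Y (\<lambda>X y. \<Sum>\<alpha>\<in>X. c \<alpha> * mono_at y \<alpha>) (mseries c) (finite_subsets_at_top UNIV)"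
  proof (rule Weierstrass_m_test_general')
    fix \<alpha> y assume "y \<in> ?Y"
    then show "cmod (c \<alpha> * mono_at y \<alpha>) \<le> cmod (c \<alpha>) * s ^ mdeg \<alpha>"
      using mono_at_bound[of y s \<alpha>] by (auto simp: norm_mult intro!: mult_left_mono)
  qed (use mseries_terms(1)[OF c] mbounded_summable[OF c s] in auto)
  moreover have "\<forall>\<^sub>F X in finite_subsets_at_top UNIV. continuous_on ?Y (\<lambda>y. \<Sum>\<alpha>\<in>X. c \<alpha> * mono_at y \<alpha>)"
    by (intro always_eventually allI continuous_intros) (auto simp: mono_at_def intro!: continuous_intros)
  ultimately show ?thesis by (intro uniform_limit_theorem) auto
qed

text \<open>The second-order Taylor remainder of each monomial is dominated by the convergent majorant series
  at the larger polyradius, which justifies termwise differentiation.\<close>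

lemma mseries_hpd:
  assumes c: "mbounded c s M" and t: "0 < t" "t < s" and h: "\<And>i. \<bar>h $ i\<bar> < t"
  shows "hpd i (mseries c) h (mseries (mderiv i c) h)"
proof -
  \<comment> \<open>The intermediate radius allows \<open>power_gap\<close> to be applied twice,
    once for each factor of \<open>k * (k - 1)\<close> from the second derivative.\<close>
  define m where "m = (s + t) / 2"
  have m: "t < m" "m < s" using t by (auto simp: m_def)
  define D where "D = 1 / ((s - m) * (m - t))"
  have D: "D \<ge> 0" using m by (simp add: D_def)
  have M: "M \<ge> 0" using c unfolding mbounded_def by (metis finite.emptyI sum.empty)
  have kb: "real k * real (k - 1) * t ^ (n - 2) \<le> D * s ^ n" if "k \<le> n" for k n
  proof (cases "n \<ge> 2")
    case True
    then obtain p where n: "n = Suc (Suc p)" using that by (metis add_2_eq_Suc le_Suc_ex)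
    have "real k * real (k - 1) * t ^ (n - 2) \<le> real (Suc (Suc p)) * real (Suc p) * t ^ p"
      using that t by (auto simp: n intro!: mult_mono)
    also have "\<dots> \<le> real (Suc (Suc p)) * (m ^ Suc p / (m - t))"
      using power_gap[of t m p] t m by (simp only: mult.assoc) (intro mult_left_mono, auto)
    also have "\<dots> = (real (Suc (Suc p)) * m ^ Suc p) / (m - t)" by simp
    also have "\<dots> \<le> (s ^ Suc (Suc p) / (s - m)) / (m - t)"
      by (intro divide_right_mono power_gap) (use t m in auto)
    finally show ?thesis by (simp add: n D_def field_simps)
  next
    case False
    then have "k = 0 \<or> k = 1" using that by auto
    then show ?thesis using D t m by auto
  qed
  let ?e = "axis i 1 :: real^'a"
  have quot: "cmod ((mseries c (h + u *\<^sub>R ?e) - mseries c h) / complex_of_real u - mseries (mderiv i c) h) \<le> D * M * \<bar>u\<bar>"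
    if u: "u \<noteq> 0" "\<bar>h $ i\<bar> + \<bar>u\<bar> \<le> t" for u
  proof -
    have hu: "\<bar>(h + u *\<^sub>R ?e) $ j\<bar> \<le> t" for j
    proof (cases "j = i")
      case True
      then have "\<bar>(h + u *\<^sub>R ?e) $ j\<bar> \<le> \<bar>h $ i\<bar> + \<bar>u\<bar>" by (simp add: axis_def abs_triangle_ineq)
      then show ?thesis using u(2) by linarith
    next
      case False
      then show ?thesis using h[of j] by (simp add: axis_def less_imp_le)
    qed
    define r where "r \<alpha> = (\<Prod>j\<in>UNIV - {i}. (h $ j) ^ \<alpha> j)" for \<alpha> :: "'a \<Rightarrow> nat"
    have mono_split: "mono_at g \<alpha> = (g $ i) ^ \<alpha> i * (\<Prod>j\<in>UNIV - {i}. (g $ j) ^ \<alpha> j)" for g :: "real^'a" and \<alpha>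
      unfolding mono_at_def by (rule prod.remove) auto
    have m1: "mono_at h \<alpha> = (h $ i) ^ \<alpha> i * r \<alpha>" for \<alpha> unfolding r_def by (rule mono_split)
    have m2: "mono_at (h + u *\<^sub>R ?e) \<alpha> = (h $ i + u) ^ \<alpha> i * r \<alpha>" for \<alpha>
      unfolding mono_split r_def by (intro arg_cong2[where f = "(*)"] prod.cong) (auto simp: axis_def)
    have rb: "\<bar>r \<alpha>\<bar> \<le> t ^ (mdeg \<alpha> - \<alpha> i)" for \<alpha>
    proof -
      have "\<bar>r \<alpha>\<bar> = (\<Prod>j\<in>UNIV - {i}. \<bar>h $ j\<bar> ^ \<alpha> j)" by (simp add: r_def abs_prod power_abs)
      also have "\<dots> \<le> (\<Prod>j\<in>UNIV - {i}. t ^ \<alpha> j)"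
      proof (intro prod_mono conjI)
        fix j show "\<bar>h $ j\<bar> ^ \<alpha> j \<le> t ^ \<alpha> j" using h[of j] by (intro power_mono) auto
      qed auto
      also have "\<dots> = t ^ (mdeg \<alpha> - \<alpha> i)"
        by (simp add: power_sum[symmetric] mdeg_def sum_diff1_nat)
      finally show ?thesis .
    qed
    have s1: "((\<lambda>\<alpha>. c \<alpha> * mono_at (h + u *\<^sub>R ?e) \<alpha>) has_sum mseries c (h + u *\<^sub>R ?e)) UNIV"
      by (rule mseries_terms[OF c]) (rule order_trans[OF hu less_imp_le[OF t(2)]])
    have s2: "((\<lambda>\<alpha>. c \<alpha> * mono_at h \<alpha>) has_sum mseries c h) UNIV"
      by (rule mseries_terms[OF c]) (rule less_imp_le[OF less_trans[OF h t(2)]])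
    \<comment> \<open>The differentiated series is shifted by one in the exponent \<open>i\<close>
      so that it is indexed like the difference quotients. Exponents outside the range of the shift
      have \<open>\<alpha> i = 0\<close>, where the shifted term vanishes.\<close>
    have s3: "((\<lambda>\<alpha>. c \<alpha> * (of_nat (\<alpha> i) * (h $ i) ^ (\<alpha> i - Suc 0) * r \<alpha>)) has_sum mseries (mderiv i c) h) UNIV"
    proof -
      have "((\<lambda>\<alpha>. mderiv i c \<alpha> * mono_at h \<alpha>) has_sum mseries (mderiv i c) h) UNIV"
        by (rule mseries_terms[OF mbounded_mderiv[OF c, of t]]) (use t less_imp_le[OF h] in auto)
      also have "(\<lambda>\<alpha>. mderiv i c \<alpha> * mono_at h \<alpha>)
        = (\<lambda>\<alpha>. c \<alpha> * (of_nat (\<alpha> i) * (h $ i) ^ (\<alpha> i - Suc 0) * r \<alpha>)) \<circ> (\<lambda>\<alpha>. \<alpha>(i := \<alpha> i + 1))"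
      proof
        fix \<alpha> :: "'a \<Rightarrow> nat"
        have "r (\<alpha>(i := \<alpha> i + 1)) = r \<alpha>" by (auto simp: r_def intro!: prod.cong)
        then show "mderiv i c \<alpha> * mono_at h \<alpha> = ((\<lambda>\<alpha>. c \<alpha> * (of_nat (\<alpha> i) * (h $ i) ^ (\<alpha> i - Suc 0) * r \<alpha>)) \<circ> (\<lambda>\<alpha>. \<alpha>(i := \<alpha> i + 1))) \<alpha>"
          by (simp add: mderiv_def m1 algebra_simps)
      qed
      finally have *: "(((\<lambda>\<alpha>. c \<alpha> * (of_nat (\<alpha> i) * (h $ i) ^ (\<alpha> i - Suc 0) * r \<alpha>)) \<circ> (\<lambda>\<alpha>. \<alpha>(i := \<alpha> i + 1)))
          has_sum mseries (mderiv i c) h) UNIV" .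
      have inj: "inj (\<lambda>\<alpha> :: 'a \<Rightarrow> nat. \<alpha>(i := \<alpha> i + 1))"
      proof (rule injI, rule ext)
        fix \<alpha> \<beta> :: "'a \<Rightarrow> nat" and j assume "\<alpha>(i := \<alpha> i + 1) = \<beta>(i := \<beta> i + 1)"
        from fun_cong[OF this, of j] show "\<alpha> j = \<beta> j" by (cases "j = i") auto
      qed
      have "((\<lambda>\<alpha>. c \<alpha> * (of_nat (\<alpha> i) * (h $ i) ^ (\<alpha> i - Suc 0) * r \<alpha>)) has_sum mseries (mderiv i c) h)
          (range (\<lambda>\<alpha>. \<alpha>(i := \<alpha> i + 1)))"
        by (rule has_sum_reindex[OF inj, THEN iffD2, OF *])
      moreover have "\<alpha> i = 0" if "\<alpha> \<notin> range (\<lambda>\<alpha>. \<alpha>(i := \<alpha> i + 1))" for \<alpha> :: "'a \<Rightarrow> nat"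
      proof (rule ccontr)
        assume "\<alpha> i \<noteq> 0"
        then have "\<alpha> = (\<alpha>(i := \<alpha> i - 1))(i := (\<alpha>(i := \<alpha> i - 1)) i + 1)" by auto
        then show False using that by blast
      qed
      ultimately show ?thesis
        by (subst has_sum_cong_neutral[where T = "range (\<lambda>\<alpha>. \<alpha>(i := \<alpha> i + 1))"]) auto
    qed
    have "((\<lambda>\<alpha>. (c \<alpha> * mono_at (h + u *\<^sub>R ?e) \<alpha> + - (c \<alpha> * mono_at h \<alpha>)) * (1 / complex_of_real u)
          + - (c \<alpha> * (of_nat (\<alpha> i) * (h $ i) ^ (\<alpha> i - Suc 0) * r \<alpha>)))
        has_sum ((mseries c (h + u *\<^sub>R ?e) + - mseries c h) * (1 / complex_of_real u) + - mseries (mderiv i c) h)) UNIV"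
      (is "(?d has_sum _) _")
      by (intro has_sum_add has_sum_cmult_left has_sum_uminusI s1 s2 s3)
    note hs = this
    have dbd: "cmod (?d \<alpha>) \<le> D * \<bar>u\<bar> * (cmod (c \<alpha>) * s ^ mdeg \<alpha>)" for \<alpha>
    proof -
      let ?q = "((h $ i + u) ^ \<alpha> i - (h $ i) ^ \<alpha> i) / u - of_nat (\<alpha> i) * (h $ i) ^ (\<alpha> i - Suc 0)"
      have "?d \<alpha> = c \<alpha> * complex_of_real (?q * r \<alpha>)"
        using u(1) by (simp add: m1 m2 field_simps)
      then have "cmod (?d \<alpha>) = cmod (c \<alpha>) * (\<bar>?q\<bar> * \<bar>r \<alpha>\<bar>)"
        by (simp only: norm_mult norm_of_real abs_mult)
      also have "\<dots> \<le> cmod (c \<alpha>) * (D * \<bar>u\<bar> * s ^ mdeg \<alpha>)"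
      proof (rule mult_left_mono)
        have q: "\<bar>?q\<bar> \<le> real (\<alpha> i) * real (\<alpha> i - 1) * t ^ (\<alpha> i - 2) * \<bar>u\<bar>"
          using lemma_termdiff3[of u "h $ i" t "\<alpha> i"] u h[of i] by simp
        have "\<bar>?q\<bar> * \<bar>r \<alpha>\<bar> \<le> (real (\<alpha> i) * real (\<alpha> i - 1) * t ^ (\<alpha> i - 2) * \<bar>u\<bar>) * t ^ (mdeg \<alpha> - \<alpha> i)"
          using t by (intro mult_mono q rb) auto
        also have "\<dots> = real (\<alpha> i) * real (\<alpha> i - 1) * t ^ (mdeg \<alpha> - 2) * \<bar>u\<bar>"
        proof (cases "\<alpha> i \<ge> 2")
          case True
          then have "mdeg \<alpha> - 2 = (\<alpha> i - 2) + (mdeg \<alpha> - \<alpha> i)" using mdeg_ge[of \<alpha> i] by simp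
          then show ?thesis by (simp add: power_add)
        next
          case False then have "\<alpha> i = 0 \<or> \<alpha> i = 1" by auto
          then show ?thesis by auto
        qed
        also have "\<dots> \<le> (D * s ^ mdeg \<alpha>) * \<bar>u\<bar>" by (intro mult_right_mono kb mdeg_ge) auto
        finally show "\<bar>?q\<bar> * \<bar>r \<alpha>\<bar> \<le> D * \<bar>u\<bar> * s ^ mdeg \<alpha>" by (simp add: mult_ac)
      qed simp
      finally show ?thesis by (simp add: mult_ac)
    qed
    have "(\<Sum>\<alpha>\<in>F. cmod (?d \<alpha>)) \<le> D * \<bar>u\<bar> * M" if "finite F" for F
    proof -
      have "(\<Sum>\<alpha>\<in>F. cmod (?d \<alpha>)) \<le> (\<Sum>\<alpha>\<in>F. D * \<bar>u\<bar> * (cmod (c \<alpha>) * s ^ mdeg \<alpha>))"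
        by (rule sum_mono) (rule dbd)
      also have "\<dots> \<le> D * \<bar>u\<bar> * M"
        unfolding sum_distrib_left[symmetric]
        using c that D unfolding mbounded_def by (intro mult_left_mono) auto
      finally show ?thesis .
    qed
    from summable_bounded(3)[OF this]
    have "cmod (infsum ?d UNIV) \<le> D * \<bar>u\<bar> * M" by simp
    then show ?thesis unfolding infsumI[OF hs] by (simp add: mult_ac)
  qed
  have "((\<lambda>u. cmod (mseries c (h + (0 + u) *\<^sub>R ?e) - mseries c (h + 0 *\<^sub>R ?e) - u *\<^sub>R mseries (mderiv i c) h) / norm u) \<longlongrightarrow> 0) (at 0)"
  proof (rule Lim_null_comparison)
    have "t - \<bar>h $ i\<bar> > 0" using h[of i] by simp
    then have "\<forall>\<^sub>F u in at 0. \<bar>u\<bar> < t - \<bar>h $ i\<bar>"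
      by (intro order_tendstoD[of _ 0]) (auto intro!: tendsto_eq_intros)
    then show "\<forall>\<^sub>F u in at 0. norm (cmod (mseries c (h + (0 + u) *\<^sub>R ?e) - mseries c (h + 0 *\<^sub>R ?e) - u *\<^sub>R mseries (mderiv i c) h) / norm u) \<le> D * M * \<bar>u\<bar>"
      using eventually_neq_at_within[of 0 0 UNIV]
    proof eventually_elim
      case (elim u)
      let ?A = "mseries c (h + u *\<^sub>R ?e) - mseries c h" and ?G = "mseries (mderiv i c) h"
      have "(?A / complex_of_real u - ?G) * complex_of_real u = ?A - u *\<^sub>R ?G"
        using elim by (simp add: field_simps scaleR_conv_of_real)
      then have "cmod (?A - u *\<^sub>R ?G) = cmod (?A / complex_of_real u - ?G) * \<bar>u\<bar>"
        by (metis norm_mult norm_of_real)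
      then have "cmod (?A - u *\<^sub>R ?G) / \<bar>u\<bar> = cmod (?A / complex_of_real u - ?G)"
        using elim by simp
      then show ?case using quot[of u] elim by simp
    qed
    show "((\<lambda>u. D * M * \<bar>u\<bar>) \<longlongrightarrow> 0) (at 0)" by (auto intro!: tendsto_eq_intros)
  qed
  then show ?thesis
    unfolding hpd_def has_vector_derivative_def has_derivative_at
    by (simp add: bounded_linear_scaleR_left)
qed

text \<open>Every derivative gives up \<open>\<delta>\<close> of the polyradius and a factor
  \<open>1 / \<delta>\<close>. Adapting \<open>\<delta>\<close> to the number of derivatives later
  gives the factorial growth.\<close>

lemma mseries_obox_pds:
  assumes c: "mbounded c s M" and f: "\<And>x. x \<in> obox x0 s \<Longrightarrow> f x = mseries c (x - x0)"
    and \<delta>: "\<delta> > 0"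
  shows "real (length is) * \<delta> < s \<Longrightarrow> \<exists>c'. mbounded c' (s - real (length is) * \<delta>) (M / \<delta> ^ length is) \<and>
    (\<forall>x\<in>obox x0 (s - real (length is) * \<delta>). pds is f x = mseries c' (x - x0))"
proof (induction "is")
  case Nil then show ?case using c f by auto
next
  case (Cons i "is")
  define t where "t = s - real (length is) * \<delta>"
  define t' where "t' = s - real (length (i # is)) * \<delta>"
  have t: "0 < t'" "t' < t" "t - t' = \<delta>" using Cons.prems \<delta> by (auto simp: t_def t'_def algebra_simps)
  have "real (length is) * \<delta> < s" using t by (simp add: t_def)
  then obtain c' where c': "mbounded c' t (M / \<delta> ^ length is)"
    "\<And>x. x \<in> obox x0 t \<Longrightarrow> pds is f x = mseries c' (x - x0)"
    using Cons.IH unfolding t_def by blast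
  have "mbounded (mderiv i c') t' (M / \<delta> ^ length (i # is))"
    using mbounded_mderiv[OF c'(1), of t' i] t by (simp add: mult.commute)
  moreover have "pds (i # is) f x = mseries (mderiv i c') (x - x0)" if x: "x \<in> obox x0 t'" for x
  proof -
    have xt: "x \<in> obox x0 t" using obox_mono[OF x] t by simp
    have "hpd i (mseries c') (x - x0) (mseries (mderiv i c') (x - x0))"
      by (rule mseries_hpd[OF c'(1) t(1,2)]) (use x in \<open>simp add: obox_def\<close>)
    then have "hpd i (\<lambda>x. mseries c' (x - x0)) x (mseries (mderiv i c') (x - x0))"
      unfolding hpd_def by (simp add: algebra_simps)
    then show ?thesis
      using hpd_imp_pd pd_cong[OF open_obox xt c'(2), where i = i] by simp
  qed
  ultimately show ?case unfolding t'_def by blast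
qed

definition locally_mseries :: "(real^'n::finite) set \<Rightarrow> (real^'n \<Rightarrow> complex) \<Rightarrow> bool" where
  "locally_mseries U f \<longleftrightarrow> (\<forall>x0\<in>U. \<exists>s>0. \<exists>c M. mbounded c s M \<and> (\<forall>x\<in>obox x0 s. f x = mseries c (x - x0)))"

lemma real_analytic_imp_mseries:
  fixes f :: "real^'n::finite \<Rightarrow> complex"
  assumes "real_analytic_on U f"
  shows "locally_mseries U f"
  unfolding locally_mseries_def
proof
  fix x0 assume "x0 \<in> U"
  then obtain r c where r: "r > 0" and hs: "\<And>x. x \<in> ball x0 r \<Longrightarrow>
      ((\<lambda>\<alpha>. c \<alpha> * (\<Prod>i\<in>UNIV. complex_of_real ((x$i - x0$i) ^ \<alpha> i))) has_sum f x) UNIV"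
    using assms unfolding real_analytic_on_def by blast
  have hs': "((\<lambda>\<alpha>. c \<alpha> * mono_at (x - x0) \<alpha>) has_sum f x) UNIV" if "x \<in> ball x0 r" for x
    using hs[OF that] by (simp add: mono_at_def)
  define s where "s = r / (2 * real CARD('n))"
  have s: "s > 0" using r by (simp add: s_def)
  have in_ball: "x \<in> ball x0 r" if "\<And>i. \<bar>x $ i - x0 $ i\<bar> \<le> s" for x
  proof -
    have "norm (x - x0) \<le> (\<Sum>i\<in>UNIV. \<bar>(x - x0) $ i\<bar>)" by (rule norm_le_l1_cart)
    also have "\<dots> \<le> (\<Sum>i\<in>(UNIV::'n set). s)" using that by (intro sum_mono) simp
    also have "\<dots> < r" using r by (simp add: s_def)
    finally show ?thesis by (simp add: dist_norm norm_minus_commute)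
  qed
  \<comment> \<open>At this corner every monomial equals \<open>s ^ mdeg \<alpha>\<close>. A
    summable family of complex numbers is absolutely summable, so convergence at this single point
    yields absolute convergence at polyradius \<open>s\<close>.\<close>
  define x1 where "x1 = x0 + (\<chi> i. s)"
  have "x1 \<in> ball x0 r" using s by (intro in_ball) (simp add: x1_def)
  from hs'[OF this] have "(\<lambda>\<alpha>. c \<alpha> * mono_at (x1 - x0) \<alpha>) summable_on UNIV"
    by (auto simp: summable_on_def)
  moreover have "mono_at (x1 - x0) \<alpha> = s ^ mdeg \<alpha>" for \<alpha>
    by (simp add: mono_at_def x1_def mdeg_def power_sum)
  ultimately have "(\<lambda>\<alpha>. c \<alpha> * complex_of_real (s ^ mdeg \<alpha>)) summable_on UNIV" by simp
  then have sm: "(\<lambda>\<alpha>. cmod (c \<alpha>) * s ^ mdeg \<alpha>) summable_on UNIV"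
    using s by (subst (asm) summable_on_iff_abs_summable_on_complex)
      (simp add: norm_mult norm_power del: of_real_power)
  have "mbounded c s (infsum (\<lambda>\<alpha>. cmod (c \<alpha>) * s ^ mdeg \<alpha>) UNIV)"
    unfolding mbounded_def using s by (auto intro!: finite_sum_le_infsum sm)
  moreover have "f x = mseries c (x - x0)" if "x \<in> obox x0 s" for x
    unfolding mseries_def
    by (rule infsumI[symmetric], rule hs', rule in_ball) (use that in \<open>auto simp: obox_def less_imp_le\<close>)
  ultimately show "\<exists>s>0. \<exists>c M. mbounded c s M \<and> (\<forall>x\<in>obox x0 s. f x = mseries c (x - x0))"
    using s by blast
qed

text \<open>The coinduction invariant is local expandability about every point. Halving the box
  leaves room for the termwise derivative to be bounded on it too.\<close>

lemma real_analytic_imp_smooth: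
  assumes U: "open U" and f: "real_analytic_on U f"
  shows "smooth_on U f"
proof (rule smooth_on_coinduct[where P = "locally_mseries U"])
  show "locally_mseries U f" by (rule real_analytic_imp_mseries[OF f])
next
  fix f assume f: "locally_mseries U f"
  have step: "\<exists>s>0. \<exists>c M. mbounded c s M \<and> (\<forall>x\<in>obox x0 s. hpd i f x (mseries (mderiv i c) (x - x0))) \<and>
      continuous (at x0) f \<and> mbounded (mderiv i c) s M" if x0U: "x0 \<in> U" for x0 i
  proof -
    obtain s c M where s: "s > 0" "mbounded c s M" "\<And>x. x \<in> obox x0 s \<Longrightarrow> f x = mseries c (x - x0)"
      using f x0U unfolding locally_mseries_def by blast
    have x0: "x0 \<in> obox x0 s" using s by (simp add: obox_def)
    have mono: "mbounded c t M" if "0 \<le> t" "t \<le> s" for t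
      unfolding mbounded_def
    proof (intro allI impI)
      fix F :: "('a \<Rightarrow> nat) set" assume "finite F"
      have "(\<Sum>\<alpha>\<in>F. cmod (c \<alpha>) * t ^ mdeg \<alpha>) \<le> (\<Sum>\<alpha>\<in>F. cmod (c \<alpha>) * s ^ mdeg \<alpha>)"
        using that by (intro sum_mono mult_left_mono power_mono) auto
      also have "\<dots> \<le> M" using s(2) \<open>finite F\<close> unfolding mbounded_def by blast
      finally show "(\<Sum>\<alpha>\<in>F. cmod (c \<alpha>) * t ^ mdeg \<alpha>) \<le> M" .
    qed
    have "hpd i f x (mseries (mderiv i c) (x - x0))" if x: "x \<in> obox x0 (s / 2)" for x
    proof (rule hpd_cong[OF open_obox[of x0 s]])
      show "x \<in> obox x0 s" using obox_mono[OF x] s(1) by simp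
      have "hpd i (mseries c) (x - x0) (mseries (mderiv i c) (x - x0))"
        by (rule mseries_hpd[OF s(2), of "s / 2"]) (use x s in \<open>auto simp: obox_def\<close>)
      then show "hpd i (\<lambda>x. mseries c (x - x0)) x (mseries (mderiv i c) (x - x0))"
        unfolding hpd_def by (simp add: algebra_simps)
    qed (use s in auto)
    moreover have "mbounded c (s / 2) (max M (M / (s - s / 2)))"
      using mono[of "s / 2"] s(1) unfolding mbounded_def by (simp add: le_max_iff_disj)
    moreover have "mbounded (mderiv i c) (s / 2) (max M (M / (s - s / 2)))"
      using mbounded_mderiv[OF s(2), of "s / 2" i] s(1) unfolding mbounded_def by (simp add: le_max_iff_disj)
    moreover have "continuous (at x0) f"
    proof -
      have "continuous_on (obox x0 s) (\<lambda>x. mseries c (x - x0))"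
      proof (rule continuous_on_compose2[OF mseries_cont[OF s(2) less_imp_le[OF s(1)]]])
        show "continuous_on (obox x0 s) (\<lambda>x. x - x0)" by (intro continuous_intros)
        show "(\<lambda>x. x - x0) ` obox x0 s \<subseteq> {h. \<forall>i. \<bar>h $ i\<bar> \<le> s}"
          unfolding obox_def by (auto simp: less_imp_le)
      qed
      then have "continuous_on (obox x0 s) f" using s(3) by (simp cong: continuous_on_cong)
      then show ?thesis using x0 continuous_on_eq_continuous_at[OF open_obox] by blast
    qed
    ultimately show ?thesis using half_gt_zero[OF s(1)] by blast
  qed
  show "continuous_on U f"
  proof (rule continuous_at_imp_continuous_on, rule ballI)
    fix x assume "x \<in> U"
    from step[OF this, of undefined] show "isCont f x" by blast
  qed
  show "(\<lambda>t. f (x + t *\<^sub>R axis i 1)) differentiable (at 0)" if x: "x \<in> U" for i x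
  proof -
    obtain s c where "s > 0" "\<forall>y\<in>obox x s. hpd i f y (mseries (mderiv i c) (y - x))"
      using step[OF x, of i] by blast
    moreover from this have "x \<in> obox x s" by (simp add: obox_def)
    ultimately have "hpd i f x (mseries (mderiv i c) (x - x))" by blast
    then show ?thesis by (rule hpd_imp_differentiable)
  qed
  show "locally_mseries U (pd i f)" for i
    unfolding locally_mseries_def
  proof
    fix x0 assume "x0 \<in> U"
    from step[OF this, of i] obtain s c M where "s > 0"
      "\<forall>x\<in>obox x0 s. hpd i f x (mseries (mderiv i c) (x - x0))" "mbounded (mderiv i c) s M" by blast
    then show "\<exists>s>0. \<exists>c M. mbounded c s M \<and> (\<forall>x\<in>obox x0 s. pd i f x = mseries c (x - x0))"
      using hpd_imp_pd by blast
  qed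
qed

definition cauchy_bounded :: "(real^'n::finite) set \<Rightarrow> (real^'n \<Rightarrow> complex) \<Rightarrow> bool" where
  "cauchy_bounded K f \<longleftrightarrow> (\<exists>C R. 0 < C \<and> 0 < R \<and>
     (\<forall>is. \<forall>x\<in>K. cmod (pds is f x) \<le> C * R ^ length is * fact (length is)))"

text \<open>A single term of the exponential series at \<open>n\<close>.\<close>

lemma power_self_le_fact: "real n ^ n \<le> exp 1 ^ n * fact n"
proof -
  have "(\<lambda>k. real n ^ k /\<^sub>R fact k) sums exp (real n)" by (rule exp_converges)
  then have "(\<Sum>k\<in>{n}. real n ^ k /\<^sub>R fact k) \<le> exp (real n)"
    using sum_le_suminf[of "\<lambda>k. real n ^ k /\<^sub>R fact k" "{n}"] by (auto simp: sums_iff)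
  then show ?thesis by (simp add: exp_of_nat_mult[symmetric] field_simps)
qed

lemma real_analytic_imp_cauchy_bounded:
  assumes f: "real_analytic_on U f" and K: "compact K" "K \<subseteq> U"
  shows "cauchy_bounded K f"
proof -
  have loc: "\<exists>s>0. cauchy_bounded (obox x0 s) f" if x0: "x0 \<in> U" for x0
  proof -
    obtain s c M where s: "s > 0" "mbounded c s M" "\<And>x. x \<in> obox x0 s \<Longrightarrow> f x = mseries c (x - x0)"
      using real_analytic_imp_mseries[OF f] x0 unfolding locally_mseries_def by blast
    have M: "M \<ge> 0" using s(2) unfolding mbounded_def by (metis finite.emptyI sum.empty)
    define R where "R = 2 * exp 1 / s"
    have "cmod (pds is f x) \<le> (M + 1) * R ^ length is * fact (length is)" if x: "x \<in> obox x0 (s / 2)" for "is" x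
    proof (cases "is = []")
      case True
      have "x \<in> obox x0 s" using obox_mono[OF x] s(1) by simp
      then have "cmod (f x) \<le> M" using s(3) mseries_terms(2)[OF s(2), of "x - x0"]
        by (auto simp: obox_def less_imp_le)
      then show ?thesis using True by simp
    next
      case False
      let ?n = "length is"
      \<comment> \<open>Half of the polyradius is shared equally among the derivatives. The
        resulting \<open>real ?n ^ ?n\<close> is traded for a factorial by
        \<open>power_self_le_fact\<close>, which is the origin of \<open>exp 1\<close> in
        \<open>R\<close>.\<close>
      define \<delta> where "\<delta> = s / (2 * real ?n)"
      have n: "real ?n > 0" using False by simp
      have \<delta>: "\<delta> > 0" "real ?n * \<delta> = s / 2" using s(1) n by (auto simp: \<delta>_def)
      have s2: "s - real ?n * \<delta> = s / 2" "real ?n * \<delta> < s" using \<delta>(2) s(1) by auto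
      obtain c' where c': "mbounded c' (s / 2) (M / \<delta> ^ ?n)"
        "\<And>x. x \<in> obox x0 (s / 2) \<Longrightarrow> pds is f x = mseries c' (x - x0)"
        using mseries_obox_pds[OF s(2,3) \<delta>(1) s2(2), unfolded s2(1)] by blast
      have "cmod (pds is f x) \<le> M / \<delta> ^ ?n"
        unfolding c'(2)[OF x] by (rule mseries_terms(2)[OF c'(1)]) (use x in \<open>auto simp: obox_def less_imp_le\<close>)
      also have "\<dots> = M * ((2 / s) ^ ?n * real ?n ^ ?n)"
        using s(1) n by (simp add: \<delta>_def power_divide power_mult_distrib field_simps)
      also have "\<dots> \<le> M * ((2 / s) ^ ?n * (exp 1 ^ ?n * fact ?n))"
        using M s(1) by (intro mult_left_mono power_self_le_fact) auto
      also have "\<dots> = M * R ^ ?n * fact ?n" by (simp add: R_def power_mult_distrib power_divide field_simps)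
      also have "\<dots> \<le> (M + 1) * R ^ ?n * fact ?n" using s(1) by (intro mult_right_mono) (auto simp: R_def)
      finally show ?thesis .
    qed
    moreover have "R > 0" using s(1) by (simp add: R_def)
    ultimately have "cauchy_bounded (obox x0 (s / 2)) f"
      unfolding cauchy_bounded_def using M by (intro exI[of _ "M + 1"] exI[of _ R]) auto
    then show ?thesis using s(1) by (intro exI[of _ "s / 2"]) auto
  qed
  then obtain s where s: "\<And>x. x \<in> K \<Longrightarrow> s x > 0 \<and> cauchy_bounded (obox x (s x)) f"
    using K(2) by (metis subsetD)
  have "K \<subseteq> (\<Union>x\<in>K. obox x (s x))" using s by (force simp: obox_def)
  then obtain T where T: "finite T" "T \<subseteq> K" "K \<subseteq> (\<Union>x\<in>T. obox x (s x))"
    using compactE_image[OF K(1), of K "\<lambda>x. obox x (s x)"] open_obox by metis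
  have union: "cauchy_bounded (A \<union> B) f" if AB: "cauchy_bounded A f" "cauchy_bounded B f" for A B
  proof -
    obtain C1 R1 C2 R2 where CR: "0 < C1" "0 < R1" "0 < C2" "0 < R2"
      "\<And>is x. x \<in> A \<Longrightarrow> cmod (pds is f x) \<le> C1 * R1 ^ length is * fact (length is)"
      "\<And>is x. x \<in> B \<Longrightarrow> cmod (pds is f x) \<le> C2 * R2 ^ length is * fact (length is)"
      using AB unfolding cauchy_bounded_def by metis
    have *: "C1 * R1 ^ n * fact n \<le> (C1 + C2) * (R1 + R2) ^ n * fact n"
      "C2 * R2 ^ n * fact n \<le> (C1 + C2) * (R1 + R2) ^ n * fact n" for n
      using CR by (intro mult_mono power_mono; simp)+
    have "cmod (pds is f x) \<le> (C1 + C2) * (R1 + R2) ^ length is * fact (length is)" if x: "x \<in> A \<union> B" for "is" x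
      using x
    proof
      assume "x \<in> A" from CR(5)[OF this, of "is"] *(1)[of "length is"] show ?thesis by linarith
    next
      assume "x \<in> B" from CR(6)[OF this, of "is"] *(2)[of "length is"] show ?thesis by linarith
    qed
    moreover have "0 < C1 + C2" "0 < R1 + R2" using CR by auto
    ultimately show ?thesis unfolding cauchy_bounded_def by blast
  qed
  have "finite T \<Longrightarrow> (\<forall>x\<in>T. cauchy_bounded (obox x (s x)) f) \<Longrightarrow> cauchy_bounded (\<Union>x\<in>T. obox x (s x)) f"
  proof (induction T rule: finite_induct)
    case empty
    have "cauchy_bounded {} f" unfolding cauchy_bounded_def by (auto intro!: exI[of _ "1::real"])
    then show ?case by simp
  qed (use union in simp)
  then have "cauchy_bounded (\<Union>x\<in>T. obox x (s x)) f" using T s by blast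
  then show ?thesis unfolding cauchy_bounded_def using T(3) by (meson subsetD)
qed

subsection \<open>Integration by parts\<close>

lemma lborel_translate:
  fixes F :: "'a::euclidean_space \<Rightarrow> 'b::{banach, second_countable_topology}"
  assumes "integrable lborel F"
  shows "integrable lborel (\<lambda>y. F (y + v))" "integral\<^sup>L lborel (\<lambda>y. F (y + v)) = integral\<^sup>L lborel F"
proof -
  have m: "F \<in> borel_measurable borel" using borel_measurable_integrable[OF assms] by simp
  have "integrable (distr lborel borel ((+) v)) F" using assms by (simp add: lborel_distr_plus)
  then show "integrable lborel (\<lambda>y. F (y + v))"
    by (subst (asm) integrable_distr_eq) (use m in \<open>auto simp: add.commute\<close>)
  have "integral\<^sup>L lborel F = integral\<^sup>L (distr lborel borel ((+) v)) F" by (simp add: lborel_distr_plus)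
  also have "\<dots> = integral\<^sup>L lborel (\<lambda>y. F (y + v))"
    by (subst integral_distr) (use m in \<open>auto simp: add.commute\<close>)
  finally show "integral\<^sup>L lborel (\<lambda>y. F (y + v)) = integral\<^sup>L lborel F" by simp
qed

lemma hpd_quotient:
  assumes "hpd i f x D"
  shows "((\<lambda>u. (f (x + u *\<^sub>R axis i 1) - f x) /\<^sub>R u) \<longlongrightarrow> D) (at 0)"
proof -
  have "((\<lambda>u. norm (f (x + (0 + u) *\<^sub>R axis i 1) - f (x + 0 *\<^sub>R axis i 1) - u *\<^sub>R D) / norm u) \<longlongrightarrow> 0) (at 0)"
    using assms unfolding hpd_def has_vector_derivative_def has_derivative_at by blast
  then have "((\<lambda>u. norm ((f (x + u *\<^sub>R axis i 1) - f x) /\<^sub>R u - D)) \<longlongrightarrow> 0) (at 0)"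
  proof (rule Lim_transform_eventually)
    show "\<forall>\<^sub>F u in at 0. norm (f (x + (0 + u) *\<^sub>R axis i 1) - f (x + 0 *\<^sub>R axis i 1) - u *\<^sub>R D) / norm u
        = norm ((f (x + u *\<^sub>R axis i 1) - f x) /\<^sub>R u - D)"
      using eventually_neq_at_within[of 0 0 UNIV]
    proof eventually_elim
      case (elim u)
      have "(f (x + u *\<^sub>R axis i 1) - f x) /\<^sub>R u - D = (f (x + u *\<^sub>R axis i 1) - f x - u *\<^sub>R D) /\<^sub>R u"
        using elim by (simp add: scaleR_diff_right)
      then show ?case by (simp add: divide_inverse mult.commute)
    qed
  qed
  then show ?thesis by (rule LIM_zero_cancel[OF tendsto_norm_zero_cancel])
qed

text \<open>The difference quotients have integral zero by translation invariance, and the Lipschitz bound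
  makes dominated convergence applicable.\<close>

lemma integral_pd_eq_0:
  fixes F F' :: "real^'n::finite \<Rightarrow> complex"
  assumes F: "integrable lborel F" and supp: "\<And>y. norm y > R \<Longrightarrow> F y = 0"
    and \<eta>: "\<eta> > 0" and lip: "\<And>y t. \<bar>t\<bar> \<le> \<eta> \<Longrightarrow> cmod (F (y + t *\<^sub>R axis i 1) - F y) \<le> C * \<bar>t\<bar>"
    and F': "F' \<in> borel_measurable borel" and AE: "AE y in lborel. hpd i F y (F' y)"
  shows "integrable lborel F'" "integral\<^sup>L lborel F' = 0"
proof -
  define t where "t n = \<eta> / (real n + 1)" for n :: nat
  have t: "t n \<noteq> 0" "\<bar>t n\<bar> \<le> \<eta>" for n
    using \<eta> by (auto simp: t_def field_simps)
  have "(\<lambda>n. \<eta> * inverse (real (Suc n))) \<longlonglongrightarrow> \<eta> * 0"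
    by (intro tendsto_mult tendsto_const LIMSEQ_inverse_real_of_nat)
  then have t0: "t \<longlonglongrightarrow> 0" unfolding t_def by (simp add: divide_inverse add.commute)
  have "0 \<le> C * \<eta>" using lip[of \<eta> 0] \<eta> by (simp add: order_trans[OF norm_ge_zero])
  then have C: "C \<ge> 0" using \<eta> by (simp add: zero_le_mult_iff)
  define s where "s n y = (F (y + t n *\<^sub>R axis i 1) - F y) /\<^sub>R t n" for n y
  have si: "integrable lborel (s n)" and s0: "integral\<^sup>L lborel (s n) = 0" for n
    unfolding s_def using F lborel_translate[OF F, of "t n *\<^sub>R axis i 1"] by auto
  define w where "w y = indicator (cball 0 (R + \<eta>)) y *\<^sub>R C" for y :: "real^'n"
  have wi: "integrable lborel w" unfolding w_def
    by (rule borel_integrable_compact) auto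
  have lim: "AE y in lborel. (\<lambda>n. s n y) \<longlonglongrightarrow> F' y"
    using AE
  proof eventually_elim
    fix y assume "hpd i F y (F' y)"
    then have "((\<lambda>h. (F (y + h *\<^sub>R axis i 1) - F y) /\<^sub>R h) \<longlongrightarrow> F' y) (at 0)"
      by (rule hpd_quotient)
    moreover have "filterlim t (at 0) sequentially"
      using t0 t by (simp add: filterlim_at)
    ultimately show "(\<lambda>n. s n y) \<longlonglongrightarrow> F' y"
      unfolding s_def by (rule filterlim_compose)
  qed
  have bd: "AE y in lborel. norm (s n y) \<le> w y" for n
  proof (rule AE_I2)
    fix y :: "real^'n"
    show "norm (s n y) \<le> w y"
    proof (cases "norm y \<le> R + \<eta>")
      case True
      then show ?thesis using lip[OF t(2), of y n] t[of n]
        by (simp add: s_def w_def divide_simps mult.commute divide_inverse[symmetric])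
    next
      case False
      have "norm y \<le> norm (y + t n *\<^sub>R axis i 1) + \<bar>t n\<bar>"
        using norm_triangle_ineq4[of "y + t n *\<^sub>R axis i 1" "t n *\<^sub>R axis i 1"] by simp
      then have "norm (y + t n *\<^sub>R axis i 1) > R" "norm y > R" using False t(2)[of n] \<eta> by auto
      then show ?thesis using supp C by (simp add: s_def w_def)
    qed
  qed

  show "integrable lborel F'"
    by (rule integrable_dominated_convergence[OF _ _ wi lim bd]) (use F' si in auto)
  have "(\<lambda>n. integral\<^sup>L lborel (s n)) \<longlonglongrightarrow> integral\<^sup>L lborel F'"
    by (rule integral_dominated_convergence[OF _ _ wi lim bd]) (use F' si in auto)
  then show "integral\<^sup>L lborel F' = 0" by (simp add: s0 LIMSEQ_const_iff)
qed

text \<open>The bumps, and the powers of the lens weight that are integrated by parts, are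
  differentiable off finitely many such hyperplanes.\<close>

lemma AE_hyperplane: "AE x in lborel. x $ k \<noteq> (a::real)" for k :: "'n::finite"
proof (rule AE_I')
  have "negligible {x::real^'n. x $ k = a}"
    using negligible_standard_hyperplane[of "axis k 1 :: real^'n" a] by (simp add: inner_axis)
  moreover have "{x::real^'n. x $ k = a} \<in> sets lborel"
    by (auto intro!: borel_closed closed_Collect_eq continuous_intros)
  ultimately show "{x::real^'n. x $ k = a} \<in> null_sets lborel"
    by (simp add: negligible_iff_null_sets null_sets_completion_iff)
qed auto

lemma integrable_weight:
  fixes w :: "real^'n::finite \<Rightarrow> real" and g :: "real^'n \<Rightarrow> 'b::{banach, second_countable_topology}"
  assumes w: "w \<in> borel_measurable borel" and b: "\<And>x. \<bar>w x\<bar> \<le> M" and K: "compact K" "\<And>x. x \<notin> K \<Longrightarrow> w x = 0"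
    and g: "continuous_on K g"
  shows "integrable lborel (\<lambda>x. w x *\<^sub>R g x)"
proof (rule Bochner_Integration.integrable_bound)
  have i: "integrable lborel (\<lambda>x. indicator K x *\<^sub>R g x)" by (rule borel_integrable_compact[OF K(1) g])
  show "integrable lborel (\<lambda>x. M *\<^sub>R (indicator K x *\<^sub>R g x))"
    by (rule integrable_scaleR_right[OF i])
  have eq: "(\<lambda>x. w x *\<^sub>R g x) = (\<lambda>x. w x *\<^sub>R (indicator K x *\<^sub>R g x))"
  proof
    fix x show "w x *\<^sub>R g x = w x *\<^sub>R (indicator K x *\<^sub>R g x)"
      using K(2)[of x] by (cases "x \<in> K") auto
  qed
  show "(\<lambda>x. w x *\<^sub>R g x) \<in> borel_measurable lborel"
    unfolding eq by (intro borel_measurable_scaleR borel_measurable_integrable[OF i]) (use w in simp)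
  show "AE x in lborel. norm (w x *\<^sub>R g x) \<le> norm (M *\<^sub>R (indicator K x *\<^sub>R g x))"
  proof (rule AE_I2)
    fix x
    have "\<bar>w x\<bar> * norm (g x) \<le> \<bar>M\<bar> * norm (g x)" using b[of x] by (intro mult_right_mono) auto
    then show "norm (w x *\<^sub>R g x) \<le> norm (M *\<^sub>R (indicator K x *\<^sub>R g x))" using K(2)[of x] by (auto simp: indicator_def)
  qed
qed

text \<open>Integration by parts for a weight that is only Lipschitz, with derivative
  \<open>dW\<close> almost everywhere. The function \<open>g\<close> is controlled on
  \<open>U\<close> only, so everything is anchored to the compact set \<open>K\<close> outside which
  the weight vanishes.\<close>

lemma integral_weight_pd:
  fixes W dW :: "real^'n::finite \<Rightarrow> real" and g :: "real^'n \<Rightarrow> complex"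
  assumes U: "open U" and K: "compact K" "K \<subseteq> U"
    and W: "W \<in> borel_measurable borel" "\<And>x. \<bar>W x\<bar> \<le> M" "\<And>x. x \<notin> K \<Longrightarrow> W x = 0"
    and dW: "dW \<in> borel_measurable borel" "\<And>x. \<bar>dW x\<bar> \<le> M" "\<And>x. x \<notin> K \<Longrightarrow> dW x = 0"
    and lip: "\<And>y t. \<bar>W (y + t *\<^sub>R axis i 1) - W y\<bar> \<le> L * \<bar>t\<bar>"
    and der: "AE y in lborel. hpd i (\<lambda>x. complex_of_real (W x)) y (complex_of_real (dW y))"
    and g: "smooth_on U g"
  shows "integrable lborel (\<lambda>x. dW x *\<^sub>R g x + W x *\<^sub>R pd i g x)"
    "integral\<^sup>L lborel (\<lambda>x. dW x *\<^sub>R g x + W x *\<^sub>R pd i g x) = 0"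
proof -
  have gc: "continuous_on U g" "continuous_on U (pd i g)"
    using smooth_on_cont[OF g, of "[]"] smooth_on_cont[OF g, of "[i]"] by auto
  note i1 = integrable_weight[OF W(1,2) K(1) W(3)] and i2 = integrable_weight[OF dW(1,2) K(1) dW(3)]
  define F where "F x = W x *\<^sub>R g x" for x
  define F' where "F' x = dW x *\<^sub>R g x + W x *\<^sub>R pd i g x" for x
  have Fi: "integrable lborel F" unfolding F_def
    by (rule i1) (use gc K in \<open>auto intro: continuous_on_subset\<close>)
  have F'i: "integrable lborel F'" unfolding F'_def
    by (intro Bochner_Integration.integrable_add i1 i2) (use gc K in \<open>auto intro: continuous_on_subset\<close>)
  then have F'm: "F' \<in> borel_measurable borel" using borel_measurable_integrable by fastforce
  obtain R where R: "\<And>x. x \<in> K \<Longrightarrow> norm x \<le> R"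
    using compact_imp_bounded[OF K(1)] bounded_iff by blast
  obtain \<eta> where \<eta>: "\<eta> > 0" "(\<Union>x\<in>K. ball x \<eta>) \<subseteq> U"
    using compact_subset_open_imp_ball_epsilon_subset[OF K(1) U K(2)] by blast
  \<comment> \<open>Difference quotients move points of \<open>K\<close> out of \<open>K\<close>.
    This closed \<open>\<eta> / 2\<close> neighbourhood is still compact in \<open>U\<close> and
    supplies the bounds on \<open>g\<close> and its derivative along the shifts.\<close>
  define K' where "K' = (\<Union>x\<in>K. \<Union>y\<in>cball 0 (\<eta> / 2). {x + y})"
  have K': "compact K'" unfolding K'_def by (intro compact_sums' K(1) compact_cball)
  have K'U: "K' \<subseteq> U"
  proof
    fix z assume "z \<in> K'"
    then obtain x y where "x \<in> K" "norm y \<le> \<eta> / 2" "z = x + y" by (auto simp: K'_def)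
    then have "z \<in> ball x \<eta>" using \<eta>(1) by (simp add: dist_norm)
    then show "z \<in> U" using \<eta>(2) \<open>x \<in> K\<close> by blast
  qed
  have "bounded (g ` K')" "bounded (pd i g ` K')"
    by (intro compact_imp_bounded compact_continuous_image continuous_on_subset[OF _ K'U] gc K')+
  then obtain B B' where B: "\<And>x. x \<in> K' \<Longrightarrow> cmod (g x) \<le> B" "\<And>x. x \<in> K' \<Longrightarrow> cmod (pd i g x) \<le> B'"
    unfolding bounded_iff by (metis imageI)
  have seg: "y + s *\<^sub>R axis i 1 \<in> K'" if "y \<in> K" "\<bar>s\<bar> \<le> \<eta> / 2" for y s
  proof -
    have "s *\<^sub>R axis i 1 \<in> cball (0::real^'n) (\<eta> / 2)" using that by simp
    then show ?thesis unfolding K'_def using that(1) by blast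
  qed
  have lipF: "cmod (F (y + t *\<^sub>R axis i 1) - F y) \<le> (L * \<bar>B\<bar> + M * \<bar>B'\<bar>) * \<bar>t\<bar>" if t: "\<bar>t\<bar> \<le> \<eta> / 2" for y t
  proof -
    let ?z = "y + t *\<^sub>R axis i 1"
    have M: "M \<ge> 0" using W(2)[of 0] by linarith
    have L: "L * \<bar>t\<bar> \<ge> 0" using lip[of y t] by linarith
    have split: "F ?z - F y = (W ?z - W y) *\<^sub>R g ?z + W y *\<^sub>R (g ?z - g y)"
      by (simp add: F_def algebra_simps)
    have Wz: "cmod ((W ?z - W y) *\<^sub>R g ?z) \<le> L * \<bar>t\<bar> * \<bar>B\<bar>" if "?z \<in> K'"
      using lip[of y t] B(1)[OF that] by (auto intro!: mult_mono order_trans[OF _ L])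
    \<comment> \<open>If \<open>y\<close> lies outside \<open>K\<close> and its shift inside, the
      increment of \<open>W\<close> alone carries the estimate, because
      \<open>W y = 0\<close>.\<close>
    consider "y \<in> K" | "y \<notin> K" "?z \<in> K" | "y \<notin> K" "?z \<notin> K" by blast
    then show ?thesis
    proof cases
      case 1
      have "cmod (g ?z - g y - t *\<^sub>R 0) \<le> \<bar>B'\<bar> * \<bar>t\<bar>"
      proof (rule pd_linearization)
        fix s assume s: "\<bar>s\<bar> \<le> \<bar>t\<bar>"
        have "y + s *\<^sub>R axis i 1 \<in> K'" by (rule seg[OF 1]) (use s t in simp)
        then show "hpd i g (y + s *\<^sub>R axis i 1) (pd i g (y + s *\<^sub>R axis i 1))"
          "cmod (pd i g (y + s *\<^sub>R axis i 1) - 0) \<le> \<bar>B'\<bar>"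
          using K'U smooth_on_hpd0[OF g] B(2)[of "y + s *\<^sub>R axis i 1"] by auto
      qed
      then have "cmod (W y *\<^sub>R (g ?z - g y)) \<le> M * (\<bar>B'\<bar> * \<bar>t\<bar>)"
        using W(2)[of y] M by (auto intro!: mult_mono)
      moreover have "cmod ((W ?z - W y) *\<^sub>R g ?z) \<le> L * \<bar>t\<bar> * \<bar>B\<bar>"
        by (rule Wz[OF seg[OF 1 t]])
      ultimately show ?thesis unfolding split
        by (intro norm_triangle_le) (simp add: algebra_simps)
    next
      case 2
      have "?z \<in> K'" using seg[OF 2(2), of 0] \<eta>(1) by simp
      then show ?thesis unfolding split
        using Wz W(3)[OF 2(1)] mult_nonneg_nonneg[OF M, of "\<bar>B'\<bar> * \<bar>t\<bar>"] by (simp add: algebra_simps)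
    next
      case 3
      moreover have "0 \<le> (L * \<bar>t\<bar>) * \<bar>B\<bar> + M * (\<bar>B'\<bar> * \<bar>t\<bar>)" by (rule add_nonneg_nonneg[OF mult_nonneg_nonneg[OF L] mult_nonneg_nonneg[OF M]]) auto
      ultimately show ?thesis using W(3) by (simp add: F_def algebra_simps)
    qed
  qed
  have AE: "AE y in lborel. hpd i F y (F' y)"
    using der
  proof eventually_elim
    fix y assume d: "hpd i (\<lambda>x. complex_of_real (W x)) y (complex_of_real (dW y))"
    show "hpd i F y (F' y)"
    proof (cases "y \<in> K")
      case True
      then have "hpd i g y (pd i g y)" using K smooth_on_hpd0[OF g] by auto
      from hpd_mult[OF d this] show ?thesis by (simp add: F_def[abs_def] F'_def scaleR_conv_of_real)
    next
      case False
      have "hpd i (\<lambda>x. 0) y 0" by (rule hpd_const)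
      then have "hpd i F y 0"
        by (rule hpd_cong[OF open_Compl[OF compact_imp_closed[OF K(1)]], rotated 2])
          (use False W(3) in \<open>auto simp: F_def\<close>)
      then show ?thesis using False W(3) dW(3) by (simp add: F'_def)
    qed
  qed
  have "integral\<^sup>L lborel F' = 0"
  proof (rule integral_pd_eq_0[OF Fi _ _ lipF F'm AE])
    show "F y = 0" if "norm y > R" for y using W(3)[of y] R[of y] that by (force simp: F_def)
    show "0 < \<eta> / 2" using \<eta> by simp
  qed
  then show "integrable lborel (\<lambda>x. dW x *\<^sub>R g x + W x *\<^sub>R pd i g x)"
    "integral\<^sup>L lborel (\<lambda>x. dW x *\<^sub>R g x + W x *\<^sub>R pd i g x) = 0"
    using F'i unfolding F'_def by auto
qed

subsection \<open>A Sobolev inequality on boxes\<close>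

text \<open>A tent rising with slope 1 to height \<open>\<epsilon>\<close> and falling linearly to 0
  at \<open>\<delta>\<close>; its derivative is \<open>bump_up\<close> minus
  \<open>bump_down\<close>.\<close>

definition bump :: "real \<Rightarrow> real \<Rightarrow> real \<Rightarrow> real" where
  "bump \<epsilon> \<delta> s = max 0 (min s (\<epsilon> * (\<delta> - s) / (\<delta> - \<epsilon>)))"

definition bump_up :: "real \<Rightarrow> real \<Rightarrow> real" where
  "bump_up \<epsilon> s = (if 0 < s \<and> s < \<epsilon> then 1 else 0)"

definition bump_down :: "real \<Rightarrow> real \<Rightarrow> real \<Rightarrow> real" where
  "bump_down \<epsilon> \<delta> s = (if \<epsilon> < s \<and> s < \<delta> then \<epsilon> / (\<delta> - \<epsilon>) else 0)"

lemma bump_bounds: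
  assumes "0 < \<epsilon>" "2 * \<epsilon> \<le> \<delta>"
  shows "0 \<le> bump \<epsilon> \<delta> s" "bump \<epsilon> \<delta> s \<le> \<epsilon>" "s \<notin> {0..\<delta>} \<Longrightarrow> bump \<epsilon> \<delta> s = 0"
    "\<bar>bump \<epsilon> \<delta> s - bump \<epsilon> \<delta> t\<bar> \<le> \<bar>s - t\<bar>"
    "0 \<le> bump_down \<epsilon> \<delta> s" "bump_down \<epsilon> \<delta> s \<le> \<epsilon> * (2 / \<delta>)"
proof -
  have d: "\<delta> - \<epsilon> > 0" "\<epsilon> / (\<delta> - \<epsilon>) \<le> 1" "0 < \<epsilon> / (\<delta> - \<epsilon>)" using assms by (auto simp: field_simps)
  have e: "\<epsilon> * (\<delta> - s) / (\<delta> - \<epsilon>) = \<epsilon> / (\<delta> - \<epsilon>) * (\<delta> - s)" for s by simp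
  show "0 \<le> bump \<epsilon> \<delta> s" by (simp add: bump_def)
  show "bump \<epsilon> \<delta> s \<le> \<epsilon>"
  proof (cases "s \<le> \<epsilon>")
    case False
    then have "\<epsilon> * (\<delta> - s) / (\<delta> - \<epsilon>) \<le> \<epsilon>" using assms by (simp add: divide_le_eq)
    then show ?thesis using assms by (auto simp: bump_def)
  qed (use assms in \<open>auto simp: bump_def\<close>)
  show "bump \<epsilon> \<delta> s = 0" if "s \<notin> {0..\<delta>}"
  proof (cases "s < 0")
    case False
    then have "\<epsilon> * (\<delta> - s) / (\<delta> - \<epsilon>) \<le> 0" using that assms by (auto simp: divide_nonpos_pos mult_nonneg_nonpos)
    then show ?thesis by (auto simp: bump_def)
  qed (auto simp: bump_def)
  have "\<bar>\<epsilon> * (\<delta> - s) / (\<delta> - \<epsilon>) - \<epsilon> * (\<delta> - t) / (\<delta> - \<epsilon>)\<bar> = \<epsilon> / (\<delta> - \<epsilon>) * \<bar>s - t\<bar>"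
  proof -
    have "\<epsilon> * (\<delta> - s) / (\<delta> - \<epsilon>) - \<epsilon> * (\<delta> - t) / (\<delta> - \<epsilon>) = \<epsilon> / (\<delta> - \<epsilon>) * (t - s)"
      unfolding e by (simp add: right_diff_distrib[symmetric] del: times_divide_eq_left)
    then show ?thesis using d(3) by (simp only: abs_mult abs_minus_commute abs_of_pos)
  qed
  also have "\<dots> \<le> \<bar>s - t\<bar>" using d by (intro mult_left_le_one_le) auto
  finally have *: "\<bar>\<epsilon> * (\<delta> - s) / (\<delta> - \<epsilon>) - \<epsilon> * (\<delta> - t) / (\<delta> - \<epsilon>)\<bar> \<le> \<bar>s - t\<bar>" .
  have "\<bar>max 0 (min s a) - max 0 (min t b)\<bar> \<le> \<bar>s - t\<bar>" if "\<bar>a - b\<bar> \<le> \<bar>s - t\<bar>" for a b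
    using that by (auto simp: max_def min_def abs_if split: if_splits)
  from this[OF *] show "\<bar>bump \<epsilon> \<delta> s - bump \<epsilon> \<delta> t\<bar> \<le> \<bar>s - t\<bar>" unfolding bump_def .
  show "0 \<le> bump_down \<epsilon> \<delta> s" using d by (auto simp: bump_down_def)
  have "\<epsilon> / (\<delta> - \<epsilon>) \<le> \<epsilon> * (2 / \<delta>)" using assms by (simp add: field_simps)
  then show "bump_down \<epsilon> \<delta> s \<le> \<epsilon> * (2 / \<delta>)" using assms by (auto simp: bump_down_def)
qed

lemma bump_deriv:
  assumes "0 < \<epsilon>" "2 * \<epsilon> \<le> \<delta>" "s \<noteq> 0" "s \<noteq> \<epsilon>" "s \<noteq> \<delta>"
  shows "(bump \<epsilon> \<delta> has_real_derivative (bump_up \<epsilon> s - bump_down \<epsilon> \<delta> s)) (at s)"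
proof -
  have d: "\<delta> - \<epsilon> > 0" using assms by auto
  have "\<epsilon> * (\<delta> - t) / (\<delta> - \<epsilon>) \<ge> t" if "t \<le> \<epsilon>" for t
  proof -
    have "t * (\<delta> - \<epsilon>) \<le> \<epsilon> * (\<delta> - \<epsilon>)" using that d by (intro mult_right_mono) auto
    also have "\<dots> \<le> \<epsilon> * (\<delta> - t)" using that assms by (intro mult_left_mono) auto
    finally show ?thesis using d by (simp add: le_divide_eq)
  qed
  note up = this
  have down: "\<epsilon> * (\<delta> - t) / (\<delta> - \<epsilon>) \<le> t" if "\<epsilon> \<le> t" for t
  proof -
    have "\<epsilon> * (\<delta> - t) \<le> \<epsilon> * (\<delta> - \<epsilon>)" using that assms by (intro mult_left_mono) auto
    also have "\<dots> \<le> t * (\<delta> - \<epsilon>)" using that d by (intro mult_right_mono) auto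
    finally show ?thesis using d by (simp add: divide_le_eq)
  qed
  consider "s < 0" | "0 < s" "s < \<epsilon>" | "\<epsilon> < s" "s < \<delta>" | "s > \<delta>" using assms by linarith
  then show ?thesis
  proof cases
    case 1
    have "((\<lambda>t. 0) has_real_derivative 0) (at s)" by auto
    then have "(bump \<epsilon> \<delta> has_real_derivative 0) (at s)"
      by (rule has_field_derivative_transform_within_open[of _ _ _ "{..<0}"])
        (use 1 bump_bounds(3)[OF assms(1,2)] in auto)
    then show ?thesis using 1 assms by (simp add: bump_up_def bump_down_def)
  next
    case 2
    have "((\<lambda>t. t) has_real_derivative 1) (at s)" by auto
    then have "(bump \<epsilon> \<delta> has_real_derivative 1) (at s)"
      by (rule has_field_derivative_transform_within_open[of _ _ _ "{0<..<\<epsilon>}"])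
        (use 2 up in \<open>auto simp: bump_def min_def\<close>)
    then show ?thesis using 2 assms by (simp add: bump_up_def bump_down_def)
  next
    case 3
    have "((\<lambda>t. \<epsilon> * (\<delta> - t) / (\<delta> - \<epsilon>)) has_real_derivative - (\<epsilon> / (\<delta> - \<epsilon>))) (at s)"
      using d by (auto intro!: derivative_eq_intros)
    then have "(bump \<epsilon> \<delta> has_real_derivative - (\<epsilon> / (\<delta> - \<epsilon>))) (at s)"
      by (rule has_field_derivative_transform_within_open[of _ _ _ "{\<epsilon><..<\<delta>}"])
        (use 3 down d assms(1) in \<open>auto simp: bump_def min_def antisym max_def divide_less_0_iff mult_less_0_iff\<close>)
    then show ?thesis using 3 assms by (simp add: bump_up_def bump_down_def)
  next
    case 4
    have "((\<lambda>t. 0) has_real_derivative 0) (at s)" by auto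
    then have "(bump \<epsilon> \<delta> has_real_derivative 0) (at s)"
      by (rule has_field_derivative_transform_within_open[of _ _ _ "{\<delta><..}"])
        (use 4 bump_bounds(3)[OF assms(1,2)] in auto)
    then show ?thesis using 4 assms by (simp add: bump_up_def bump_down_def)
  qed
qed

text \<open>\<open>x\<close> is the lower corner, not the centre, to match the one-sided
  tent.\<close>

definition cube :: "real^'n::finite \<Rightarrow> real \<Rightarrow> (real^'n) set" where
  "cube x \<delta> = {y. \<forall>i. x $ i \<le> y $ i \<and> y $ i \<le> x $ i + \<delta>}"

lemma compact_cube: "compact (cube x \<delta>)"
proof -
  have "cube x \<delta> = cbox x (x + (\<chi> i. \<delta>))" by (auto simp: cube_def mem_box_cart)
  then show ?thesis by simp
qed

lemma integrable_cube: "continuous_on (cube x \<delta>) f \<Longrightarrow> integrable lborel (\<lambda>y. indicator (cube x \<delta>) y * (cmod (f y)))"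
  using borel_integrable_compact[OF compact_cube, of x \<delta> "\<lambda>y. cmod (f y)"]
  by (simp add: continuous_on_norm)

lemma measurable_component [measurable]: "(\<lambda>y::real^'n. y $ i) \<in> borel_measurable borel"
  by (intro borel_measurable_continuous_onI continuous_intros)

lemma bump_measurable:
  "(\<lambda>y::real^'n. bump \<epsilon> \<delta> (y $ i - a)) \<in> borel_measurable borel"
  "(\<lambda>y::real^'n. bump_up \<epsilon> (y $ i - a)) \<in> borel_measurable borel"
  "(\<lambda>y::real^'n. bump_down \<epsilon> \<delta> (y $ i - a)) \<in> borel_measurable borel"
  unfolding bump_def bump_up_def bump_down_def by measurable

text \<open>Integrating by parts once in each direction of \<open>T\<close> replaces the concentrated kernel
  \<open>bump_up\<close> of height 1 and width \<open>\<epsilon>\<close> by kernels of size \<open>\<epsilon>\<close> spread over the cube.\<close>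

lemma cube_kernel_bound:
  fixes w :: "real^'n::finite \<Rightarrow> complex"
  assumes U: "open U" "cube x \<delta> \<subseteq> U" and \<epsilon>: "0 < \<epsilon>" "2 * \<epsilon> \<le> \<delta>"
  shows "finite T \<Longrightarrow> smooth_on U w \<Longrightarrow> G \<in> borel_measurable borel \<Longrightarrow> (\<And>y. 0 \<le> G y) \<Longrightarrow> (\<And>y. G y \<le> M) \<Longrightarrow>
    (\<And>y i. i \<notin> T \<Longrightarrow> y $ i - x $ i \<notin> {0..\<delta>} \<Longrightarrow> G y = 0) \<Longrightarrow>
    (\<And>y i t. i \<in> T \<Longrightarrow> G (y + t *\<^sub>R axis i 1) = G y) \<Longrightarrow>
    (\<And>is. length is \<le> card T \<Longrightarrow> integral\<^sup>L lborel (\<lambda>y. indicator (cube x \<delta>) y * cmod (pds is w y)) \<le> \<beta>) \<Longrightarrow>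
    cmod (integral\<^sup>L lborel (\<lambda>y. ((\<Prod>i\<in>T. bump_up \<epsilon> (y $ i - x $ i)) * G y) *\<^sub>R w y)) \<le> M * (\<epsilon> * (1 + 2 / \<delta>)) ^ card T * \<beta>"
proof (induction T arbitrary: w G M rule: finite_induct)
  case (empty w G M)
  have M: "M \<ge> 0" using empty(3,4)[of 0] by linarith
  have G0: "G y = 0" if "y \<notin> cube x \<delta>" for y
    using empty(5)[of _ y] that by (auto simp: cube_def) (metis add.commute diff_ge_0_iff_ge diff_le_eq)
  have wc: "continuous_on (cube x \<delta>) w"
    using smooth_on_cont[OF empty(1), of "[]"] U continuous_on_subset by auto
  have "cmod (integral\<^sup>L lborel (\<lambda>y. G y *\<^sub>R w y)) \<le> integral\<^sup>L lborel (\<lambda>y. norm (G y *\<^sub>R w y))"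
    by (rule integral_norm_bound)
  also have "\<dots> \<le> integral\<^sup>L lborel (\<lambda>y. M * (indicator (cube x \<delta>) y * cmod (w y)))"
  proof (rule integral_mono)
    show "integrable lborel (\<lambda>y. norm (G y *\<^sub>R w y))"
      by (rule integrable_norm, rule integrable_weight[OF empty(2) _ compact_cube G0 wc, of M])
        (use empty(3,4) in auto)
    show "integrable lborel (\<lambda>y. M * (indicator (cube x \<delta>) y * cmod (w y)))"
      by (intro integrable_mult_right integrable_cube wc)
    show "norm (G y *\<^sub>R w y) \<le> M * (indicator (cube x \<delta>) y * cmod (w y))" for y
      using empty(3,4)[of y] G0[of y] by (auto simp: indicator_def mult_right_mono)
  qed
  also have "\<dots> = M * integral\<^sup>L lborel (\<lambda>y. indicator (cube x \<delta>) y * cmod (w y))" by simp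
  also have "\<dots> \<le> M * \<beta>" using empty(7)[of "[]"] M by (intro mult_left_mono) auto
  finally show ?case by simp
next
  case (insert i T w G M)
  have M: "M \<ge> 0" using insert.prems(3,4)[of 0] by linarith
  let ?H = "\<lambda>y. (\<Prod>j\<in>T. bump_up \<epsilon> (y $ j - x $ j)) * G y"
  let ?up = "\<lambda>y. bump_up \<epsilon> (y $ i - x $ i)" and ?dn = "\<lambda>y. bump_down \<epsilon> \<delta> (y $ i - x $ i)"
    and ?b = "\<lambda>y. bump \<epsilon> \<delta> (y $ i - x $ i)"
  have P01: "0 \<le> (\<Prod>j\<in>T. bump_up \<epsilon> (y $ j - x $ j))" "(\<Prod>j\<in>T. bump_up \<epsilon> (y $ j - x $ j)) \<le> 1" for y
    by (auto intro!: prod_nonneg prod_le_1 simp: bump_up_def)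
  have H01: "0 \<le> ?H y" "?H y \<le> M" for y
    using P01[of y] insert.prems(3,4)[of y] M
    by (auto intro!: mult_nonneg_nonneg order_trans[OF mult_left_le_one_le])
  have Hm: "?H \<in> borel_measurable borel"
    by (intro borel_measurable_times borel_measurable_prod bump_measurable insert.prems)
  have H0: "?H y = 0" if "j \<noteq> i" "y $ j - x $ j \<notin> {0..\<delta>}" for y j
  proof (cases "j \<in> T")
    case True
    have "bump_up \<epsilon> (y $ j - x $ j) = 0" using that \<epsilon> by (auto simp: bump_up_def)
    then have "(\<Prod>j\<in>T. bump_up \<epsilon> (y $ j - x $ j)) = 0" using True insert.hyps(1) by auto
    then show ?thesis by simp
  next
    case False then show ?thesis using insert.prems(5)[of j y] that by auto
  qed
  have in_cube: "\<exists>j. y $ j - x $ j \<notin> {0..\<delta>}" if "y \<notin> cube x \<delta>" for y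
    using that by (auto simp: cube_def not_le) (metis add.commute diff_ge_0_iff_ge diff_le_eq not_le)+
  have upb: "?up y = 0" "?dn y = 0" "?b y = 0" if "y $ i - x $ i \<notin> {0..\<delta>}" for y
    using that \<epsilon> bump_bounds(3)[OF \<epsilon>] by (auto simp: bump_up_def bump_down_def)
  have zero: "?up y * ?H y = 0 \<and> ?dn y * ?H y = 0 \<and> ?b y * ?H y = 0" if "y \<notin> cube x \<delta>" for y
  proof -
    obtain j where "y $ j - x $ j \<notin> {0..\<delta>}" using in_cube[OF \<open>y \<notin> cube x \<delta>\<close>] by blast
    then show ?thesis using H0[of j y] upb[of y] by (cases "j = i") auto
  qed
  have Hinv: "?H (y + t *\<^sub>R axis i 1) = ?H y" for y t
  proof -
    have "(\<Prod>j\<in>T. bump_up \<epsilon> ((y + t *\<^sub>R axis i 1) $ j - x $ j)) = (\<Prod>j\<in>T. bump_up \<epsilon> (y $ j - x $ j))"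
      using insert.hyps(2) by (intro prod.cong) (auto simp: axis_def)
    then show ?thesis using insert.prems(6) by simp
  qed
  have upd: "\<bar>?up y\<bar> \<le> 1" "\<bar>?dn y\<bar> \<le> 1" "\<bar>?b y\<bar> \<le> \<epsilon>" for y
  proof -
    show "\<bar>?up y\<bar> \<le> 1" by (simp add: bump_up_def)
    have "\<epsilon> * (2 / \<delta>) \<le> 1" using \<epsilon> by (simp add: divide_le_eq)
    then show "\<bar>?dn y\<bar> \<le> 1" using bump_bounds(5,6)[OF \<epsilon>, of "y $ i - x $ i"] by linarith
    show "\<bar>?b y\<bar> \<le> \<epsilon>" using bump_bounds(1,2)[OF \<epsilon>, of "y $ i - x $ i"] by linarith
  qed
  have ibp: "integral\<^sup>L lborel (\<lambda>y. ((?up y - ?dn y) * ?H y) *\<^sub>R w y + (?b y * ?H y) *\<^sub>R pd i w y) = 0"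
  proof (rule integral_weight_pd(2)[OF U(1) compact_cube U(2)])
    show "(\<lambda>y. ?b y * ?H y) \<in> borel_measurable borel" "(\<lambda>y. (?up y - ?dn y) * ?H y) \<in> borel_measurable borel"
      by (intro borel_measurable_times borel_measurable_diff bump_measurable Hm)+
    show "\<bar>?b y * ?H y\<bar> \<le> (2 + \<epsilon>) * M" for y
      unfolding abs_mult using upd(3)[of y] H01[of y] \<epsilon> by (intro mult_mono) auto
    show "\<bar>(?up y - ?dn y) * ?H y\<bar> \<le> (2 + \<epsilon>) * M" for y
      unfolding abs_mult using upd(1,2)[of y] H01[of y] \<epsilon> by (intro mult_mono) auto
    show "?b y * ?H y = 0" "(?up y - ?dn y) * ?H y = 0" if "y \<notin> cube x \<delta>" for y
      using zero[OF that] by (auto simp: left_diff_distrib)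
    show "\<bar>?b (y + t *\<^sub>R axis i 1) * ?H (y + t *\<^sub>R axis i 1) - ?b y * ?H y\<bar> \<le> M * \<bar>t\<bar>" for y t
    proof -
      have "\<bar>?b (y + t *\<^sub>R axis i 1) * ?H (y + t *\<^sub>R axis i 1) - ?b y * ?H y\<bar>
          = ?H y * \<bar>?b (y + t *\<^sub>R axis i 1) - ?b y\<bar>"
        unfolding Hinv left_diff_distrib[symmetric] abs_mult[of "_ - _"] abs_of_nonneg[OF H01(1)] by (rule mult.commute)
      also have "\<dots> \<le> M * \<bar>t\<bar>"
        using bump_bounds(4)[OF \<epsilon>, of "(y + t *\<^sub>R axis i 1) $ i - x $ i" "y $ i - x $ i"] H01[of y] M
        by (intro mult_mono) (auto simp: axis_def)
      finally show ?thesis .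
    qed
    have "AE y in lborel. (y::real^'n) $ i \<noteq> x $ i \<and> y $ i \<noteq> x $ i + \<epsilon> \<and> y $ i \<noteq> x $ i + \<delta>"
      using AE_hyperplane[of i "x $ i"] AE_hyperplane[of i "x $ i + \<epsilon>"] AE_hyperplane[of i "x $ i + \<delta>"] by auto
    then show "AE y in lborel. hpd i (\<lambda>y. complex_of_real (?b y * ?H y)) y (complex_of_real ((?up y - ?dn y) * ?H y))"
    proof eventually_elim
      case (elim y)
      have 1: "(bump \<epsilon> \<delta> has_real_derivative ?up y - ?dn y) (at (0 + (y $ i - x $ i)))"
        using bump_deriv[OF \<epsilon>, of "y $ i - x $ i"] elim by auto
      have "((\<lambda>t. bump \<epsilon> \<delta> (t + (y $ i - x $ i))) has_real_derivative ?up y - ?dn y) (at 0)"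
        by (rule DERIV_shift[THEN iffD1, OF 1])
      then have "((\<lambda>t. bump \<epsilon> \<delta> (t + (y $ i - x $ i)) * ?H y) has_real_derivative (?up y - ?dn y) * ?H y) (at 0)"
        by (rule DERIV_cmult_right)
      also have "(\<lambda>t. bump \<epsilon> \<delta> (t + (y $ i - x $ i)) * ?H y) = (\<lambda>t. ?b (y + t *\<^sub>R axis i 1) * ?H (y + t *\<^sub>R axis i 1))"
        unfolding Hinv by (auto simp: axis_def algebra_simps)
      finally show ?case unfolding hpd_def
        by (intro has_vector_derivative_of_real) (simp add: has_real_derivative_iff_has_vector_derivative)
    qed
  qed (rule insert.prems(1))
  have wc: "continuous_on (cube x \<delta>) w" "continuous_on (cube x \<delta>) (pd i w)"
    using smooth_on_cont[OF insert.prems(1), of "[]"] smooth_on_cont[OF insert.prems(1), of "[i]"] U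
    by (auto intro: continuous_on_subset)
  have intg: "integrable lborel (\<lambda>y. (f y * ?H y) *\<^sub>R v y)"
    if "f \<in> borel_measurable borel" "\<And>y. \<bar>f y\<bar> \<le> 1 + \<epsilon>" "\<And>y. y \<notin> cube x \<delta> \<Longrightarrow> f y * ?H y = 0"
      "continuous_on (cube x \<delta>) v" for f and v :: "real^'n \<Rightarrow> complex"
  proof (rule integrable_weight[OF _ _ compact_cube that(3,4)])
    show "(\<lambda>y. f y * ?H y) \<in> borel_measurable borel" by (intro borel_measurable_times that(1) Hm)
    show "\<bar>f y * ?H y\<bar> \<le> (1 + \<epsilon>) * M" for y
      unfolding abs_mult[of "f y"] using that(2)[of y] H01[of y] \<epsilon> by (intro mult_mono) auto
  qed
  have "\<bar>?up y\<bar> \<le> 1 + \<epsilon>" "\<bar>?dn y\<bar> \<le> 1 + \<epsilon>" "\<bar>?b y\<bar> \<le> 1 + \<epsilon>" for y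
    using upd[of y] \<epsilon> by linarith+
  note ub = this
  have int: "integrable lborel (\<lambda>y. (?up y * ?H y) *\<^sub>R w y)" "integrable lborel (\<lambda>y. (?dn y * ?H y) *\<^sub>R w y)"
    "integrable lborel (\<lambda>y. (?b y * ?H y) *\<^sub>R pd i w y)"
    by (rule intg[OF bump_measurable(2) ub(1) _ wc(1)] intg[OF bump_measurable(3) ub(2) _ wc(1)]
        intg[OF bump_measurable(1) ub(3) _ wc(2)]; use zero in blast)+
  have "integral\<^sup>L lborel (\<lambda>y. ((?up y - ?dn y) * ?H y) *\<^sub>R w y + (?b y * ?H y) *\<^sub>R pd i w y)
    = integral\<^sup>L lborel (\<lambda>y. (?up y * ?H y) *\<^sub>R w y) - integral\<^sup>L lborel (\<lambda>y. (?dn y * ?H y) *\<^sub>R w y)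
      + integral\<^sup>L lborel (\<lambda>y. (?b y * ?H y) *\<^sub>R pd i w y)"
    using int by (simp add: left_diff_distrib scaleR_left_diff_distrib)
  then have key: "integral\<^sup>L lborel (\<lambda>y. (?up y * ?H y) *\<^sub>R w y)
    = integral\<^sup>L lborel (\<lambda>y. (?dn y * ?H y) *\<^sub>R w y) - integral\<^sup>L lborel (\<lambda>y. (?b y * ?H y) *\<^sub>R pd i w y)"
    using ibp by (simp add: algebra_simps)
  let ?I = "(\<epsilon> * (1 + 2 / \<delta>)) ^ card T"
  have c: "card (insert i T) = Suc (card T)" using insert.hyps by simp
  have inv': "f (y $ i - x $ i) * G y = f ((y + t *\<^sub>R axis j 1) $ i - x $ i) * G (y + t *\<^sub>R axis j 1)"
    if "j \<in> T" for f :: "real \<Rightarrow> real" and y j t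
    using that insert.hyps(2) insert.prems(6)[of j y t] by (auto simp: axis_def)
  \<comment> \<open>The factor for direction \<open>i\<close> is moved into the weight
    \<open>G\<close>, which leaves a kernel over \<open>T\<close> alone; the new sup bound carries
    the factor of size \<open>\<epsilon>\<close>.\<close>
  have b1: "cmod (integral\<^sup>L lborel (\<lambda>y. ((\<Prod>j\<in>T. bump_up \<epsilon> (y $ j - x $ j)) * (?dn y * G y)) *\<^sub>R w y)) \<le> (\<epsilon> * (2 / \<delta>) * M) * ?I * \<beta>"
  proof (rule insert.IH)
    show "(\<lambda>y. ?dn y * G y) \<in> borel_measurable borel"
      by (intro borel_measurable_times bump_measurable insert.prems)
    show "0 \<le> ?dn y * G y" for y
      using bump_bounds(5)[OF \<epsilon>, of "y $ i - x $ i"] insert.prems(3)[of y] by simp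
    show "?dn y * G y \<le> \<epsilon> * (2 / \<delta>) * M" for y
      by (rule mult_mono) (use bump_bounds(6)[OF \<epsilon>, of "y $ i - x $ i"] insert.prems(3,4)[of y] \<epsilon> in auto)
    show "?dn (y + t *\<^sub>R axis j 1) * G (y + t *\<^sub>R axis j 1) = ?dn y * G y" if "j \<in> T" for y j t
      by (rule inv'[OF that, symmetric])
    show "?dn y * G y = 0" if "j \<notin> T" "y $ j - x $ j \<notin> {0..\<delta>}" for y j
      using that upb(2)[of y] insert.prems(5)[of j y] by (cases "j = i") auto
    show "integral\<^sup>L lborel (\<lambda>y. indicator (cube x \<delta>) y * cmod (pds is w y)) \<le> \<beta>" if "length is \<le> card T" for "is"
      using insert.prems(7)[of "is"] that c by simp
  qed (rule insert.prems(1))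
  have b2: "cmod (integral\<^sup>L lborel (\<lambda>y. ((\<Prod>j\<in>T. bump_up \<epsilon> (y $ j - x $ j)) * (?b y * G y)) *\<^sub>R pd i w y)) \<le> (\<epsilon> * M) * ?I * \<beta>"
  proof (rule insert.IH)
    show "(\<lambda>y. ?b y * G y) \<in> borel_measurable borel"
      by (intro borel_measurable_times bump_measurable insert.prems)
    show "?b (y + t *\<^sub>R axis j 1) * G (y + t *\<^sub>R axis j 1) = ?b y * G y" if "j \<in> T" for y j t
      by (rule inv'[OF that, symmetric])
    show "0 \<le> ?b y * G y" "?b y * G y \<le> \<epsilon> * M" for y
      using bump_bounds(1,2)[OF \<epsilon>, of "y $ i - x $ i"] insert.prems(3,4)[of y] \<epsilon> by (auto intro!: mult_mono)
    show "?b y * G y = 0" if "j \<notin> T" "y $ j - x $ j \<notin> {0..\<delta>}" for y j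
      using that upb(3)[of y] insert.prems(5)[of j y] by (cases "j = i") auto
    show "smooth_on U (pd i w)" by (rule smooth_on_pd[OF insert.prems(1)])
    show "integral\<^sup>L lborel (\<lambda>y. indicator (cube x \<delta>) y * cmod (pds is (pd i w) y)) \<le> \<beta>" if "length is \<le> card T" for "is"
      using insert.prems(7)[of "is @ [i]"] that c by (simp add: pds_append)
  qed
  have "cmod (integral\<^sup>L lborel (\<lambda>y. (?up y * ?H y) *\<^sub>R w y)) \<le> (\<epsilon> * (2 / \<delta>) * M) * ?I * \<beta> + (\<epsilon> * M) * ?I * \<beta>"
    unfolding key using b1 b2 by (intro norm_triangle_le_diff add_mono) (auto simp: mult_ac)
  also have "\<dots> = M * (\<epsilon> * (1 + 2 / \<delta>)) ^ card (insert i T) * \<beta>"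
    unfolding c by (simp add: algebra_simps)
  finally show ?case using insert.hyps by (simp add: mult_ac)
qed

text \<open>The kernel estimate is of order \<open>\<epsilon> ^ CARD('n)\<close>, the volume of the
  box on which \<open>w\<close> is averaged, so dividing by the volume gives a bound that survives
  shrinking the box. Only L1 norms of derivatives up to order \<open>CARD('n)\<close> enter.\<close>

lemma sobolev_cube:
  fixes w :: "real^'n::finite \<Rightarrow> complex"
  assumes U: "open U" "cube x \<delta> \<subseteq> U" and \<delta>: "0 < \<delta>" and w: "smooth_on U w"
    and \<beta>: "\<And>is. length is \<le> CARD('n) \<Longrightarrow> integral\<^sup>L lborel (\<lambda>y. indicator (cube x \<delta>) y * cmod (pds is w y)) \<le> \<beta>"
  shows "cmod (w x) \<le> (1 + 2 / \<delta>) ^ CARD('n) * \<beta>"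
proof (rule ccontr)
  let ?n = "CARD('n)"
  assume "\<not> ?thesis"
  then have "0 < cmod (w x) - (1 + 2 / \<delta>) ^ ?n * \<beta>" by simp
  then obtain e where e: "0 < e" "e < cmod (w x) - (1 + 2 / \<delta>) ^ ?n * \<beta>" using dense by blast
  have xU: "x \<in> U" using U \<delta> by (auto simp: cube_def)
  have "isCont w x"
    using smooth_on_cont[OF w, of "[]"] U(1) xU by (simp add: continuous_on_eq_continuous_at)
  then obtain d where d: "d > 0" "\<And>y. dist y x < d \<Longrightarrow> dist (w y) (w x) < e"
    using e unfolding continuous_at_eps_delta by blast
  \<comment> \<open>Points of the box of side \<open>\<epsilon>\<close> are within
    \<open>real ?n * \<epsilon>\<close> of its corner in the l1 norm, hence inside the ball of
    radius \<open>d\<close>.\<close>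
  define \<epsilon> where "\<epsilon> = min (\<delta> / 2) (d / (2 * real ?n))"
  have \<epsilon>: "0 < \<epsilon>" "2 * \<epsilon> \<le> \<delta>" "real ?n * \<epsilon> < d" using \<delta> d(1) by (auto simp: \<epsilon>_def min_def field_simps)
  define P where "P y = (\<Prod>i\<in>UNIV. bump_up \<epsilon> (y $ i - x $ i))" for y
  define B where "B = box x (x + (\<chi> i. \<epsilon>))"
  have P: "P y = indicator B y" for y
  proof (cases "y \<in> B")
    case True
    then have "0 < y $ i - x $ i \<and> y $ i - x $ i < \<epsilon>" for i
      by (simp add: B_def mem_box_cart) (metis add.commute less_diff_eq diff_less_eq)
    then have "\<And>i. bump_up \<epsilon> (y $ i - x $ i) = 1" by (simp add: bump_up_def)
    then show ?thesis using True by (simp add: P_def)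
  next
    case False
    then obtain i where "\<not> (x $ i < y $ i \<and> y $ i < x $ i + \<epsilon>)" by (auto simp: B_def mem_box_cart)
    then have "bump_up \<epsilon> (y $ i - x $ i) = 0" by (auto simp: bump_up_def)
    then show ?thesis using False by (force simp: P_def)
  qed
  have mB: "measure lborel B = \<epsilon> ^ ?n"
  proof -
    have "(x + (\<chi> i. \<epsilon>) - x) \<bullet> b = \<epsilon>" if "b \<in> Basis" for b :: "real^'n"
      using that by (auto simp: Basis_vec_def inner_axis)
    moreover have "x \<bullet> b \<le> (x + (\<chi> i. \<epsilon>)) \<bullet> b" if "b \<in> Basis" for b :: "real^'n"
      using that \<epsilon> by (auto simp: Basis_vec_def inner_axis)
    ultimately have "measure lborel B = (\<Prod>b\<in>(Basis::(real^'n) set). \<epsilon>)"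
      unfolding B_def by (subst measure_lborel_box_eq) (auto intro!: prod.cong)
    then show ?thesis by simp
  qed
  have near: "cmod (w y - w x) \<le> e" if "y \<in> B" for y
  proof -
    have "norm (y - x) \<le> (\<Sum>i\<in>UNIV. \<bar>(y - x) $ i\<bar>)" by (rule norm_le_l1_cart)
    also have "\<dots> \<le> (\<Sum>i\<in>(UNIV::'n set). \<epsilon>)" using that by (intro sum_mono) (auto simp: B_def mem_box_cart less_imp_le abs_le_iff algebra_simps)
    finally have "dist y x < d" using \<epsilon>(3) by (simp add: dist_norm)
    then show ?thesis using d(2)[of y] by (simp add: dist_norm less_imp_le)
  qed
  have BC: "B \<subseteq> cube x \<delta>" using \<epsilon> by (auto simp: B_def cube_def mem_box_cart) (smt (verit))+
  have Pm: "P \<in> borel_measurable borel" unfolding P_def by (intro borel_measurable_prod bump_measurable)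
  have wc: "continuous_on (cube x \<delta>) w"
    using smooth_on_cont[OF w, of "[]"] U continuous_on_subset by auto
  have i1: "integrable lborel (\<lambda>y. P y *\<^sub>R (w y - w x))"
    by (rule integrable_weight[OF Pm _ compact_cube, of 1 x \<delta>])
      (use BC wc in \<open>auto simp: P indicator_def intro!: continuous_intros\<close>)
  have i2: "integrable lborel (\<lambda>y. P y *\<^sub>R w x)"
    by (rule integrable_weight[OF Pm _ compact_cube, of 1 x \<delta>])
      (use BC wc in \<open>auto simp: P indicator_def intro!: continuous_intros\<close>)
  have "integrable lborel (\<lambda>y. P y *\<^sub>R (1::real))"
    by (rule integrable_weight[OF Pm _ compact_cube, of 1 x \<delta>])
      (use BC in \<open>auto simp: P indicator_def\<close>)
  then have i3: "integrable lborel P" by simp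
  have "integral\<^sup>L lborel (\<lambda>y. P y *\<^sub>R w y) = integral\<^sup>L lborel (\<lambda>y. P y *\<^sub>R (w y - w x) + P y *\<^sub>R w x)"
    by (simp add: scaleR_diff_right)
  also have "\<dots> = integral\<^sup>L lborel (\<lambda>y. P y *\<^sub>R (w y - w x)) + \<epsilon> ^ ?n *\<^sub>R w x"
    using i1 i2 i3 by (simp add: P[abs_def] mB)
  finally have eq: "\<epsilon> ^ ?n *\<^sub>R w x = integral\<^sup>L lborel (\<lambda>y. P y *\<^sub>R w y) - integral\<^sup>L lborel (\<lambda>y. P y *\<^sub>R (w y - w x))" by simp
  have "cmod (integral\<^sup>L lborel (\<lambda>y. (P y * 1) *\<^sub>R w y)) \<le> 1 * (\<epsilon> * (1 + 2 / \<delta>)) ^ card (UNIV :: 'n set) * \<beta>"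
    unfolding P_def by (rule cube_kernel_bound[OF U \<epsilon>(1,2) _ w]) (use \<beta> in auto)
  moreover have "cmod (integral\<^sup>L lborel (\<lambda>y. P y *\<^sub>R (w y - w x))) \<le> e * \<epsilon> ^ ?n"
  proof -
    have "cmod (integral\<^sup>L lborel (\<lambda>y. P y *\<^sub>R (w y - w x))) \<le> integral\<^sup>L lborel (\<lambda>y. norm (P y *\<^sub>R (w y - w x)))"
      by (rule integral_norm_bound)
    also have "\<dots> \<le> integral\<^sup>L lborel (\<lambda>y. e * P y)"
    proof (rule integral_mono)
      show "integrable lborel (\<lambda>y. norm (P y *\<^sub>R (w y - w x)))" by (rule integrable_norm[OF i1])
      show "integrable lborel (\<lambda>y. e * P y)" by (rule integrable_mult_right[OF i3])
      show "norm (P y *\<^sub>R (w y - w x)) \<le> e * P y" for y using near[of y] by (auto simp: P indicator_def)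
    qed
    finally show ?thesis by (simp add: P[abs_def] mB)
  qed
  ultimately have "cmod (\<epsilon> ^ ?n *\<^sub>R w x) \<le> (\<epsilon> * (1 + 2 / \<delta>)) ^ ?n * \<beta> + e * \<epsilon> ^ ?n"
    unfolding eq by (intro norm_triangle_le_diff add_mono) auto
  then have "\<epsilon> ^ ?n * cmod (w x) \<le> \<epsilon> ^ ?n * ((1 + 2 / \<delta>) ^ ?n * \<beta> + e)"
    using \<epsilon>(1) unfolding power_mult_distrib by (simp add: algebra_simps)
  then have "cmod (w x) \<le> (1 + 2 / \<delta>) ^ ?n * \<beta> + e" using \<epsilon>(1) by simp
  then show False using e by simp
qed

subsection \<open>The weight\<close>

definition tang :: "'n::finite \<Rightarrow> real \<Rightarrow> real^'n \<Rightarrow> real" where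
  "tang k0 r x = max 0 (r\<^sup>2 - (\<Sum>j\<in>UNIV - {k0}. (x $ j)\<^sup>2))"

text \<open>The kink at \<open>x $ k0 = 0\<close> makes the energy identity below coercive on both sides of the
  degeneracy hyperplane; \<open>tang\<close> enters squared so that the tangential gradient of the weight is
  controlled by its square root.\<close>

definition lens :: "'n::finite \<Rightarrow> real \<Rightarrow> real \<Rightarrow> real^'n \<Rightarrow> real" where
  "lens k0 \<sigma> r x = (tang k0 r x)\<^sup>2 + \<sigma> * x $ k0 - 2 * \<bar>x $ k0\<bar>"

definition wt :: "'n::finite \<Rightarrow> real \<Rightarrow> real \<Rightarrow> real^'n \<Rightarrow> real" where
  "wt k0 \<sigma> r x = max 0 (lens k0 \<sigma> r x)"

text \<open>The gradient of \<open>lens\<close> off the hyperplane of the kink. On it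
  \<open>sgn\<close> is 0 and the entry for \<open>k0\<close> is \<open>\<sigma>\<close>, a value
  taken on a null set only.\<close>

definition dlens :: "'n::finite \<Rightarrow> real \<Rightarrow> real \<Rightarrow> 'n \<Rightarrow> real^'n \<Rightarrow> real" where
  "dlens k0 \<sigma> r i x = (if i = k0 then \<sigma> - 2 * sgn (x $ k0) else - 4 * x $ i * tang k0 r x)"

text \<open>An explicit compact set containing the region where \<open>wt\<close> is positive, the
  same for both signs \<open>\<sigma>\<close>; all bounds on coefficients refer to it.\<close>

definition wt_supp :: "'n::finite \<Rightarrow> real \<Rightarrow> (real^'n) set" where
  "wt_supp k0 r = {x. (\<Sum>j\<in>UNIV - {k0}. (x $ j)\<^sup>2) \<le> r\<^sup>2 \<and> \<bar>x $ k0\<bar> \<le> r ^ 4}"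

lemma compact_wt_supp: "compact (wt_supp k0 r)"
proof -
  have "closed (wt_supp k0 r)"
    unfolding wt_supp_def by (intro closed_Collect_conj closed_Collect_le continuous_intros)
  moreover have "bounded (wt_supp k0 r)"
  proof (rule boundedI)
    fix x :: "real^'a" assume x: "x \<in> wt_supp k0 r"
    have "\<bar>x $ i\<bar> \<le> \<bar>r\<bar> + r ^ 4" for i
    proof (cases "i = k0")
      case False
      have "(x $ i)\<^sup>2 \<le> (\<Sum>j\<in>UNIV - {k0}. (x $ j)\<^sup>2)" using False by (intro member_le_sum) auto
      then have "(x $ i)\<^sup>2 \<le> r\<^sup>2" using x by (simp add: wt_supp_def)
      then have "\<bar>x $ i\<bar> \<le> \<bar>r\<bar>" by (simp add: abs_le_square_iff)
      moreover have "0 \<le> r ^ 4" by simp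
      ultimately show ?thesis by linarith
    qed (use x in \<open>auto simp: wt_supp_def\<close>)
    then show "norm x \<le> (\<Sum>i\<in>(UNIV::'a set). \<bar>r\<bar> + r ^ 4)"
      by (intro order_trans[OF norm_le_l1_cart] sum_mono)
  qed
  ultimately show ?thesis by (simp add: compact_eq_bounded_closed)
qed

lemma tang_cont: "continuous_on S (tang k0 r)"
  unfolding tang_def by (intro continuous_intros)

lemma lens_cont: "continuous_on S (lens k0 \<sigma> r)"
  unfolding lens_def by (intro continuous_intros tang_cont)

lemma wt_cont: "continuous_on S (wt k0 \<sigma> r)"
  unfolding wt_def by (intro continuous_intros lens_cont)

text \<open>Powers at least 2 of the positive part are differentiable across 0, so cutting off the
  weight at the edge of the lens creates no boundary terms. The energy estimate therefore takes
  \<open>N \<ge> 2\<close>, which keeps \<open>2 * N - 1\<close> above 1.\<close>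

lemma DERIV_pos_power:
  assumes "m \<ge> 2"
  shows "((\<lambda>s::real. max 0 s ^ m) has_real_derivative real m * max 0 s ^ (m - 1)) (at s)"
proof -
  consider "s < 0" | "s = 0" | "s > 0" by linarith
  then show ?thesis
  proof cases
    case 1
    have "((\<lambda>t. 0) has_real_derivative 0) (at s)" by auto
    then have "((\<lambda>s::real. max 0 s ^ m) has_real_derivative 0) (at s)"
      by (rule has_field_derivative_transform_within_open[of _ _ _ "{..<0}"]) (use 1 assms in auto)
    then show ?thesis using 1 assms by (simp add: max_absorb1 zero_power)
  next
    case 2
    have "((\<lambda>h::real. (max 0 (0 + h) ^ m - max 0 0 ^ m) / h) \<longlongrightarrow> 0) (at 0)"
    proof (rule Lim_null_comparison)
      have "\<bar>max 0 h ^ m / h\<bar> \<le> \<bar>h\<bar> ^ (m - 1)" for h :: real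
      proof (cases "h > 0")
        case True
        have "h ^ m = h ^ (m - 1) * h" using assms by (metis One_nat_def Suc_diff_le diff_Suc_1 le_simps(3) one_le_numeral order_trans power_Suc2 Suc_diff_1 numeral_2_eq_2 zero_less_Suc less_le_trans)
        then show ?thesis using True by (simp add: max_def)
      next
        case False then show ?thesis using assms by (simp add: max_absorb1 zero_power)
      qed
      then show "\<forall>\<^sub>F h in at 0. norm ((max 0 (0 + h) ^ m - max 0 0 ^ m) / h) \<le> \<bar>h\<bar> ^ (m - 1)"
        using assms by (intro always_eventually) (simp add: zero_power)
      have "((\<lambda>h::real. \<bar>h\<bar> ^ (m - 1)) \<longlongrightarrow> \<bar>0\<bar> ^ (m - 1)) (at 0)" by (intro tendsto_intros)
      then show "((\<lambda>h::real. \<bar>h\<bar> ^ (m - 1)) \<longlongrightarrow> 0) (at 0)" using assms by (simp add: zero_power)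
    qed
    then show ?thesis using 2 assms unfolding DERIV_def by (simp add: zero_power)
  next
    case 3
    have "((\<lambda>s. s ^ m) has_real_derivative real m * s ^ (m - 1)) (at s)"
      by (auto intro!: derivative_eq_intros)
    then have "((\<lambda>s::real. max 0 s ^ m) has_real_derivative real m * s ^ (m - 1)) (at s)"
      by (rule has_field_derivative_transform_within_open[of _ _ _ "{0<..}"]) (use 3 in \<open>auto simp: max_def\<close>)
    then show ?thesis using 3 by (simp add: max_def)
  qed
qed

context
  fixes k0 :: "'n::finite" and \<sigma> r :: real
  assumes \<sigma>: "\<sigma> = 1 \<or> \<sigma> = -1" and r: "0 < r" "r \<le> 1"
begin

lemma tang_bounds: "0 \<le> tang k0 r x" "tang k0 r x \<le> r\<^sup>2" "tang k0 r x \<le> 1"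
proof -
  show 1: "0 \<le> tang k0 r x" "tang k0 r x \<le> r\<^sup>2"
    by (auto simp: tang_def sum_nonneg)
  have "r\<^sup>2 \<le> 1" using r by (simp add: power_le_one)
  then show "tang k0 r x \<le> 1" using 1 by linarith
qed

lemma tang_component: "j \<noteq> k0 \<Longrightarrow> \<bar>x $ j\<bar> * tang k0 r x \<le> r * tang k0 r x"
proof (cases "tang k0 r x = 0")
  case False
  assume "j \<noteq> k0"
  then have "(x $ j)\<^sup>2 \<le> (\<Sum>j\<in>UNIV - {k0}. (x $ j)\<^sup>2)" by (intro member_le_sum) auto
  also have "\<dots> \<le> r\<^sup>2" using False by (auto simp: tang_def max_def split: if_splits)
  finally have "\<bar>x $ j\<bar> \<le> r" using r abs_le_square_iff[of "x $ j" r] by simp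
  then show ?thesis using tang_bounds(1) by (rule mult_right_mono)
qed simp

text \<open>The kink wins over the linear term, which closes the lens in the direction
  \<open>k0\<close>.\<close>

lemma lens_le: "lens k0 \<sigma> r x \<le> (tang k0 r x)\<^sup>2 - \<bar>x $ k0\<bar>"
  using \<sigma> unfolding lens_def by (auto simp: abs_if)

lemma tang_sq_le: "(tang k0 r x)\<^sup>2 \<le> r ^ 4"
  using power_mono[OF tang_bounds(2,1), of x 2] by simp

lemma wt_bounds: "0 \<le> wt k0 \<sigma> r x" "wt k0 \<sigma> r x \<le> r ^ 4" "wt k0 \<sigma> r x \<le> 1"
proof -
  have "r ^ 4 \<le> 1" using r by (simp add: power_le_one)
  moreover have "0 \<le> r ^ 4" using r by simp
  ultimately show "0 \<le> wt k0 \<sigma> r x" "wt k0 \<sigma> r x \<le> r ^ 4" "wt k0 \<sigma> r x \<le> 1"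
    using lens_le[of x] tang_sq_le[of x] unfolding wt_def by linarith+
qed

text \<open>The third claim makes the tangential gradient of the weight harmless: that gradient is
  at most \<open>4 * r * tang k0 r x\<close>, and the square of \<open>tang\<close> splits into a
  part with an additional power of the weight and a part with the degeneracy factor.\<close>

lemma wt_pos:
  assumes "wt k0 \<sigma> r x > 0"
  shows "x \<in> wt_supp k0 r" "wt k0 \<sigma> r x = lens k0 \<sigma> r x" "(tang k0 r x)\<^sup>2 \<le> wt k0 \<sigma> r x + 3 * \<bar>x $ k0\<bar>"
proof -
  show e: "wt k0 \<sigma> r x = lens k0 \<sigma> r x" using assms by (simp add: wt_def max_def split: if_splits)
  have "\<sigma> * x $ k0 \<ge> - \<bar>x $ k0\<bar>" using \<sigma> by (auto simp: abs_if)
  then show "(tang k0 r x)\<^sup>2 \<le> wt k0 \<sigma> r x + 3 * \<bar>x $ k0\<bar>" unfolding e lens_def by linarith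
  have p: "(tang k0 r x)\<^sup>2 > \<bar>x $ k0\<bar>" using lens_le[of x] assms e by linarith
  then have "tang k0 r x \<noteq> 0" by auto
  then show "x \<in> wt_supp k0 r"
    using p tang_sq_le[of x] by (auto simp: wt_supp_def tang_def max_def split: if_splits)
qed

lemma wt_zero: "x \<notin> wt_supp k0 r \<Longrightarrow> wt k0 \<sigma> r x = 0"
  using wt_pos(1)[of x] wt_bounds(1)[of x] by fastforce

text \<open>With \<open>a\<close> the normal slope, the energy form has coefficient
  \<open>2 + \<sigma> * a\<close> at the elliptic part and \<open>2 - \<sigma> * a\<close> at
  \<open>\<sigma> x\<^sub>1 |\<partial>\<^sub>1 v|\<^sup>2\<close>. The values 3 and -1 keep the
  first positive and give the second the sign of \<open>\<sigma> * x $ k0\<close>.\<close>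

lemma dlens_k0: "x $ k0 \<noteq> 0 \<Longrightarrow> \<sigma> * dlens k0 \<sigma> r k0 x = (if \<sigma> * x $ k0 < 0 then 3 else -1)"
  using \<sigma> by (auto simp: dlens_def sgn_if)

lemma dlens_bound: "\<bar>dlens k0 \<sigma> r i x\<bar> \<le> 4"
proof (cases "i = k0")
  case False
  have "\<bar>x $ i\<bar> * tang k0 r x \<le> 1 * 1"
    using order_trans[OF tang_component[OF False] mult_mono[OF r(2) tang_bounds(3)]] tang_bounds(1) by simp
  then show ?thesis using False tang_bounds(1)[of x] by (simp add: dlens_def abs_mult)
qed (use \<sigma> in \<open>auto simp: dlens_def sgn_if\<close>)

lemma dlens_tang: "i \<noteq> k0 \<Longrightarrow> \<bar>dlens k0 \<sigma> r i x\<bar> \<le> 4 * r * tang k0 r x"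
  using tang_component[of i x] tang_bounds(1)[of x] by (simp add: dlens_def abs_mult)

lemma lens_deriv:
  assumes "i = k0 \<Longrightarrow> x $ k0 + t \<noteq> 0"
  shows "((\<lambda>t. lens k0 \<sigma> r (x + t *\<^sub>R axis i 1)) has_real_derivative dlens k0 \<sigma> r i (x + t *\<^sub>R axis i 1)) (at t)"
proof (cases "i = k0")
  case True
  define a where "a = x $ k0 + t"
  have a: "a \<noteq> 0" using assms True by (simp add: a_def)
  have tg: "tang k0 r (x + s *\<^sub>R axis k0 1) = tang k0 r x" for s
    unfolding tang_def by (intro arg_cong2[where f = max] arg_cong2[where f = "(-)"] sum.cong refl) (auto simp: axis_def)
  have "((\<lambda>s. sgn a * (x $ k0 + s)) has_real_derivative sgn a) (at t)"
    by (auto intro!: derivative_eq_intros)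
  then have abs: "((\<lambda>s. \<bar>x $ k0 + s\<bar>) has_real_derivative sgn a) (at t)"
  proof (rule has_field_derivative_transform_within_open)
    show "open {s. 0 < sgn a * (x $ k0 + s)}" by (intro open_Collect_less continuous_intros)
    show "t \<in> {s. 0 < sgn a * (x $ k0 + s)}" using a by (simp add: a_def[symmetric] sgn_if)
  qed (use a in \<open>auto simp: sgn_if split: if_splits\<close>)
  have "((\<lambda>s. (tang k0 r x)\<^sup>2 + \<sigma> * (x $ k0 + s) - 2 * \<bar>x $ k0 + s\<bar>) has_real_derivative \<sigma> - 2 * sgn a) (at t)"
    by (auto intro!: derivative_eq_intros abs)
  then show ?thesis using True by (simp add: lens_def tg dlens_def a_def)
next
  case False
  let ?S = "\<lambda>s. r\<^sup>2 - (\<Sum>j\<in>UNIV - {k0}. ((x + s *\<^sub>R axis i 1) $ j)\<^sup>2)"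
  have "(\<Sum>j\<in>UNIV - {k0}. 2 * (x + t *\<^sub>R axis i 1) $ j * axis i 1 $ j) = 2 * (x + t *\<^sub>R axis i 1) $ i"
    using False by (subst sum.remove[of _ i]) (auto simp: axis_def intro!: sum.neutral)
  moreover have "(?S has_real_derivative - (\<Sum>j\<in>UNIV - {k0}. 2 * (x + t *\<^sub>R axis i 1) $ j * axis i 1 $ j)) (at t)"
    by (auto intro!: derivative_eq_intros sum.cong simp: sum_negf[symmetric] algebra_simps)
  ultimately have "(?S has_real_derivative - 2 * (x + t *\<^sub>R axis i 1) $ i) (at t)" by simp
  from DERIV_chain2[OF DERIV_pos_power[of 2 "?S t"] this]
  have 1: "((\<lambda>s. (tang k0 r (x + s *\<^sub>R axis i 1))\<^sup>2) has_real_derivative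
      2 * tang k0 r (x + t *\<^sub>R axis i 1) * (- 2 * (x + t *\<^sub>R axis i 1) $ i)) (at t)"
    by (simp add: tang_def)
  have "((\<lambda>s. (tang k0 r (x + s *\<^sub>R axis i 1))\<^sup>2 + \<sigma> * x $ k0 - 2 * \<bar>x $ k0\<bar>) has_real_derivative
      2 * tang k0 r (x + t *\<^sub>R axis i 1) * (- 2 * (x + t *\<^sub>R axis i 1) $ i)) (at t)"
    by (rule derivative_eq_intros 1 refl)+ simp
  moreover have "(x + s *\<^sub>R axis i 1) $ k0 = x $ k0" for s using False by (simp add: axis_def)
  moreover have "2 * tang k0 r (x + t *\<^sub>R axis i 1) * (- 2 * (x + t *\<^sub>R axis i 1) $ i) = dlens k0 \<sigma> r i (x + t *\<^sub>R axis i 1)"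
    using False unfolding dlens_def by simp
  ultimately show ?thesis unfolding lens_def by (simp only:)
qed

text \<open>In direction \<open>k0\<close> the kink rules out the mean value inequality, so the
  increment is computed exactly, with slope at most 3; the constant 4 covers this and the tangential
  directions.\<close>

lemma wt_power_lipschitz:
  "\<bar>wt k0 \<sigma> r (y + t *\<^sub>R axis i 1) ^ m - wt k0 \<sigma> r y ^ m\<bar> \<le> real m * 4 * \<bar>t\<bar>"
proof -
  have "\<bar>lens k0 \<sigma> r (y + t *\<^sub>R axis i 1) - lens k0 \<sigma> r y\<bar> \<le> 4 * \<bar>t\<bar>"
  proof (cases "i = k0")
    case True
    have tg: "tang k0 r (y + t *\<^sub>R axis k0 1) = tang k0 r y"
      unfolding tang_def by (intro arg_cong2[where f = max] arg_cong2[where f = "(-)"] sum.cong refl) (auto simp: axis_def)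
    have c: "(y + t *\<^sub>R axis k0 1) $ k0 = y $ k0 + t" by (simp add: axis_def)
    define d where "d = \<bar>y $ k0 + t\<bar> - \<bar>y $ k0\<bar>"
    have d: "\<bar>d\<bar> \<le> \<bar>t\<bar>" unfolding d_def by linarith
    have "lens k0 \<sigma> r (y + t *\<^sub>R axis k0 1) - lens k0 \<sigma> r y = \<sigma> * t - 2 * d"
      unfolding lens_def tg c d_def by (simp add: algebra_simps)
    then show ?thesis unfolding True using \<sigma> d by auto
  next
    case False
    have "norm (lens k0 \<sigma> r (y + t *\<^sub>R axis i 1) - lens k0 \<sigma> r (y + 0 *\<^sub>R axis i 1)) \<le> 4 * norm (t - 0)"
      by (rule field_differentiable_bound[where S = UNIV]) (use lens_deriv False dlens_bound in auto)
    then show ?thesis by simp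
  qed
  moreover have "\<bar>max 0 a - max 0 b\<bar> \<le> \<bar>a - b\<bar>" for a b :: real by (auto simp: max_def)
  ultimately have 1: "\<bar>wt k0 \<sigma> r (y + t *\<^sub>R axis i 1) - wt k0 \<sigma> r y\<bar> \<le> 4 * \<bar>t\<bar>"
    unfolding wt_def by (meson order_trans)
  have "norm (wt k0 \<sigma> r (y + t *\<^sub>R axis i 1) ^ m - wt k0 \<sigma> r y ^ m) \<le> real m * norm (wt k0 \<sigma> r (y + t *\<^sub>R axis i 1) - wt k0 \<sigma> r y)"
    by (rule norm_power_diff) (use wt_bounds in auto)
  also have "\<dots> \<le> real m * (4 * \<bar>t\<bar>)" using 1 by (intro mult_left_mono) auto
  finally show ?thesis by (simp add: mult.assoc)
qed

lemma wt_hpd: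
  assumes "m \<ge> 2" "y $ k0 \<noteq> 0"
  shows "hpd i (\<lambda>x. complex_of_real (wt k0 \<sigma> r x ^ m)) y (complex_of_real (real m * wt k0 \<sigma> r y ^ (m - 1) * dlens k0 \<sigma> r i y))"
proof -
  have "((\<lambda>t. lens k0 \<sigma> r (y + t *\<^sub>R axis i 1)) has_real_derivative dlens k0 \<sigma> r i (y + 0 *\<^sub>R axis i 1)) (at 0)"
    by (rule lens_deriv) (use assms in auto)
  from DERIV_chain2[OF DERIV_pos_power[OF assms(1)] this]
  show ?thesis unfolding hpd_def wt_def
    by (intro has_vector_derivative_of_real) (simp add: has_real_derivative_iff_has_vector_derivative)
qed

lemma sgn_component_measurable: "(\<lambda>x::real^'n. sgn (x $ k)) \<in> borel_measurable borel"
  by (rule measurable_compose[OF borel_measurable_continuous_onI borel_measurable_sgn])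
    (intro continuous_intros)

lemma dlens_measurable: "dlens k0 \<sigma> r i \<in> borel_measurable borel"
proof (cases "i = k0")
  case True
  then have "dlens k0 \<sigma> r i = (\<lambda>x. \<sigma> - 2 * sgn (x $ k0))" by (auto simp: dlens_def)
  then show ?thesis by (simp add: sgn_component_measurable)
next
  case False
  then have "dlens k0 \<sigma> r i = (\<lambda>x. - 4 * x $ i * tang k0 r x)" by (auto simp: dlens_def)
  then show ?thesis by (auto intro!: borel_measurable_continuous_onI continuous_intros tang_cont)
qed

lemma wt_measurable: "(\<lambda>x. wt k0 \<sigma> r x ^ m) \<in> borel_measurable borel"
  by (intro borel_measurable_continuous_onI continuous_intros wt_cont)

lemma integral_wt_pd:
  fixes g :: "real^'n \<Rightarrow> complex"
  assumes U: "open U" "wt_supp k0 r \<subseteq> U" and g: "smooth_on U g" and m: "m \<ge> 2"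
  shows "integrable lborel (\<lambda>x. (real m * wt k0 \<sigma> r x ^ (m - 1) * dlens k0 \<sigma> r i x) *\<^sub>R g x + wt k0 \<sigma> r x ^ m *\<^sub>R pd i g x)"
    "integral\<^sup>L lborel (\<lambda>x. (real m * wt k0 \<sigma> r x ^ (m - 1) * dlens k0 \<sigma> r i x) *\<^sub>R g x + wt k0 \<sigma> r x ^ m *\<^sub>R pd i g x) = 0"
proof -
  have p: "0 \<le> wt k0 \<sigma> r x ^ k" "wt k0 \<sigma> r x ^ k \<le> 1" for x k
    using wt_bounds[of x] by (auto intro: power_le_one)
  have b: "\<bar>wt k0 \<sigma> r x ^ m\<bar> \<le> 1 + real m * 4" for x using p[of x m] by simp
  have b': "\<bar>real m * wt k0 \<sigma> r x ^ (m - 1) * dlens k0 \<sigma> r i x\<bar> \<le> 1 + real m * 4" for x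
  proof -
    have "\<bar>real m * wt k0 \<sigma> r x ^ (m - 1) * dlens k0 \<sigma> r i x\<bar> = (real m * wt k0 \<sigma> r x ^ (m - 1)) * \<bar>dlens k0 \<sigma> r i x\<bar>"
      using p[of x "m - 1"] by (simp add: abs_mult)
    also have "\<dots> \<le> (real m * 1) * 4" by (intro mult_mono dlens_bound mult_left_mono p) auto
    finally show ?thesis by simp
  qed
  have z: "wt k0 \<sigma> r x ^ m = 0" "real m * wt k0 \<sigma> r x ^ (m - 1) * dlens k0 \<sigma> r i x = 0" if "x \<notin> wt_supp k0 r" for x
    using wt_zero[OF that] m by auto
  have ae: "AE y in lborel. hpd i (\<lambda>x. complex_of_real (wt k0 \<sigma> r x ^ m)) y (complex_of_real (real m * wt k0 \<sigma> r y ^ (m - 1) * dlens k0 \<sigma> r i y))"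
    using AE_hyperplane[of k0 0] by eventually_elim (rule wt_hpd[OF m])
  have dm: "(\<lambda>x. real m * wt k0 \<sigma> r x ^ (m - 1) * dlens k0 \<sigma> r i x) \<in> borel_measurable borel"
    by (intro borel_measurable_times wt_measurable dlens_measurable) auto
  note * = integral_weight_pd[OF U(1) compact_wt_supp U(2) wt_measurable b z(1) dm b' z(2) wt_power_lipschitz ae g]
  show "integrable lborel (\<lambda>x. (real m * wt k0 \<sigma> r x ^ (m - 1) * dlens k0 \<sigma> r i x) *\<^sub>R g x + wt k0 \<sigma> r x ^ m *\<^sub>R pd i g x)"
    "integral\<^sup>L lborel (\<lambda>x. (real m * wt k0 \<sigma> r x ^ (m - 1) * dlens k0 \<sigma> r i x) *\<^sub>R g x + wt k0 \<sigma> r x ^ m *\<^sub>R pd i g x) = 0"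
    using * by blast+
qed

end

subsection \<open>The pointwise energy inequality\<close>

lemma amgm_weighted: "0 < p \<Longrightarrow> 2 * a * b \<le> p * a\<^sup>2 + b\<^sup>2 / p" for a b p :: real
proof -
  assume p: "0 < p"
  have "0 \<le> (p * a - b)\<^sup>2 / p" using p by simp
  also have "(p * a - b)\<^sup>2 / p = p * a\<^sup>2 + b\<^sup>2 / p - 2 * a * b"
    using p by (simp add: power2_eq_square field_simps)
  finally show ?thesis by simp
qed

text \<open>Values at one point, after a high power of the weight has been divided out:
  \<open>t\<close> is the distance to the degeneracy, \<open>\<tau>\<close> the tangential profile;
  \<open>E\<close>, \<open>w1\<close>, \<open>w\<close>, \<open>f\<close> are the sizes of the
  tangential gradient, the normal derivative, the function and the source. Each product is split by
  a weighted arithmetic-geometric mean so that the gradient parts fit into half of what the energy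
  controls, while the terms in \<open>w\<close> may grow like \<open>N^3\<close>.\<close>

lemma error_terms_absorbed:
  fixes N X t \<tau> E w1 w f c l r k :: real
  assumes N: "N \<ge> 1" and X: "0 \<le> X" "X \<le> r" and r: "0 \<le> r" "r \<le> 1" and t: "0 \<le> t"
    and \<tau>: "0 \<le> \<tau>" "\<tau>\<^sup>2 \<le> X + 3 * t" and c: "c \<ge> 1" and l: "0 < l" "l \<le> 1" and rc: "96 * r * c\<^sup>2 \<le> l"
    and k: "0 \<le> k" "k + 1 \<le> N"
  shows "X^3 * (f * w1 + 2 * c * E * w1 + c * w * w1 + c * E\<^sup>2) + 8 * N * c * r * X\<^sup>2 * (\<tau> * E * w1)
     + 6 * N * (2 * N) * X * (t * w1 * w) + 3 * N * (2 * N) * X * ((k + 1) * w\<^sup>2)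
     + 8 * N * (2 * N) * c * r * X * (\<tau> * E * w) + 2 * N * X\<^sup>2 * (f * w + c * w1 * w + 2 * c * E * w + c * w\<^sup>2)
    \<le> N * X\<^sup>2 * (l / 2 * E\<^sup>2 + 1 / 2 * t * w1\<^sup>2) + (N / 4 + 2) * X^3 * w1\<^sup>2
     + 500 * c\<^sup>2 / l * N^3 * (X + t) * w\<^sup>2 + 5 / N * X^3 * f\<^sup>2"
proof -
  have X1: "X \<le> 1" using X r by simp
  have c2: "c \<le> c\<^sup>2" "1 \<le> c\<^sup>2" using self_le_power[OF c, of 2] one_le_power[OF c, of 2] by auto
  \<comment> \<open>Smallness comes from the radius: errors with coefficients as large as
    \<open>c\<^sup>2\<close> are matched against the ellipticity constant \<open>l\<close>.\<close>
  have rc1: "r * c \<le> l / 96" "r * c\<^sup>2 \<le> l / 96" "r \<le> l / 96"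
  proof -
    show 1: "r * c\<^sup>2 \<le> l / 96" using rc by simp
    show "r * c \<le> l / 96" using mult_left_mono[OF c2(1) r(1)] 1 by simp
    show "r \<le> l / 96" using mult_left_mono[OF c2(2) r(1)] 1 by simp
  qed
  \<comment> \<open>The top order quantities are \<open>a\<close>, \<open>b\<close>,
    \<open>d\<close>; \<open>g\<close> and \<open>h\<close> are of lower order, and \<open>y\<close>
    is the source.\<close>
  define a where "a = X\<^sup>2 * E\<^sup>2"
  define b where "b = X\<^sup>2 * t * w1\<^sup>2"
  define d where "d = X^3 * w1\<^sup>2"
  define g where "g = X * w\<^sup>2"
  define h where "h = t * w\<^sup>2"
  define y where "y = X^3 * f\<^sup>2"
  have nn: "0 \<le> a" "0 \<le> b" "0 \<le> d" "0 \<le> g" "0 \<le> h" "0 \<le> y"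
    using X t by (auto simp: a_def b_def d_def g_def h_def y_def)
  \<comment> \<open>One power of \<open>X\<close> is traded for \<open>r\<close>, which makes the
    term small against the elliptic part.\<close>
  have X3: "X^3 * E\<^sup>2 \<le> r * a" 
    using X mult_right_mono[of X r a] nn by (simp add: a_def power3_eq_cube power2_eq_square mult_ac)
  have X3w: "X^3 * w\<^sup>2 \<le> g"
  proof -
    have "X\<^sup>2 * g \<le> 1 * g" using X X1 nn by (intro mult_right_mono) (auto intro: power_le_one)
    then show ?thesis by (simp add: g_def power3_eq_cube power2_eq_square mult_ac)
  qed
  have X2w: "X\<^sup>2 * w\<^sup>2 \<le> g"
  proof -
    have "X * g \<le> 1 * g" using X X1 nn by (intro mult_right_mono) auto
    then show ?thesis by (simp add: g_def power2_eq_square mult_ac)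
  qed
  have N3: "N \<le> N^3" "1 \<le> N^3" "N\<^sup>2 * N = N^3" using self_le_power[OF N, of 3] one_le_power[OF N, of 3] by (auto simp: power3_eq_cube power2_eq_square)
  have q1: "X^3 * (f * w1) \<le> N / 16 * d + 4 / N * y"
  proof -
    have "2 * w1 * f \<le> (N / 8) * w1\<^sup>2 + f\<^sup>2 / (N / 8)" by (rule amgm_weighted) (use N in simp)
    then have "X^3 * (2 * w1 * f) \<le> X^3 * ((N / 8) * w1\<^sup>2 + f\<^sup>2 / (N / 8))" using X by (intro mult_left_mono) auto
    then show ?thesis by (simp add: d_def y_def algebra_simps)
  qed
  have q2: "X^3 * (2 * c * E * w1) \<le> d + l / 96 * a"
  proof -
    have "2 * w1 * (c * E) \<le> 1 * w1\<^sup>2 + (c * E)\<^sup>2 / 1" by (rule amgm_weighted) simp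
    then have "X^3 * (2 * w1 * (c * E)) \<le> X^3 * (w1\<^sup>2 + (c * E)\<^sup>2)" using X by (intro mult_left_mono) auto
    also have "\<dots> = d + c\<^sup>2 * (X^3 * E\<^sup>2)" by (simp add: d_def power_mult_distrib algebra_simps)
    also have "\<dots> \<le> d + c\<^sup>2 * (r * a)" using X3 by (intro add_left_mono mult_left_mono) auto
    also have "\<dots> \<le> d + l / 96 * a" using mult_right_mono[OF rc1(2) nn(1)] by (simp add: mult_ac)
    finally show ?thesis by (simp add: mult_ac)
  qed
  have q3: "X^3 * (c * w * w1) \<le> d + c\<^sup>2 * g"
  proof -
    have "2 * w1 * (c * w) \<le> 1 * w1\<^sup>2 + (c * w)\<^sup>2 / 1" by (rule amgm_weighted) simp
    moreover have "2 * w1 * (c * w) = 2 * (c * w * w1)" by simp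
    ultimately have "c * w * w1 \<le> w1\<^sup>2 + (c * w)\<^sup>2"
      using zero_le_power2[of w1] zero_le_power2[of "c * w"] by linarith
    then have "X^3 * (c * w * w1) \<le> X^3 * (w1\<^sup>2 + (c * w)\<^sup>2)" using X by (intro mult_left_mono) auto
    also have "\<dots> = d + c\<^sup>2 * (X^3 * w\<^sup>2)" by (simp add: d_def power_mult_distrib algebra_simps)
    also have "\<dots> \<le> d + c\<^sup>2 * g" using X3w by (intro add_left_mono mult_left_mono) auto
    finally show ?thesis .
  qed
  have q4: "X^3 * (c * E\<^sup>2) \<le> l / 96 * a"
  proof -
    have "X^3 * (c * E\<^sup>2) = c * (X^3 * E\<^sup>2)" by simp
    also have "\<dots> \<le> c * (r * a)" using X3 c by (intro mult_left_mono) auto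
    also have "\<dots> \<le> l / 96 * a" using mult_right_mono[OF rc1(1) nn(1)] by (simp add: mult_ac)
    finally show ?thesis .
  qed
  have q5: "8 * N * c * r * X\<^sup>2 * (\<tau> * E * w1) \<le> N * (l / 24 * a + 1 / 24 * d + 1 / 8 * b)"
  proof -
    have "2 * E * (\<tau> * w1) \<le> 1 * E\<^sup>2 + (\<tau> * w1)\<^sup>2 / 1" by (rule amgm_weighted) simp
    also have "(\<tau> * w1)\<^sup>2 / 1 \<le> (X + 3 * t) * w1\<^sup>2" using \<tau>(2) by (simp add: power_mult_distrib mult_right_mono)
    finally have "X\<^sup>2 * (2 * E * (\<tau> * w1)) \<le> X\<^sup>2 * (E\<^sup>2 + (X + 3 * t) * w1\<^sup>2)" by (intro mult_left_mono) auto
    also have "\<dots> = a + d + 3 * b" by (simp add: a_def b_def d_def power3_eq_cube power2_eq_square algebra_simps)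
    finally have *: "X\<^sup>2 * (2 * E * (\<tau> * w1)) \<le> a + d + 3 * b" .
    have "8 * N * c * r * X\<^sup>2 * (\<tau> * E * w1) = 4 * N * (r * c) * (X\<^sup>2 * (2 * E * (\<tau> * w1)))" by simp
    also have "\<dots> \<le> 4 * N * (r * c) * (a + d + 3 * b)" using N r c * by (intro mult_left_mono) auto
    also have "\<dots> \<le> 4 * N * (l / 96) * (a + d + 3 * b)" using N nn rc1 by (intro mult_right_mono mult_left_mono) auto
    also have "\<dots> = N * (l / 24 * a + l / 24 * d + l / 8 * b)" by (simp add: algebra_simps)
    also have "\<dots> \<le> N * (l / 24 * a + 1 / 24 * d + 1 / 8 * b)"
      using N nn l by (intro mult_left_mono add_mono mult_right_mono) auto
    finally show ?thesis .
  qed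
  have q6: "6 * N * (2 * N) * X * (t * w1 * w) \<le> N * (1 / 8 * b) + 288 * N^3 * h"
  proof -
    have "2 * (X * w1) * (6 * N * w) \<le> (1 / 8) * (X * w1)\<^sup>2 + (6 * N * w)\<^sup>2 / (1 / 8)" by (rule amgm_weighted) simp
    then have "N * t * (2 * (X * w1) * (6 * N * w)) \<le> N * t * ((1 / 8) * (X * w1)\<^sup>2 + (6 * N * w)\<^sup>2 / (1 / 8))"
      using N t by (intro mult_left_mono) auto
    then show ?thesis by (simp add: b_def h_def power2_eq_square power3_eq_cube algebra_simps)
  qed
  have q7: "3 * N * (2 * N) * X * ((k + 1) * w\<^sup>2) \<le> 6 * N^3 * g"
  proof -
    have "6 * N\<^sup>2 * g * (k + 1) \<le> 6 * N\<^sup>2 * g * N" using k nn by (intro mult_left_mono) auto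
    then show ?thesis by (simp add: g_def power2_eq_square power3_eq_cube algebra_simps)
  qed
  have q8: "8 * N * (2 * N) * c * r * X * (\<tau> * E * w) \<le> N * (l / 16 * a) + 12 * N^3 * (g + 3 * h)"
  proof -
    have "2 * (X * E) * (8 * N * c * r * \<tau> * w) \<le> (l / 16) * (X * E)\<^sup>2 + (8 * N * c * r * \<tau> * w)\<^sup>2 / (l / 16)"
      by (rule amgm_weighted) (use l in simp)
    then have "N * (2 * (X * E) * (8 * N * c * r * \<tau> * w)) \<le> N * ((l / 16) * (X * E)\<^sup>2 + (8 * N * c * r * \<tau> * w)\<^sup>2 / (l / 16))"
      using N by (intro mult_left_mono) auto
    also have "\<dots> = N * (l / 16 * a) + (1024 * (r * (r * c\<^sup>2) / l)) * N^3 * (\<tau>\<^sup>2 * w\<^sup>2)"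
      using l by (simp add: a_def power2_eq_square power3_eq_cube field_simps)
    also have "\<dots> \<le> N * (l / 16 * a) + 12 * N^3 * ((X + 3 * t) * w\<^sup>2)"
    proof (intro add_left_mono mult_mono mult_right_mono \<tau>)
      have "r * (r * c\<^sup>2) \<le> 1 * (l / 96)" using r rc1 c l by (intro mult_mono) auto
      then have "r * (r * c\<^sup>2) / l \<le> 1 / 96" using l by (simp add: field_simps)
      then show "1024 * (r * (r * c\<^sup>2) / l) \<le> 12" by simp
    qed (use N X t in auto)
    finally show ?thesis by (simp add: g_def h_def algebra_simps)
  qed
  have q9: "2 * N * X\<^sup>2 * (f * w) \<le> 1 / N * y + N^3 * g"
  proof -
    have "2 * (N * w) * (X * f) \<le> N * (N * w)\<^sup>2 + (X * f)\<^sup>2 / N" by (rule amgm_weighted) (use N in simp)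
    then have "X * (2 * (N * w) * (X * f)) \<le> X * (N * (N * w)\<^sup>2 + (X * f)\<^sup>2 / N)" using X by (intro mult_left_mono) auto
    then show ?thesis by (simp add: y_def g_def power2_eq_square power3_eq_cube algebra_simps)
  qed
  have q10: "2 * N * X\<^sup>2 * (c * w1 * w) \<le> N / 16 * d + 16 * c\<^sup>2 * N^3 * g"
  proof -
    have "2 * (X * w1) * (c * w) \<le> (1 / 16) * (X * w1)\<^sup>2 + (c * w)\<^sup>2 / (1 / 16)" by (rule amgm_weighted) simp
    then have "N * X * (2 * (X * w1) * (c * w)) \<le> N * X * ((1 / 16) * (X * w1)\<^sup>2 + (c * w)\<^sup>2 / (1 / 16))"
      using N X by (intro mult_left_mono) auto
    then have "2 * N * X\<^sup>2 * (c * w1 * w) \<le> N / 16 * d + N * (16 * c\<^sup>2 * g)"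
      by (simp add: d_def g_def power2_eq_square power3_eq_cube algebra_simps)
    also have "\<dots> \<le> N / 16 * d + N^3 * (16 * c\<^sup>2 * g)" using N3 nn by (intro add_left_mono mult_right_mono) auto
    finally show ?thesis by (simp add: mult_ac)
  qed
  have q11: "2 * N * X\<^sup>2 * (2 * c * E * w) \<le> N * (l / 16 * a) + 64 * c\<^sup>2 / l * N^3 * g"
  proof -
    have "2 * E * (2 * c * w) \<le> (l / 16) * E\<^sup>2 + (2 * c * w)\<^sup>2 / (l / 16)" by (rule amgm_weighted) (use l in simp)
    then have "N * X\<^sup>2 * (2 * E * (2 * c * w)) \<le> N * X\<^sup>2 * ((l / 16) * E\<^sup>2 + (2 * c * w)\<^sup>2 / (l / 16))"
      using N by (intro mult_left_mono) auto
    also have "\<dots> = N * (l / 16 * a) + N * (64 * c\<^sup>2 / l * (X\<^sup>2 * w\<^sup>2))"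
      using l by (simp add: a_def power2_eq_square field_simps)
    also have "\<dots> \<le> N * (l / 16 * a) + N^3 * (64 * c\<^sup>2 / l * g)"
      using N3 l X2w nn N by (intro add_left_mono mult_mono mult_left_mono) auto
    finally show ?thesis by (simp add: mult_ac)
  qed
  have q12: "2 * N * X\<^sup>2 * (c * w\<^sup>2) \<le> 2 * c\<^sup>2 * N^3 * g"
  proof -
    have "(2 * N) * (c * (X\<^sup>2 * w\<^sup>2)) \<le> (2 * N^3) * (c\<^sup>2 * g)"
      using N3 X2w c2 c N nn by (intro mult_mono) auto
    then show ?thesis by (simp add: mult_ac)
  qed
  \<comment> \<open>\<open>c\<^sup>2 / l\<close> dominates every constant that arises in front of
    \<open>g\<close> and \<open>h\<close>, so these add up to one coefficient, whose numerical
    factor stays below 500.\<close>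
  define C where "C = c\<^sup>2 / l"
  have C: "c\<^sup>2 \<le> C" "1 \<le> C" using c2 l by (auto simp: C_def le_divide_eq mult_left_le order_trans[of l 1])
  have G: "c\<^sup>2 * g \<le> C * N^3 * g" "6 * N^3 * g \<le> 6 * (C * N^3 * g)" "N^3 * g \<le> C * N^3 * g"
    "16 * c\<^sup>2 * N^3 * g \<le> 16 * (C * N^3 * g)" "2 * c\<^sup>2 * N^3 * g \<le> 2 * (C * N^3 * g)" "64 * c\<^sup>2 / l * N^3 * g = 64 * (C * N^3 * g)"
    "N^3 * h \<le> C * N^3 * h"
  proof -
    have p: "c\<^sup>2 * (N^3 * g) \<le> C * (N^3 * g)" "1 * (N^3 * g) \<le> C * (N^3 * g)" "1 * (N^3 * h) \<le> C * (N^3 * h)" "1 * g \<le> N^3 * g"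
      using C nn N N3 by (intro mult_right_mono; simp)+
    have "c\<^sup>2 * g \<le> c\<^sup>2 * (N^3 * g)" using p(4) by (intro mult_left_mono) auto
    then show "c\<^sup>2 * g \<le> C * N^3 * g" "6 * N^3 * g \<le> 6 * (C * N^3 * g)" "N^3 * g \<le> C * N^3 * g"
      "16 * c\<^sup>2 * N^3 * g \<le> 16 * (C * N^3 * g)" "2 * c\<^sup>2 * N^3 * g \<le> 2 * (C * N^3 * g)" "64 * c\<^sup>2 / l * N^3 * g = 64 * (C * N^3 * g)"
      "N^3 * h \<le> C * N^3 * h"
      using p by (auto simp: C_def mult.assoc)
  qed
  have A: "l * a \<le> N * (l * a)" "0 \<le> l * a" "0 \<le> N * (l * a)" "0 \<le> N * b" "0 \<le> N * d" "0 \<le> C * N^3 * g" "0 \<le> C * N^3 * h"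
    using N l nn C mult_right_mono[of 1 N "l * a"] by auto
  have "X^3 * (f * w1 + 2 * c * E * w1 + c * w * w1 + c * E\<^sup>2) + 8 * N * c * r * X\<^sup>2 * (\<tau> * E * w1)
     + 6 * N * (2 * N) * X * (t * w1 * w) + 3 * N * (2 * N) * X * ((k + 1) * w\<^sup>2)
     + 8 * N * (2 * N) * c * r * X * (\<tau> * E * w) + 2 * N * X\<^sup>2 * (f * w + c * w1 * w + 2 * c * E * w + c * w\<^sup>2)
    = X^3 * (f * w1) + X^3 * (2 * c * E * w1) + X^3 * (c * w * w1) + X^3 * (c * E\<^sup>2) + 8 * N * c * r * X\<^sup>2 * (\<tau> * E * w1)
     + 6 * N * (2 * N) * X * (t * w1 * w) + 3 * N * (2 * N) * X * ((k + 1) * w\<^sup>2)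
     + 8 * N * (2 * N) * c * r * X * (\<tau> * E * w) + 2 * N * X\<^sup>2 * (f * w) + 2 * N * X\<^sup>2 * (c * w1 * w)
     + 2 * N * X\<^sup>2 * (2 * c * E * w) + 2 * N * X\<^sup>2 * (c * w\<^sup>2)" by (simp add: distrib_left)
  also have "\<dots> \<le> (1 / 2) * (N * (l * a)) + (1 / 2) * (N * b) + (1 / 4) * (N * d) + 2 * d + 5 * (y / N) + 500 * (C * N^3 * h) + 500 * (C * N^3 * g)"
  proof -
    have e: "N / 16 * d = (1 / 16) * (N * d)" "4 / N * y = 4 * (y / N)" "1 / N * y = y / N" "l / 96 * a = (1 / 96) * (l * a)"
      "N * (l / 24 * a + 1 / 24 * d + 1 / 8 * b) = (1 / 24) * (N * (l * a)) + (1 / 24) * (N * d) + (1 / 8) * (N * b)"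
      "N * (l / 16 * a) = (1 / 16) * (N * (l * a))" "N * (1 / 8 * b) = (1 / 8) * (N * b)"
      "288 * N^3 * h = 288 * (N^3 * h)" "12 * N^3 * (g + 3 * h) = 12 * (N^3 * g) + 36 * (N^3 * h)"
      by (simp_all add: algebra_simps)
    note q = q1[unfolded e] q2[unfolded e] q3 q4[unfolded e] q5[unfolded e] q6[unfolded e] q7 q8[unfolded e] q9[unfolded e]
      q10[unfolded e] q11[unfolded e] q12
    show ?thesis using q A G by linarith
  qed
  also have "\<dots> = N * X\<^sup>2 * (l / 2 * E\<^sup>2 + 1 / 2 * t * w1\<^sup>2) + (N / 4 + 2) * X^3 * w1\<^sup>2
     + 500 * c\<^sup>2 / l * N^3 * (X + t) * w\<^sup>2 + 5 / N * X^3 * f\<^sup>2"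
  proof -
    have "500 * (C * N^3 * h) + 500 * (C * N^3 * g) = 500 * C * N^3 * (X + t) * w\<^sup>2"
      by (simp add: g_def h_def algebra_simps)
    then show ?thesis by (simp add: a_def b_def d_def y_def C_def algebra_simps)
  qed
  finally show ?thesis .
qed

lemma smooth_on_cnj:
  assumes U: "open U" and f: "smooth_on U f"
  shows "smooth_on U (\<lambda>x. cnj (f x))"
proof (rule smooth_on_coinduct[where P = "\<lambda>h. \<exists>f. smooth_on U f \<and> (\<forall>x\<in>U. h x = cnj (f x))"])
  show "\<exists>g. smooth_on U g \<and> (\<forall>x\<in>U. cnj (f x) = cnj (g x))" using f by auto
next
  fix h assume "\<exists>f. smooth_on U f \<and> (\<forall>x\<in>U. h x = cnj (f x))"
  then obtain f where f: "smooth_on U f" and h: "\<And>x. x \<in> U \<Longrightarrow> cnj (f x) = h x" by auto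
  have d: "hpd i h x (cnj (pd i f x))" if "x \<in> U" for i x
    by (rule hpd_cong[OF U that h hpd_cnj[OF smooth_on_hpd0[OF f that]]])
  have "continuous_on U (\<lambda>x. cnj (f x))"
    using smooth_on_cont[OF f, of "[]"] by (auto intro: continuous_on_cnj)
  then show "continuous_on U h" using h by (simp cong: continuous_on_cong)
  show "(\<lambda>t. h (x + t *\<^sub>R axis i 1)) differentiable (at 0)" if "x \<in> U" for i x
    by (rule hpd_imp_differentiable[OF d[OF that]])
  show "\<exists>f. smooth_on U f \<and> (\<forall>x\<in>U. pd i h x = cnj (f x))" for i
    using hpd_imp_pd[OF d] smooth_on_pd[OF f] by blast
qed

section \<open>Divergence identities for the energy fluxes\<close>

text \<open>The form is real and symmetric, hence hermitian, so exchanging its arguments only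
  conjugates it.\<close>

lemma Re_swap:
  assumes "\<And>j k. q j k = q k j" "\<And>j k. Im (q j k) = 0"
  shows "Re (\<Sum>j\<in>T. \<Sum>k\<in>T. q j k * a k * cnj (b j)) = Re (\<Sum>j\<in>T. \<Sum>k\<in>T. q j k * b k * cnj (a j))"
proof -
  have c: "cnj (q j k) = q j k" for j k using assms(2) by (simp add: complex_eq_iff)
  have "Re (\<Sum>j\<in>T. \<Sum>k\<in>T. q j k * a k * cnj (b j)) = Re (cnj (\<Sum>j\<in>T. \<Sum>k\<in>T. q j k * a k * cnj (b j)))"
    by (rule cnj.sel(1)[symmetric])
  also have "cnj (\<Sum>j\<in>T. \<Sum>k\<in>T. q j k * a k * cnj (b j)) = (\<Sum>j\<in>T. \<Sum>k\<in>T. q j k * b j * cnj (a k))"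
    by (simp add: c mult_ac)
  also have "\<dots> = (\<Sum>j\<in>T. \<Sum>k\<in>T. q j k * b k * cnj (a j))"
    by (subst sum.swap) (simp add: assms(1))
  finally show ?thesis .
qed

text \<open>The flux belongs to the multiplier \<open>cnj v1\<close>. In its divergence the mixed
  derivatives \<open>v1t\<close> cancel by symmetry of the form and the second order part of the
  operator remains; differentiating the factor \<open>x1\<close> leaves
  \<open>1 / 2 * (cmod v1)\<^sup>2\<close>.\<close>

lemma flux_divergence1:
  fixes x1 v1 v11 :: complex
  assumes "\<And>j k. q j k = q k j" "\<And>j k. Im (q j k) = 0" and x1: "Im x1 = 0"
  shows "Re ((1 / 2) * ((1 * (v1 * cnj v1) + x1 * (v11 * cnj v1 + v1 * cnj v11))
       - (\<Sum>j\<in>T. \<Sum>k\<in>T. (q1 j k * vt k + q j k * v1t k) * cnj (vt j) + q j k * vt k * cnj (v1t j)))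
     + (\<Sum>j\<in>T. \<Sum>k\<in>T. (qt j k * vt k + q j k * vtt j k) * cnj v1 + q j k * vt k * cnj (v1t j)))
   = 1 / 2 * (cmod v1)\<^sup>2 + Re ((x1 * v11 + (\<Sum>j\<in>T. \<Sum>k\<in>T. q j k * vtt j k)) * cnj v1)
     - 1 / 2 * Re (\<Sum>j\<in>T. \<Sum>k\<in>T. q1 j k * vt k * cnj (vt j)) + Re (\<Sum>j\<in>T. \<Sum>k\<in>T. qt j k * vt k * cnj v1)"
proof -
  have s1: "(\<Sum>j\<in>T. \<Sum>k\<in>T. (q1 j k * vt k + q j k * v1t k) * cnj (vt j) + q j k * vt k * cnj (v1t j))
    = (\<Sum>j\<in>T. \<Sum>k\<in>T. q1 j k * vt k * cnj (vt j)) + (\<Sum>j\<in>T. \<Sum>k\<in>T. q j k * v1t k * cnj (vt j))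
      + (\<Sum>j\<in>T. \<Sum>k\<in>T. q j k * vt k * cnj (v1t j))"
    by (simp add: sum.distrib distrib_right)
  have s2: "(\<Sum>j\<in>T. \<Sum>k\<in>T. (qt j k * vt k + q j k * vtt j k) * cnj v1 + q j k * vt k * cnj (v1t j))
    = (\<Sum>j\<in>T. \<Sum>k\<in>T. qt j k * vt k * cnj v1) + (\<Sum>j\<in>T. \<Sum>k\<in>T. q j k * vtt j k) * cnj v1
      + (\<Sum>j\<in>T. \<Sum>k\<in>T. q j k * vt k * cnj (v1t j))"
    by (simp add: sum.distrib distrib_right sum_distrib_right)
  have sw: "Re (\<Sum>j\<in>T. \<Sum>k\<in>T. q j k * v1t k * cnj (vt j)) = Re (\<Sum>j\<in>T. \<Sum>k\<in>T. q j k * vt k * cnj (v1t j))"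
    by (rule Re_swap[OF assms(1,2)])
  have m: "Re (v1 * cnj v1) = (cmod v1)\<^sup>2" by (metis Re_complex_of_real complex_norm_square)
  have x: "Re (x1 * (v11 * cnj v1 + v1 * cnj v11)) = 2 * Re (x1 * v11 * cnj v1)"
    using x1 by (simp add: algebra_simps)
  have h: "Re ((1 / 2) * z) = 1 / 2 * Re z" for z by simp
  show ?thesis unfolding s1 s2
    unfolding plus_complex.simps minus_complex.simps h distrib_right mult_1_left m x sw by argo
qed

text \<open>The flux belongs to the multiplier \<open>cnj v\<close>. The summand with
  \<open>(\<kappa> - 1) / 2\<close> and the derivative of the factor \<open>x1\<close> add up to
  \<open>\<kappa> * Re (v1 * cnj v)\<close>, designed to cancel the first order term of the
  commutator.\<close>

lemma flux_divergence2:
  fixes x1 v v1 v11 :: complex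
  assumes x1: "Im x1 = 0"
  shows "Re ((1 * (v1 * cnj v) + x1 * (v11 * cnj v + v1 * cnj v1)) + complex_of_real ((\<kappa> - 1) / 2) * (v1 * cnj v + v * cnj v1)
     + (\<Sum>j\<in>T. \<Sum>k\<in>T. (qt j k * vt k + q j k * vtt j k) * cnj v + q j k * vt k * cnj (vt j)))
   = Re ((x1 * v11 + (\<Sum>j\<in>T. \<Sum>k\<in>T. q j k * vtt j k)) * cnj v) + Re x1 * (cmod v1)\<^sup>2 + \<kappa> * Re (v1 * cnj v)
     + Re (\<Sum>j\<in>T. \<Sum>k\<in>T. qt j k * vt k * cnj v) + Re (\<Sum>j\<in>T. \<Sum>k\<in>T. q j k * vt k * cnj (vt j))"
proof -
  have s2: "(\<Sum>j\<in>T. \<Sum>k\<in>T. (qt j k * vt k + q j k * vtt j k) * cnj v + q j k * vt k * cnj (vt j))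
    = (\<Sum>j\<in>T. \<Sum>k\<in>T. qt j k * vt k * cnj v) + (\<Sum>j\<in>T. \<Sum>k\<in>T. q j k * vtt j k) * cnj v
      + (\<Sum>j\<in>T. \<Sum>k\<in>T. q j k * vt k * cnj (vt j))"
    by (simp add: sum.distrib distrib_right sum_distrib_right)
  have m: "Re (x1 * (v11 * cnj v + v1 * cnj v1)) = Re (x1 * v11 * cnj v) + Re x1 * (cmod v1)\<^sup>2"
  proof -
    have "Re (x1 * (v1 * cnj v1)) = Re x1 * (cmod v1)\<^sup>2"
      using x1 unfolding complex_norm_square[symmetric] by simp
    then show ?thesis by (simp only: distrib_left plus_complex.simps mult.assoc)
  qed
  have n: "Re (complex_of_real ((\<kappa> - 1) / 2) * (v1 * cnj v + v * cnj v1)) = (\<kappa> - 1) * Re (v1 * cnj v)"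
    by (simp add: algebra_simps)
  show ?thesis unfolding s2
    unfolding plus_complex.simps distrib_right mult_1_left m n by argo
qed

text \<open>Applied with \<open>z k\<close> the tangential derivatives of \<open>v\<close> and \<open>E\<close> their euclidean norm.\<close>

lemma double_sum_bound:
  fixes q :: "'n::finite \<Rightarrow> 'n \<Rightarrow> complex"
  assumes q: "\<And>j k. cmod (q j k) \<le> C" and z: "\<And>k. k \<in> T \<Longrightarrow> cmod (z k) \<le> E" and y: "\<And>j. j \<in> T \<Longrightarrow> cmod (y j) \<le> D"
    and C: "real CARD('n) * real CARD('n) * C \<le> c" and E: "0 \<le> E" "0 \<le> D"
  shows "cmod (\<Sum>j\<in>T. \<Sum>k\<in>T. q j k * z k * y j) \<le> c * E * D"
proof -
  have nn: "0 \<le> C" using order_trans[OF norm_ge_zero] q by blast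
  have "cmod (\<Sum>j\<in>T. \<Sum>k\<in>T. q j k * z k * y j) \<le> (\<Sum>j\<in>T. \<Sum>k\<in>T. C * E * D)"
    using q z y nn E by (intro order_trans[OF norm_sum] sum_mono) (auto simp: norm_mult intro!: mult_mono mult_nonneg_nonneg)
  also have "\<dots> = real (card T) * real (card T) * (C * E * D)" by simp
  also have "\<dots> \<le> real CARD('n) * real CARD('n) * (C * E * D)"
    using nn E by (intro mult_mono mult_nonneg_nonneg) (auto intro: card_mono)
  also have "\<dots> = (real CARD('n) * real CARD('n) * C) * (E * D)" by simp
  also have "\<dots> \<le> c * (E * D)" using C E by (intro mult_right_mono mult_nonneg_nonneg) auto
  finally show ?thesis by simp
qed

text \<open>Linear bookkeeping on opaque products. The constant \<open>c + 3\<close> collects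
  \<open>c + 1/2\<close> from the divergence and 2 from the absorbed errors, rounded up.\<close>

lemma combine_bounds:
  fixes N l E t W k c S e0 e1 e2 e3 e4 e5 q n3 u w p f R R2 R3 :: real
  assumes low: "N * R2 * (l * E + t * W) - R3 * (- (k - c - 1/2) * W + e0) - e3 - e1 - e2 - e4 - e5 \<le> S"
    and err: "R3 * e0 + e3 + e1 + e2 + e4 + e5 \<le> N * R2 * (l / 2 * E + 1 / 2 * t * W) + (N / 4 + 2) * R3 * W
      + q * n3 * (R + t) * w + p * R3 * f"
    and nn: "0 \<le> R3 * W"
  shows "N * (l / 2) * (R2 * E) + N / 2 * (R2 * (t * W)) + (k - (c + 3) - N / 4) * (R3 * W)
    \<le> S + q * n3 * (R * w + t * w) + p * (R3 * f)"
proof -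
  have a: "N * R2 * (l * E + t * W) = N * (R2 * E) * l + N * (R2 * (t * W))" by (simp add: field_simps)
  have b: "N * R2 * (l / 2 * E + 1 / 2 * t * W) = N * (R2 * E) * l / 2 + N * (R2 * (t * W)) / 2" by (simp add: field_simps)
  have c: "N * (l / 2) * (R2 * E) = N * (R2 * E) * l / 2" "N / 2 * (R2 * (t * W)) = N * (R2 * (t * W)) / 2" by simp_all
  have d: "R3 * (- (k - c - 1/2) * W + e0) = - (k * (R3 * W)) + c * (R3 * W) + 1/2 * (R3 * W) + R3 * e0" by (simp add: field_simps)
  have e: "(N / 4 + 2) * R3 * W = N * (R3 * W) / 4 + 2 * (R3 * W)" by (simp add: field_simps)
  have f: "(k - (c + 3) - N / 4) * (R3 * W) = k * (R3 * W) - c * (R3 * W) - 3 * (R3 * W) - N * (R3 * W) / 4" by (simp add: field_simps)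
  have g: "q * n3 * (R + t) * w = q * n3 * (R * w + t * w)" "p * R3 * f = p * (R3 * f)" by (simp_all add: distrib_right mult.assoc)
  show ?thesis using assms unfolding a b c d e f g by linarith
qed

section \<open>The operator on the lens and its pointwise energy inequality\<close>

text \<open>\<open>l\<close> is the ellipticity constant for the sign \<open>\<sigma>\<close>,
  \<open>C0\<close> bounds the coefficients and the first derivatives of \<open>Q\<close>, and
  \<open>c\<close> dominates the double sums over indices. The condition \<open>rc\<close> ties the
  size of the lens to these; it can be met because \<open>l\<close> and \<open>C0\<close> are
  determined on a fixed ball before \<open>r\<close> is chosen.\<close>

locale lens_operator =
  fixes U :: "(real^'n::finite) set" and k0 :: 'n and \<sigma> r l c C0 :: real
    and A Cc :: "real^'n \<Rightarrow> complex" and Q :: "'n \<Rightarrow> 'n \<Rightarrow> real^'n \<Rightarrow> complex" and B :: "'n \<Rightarrow> real^'n \<Rightarrow> complex"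
  assumes U: "open U" "wt_supp k0 r \<subseteq> U"
    and \<sigma>: "\<sigma> = 1 \<or> \<sigma> = -1" and r: "0 < r" "r \<le> 1"
    and smooth: "smooth_on U A" "smooth_on U Cc" "\<And>j k. smooth_on U (Q j k)" "\<And>j. smooth_on U (B j)"
    and Qsym: "\<And>j k. Q j k = Q k j" and Qreal: "\<And>j k x. x \<in> U \<Longrightarrow> Im (Q j k x) = 0"
    and bounds: "\<And>x. x \<in> wt_supp k0 r \<Longrightarrow> cmod (A x) \<le> C0" "\<And>x. x \<in> wt_supp k0 r \<Longrightarrow> cmod (Cc x) \<le> C0"
      "\<And>j k x. x \<in> wt_supp k0 r \<Longrightarrow> cmod (Q j k x) \<le> C0" "\<And>i j k x. x \<in> wt_supp k0 r \<Longrightarrow> cmod (pd i (Q j k) x) \<le> C0"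
      "\<And>j x. x \<in> wt_supp k0 r \<Longrightarrow> cmod (B j x) \<le> C0"
    and ell: "\<And>x z. x \<in> wt_supp k0 r \<Longrightarrow> l * (\<Sum>j\<in>UNIV - {k0}. (cmod (z j))\<^sup>2)
      \<le> \<sigma> * Re (\<Sum>j\<in>UNIV - {k0}. \<Sum>k\<in>UNIV - {k0}. Q j k x * z k * cnj (z j))"
    and l: "0 < l" "l \<le> 1" and c: "1 \<le> c" "real CARD('n) * real CARD('n) * C0 \<le> c" and rc: "96 * r * c\<^sup>2 \<le> l"
begin

abbreviation "T \<equiv> UNIV - {k0}"

abbreviation "X \<equiv> wt k0 \<sigma> r"

definition Lop :: "(real^'n \<Rightarrow> complex) \<Rightarrow> real^'n \<Rightarrow> complex" where
  "Lop v x = complex_of_real (x $ k0) * pd k0 (pd k0 v) x + (\<Sum>j\<in>T. \<Sum>k\<in>T. Q j k x * pd j (pd k v) x)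
     + A x * pd k0 v x + (\<Sum>j\<in>T. B j x * pd j v x) + Cc x * v x"

definition tgrad2 :: "(real^'n \<Rightarrow> complex) \<Rightarrow> real^'n \<Rightarrow> real" where
  "tgrad2 v x = (\<Sum>j\<in>T. (cmod (pd j v x))\<^sup>2)"

text \<open>\<open>flux_a\<close> and \<open>flux_b\<close> are the normal and tangential components
  of the flux for the multiplier \<open>\<partial>\<^sub>1 v\<close>; \<open>flux_c\<close> and
  \<open>flux_d\<close> are those for the multiplier \<open>v\<close>.\<close>

definition flux_a :: "(real^'n \<Rightarrow> complex) \<Rightarrow> real^'n \<Rightarrow> complex" where
  "flux_a v x = (1 / 2) * (complex_of_real (x $ k0) * (pd k0 v x * cnj (pd k0 v x))
     - (\<Sum>j\<in>T. \<Sum>k\<in>T. Q j k x * pd k v x * cnj (pd j v x)))"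

definition flux_b :: "(real^'n \<Rightarrow> complex) \<Rightarrow> 'n \<Rightarrow> real^'n \<Rightarrow> complex" where
  "flux_b v j x = (\<Sum>k\<in>T. Q j k x * pd k v x * cnj (pd k0 v x))"

definition flux_c :: "nat \<Rightarrow> (real^'n \<Rightarrow> complex) \<Rightarrow> real^'n \<Rightarrow> complex" where
  "flux_c k v x = complex_of_real (x $ k0) * (pd k0 v x * cnj (v x)) + complex_of_real ((real k - 1) / 2) * (v x * cnj (v x))"

definition flux_d :: "(real^'n \<Rightarrow> complex) \<Rightarrow> 'n \<Rightarrow> real^'n \<Rightarrow> complex" where
  "flux_d v j x = (\<Sum>k\<in>T. Q j k x * pd k v x * cnj (v x))"

lemmas smooth_intros = smooth_on_mult[OF U(1)] smooth_on_add[OF U(1)] smooth_on_sum[OF U(1)] smooth_on_cnj[OF U(1)]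
  smooth_on_const smooth_on_coord smooth smooth_on_pd

lemma smooth_on_diff: "smooth_on U f \<Longrightarrow> smooth_on U g \<Longrightarrow> smooth_on U (\<lambda>x. f x - g x)"
  using smooth_on_add[OF U(1), of f "\<lambda>x. (-1) * g x"] smooth_on_mult[OF U(1) smooth_on_const[of U "-1"], of g] by simp

lemma flux_smooth:
  assumes v: "smooth_on U v"
  shows "smooth_on U (flux_a v)" "smooth_on U (flux_b v j)" "smooth_on U (flux_c k v)" "smooth_on U (flux_d v j)"
  unfolding flux_a_def[abs_def] flux_b_def[abs_def] flux_c_def[abs_def] flux_d_def[abs_def]
  by (intro smooth_intros smooth_on_diff v)+

lemma flux_pd:
  assumes v: "smooth_on U v" and x: "x \<in> U"
  shows "pd k0 (flux_a v) x = (1 / 2) * ((1 * (pd k0 v x * cnj (pd k0 v x))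
        + complex_of_real (x $ k0) * (pd k0 (pd k0 v) x * cnj (pd k0 v x) + pd k0 v x * cnj (pd k0 (pd k0 v) x)))
       - (\<Sum>j\<in>T. \<Sum>k\<in>T. (pd k0 (Q j k) x * pd k v x + Q j k x * pd k0 (pd k v) x) * cnj (pd j v x)
          + Q j k x * pd k v x * cnj (pd k0 (pd j v) x)))"
    "pd j (flux_b v j) x = (\<Sum>k\<in>T. (pd j (Q j k) x * pd k v x + Q j k x * pd j (pd k v) x) * cnj (pd k0 v x)
          + Q j k x * pd k v x * cnj (pd k0 (pd j v) x))"
    "pd k0 (flux_c k v) x = (1 * (pd k0 v x * cnj (v x)) + complex_of_real (x $ k0) * (pd k0 (pd k0 v) x * cnj (v x) + pd k0 v x * cnj (pd k0 v x)))
        + complex_of_real ((real k - 1) / 2) * (pd k0 v x * cnj (v x) + v x * cnj (pd k0 v x))"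
    "pd j (flux_d v j) x = (\<Sum>k\<in>T. (pd j (Q j k) x * pd k v x + Q j k x * pd j (pd k v) x) * cnj (v x)
          + Q j k x * pd k v x * cnj (pd j v x))"
proof -
  have V: "hpd i v x (pd i v x)" "hpd i (pd k v) x (pd i (pd k v) x)" "hpd i (Q j k) x (pd i (Q j k) x)" for i j k
    using smooth_on_hpd0[OF _ x] v smooth smooth_on_pd[OF v] by auto
  have X: "hpd k0 (\<lambda>x. complex_of_real (x $ k0)) x 1" using hpd_coord[of k0 k0 x] by simp
  have d: "hpd i f x D \<Longrightarrow> hpd i g x E \<Longrightarrow> hpd i (\<lambda>x. f x - g x) x (D - E)" for i f g D E
    unfolding hpd_def by (rule has_vector_derivative_diff)
  have cm: "hpd i f x D \<Longrightarrow> hpd i (\<lambda>x. a * f x) x (a * D)" for i f D a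
    using hpd_mult[OF hpd_const, of i f x D a] by simp
  have com: "pd j (pd k0 v) x = pd k0 (pd j v) x" by (rule pd_commute[OF U(1) v x])
  show "pd k0 (flux_a v) x = (1 / 2) * ((1 * (pd k0 v x * cnj (pd k0 v x))
        + complex_of_real (x $ k0) * (pd k0 (pd k0 v) x * cnj (pd k0 v x) + pd k0 v x * cnj (pd k0 (pd k0 v) x)))
       - (\<Sum>j\<in>T. \<Sum>k\<in>T. (pd k0 (Q j k) x * pd k v x + Q j k x * pd k0 (pd k v) x) * cnj (pd j v x)
          + Q j k x * pd k v x * cnj (pd k0 (pd j v) x)))"
    unfolding flux_a_def[abs_def] by (intro hpd_imp_pd cm d hpd_mult hpd_cnj hpd_sum V X)
  show "pd j (flux_b v j) x = (\<Sum>k\<in>T. (pd j (Q j k) x * pd k v x + Q j k x * pd j (pd k v) x) * cnj (pd k0 v x)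
          + Q j k x * pd k v x * cnj (pd k0 (pd j v) x))"
    unfolding flux_b_def[abs_def] com[symmetric] by (intro hpd_imp_pd hpd_mult hpd_cnj hpd_sum V)
  show "pd k0 (flux_c k v) x = (1 * (pd k0 v x * cnj (v x)) + complex_of_real (x $ k0) * (pd k0 (pd k0 v) x * cnj (v x) + pd k0 v x * cnj (pd k0 v x)))
        + complex_of_real ((real k - 1) / 2) * (pd k0 v x * cnj (v x) + v x * cnj (pd k0 v x))"
    unfolding flux_c_def[abs_def] by (intro hpd_imp_pd cm hpd_add hpd_mult hpd_cnj V X)
  show "pd j (flux_d v j) x = (\<Sum>k\<in>T. (pd j (Q j k) x * pd k v x + Q j k x * pd j (pd k v) x) * cnj (v x)
          + Q j k x * pd k v x * cnj (pd j v x))"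
    unfolding flux_d_def[abs_def] by (intro hpd_imp_pd hpd_mult hpd_cnj hpd_sum V)
qed

text \<open>The multiplier is \<open>X\<^sup>2\<^sup>N \<partial>\<^sub>1v\<close> minus \<open>2N\<sigma>X\<^sup>2\<^sup>N\<^sup>-\<^sup>1 v\<close>; \<open>bracket\<close> is the resulting divergence.\<close>

definition bracket :: "nat \<Rightarrow> nat \<Rightarrow> (real^'n \<Rightarrow> complex) \<Rightarrow> real^'n \<Rightarrow> complex" where
  "bracket N k v x =
     (2 * real N * \<sigma>) *\<^sub>R (((real (2 * N - 1) * X x ^ (2 * N - 1 - 1) * dlens k0 \<sigma> r k0 x) *\<^sub>R flux_c k v x + X x ^ (2 * N - 1) *\<^sub>R pd k0 (flux_c k v) x)
       + (\<Sum>j\<in>T. (real (2 * N - 1) * X x ^ (2 * N - 1 - 1) * dlens k0 \<sigma> r j x) *\<^sub>R flux_d v j x + X x ^ (2 * N - 1) *\<^sub>R pd j (flux_d v j) x))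
     - (((real (2 * N) * X x ^ (2 * N - 1) * dlens k0 \<sigma> r k0 x) *\<^sub>R flux_a v x + X x ^ (2 * N) *\<^sub>R pd k0 (flux_a v) x)
       + (\<Sum>j\<in>T. (real (2 * N) * X x ^ (2 * N - 1) * dlens k0 \<sigma> r j x) *\<^sub>R flux_b v j x + X x ^ (2 * N) *\<^sub>R pd j (flux_b v j) x))"

lemma integral_bracket:
  assumes v: "smooth_on U v" and N: "N \<ge> 2"
  shows "integrable lborel (bracket N k v)" "integral\<^sup>L lborel (bracket N k v) = 0"
proof -
  have m: "2 \<le> 2 * N - 1" "2 \<le> 2 * N" using N by auto
  define Z where "Z f \<longleftrightarrow> has_bochner_integral lborel f (0::complex)" for f :: "real^'n \<Rightarrow> complex"
  have Z: "Z (\<lambda>x. f x + g x)" "Z (\<lambda>x. f x - g x)" if "Z f" "Z g" for f g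
    using has_bochner_integral_add[of lborel f 0 g 0] has_bochner_integral_diff[of lborel f 0 g 0] that
    by (auto simp: Z_def)
  have Zs: "Z (\<lambda>x. a *\<^sub>R f x)" if "Z f" for f a
    using has_bochner_integral_scaleR_right[of a lborel f 0] that by (auto simp: Z_def)
  have Zsum: "Z (\<lambda>x. \<Sum>j\<in>T. F j x)" if "\<And>j. j \<in> T \<Longrightarrow> Z (F j)" for F
    using has_bochner_integral_sum[of T lborel F "\<lambda>_. 0"] that by (auto simp: Z_def)
  have Zi: "Z (\<lambda>x. (real m * X x ^ (m - 1) * dlens k0 \<sigma> r i x) *\<^sub>R g x + X x ^ m *\<^sub>R pd i g x)"
    if "smooth_on U g" "2 \<le> m" for m i g
    unfolding Z_def has_bochner_integral_iff using integral_wt_pd[OF \<sigma> r U that] by blast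
  have "Z (bracket N k v)"
    unfolding bracket_def[abs_def]
    by (rule Z(2)[OF Zs[OF Z(1)[OF Zi[OF flux_smooth(3)[OF v] m(1)] Zsum[OF Zi[OF flux_smooth(4)[OF v] m(1)]]]]
        Z(1)[OF Zi[OF flux_smooth(1)[OF v] m(2)] Zsum[OF Zi[OF flux_smooth(2)[OF v] m(2)]]]])
  then show "integrable lborel (bracket N k v)" "integral\<^sup>L lborel (bracket N k v) = 0"
    unfolding Z_def has_bochner_integral_iff by auto
qed

lemma C0_bounds: "0 \<le> C0" "C0 \<le> c" "real CARD('n) * C0 \<le> c"
proof -
  have "0 \<in> wt_supp k0 r" using r by (auto simp: wt_supp_def)
  from bounds(1)[OF this] show 0: "0 \<le> C0" using norm_ge_zero order_trans by blast
  have "1 * (1 * C0) \<le> real CARD('n) * (real CARD('n) * C0)" "1 * (real CARD('n) * C0) \<le> real CARD('n) * (real CARD('n) * C0)"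
    using 0 by (intro mult_mono; simp add: Suc_leI)+
  then show "C0 \<le> c" "real CARD('n) * C0 \<le> c" using c(2) unfolding mult.assoc mult_1_left by linarith+
qed

text \<open>The source is \<open>Lop v\<close> plus \<open>k\<close> times the normal derivative
  because \<open>v\<close> will be a partial derivative of the solution with \<open>k\<close> normal
  indices. The bound \<open>k + 1 \<le> N\<close> lets the term with \<open>k\<close> in
  \<open>flux_c\<close> be counted as a power of \<open>N\<close>.\<close>

lemma bracket_lower_bound:
  fixes k N :: nat
  assumes v: "smooth_on U v" and N: "N \<ge> 2" and k: "k + 1 \<le> N" and x0: "x $ k0 \<noteq> 0"
  shows "real N * (l / 2) * (X x ^ (2 * N - 1) * tgrad2 v x) + real N / 2 * (X x ^ (2 * N - 1) * (\<bar>x $ k0\<bar> * (cmod (pd k0 v x))\<^sup>2))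
      + (real k - (c + 3) - real N / 4) * (X x ^ (2 * N) * (cmod (pd k0 v x))\<^sup>2)
    \<le> Re (bracket N k v x) + 500 * c\<^sup>2 / l * real N ^ 3 * (X x ^ (2 * N - 2) * (cmod (v x))\<^sup>2 + X x ^ (2 * N - 3) * (\<bar>x $ k0\<bar> * (cmod (v x))\<^sup>2))
      + 5 / real N * (X x ^ (2 * N) * (cmod (Lop v x + of_nat k * pd k0 v x))\<^sup>2)"
proof (cases "X x = 0")
  case True
  have z: "X x ^ (2 * N) = 0" "X x ^ (2 * N - 1) = 0" "X x ^ (2 * N - 2) = 0" "X x ^ (2 * N - 3) = 0" "X x ^ (2 * N - 1 - 1) = 0"
    using True N by auto
  show ?thesis unfolding bracket_def z by simp
next
  case False
  then have X: "X x > 0" using wt_bounds(1)[OF \<sigma> r, of k0 x] by simp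
  have supp: "x \<in> wt_supp k0 r" by (rule wt_pos(1)[OF \<sigma> r X])
  then have xU: "x \<in> U" using U by blast
  \<comment> \<open>With this common factor all other powers of the weight become \<open>X\<close>,
    \<open>X\<^sup>2\<close>, \<open>X^3\<close>, and the claim turns into a polynomial inequality
    at one point.\<close>
  define P where "P = X x ^ (2 * N - 3)"
  have P: "P \<ge> 0" using X by (simp add: P_def)
  obtain p where p: "2 * N = p + 3" using N le_Suc_ex[of 3 "2 * N"] by (auto simp: add.commute)
  have pw: "X x ^ (2 * N) = P * X x ^ 3" "X x ^ (2 * N - 1) = P * (X x)\<^sup>2" "X x ^ (2 * N - 2) = P * X x" "X x ^ (2 * N - 1 - 1) = P * X x"
    unfolding P_def p by (simp_all add: power_add power3_eq_cube power2_eq_square)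
  define \<rho> where "\<rho> = X x"
  define t where "t = \<bar>x $ k0\<bar>"
  define \<tau> where "\<tau> = tang k0 r x"
  define E where "E = sqrt (tgrad2 v x)"
  define w where "w = cmod (v x)"
  define w1 where "w1 = cmod (pd k0 v x)"
  define F where "F = Lop v x + of_nat k * pd k0 v x"
  define f where "f = cmod F"
  define dl where "dl i = dlens k0 \<sigma> r i x" for i
  have nn: "0 \<le> \<rho>" "0 \<le> t" "0 \<le> \<tau>" "0 \<le> E" "0 \<le> w" "0 \<le> w1" "0 \<le> f" "0 \<le> c" "0 \<le> real N" "0 \<le> r"
    using X c r tang_bounds(1)[OF \<sigma> r] by (auto simp: \<rho>_def t_def \<tau>_def E_def w_def w1_def f_def tgrad2_def sum_nonneg)
  have E2: "E\<^sup>2 = tgrad2 v x" by (simp add: E_def tgrad2_def sum_nonneg)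
  have vE: "cmod (pd j v x) \<le> E" if "j \<in> T" for j
  proof -
    have "(cmod (pd j v x))\<^sup>2 \<le> tgrad2 v x" unfolding tgrad2_def by (rule member_le_sum) (use that in auto)
    then show ?thesis unfolding E_def using real_le_rsqrt by blast
  qed
  note B = bounds[OF supp]
  have nC: "real CARD('n) * C0 \<le> c" "C0 \<le> c" using C0_bounds by auto
  let ?v1 = "pd k0 v x"
  let ?BV = "\<Sum>j\<in>T. B j x * pd j v x"
  let ?M = "complex_of_real (x $ k0) * pd k0 (pd k0 v) x + (\<Sum>j\<in>T. \<Sum>k\<in>T. Q j k x * pd j (pd k v) x)"
  let ?q = "\<Sum>j\<in>T. \<Sum>k\<in>T. Q j k x * pd k v x * cnj (pd j v x)"
  have M: "?M = F - A x * ?v1 - of_nat k * ?v1 - ?BV - Cc x * v x"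
    unfolding F_def Lop_def by simp
  have BV: "cmod ?BV \<le> c * E"
  proof -
    have "cmod ?BV \<le> (\<Sum>j\<in>T. C0 * E)"
      using B(5) vE C0_bounds nn by (intro order_trans[OF norm_sum] sum_mono) (auto simp: norm_mult intro!: mult_mono)
    also have "\<dots> = real (card T) * (C0 * E)" by simp
    also have "\<dots> \<le> real CARD('n) * (C0 * E)"
      using C0_bounds nn by (intro mult_right_mono) (auto intro: card_mono)
    also have "\<dots> \<le> c * E" using nC nn by (simp add: mult.assoc[symmetric] mult_right_mono)
    finally show ?thesis .
  qed
  have MR: "\<bar>Re (?M * cnj z) - Re (- (of_nat k * ?v1) * cnj z)\<bar> \<le> (f + c * E + c * w) * cmod z + \<bar>Re (A x * ?v1 * cnj z)\<bar>" for z
  proof -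
    have "Re (?M * cnj z) - Re (- (of_nat k * ?v1) * cnj z) = Re (F * cnj z) - Re (A x * ?v1 * cnj z) - Re (?BV * cnj z) - Re (Cc x * v x * cnj z)"
      unfolding M by (simp add: left_diff_distrib)
    moreover have "\<bar>Re (F * cnj z)\<bar> \<le> f * cmod z" unfolding f_def by (metis abs_Re_le_cmod norm_mult complex_mod_cnj)
    moreover have "\<bar>Re (?BV * cnj z)\<bar> \<le> c * E * cmod z"
      by (rule order_trans[OF abs_Re_le_cmod]) (simp add: norm_mult mult_right_mono BV)
    moreover have "\<bar>Re (Cc x * v x * cnj z)\<bar> \<le> c * w * cmod z"
      by (rule order_trans[OF abs_Re_le_cmod])
        (use B(2) nC in \<open>auto simp: norm_mult w_def intro!: mult_right_mono order_trans[OF B(2)]\<close>)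
    ultimately show ?thesis by (simp only: distrib_right)
  qed
  have R1_eq: "Re (pd k0 (flux_a v) x + (\<Sum>j\<in>T. pd j (flux_b v j) x))
    = 1 / 2 * w1\<^sup>2 + Re (?M * cnj ?v1) - 1 / 2 * Re (\<Sum>j\<in>T. \<Sum>k\<in>T. pd k0 (Q j k) x * pd k v x * cnj (pd j v x))
      + Re (\<Sum>j\<in>T. \<Sum>k\<in>T. pd j (Q j k) x * pd k v x * cnj ?v1)" (is "?R1 = _")
    unfolding flux_pd[OF v xU] w1_def
    by (rule flux_divergence1[where q = "\<lambda>j k. Q j k x"]) (use Qsym Qreal[OF xU] in auto)
  have R1_q1: "\<bar>Re (\<Sum>j\<in>T. \<Sum>k\<in>T. pd k0 (Q j k) x * pd k v x * cnj (pd j v x))\<bar> \<le> c * E * E"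
    by (rule order_trans[OF abs_Re_le_cmod double_sum_bound[OF B(4) vE _ c(2)]]) (use vE nn in auto)
  have R1_qt: "\<bar>Re (\<Sum>j\<in>T. \<Sum>k\<in>T. pd j (Q j k) x * pd k v x * cnj ?v1)\<bar> \<le> c * E * w1"
    by (rule order_trans[OF abs_Re_le_cmod double_sum_bound[OF B(4) vE _ c(2)]]) (use nn in \<open>auto simp: w1_def\<close>)
  have R1_k: "Re (- (of_nat k * ?v1) * cnj ?v1) = - real k * w1\<^sup>2"
  proof -
    have "- (of_nat k * ?v1) * cnj ?v1 = - (of_nat k * (?v1 * cnj ?v1))" by simp
    also have "\<dots> = complex_of_real (- real k * w1\<^sup>2)" unfolding complex_norm_square[symmetric] w1_def by simp
    finally show ?thesis by (simp only: Re_complex_of_real)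
  qed
  have R1_A: "\<bar>Re (A x * ?v1 * cnj ?v1)\<bar> \<le> c * w1\<^sup>2"
  proof (rule order_trans[OF abs_Re_le_cmod])
    have "cmod (A x * ?v1 * cnj ?v1) = cmod (A x) * w1\<^sup>2" by (simp add: norm_mult w1_def power2_eq_square)
    also have "\<dots> \<le> c * w1\<^sup>2" using B(1) nC by (intro mult_right_mono) auto
    finally show "cmod (A x * ?v1 * cnj ?v1) \<le> c * w1\<^sup>2" .
  qed
  note R1_facts = R1_eq R1_q1 R1_qt R1_k R1_A MR[of ?v1]
  \<comment> \<open>The linear reasoning is stated over plain variables so that the double sums
    enter as atoms.\<close>
  have lin: "(R::real) = 1 / 2 * W + RM - 1 / 2 * s1 + s2 \<Longrightarrow> \<bar>s1\<bar> \<le> p \<Longrightarrow> \<bar>s2\<bar> \<le> q \<Longrightarrow> m = kW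
     \<Longrightarrow> \<bar>z\<bar> \<le> cW \<Longrightarrow> \<bar>RM - m\<bar> \<le> u + \<bar>z\<bar> \<Longrightarrow> R \<le> 1 / 2 * W + kW + cW + u + p + q" for R W RM s1 s2 p q m kW cW u z
    by linarith
  have "?R1 \<le> 1 / 2 * w1\<^sup>2 + - real k * w1\<^sup>2 + c * w1\<^sup>2 + (f + c * E + c * w) * cmod ?v1 + c * E * E + c * E * w1"
    by (rule lin[OF R1_facts])
  also have "\<dots> = - (real k - c - 1/2) * w1\<^sup>2 + (f * w1 + 2 * c * E * w1 + c * w * w1 + c * E\<^sup>2)"
    unfolding w1_def[symmetric] by (simp add: field_simps power2_eq_square)
  finally have R1: "?R1 \<le> - (real k - c - 1/2) * w1\<^sup>2 + (f * w1 + 2 * c * E * w1 + c * w * w1 + c * E\<^sup>2)" .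
  \<comment> \<open>The term \<open>real k * Re (?v1 * cnj (v x))\<close> from \<open>flux_c\<close>
    cancels the \<open>- of_nat k * ?v1\<close> contained in \<open>?M\<close>, so that no term of
    size \<open>k\<close> survives here.\<close>
  have "Re (pd k0 (flux_c k v) x + (\<Sum>j\<in>T. pd j (flux_d v j) x))
    = Re (?M * cnj (v x)) + x $ k0 * w1\<^sup>2 + real k * Re (?v1 * cnj (v x))
      + Re (\<Sum>j\<in>T. \<Sum>k\<in>T. pd j (Q j k) x * pd k v x * cnj (v x)) + Re ?q" (is "?R2 = _")
    unfolding flux_pd[OF v xU] w1_def
    by (subst flux_divergence2[where q = "\<lambda>j k. Q j k x"]) auto
  moreover have "\<bar>Re (\<Sum>j\<in>T. \<Sum>k\<in>T. pd j (Q j k) x * pd k v x * cnj (v x))\<bar> \<le> c * E * w"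
    by (rule order_trans[OF abs_Re_le_cmod double_sum_bound[OF B(4) vE _ c(2)]]) (use nn in \<open>auto simp: w_def\<close>)
  moreover have "Re (- (of_nat k * ?v1) * cnj (v x)) = - real k * Re (?v1 * cnj (v x))"
    by (simp add: algebra_simps)
  moreover have "\<bar>Re (A x * ?v1 * cnj (v x))\<bar> \<le> c * w1 * w"
    by (rule order_trans[OF abs_Re_le_cmod])
      (use B(1) nC in \<open>auto simp: norm_mult w_def w1_def intro!: mult_right_mono order_trans[OF B(1)]\<close>)
  ultimately have R2: "\<bar>?R2 - (x $ k0 * w1\<^sup>2 + Re ?q)\<bar> \<le> f * w + c * w1 * w + 2 * c * E * w + c * w\<^sup>2"
    using MR[of "v x"] unfolding w_def[symmetric] power2_eq_square[of w] distrib_right by linarith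
  have ga: "Re (flux_a v x) = 1 / 2 * (x $ k0 * w1\<^sup>2 - Re ?q)"
  proof -
    have "Re (complex_of_real (x $ k0) * (?v1 * cnj ?v1)) = x $ k0 * w1\<^sup>2"
      unfolding complex_norm_square[symmetric] w1_def by simp
    moreover have "Re ((1 / 2) * z) = 1 / 2 * Re z" for z by simp
    ultimately show ?thesis unfolding flux_a_def by (simp only: minus_complex.simps)
  qed
  have gc: "\<bar>Re (flux_c k v x)\<bar> \<le> t * w1 * w + 1 / 2 * ((real k + 1) * w\<^sup>2)"
  proof (rule order_trans[OF abs_Re_le_cmod])
    have "cmod (flux_c k v x) \<le> cmod (complex_of_real (x $ k0) * (?v1 * cnj (v x))) + cmod (complex_of_real ((real k - 1) / 2) * (v x * cnj (v x)))"
      unfolding flux_c_def by (rule norm_triangle_ineq)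
    also have "cmod (complex_of_real (x $ k0) * (?v1 * cnj (v x))) = t * w1 * w"
      by (simp add: norm_mult t_def w1_def w_def)
    also have "cmod (complex_of_real ((real k - 1) / 2) * (v x * cnj (v x))) = \<bar>(real k - 1) / 2\<bar> * w\<^sup>2"
      by (simp only: norm_mult norm_of_real complex_mod_cnj w_def power2_eq_square)
    also have "\<dots> \<le> (1 / 2 * (real k + 1)) * w\<^sup>2" by (intro mult_right_mono) auto
    finally show "cmod (flux_c k v x) \<le> t * w1 * w + 1 / 2 * ((real k + 1) * w\<^sup>2)" by simp
  qed
  have dlj: "\<bar>dl j\<bar> \<le> 4 * r * \<tau>" if "j \<in> T" for j
    unfolding dl_def \<tau>_def using dlens_tang[OF \<sigma> r, of j k0 x] that by simp
  have gbd: "\<bar>\<Sum>j\<in>T. dl j * Re (\<Sum>k\<in>T. Q j k x * pd k v x * cnj z)\<bar> \<le> 4 * r * \<tau> * (c * E * cmod z)" for z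
  proof -
    have "(\<Sum>j\<in>T. dl j * Re (\<Sum>k\<in>T. Q j k x * pd k v x * cnj z)) = Re (\<Sum>j\<in>T. \<Sum>k\<in>T. Q j k x * pd k v x * (complex_of_real (dl j) * cnj z))"
      by (simp add: sum_distrib_left algebra_simps)
    also have "\<bar>\<dots>\<bar> \<le> c * E * (4 * r * \<tau> * cmod z)"
      by (rule order_trans[OF abs_Re_le_cmod double_sum_bound[OF B(3) vE _ c(2)]])
        (use nn dlj in \<open>auto simp: norm_mult intro!: mult_right_mono mult_nonneg_nonneg\<close>)
    finally show ?thesis by (simp add: mult_ac)
  qed
  have "Re (bracket N k v x) = P * (2 * real N * \<sigma> * (real (2 * N - 1) * \<rho> * (dl k0 * Re (flux_c k v x) + (\<Sum>j\<in>T. dl j * Re (flux_d v j x))) + \<rho>\<^sup>2 * ?R2)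
      - (2 * real N * \<rho>\<^sup>2 * (dl k0 * Re (flux_a v x) + (\<Sum>j\<in>T. dl j * Re (flux_b v j x))) + \<rho>^3 * ?R1))"
    unfolding bracket_def unfolding pw unfolding \<rho>_def[symmetric] dl_def[symmetric]
    by (simp add: sum.distrib sum_distrib_left algebra_simps)
  moreover define S where "S = 2 * real N * \<sigma> * (real (2 * N - 1) * \<rho> * (dl k0 * Re (flux_c k v x) + (\<Sum>j\<in>T. dl j * Re (flux_d v j x))) + \<rho>\<^sup>2 * ?R2)
      - (2 * real N * \<rho>\<^sup>2 * (dl k0 * Re (flux_a v x) + (\<Sum>j\<in>T. dl j * Re (flux_b v j x))) + \<rho>^3 * ?R1)"
  ultimately have br: "Re (bracket N k v x) = P * S" by simp
  define a where "a = dl k0"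
  have a: "\<bar>a\<bar> \<le> 3" unfolding a_def dl_def using \<sigma> by (auto simp: dlens_def sgn_if)
  have sx: "(if \<sigma> * x $ k0 < 0 then 3 else -1) = \<sigma> * a" using dlens_k0[OF \<sigma> r x0] by (simp add: a_def dl_def)
  have elx: "l * E\<^sup>2 \<le> \<sigma> * Re ?q" unfolding E2 tgrad2_def by (rule ell[OF supp])
  \<comment> \<open>The coercive core. With \<open>y\<close> and \<open>s\<close> as below, the form
    is \<open>5 * y - s * w1\<^sup>2\<close> where \<open>s\<close> is negative and
    \<open>y + 3 * s * w1\<^sup>2\<close> elsewhere; both dominate
    \<open>l * E\<^sup>2 + t * w1\<^sup>2\<close>.\<close>
  have main: "real N * \<rho>\<^sup>2 * (l * E\<^sup>2 + t * w1\<^sup>2) \<le> 2 * real N * \<sigma> * \<rho>\<^sup>2 * (x $ k0 * w1\<^sup>2 + Re ?q) - 2 * real N * \<rho>\<^sup>2 * (a * (1 / 2 * (x $ k0 * w1\<^sup>2 - Re ?q)))"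
  proof -
    define y where "y = \<sigma> * Re ?q"
    define s where "s = \<sigma> * x $ k0"
    have y: "a * Re ?q = (\<sigma> * a) * y" "x $ k0 = \<sigma> * s" "a * x $ k0 = (\<sigma> * a) * s"
      unfolding y_def s_def using \<sigma> by (elim disjE; simp)+
    have t: "t = \<bar>s\<bar>" using \<sigma> by (auto simp: t_def s_def)
    have "0 \<le> l * E\<^sup>2" using l by simp
    then have ly: "l * E\<^sup>2 \<le> y" "0 \<le> y" using elx unfolding y_def by auto
    have "l * E\<^sup>2 + t * w1\<^sup>2 \<le> (2 + \<sigma> * a) * y + (2 - \<sigma> * a) * (s * w1\<^sup>2)"
    proof (cases "s < 0")
      case True
      then have "\<sigma> * a = 3" using sx by (simp add: s_def)
      then show ?thesis using ly True t by simp
    next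
      case False
      then have e: "\<sigma> * a = -1" using sx by (simp add: s_def)
      have "0 \<le> s * w1\<^sup>2" using False by simp
      moreover have "t * w1\<^sup>2 = s * w1\<^sup>2" using False t by simp
      moreover have "(2 + -1) * y + (2 - -1) * (s * w1\<^sup>2) = y + 3 * (s * w1\<^sup>2)" by simp
      ultimately show ?thesis unfolding e using ly by linarith
    qed
    then have "real N * \<rho>\<^sup>2 * (l * E\<^sup>2 + t * w1\<^sup>2) \<le> real N * \<rho>\<^sup>2 * ((2 + \<sigma> * a) * y + (2 - \<sigma> * a) * (s * w1\<^sup>2))"
      using nn by (intro mult_left_mono) auto
    also have "(2 + \<sigma> * a) * y + (2 - \<sigma> * a) * (s * w1\<^sup>2) = 2 * (s * w1\<^sup>2 + y) - ((\<sigma> * a) * s * w1\<^sup>2 - (\<sigma> * a) * y)" by (simp add: algebra_simps)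
    also have "\<dots> = 2 * (\<sigma> * (x $ k0 * w1\<^sup>2 + Re ?q)) - a * (x $ k0 * w1\<^sup>2 - Re ?q)"
      unfolding y(1)[symmetric] y(3)[symmetric] by (simp add: s_def y_def algebra_simps)
    finally show ?thesis by (simp add: algebra_simps)
  qed
  have sig: "\<bar>\<sigma> * z\<bar> = \<bar>z\<bar>" for z using \<sigma> by auto
  have e1: "\<bar>2 * real N * \<sigma> * (real (2 * N - 1) * \<rho> * (a * Re (flux_c k v x)))\<bar>
      \<le> 6 * real N * (2 * real N) * \<rho> * (t * w1 * w) + 3 * real N * (2 * real N) * \<rho> * ((real k + 1) * w\<^sup>2)"
  proof -
    have "\<bar>a * Re (flux_c k v x)\<bar> \<le> 3 * (t * w1 * w + 1 / 2 * ((real k + 1) * w\<^sup>2))"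
      unfolding abs_mult by (intro mult_mono a gc) auto
    then have "2 * real N * (real (2 * N - 1) * \<rho> * \<bar>a * Re (flux_c k v x)\<bar>)
        \<le> 2 * real N * (2 * real N * \<rho> * (3 * (t * w1 * w + 1 / 2 * ((real k + 1) * w\<^sup>2))))"
      using nn by (intro mult_left_mono mult_mono) auto
    moreover have "\<bar>2 * real N * \<sigma> * (real (2 * N - 1) * \<rho> * (a * Re (flux_c k v x)))\<bar> = 2 * real N * (real (2 * N - 1) * \<rho> * \<bar>a * Re (flux_c k v x)\<bar>)"
      using nn(1) \<sigma> by (auto simp: abs_mult)
    ultimately show ?thesis by (simp add: algebra_simps)
  qed
  have e2: "\<bar>2 * real N * \<sigma> * (real (2 * N - 1) * \<rho> * (\<Sum>j\<in>T. dl j * Re (flux_d v j x)))\<bar>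
      \<le> 8 * real N * (2 * real N) * c * r * \<rho> * (\<tau> * E * w)"
  proof -
    have "\<bar>\<Sum>j\<in>T. dl j * Re (flux_d v j x)\<bar> \<le> 4 * r * \<tau> * (c * E * w)"
      unfolding flux_d_def w_def by (rule gbd)
    then have "2 * real N * (real (2 * N - 1) * \<rho> * \<bar>\<Sum>j\<in>T. dl j * Re (flux_d v j x)\<bar>)
        \<le> 2 * real N * (2 * real N * \<rho> * (4 * r * \<tau> * (c * E * w)))"
      using nn by (intro mult_left_mono mult_mono) auto
    moreover have "\<bar>2 * real N * \<sigma> * (real (2 * N - 1) * \<rho> * (\<Sum>j\<in>T. dl j * Re (flux_d v j x)))\<bar>
       = 2 * real N * (real (2 * N - 1) * \<rho> * \<bar>\<Sum>j\<in>T. dl j * Re (flux_d v j x)\<bar>)"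
      using nn(1) \<sigma> by (auto simp: abs_mult)
    ultimately show ?thesis by (simp add: algebra_simps)
  qed
  have e3: "\<bar>2 * real N * \<rho>\<^sup>2 * (\<Sum>j\<in>T. dl j * Re (flux_b v j x))\<bar> \<le> 8 * real N * c * r * \<rho>\<^sup>2 * (\<tau> * E * w1)"
  proof -
    have "\<bar>\<Sum>j\<in>T. dl j * Re (flux_b v j x)\<bar> \<le> 4 * r * \<tau> * (c * E * w1)"
      unfolding flux_b_def w1_def by (rule gbd)
    then have "2 * real N * \<rho>\<^sup>2 * \<bar>\<Sum>j\<in>T. dl j * Re (flux_b v j x)\<bar> \<le> 2 * real N * \<rho>\<^sup>2 * (4 * r * \<tau> * (c * E * w1))"
      using nn by (intro mult_left_mono) auto
    then show ?thesis by (simp add: abs_mult algebra_simps)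
  qed
  have e4: "\<bar>2 * real N * \<sigma> * \<rho>\<^sup>2 * (?R2 - (x $ k0 * w1\<^sup>2 + Re ?q))\<bar> \<le> 2 * real N * \<rho>\<^sup>2 * (f * w + c * w1 * w + 2 * c * E * w + c * w\<^sup>2)"
  proof -
    have "2 * real N * \<rho>\<^sup>2 * \<bar>?R2 - (x $ k0 * w1\<^sup>2 + Re ?q)\<bar> \<le> 2 * real N * \<rho>\<^sup>2 * (f * w + c * w1 * w + 2 * c * E * w + c * w\<^sup>2)"
      using nn by (intro mult_left_mono R2) auto
    moreover have "\<bar>2 * real N * \<sigma> * \<rho>\<^sup>2 * (?R2 - (x $ k0 * w1\<^sup>2 + Re ?q))\<bar> = 2 * real N * \<rho>\<^sup>2 * \<bar>?R2 - (x $ k0 * w1\<^sup>2 + Re ?q)\<bar>"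
      using \<sigma> by (auto simp: abs_mult)
    ultimately show ?thesis by simp
  qed
  have e5: "\<rho>^3 * ?R1 \<le> \<rho>^3 * (- (real k - c - 1/2) * w1\<^sup>2 + (f * w1 + 2 * c * E * w1 + c * w * w1 + c * E\<^sup>2))"
    using nn by (intro mult_left_mono R1) auto
  have err: "\<rho>^3 * (f * w1 + 2 * c * E * w1 + c * w * w1 + c * E\<^sup>2) + 8 * real N * c * r * \<rho>\<^sup>2 * (\<tau> * E * w1)
     + 6 * real N * (2 * real N) * \<rho> * (t * w1 * w) + 3 * real N * (2 * real N) * \<rho> * ((real k + 1) * w\<^sup>2)
     + 8 * real N * (2 * real N) * c * r * \<rho> * (\<tau> * E * w) + 2 * real N * \<rho>\<^sup>2 * (f * w + c * w1 * w + 2 * c * E * w + c * w\<^sup>2)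
    \<le> real N * \<rho>\<^sup>2 * (l / 2 * E\<^sup>2 + 1 / 2 * t * w1\<^sup>2) + (real N / 4 + 2) * \<rho>^3 * w1\<^sup>2
     + 500 * c\<^sup>2 / l * real N^3 * (\<rho> + t) * w\<^sup>2 + 5 / real N * \<rho>^3 * f\<^sup>2"
  proof (rule error_terms_absorbed)
    have "r ^ 4 \<le> r ^ 1" using r by (intro power_decreasing) auto
    then show "\<rho> \<le> r" using wt_bounds(2)[OF \<sigma> r, of k0 x] unfolding \<rho>_def by simp
    show "\<tau>\<^sup>2 \<le> \<rho> + 3 * t" unfolding \<tau>_def \<rho>_def t_def by (rule wt_pos(3)[OF \<sigma> r X])
  qed (use nn N k r c l rc in auto)
  have "S = (2 * real N * \<sigma> * (real (2 * N - 1) * \<rho> * (a * Re (flux_c k v x)))) + (2 * real N * \<sigma> * (real (2 * N - 1) * \<rho> * (\<Sum>j\<in>T. dl j * Re (flux_d v j x))))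
     + (2 * real N * \<sigma> * \<rho>\<^sup>2 * (?R2 - (x $ k0 * w1\<^sup>2 + Re ?q))) + (2 * real N * \<sigma> * \<rho>\<^sup>2 * (x $ k0 * w1\<^sup>2 + Re ?q) - 2 * real N * \<rho>\<^sup>2 * (a * (1 / 2 * (x $ k0 * w1\<^sup>2 - Re ?q))))
     - 2 * real N * \<rho>\<^sup>2 * (\<Sum>j\<in>T. dl j * Re (flux_b v j x)) - \<rho>^3 * ?R1"
    unfolding S_def ga a_def by (simp add: distrib_left right_diff_distrib mult.assoc)
  note S_eq = this
  have lin: "(S1::real) = a1 + a2 + a3 + a4 - a5 - a6 \<Longrightarrow> \<bar>a1\<bar> \<le> b1 + b1' \<Longrightarrow> \<bar>a2\<bar> \<le> b2 \<Longrightarrow> \<bar>a3\<bar> \<le> b3 \<Longrightarrow> b4 \<le> a4 \<Longrightarrow> \<bar>a5\<bar> \<le> b5 \<Longrightarrow> a6 \<le> b6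
      \<Longrightarrow> b4 - b6 - b5 - b1 - b1' - b2 - b3 \<le> S1" for S1 a1 a2 a3 a4 a5 a6 b1 b1' b2 b3 b4 b5 b6
    by linarith
  note low = lin[OF S_eq e1 e2 e4 main e3 e5]
  have "0 \<le> \<rho>^3 * w1\<^sup>2" using nn by simp
  from combine_bounds[OF low err this]
  have "real N * (l / 2) * (\<rho>\<^sup>2 * E\<^sup>2) + real N / 2 * (\<rho>\<^sup>2 * (t * w1\<^sup>2)) + (real k - (c + 3) - real N / 4) * (\<rho>^3 * w1\<^sup>2)
     \<le> S + 500 * c\<^sup>2 / l * real N ^ 3 * (\<rho> * w\<^sup>2 + t * w\<^sup>2) + 5 / real N * (\<rho>^3 * f\<^sup>2)" .
  from mult_left_mono[OF this P] show ?thesis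
    unfolding br unfolding pw unfolding P_def[symmetric]
    unfolding \<rho>_def[symmetric] t_def[symmetric] w_def[symmetric] w1_def[symmetric] F_def[symmetric] f_def[symmetric] E2[symmetric]
    by (simp add: algebra_simps)
qed

end

subsection \<open>Weighted norms\<close>

context lens_operator
begin

definition wint :: "nat \<Rightarrow> (real^'n \<Rightarrow> real) \<Rightarrow> real" where
  "wint p g = integral\<^sup>L lborel (\<lambda>x. X x ^ p * g x)"

lemma wt_power: "0 \<le> X x ^ p" "X x ^ p \<le> 1"
  using wt_bounds[OF \<sigma> r, of k0 x] by (auto intro: power_le_one)

lemma wt_power_zero: "x \<notin> wt_supp k0 r \<Longrightarrow> 0 < p \<Longrightarrow> X x ^ p = 0"
  using wt_zero[OF \<sigma> r, of x k0] by simp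

lemma wint_integrable:
  assumes "continuous_on (wt_supp k0 r) g" "p > 0"
  shows "integrable lborel (\<lambda>x. X x ^ p * g x)"
proof -
  have "integrable lborel (\<lambda>x. X x ^ p *\<^sub>R g x)"
    by (rule integrable_weight[OF wt_measurable[OF \<sigma> r] _ compact_wt_supp wt_power_zero[OF _ assms(2)] assms(1), of 1])
      (use wt_power in auto)
  then show ?thesis by simp
qed

lemma wint_mono:
  assumes "continuous_on (wt_supp k0 r) g" "continuous_on (wt_supp k0 r) h" "p > 0" "q > 0"
    and "\<And>x. x \<in> wt_supp k0 r \<Longrightarrow> X x ^ p * g x \<le> X x ^ q * h x"
  shows "wint p g \<le> wint q h"
  unfolding wint_def
proof (rule integral_mono)
  show "X x ^ p * g x \<le> X x ^ q * h x" for x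
  proof (cases "x \<in> wt_supp k0 r")
    case False
    then have "X x ^ p = 0" "X x ^ q = 0" using wt_power_zero assms(3,4) by blast+
    then show ?thesis by (simp only:)
  qed (rule assms(5))
qed (use wint_integrable assms in auto)

lemma wint_nonneg: "(\<And>x. 0 \<le> g x) \<Longrightarrow> 0 \<le> wint p g"
  unfolding wint_def by (intro integral_nonneg_AE always_eventually allI mult_nonneg_nonneg wt_power)

lemma wint_add:
  assumes "continuous_on (wt_supp k0 r) g" "continuous_on (wt_supp k0 r) h" "p > 0"
  shows "wint p (\<lambda>x. g x + h x) = wint p g + wint p h"
  unfolding wint_def using wint_integrable assms by (simp add: distrib_left)

lemma wint_cmult: "wint p (\<lambda>x. a * g x) = a * wint p g"
proof -
  have "(\<lambda>x. X x ^ p * (a * g x)) = (\<lambda>x. a * (X x ^ p * g x))" by (simp add: mult_ac)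
  then show ?thesis unfolding wint_def by simp
qed

text \<open>The exponent \<open>p\<close> sits inside the integral, so the weight multiplying
  \<open>g\<close> is \<open>X\<close> to the power \<open>p / 2\<close>; odd exponents do
  occur.\<close>

definition wnorm :: "nat \<Rightarrow> (real^'n \<Rightarrow> complex) \<Rightarrow> real" where
  "wnorm p g = sqrt (wint p (\<lambda>x. (cmod (g x))\<^sup>2))"

abbreviation "wcont g \<equiv> continuous_on (wt_supp k0 r) g"

lemma wnorm_nonneg: "0 \<le> wnorm p g"
  unfolding wnorm_def by (simp add: wint_nonneg)

lemma wnorm_sq: "(wnorm p g)\<^sup>2 = wint p (\<lambda>x. (cmod (g x))\<^sup>2)"
  unfolding wnorm_def by (simp add: wint_nonneg)

lemma wnorm_le: "0 \<le> \<gamma> \<Longrightarrow> wint p (\<lambda>x. (cmod (g x))\<^sup>2) \<le> \<gamma>\<^sup>2 \<Longrightarrow> wnorm p g \<le> \<gamma>"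
  unfolding wnorm_def by (rule real_le_lsqrt)

lemma cont_sq: "wcont g \<Longrightarrow> continuous_on (wt_supp k0 r) (\<lambda>x. (cmod (g x))\<^sup>2)"
  by (intro continuous_intros)

lemma wnorm_mono:
  assumes "wcont g" "wcont h" "0 < p" "0 < q" "0 \<le> C"
    and "\<And>x. x \<in> wt_supp k0 r \<Longrightarrow> X x ^ p * (cmod (g x))\<^sup>2 \<le> C\<^sup>2 * (X x ^ q * (cmod (h x))\<^sup>2)"
  shows "wnorm p g \<le> C * wnorm q h"
proof (rule wnorm_le)
  have "wint p (\<lambda>x. (cmod (g x))\<^sup>2) \<le> wint q (\<lambda>x. C\<^sup>2 * (cmod (h x))\<^sup>2)"
    by (rule wint_mono) (use assms in \<open>auto intro!: continuous_intros simp: mult_ac\<close>)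
  then show "wint p (\<lambda>x. (cmod (g x))\<^sup>2) \<le> (C * wnorm q h)\<^sup>2"
    by (simp add: wint_cmult power_mult_distrib wnorm_sq)
qed (use assms wnorm_nonneg in auto)

lemma wnorm_triangle:
  assumes g: "wcont g" and h: "wcont h" and p: "p > 0"
  shows "wnorm p (\<lambda>x. g x + h x) \<le> wnorm p g + wnorm p h"
proof (rule field_le_epsilon)
  fix e :: real assume e: "0 < e"
  \<comment> \<open>Padding by \<open>e / 2\<close> makes both numbers positive, so the cross term
    can be split with ratio \<open>b / a\<close>; this yields \<open>(a + b)\<^sup>2\<close>
    directly, without a Cauchy-Schwarz inequality.\<close>
  define a where "a = wnorm p g + e / 2"
  define b where "b = wnorm p h + e / 2"
  have ab: "a > 0" "b > 0" using e wnorm_nonneg[of p g] wnorm_nonneg[of p h] by (auto simp: a_def b_def)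
  have "wint p (\<lambda>x. (cmod (g x + h x))\<^sup>2) \<le> wint p (\<lambda>x. (1 + b / a) * (cmod (g x))\<^sup>2 + (1 + a / b) * (cmod (h x))\<^sup>2)"
  proof (rule wint_mono)
    fix x
    have "(cmod (g x + h x))\<^sup>2 \<le> (cmod (g x) + cmod (h x))\<^sup>2" by (intro power_mono norm_triangle_ineq) auto
    also have "\<dots> \<le> (1 + b / a) * (cmod (g x))\<^sup>2 + (1 + a / b) * (cmod (h x))\<^sup>2"
    proof -
      have "2 * cmod (g x) * cmod (h x) \<le> (b / a) * (cmod (g x))\<^sup>2 + (cmod (h x))\<^sup>2 / (b / a)"
        by (rule amgm_weighted) (use ab in simp)
      then show ?thesis by (simp add: power2_sum algebra_simps)
    qed
    finally show "X x ^ p * (cmod (g x + h x))\<^sup>2 \<le> X x ^ p * ((1 + b / a) * (cmod (g x))\<^sup>2 + (1 + a / b) * (cmod (h x))\<^sup>2)"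
      by (intro mult_left_mono wt_power)
  qed (use g h p in \<open>auto intro!: continuous_intros\<close>)
  also have "\<dots> = (1 + b / a) * (wnorm p g)\<^sup>2 + (1 + a / b) * (wnorm p h)\<^sup>2"
    using g h p by (subst wint_add) (auto intro!: continuous_intros simp: wint_cmult wnorm_sq)
  also have "\<dots> \<le> (1 + b / a) * a\<^sup>2 + (1 + a / b) * b\<^sup>2"
    using ab wnorm_nonneg e by (intro add_mono mult_left_mono power_mono) (auto simp: a_def b_def)
  also have "\<dots> = (a + b)\<^sup>2" using ab by (simp add: power2_eq_square field_simps)
  finally have "wnorm p (\<lambda>x. g x + h x) \<le> a + b" using ab by (intro wnorm_le) auto
  then show "wnorm p (\<lambda>x. g x + h x) \<le> wnorm p g + wnorm p h + e" by (simp add: a_def b_def)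
qed

lemma wnorm_zero: "wnorm p (\<lambda>x. 0) = 0"
  unfolding wnorm_def wint_def by simp

lemma wnorm_cong: "(\<And>x. x \<in> wt_supp k0 r \<Longrightarrow> g x = h x) \<Longrightarrow> 0 < p \<Longrightarrow> wnorm p g = wnorm p h"
  unfolding wnorm_def wint_def
  by (intro arg_cong[where f = sqrt] Bochner_Integration.integral_cong refl)
    (metis mult_zero_left wt_zero[OF \<sigma> r] zero_power)

lemma wnorm_sum:
  assumes "\<And>j. j \<in> S \<Longrightarrow> wcont (g j)" "p > 0"
  shows "wnorm p (\<lambda>x. \<Sum>j\<in>S. g j x) \<le> (\<Sum>j\<in>S. wnorm p (g j))"
  using assms
proof (induction S rule: infinite_finite_induct)
  case (insert j S)
  then have "wnorm p (\<lambda>x. g j x + (\<Sum>j\<in>S. g j x)) \<le> wnorm p (g j) + wnorm p (\<lambda>x. \<Sum>j\<in>S. g j x)"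
    by (intro wnorm_triangle continuous_intros) auto
  then show ?case using insert by simp
qed (simp_all add: wnorm_zero)

lemma wnorm_sum_list:
  assumes "\<And>y. y \<in> set L \<Longrightarrow> wcont (g y)" "p > 0"
  shows "wnorm p (\<lambda>x. \<Sum>y\<leftarrow>L. g y x) \<le> (\<Sum>y\<leftarrow>L. wnorm p (g y))"
  using assms
proof (induction L)
  case (Cons y L)
  then have "wnorm p (\<lambda>x. g y x + (\<Sum>y\<leftarrow>L. g y x)) \<le> wnorm p (g y) + wnorm p (\<lambda>x. \<Sum>y\<leftarrow>L. g y x)"
    by (intro wnorm_triangle continuous_on_sum_list) auto
  then show ?case using Cons by simp
qed (simp add: wnorm_zero)

lemma wnorm_mult_le:
  assumes "wcont a" "wcont g" "p > 0" "0 \<le> C" "\<And>x. x \<in> wt_supp k0 r \<Longrightarrow> cmod (a x) \<le> C"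
  shows "wnorm p (\<lambda>x. a x * g x) \<le> C * wnorm p g"
proof (rule wnorm_mono)
  fix x assume "x \<in> wt_supp k0 r"
  then have "(cmod (a x))\<^sup>2 * (X x ^ p * (cmod (g x))\<^sup>2) \<le> C\<^sup>2 * (X x ^ p * (cmod (g x))\<^sup>2)"
    using assms wt_power by (intro mult_right_mono power_mono mult_nonneg_nonneg) auto
  then show "X x ^ p * (cmod (a x * g x))\<^sup>2 \<le> C\<^sup>2 * (X x ^ p * (cmod (g x))\<^sup>2)"
    by (simp add: norm_mult power_mult_distrib mult_ac)
qed (use assms in \<open>auto intro!: continuous_intros\<close>)

lemma wnorm_power_mono:
  assumes "wcont g" "0 < q" "q \<le> p"
  shows "wnorm p g \<le> wnorm q g"
proof -
  have "wnorm p g \<le> 1 * wnorm q g"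
    by (rule wnorm_mono)
      (use assms wt_bounds[OF \<sigma> r] in \<open>auto intro!: mult_right_mono power_decreasing\<close>)
  then show ?thesis by simp
qed

text \<open>At the power of the weight that goes with the tangential derivatives, the energy
  controls the normal derivative only with this half power of the distance to the
  degeneracy.\<close>

definition sqx :: "(real^'n \<Rightarrow> complex) \<Rightarrow> real^'n \<Rightarrow> complex" where
  "sqx g x = complex_of_real (sqrt \<bar>x $ k0\<bar>) * g x"

lemma sqx_cont: "wcont g \<Longrightarrow> wcont (sqx g)"
  unfolding sqx_def[abs_def] by (intro continuous_intros)

lemma cmod_sqx: "(cmod (sqx g x))\<^sup>2 = \<bar>x $ k0\<bar> * (cmod (g x))\<^sup>2"
  unfolding sqx_def by (simp add: norm_mult power_mult_distrib)

section \<open>The integrated energy estimate\<close>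

text \<open>The bracket integrates to 0, so only the pointwise bound remains. For the squared norms
  the coefficient on the right exceeds that on the left by \<open>N\<^sup>2\<close>: one factor
  \<open>N\<close> per derivative gained, exactly what a factorial allows. The last coefficient on
  the left may be negative; it is positive once \<open>k\<close> exceeds
  \<open>c + 3 + N / 4\<close>.\<close>

lemma energy_estimate:
  fixes k N :: nat
  assumes v: "smooth_on U v" and N: "N \<ge> 2" and k: "k + 1 \<le> N" and F: "\<And>x. x \<in> U \<Longrightarrow> F x = Lop v x + of_nat k * pd k0 v x"
    and Fc: "wcont F"
  shows "real N * (l / 2) * (\<Sum>j\<in>T. (wnorm (2 * N - 1) (pd j v))\<^sup>2) + real N / 2 * (wnorm (2 * N - 1) (sqx (pd k0 v)))\<^sup>2
      + (real k - (c + 3) - real N / 4) * (wnorm (2 * N) (pd k0 v))\<^sup>2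
    \<le> 500 * c\<^sup>2 / l * real N ^ 3 * ((wnorm (2 * N - 2) v)\<^sup>2 + (wnorm (2 * N - 3) (sqx v))\<^sup>2) + 5 / real N * (wnorm (2 * N) F)\<^sup>2"
proof -
  have vc: "wcont v" "wcont (pd j v)" for j
    using smooth_on_cont[OF v, of "[]"] smooth_on_cont[OF v, of "[j]"] U by (auto intro: continuous_on_subset)
  define lhs where "lhs x = real N * (l / 2) * (X x ^ (2 * N - 1) * tgrad2 v x) + real N / 2 * (X x ^ (2 * N - 1) * (cmod (sqx (pd k0 v) x))\<^sup>2)
      + (real k - (c + 3) - real N / 4) * (X x ^ (2 * N) * (cmod (pd k0 v x))\<^sup>2)" for x
  define rhs where "rhs x = 500 * c\<^sup>2 / l * real N ^ 3 * (X x ^ (2 * N - 2) * (cmod (v x))\<^sup>2 + X x ^ (2 * N - 3) * (cmod (sqx v x))\<^sup>2)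
      + 5 / real N * (X x ^ (2 * N) * (cmod (F x))\<^sup>2)" for x
  have pos: "0 < 2 * N - 1" "0 < 2 * N" "0 < 2 * N - 2" "0 < 2 * N - 3" using N by auto
  note ii = wint_integrable[OF cont_sq pos(1)] wint_integrable[OF cont_sq pos(2)] wint_integrable[OF cont_sq pos(3)] wint_integrable[OF cont_sq pos(4)]
  have tg: "continuous_on (wt_supp k0 r) (tgrad2 v)" unfolding tgrad2_def[abs_def] using vc by (intro continuous_intros)
  have li: "integrable lborel lhs"
    unfolding lhs_def[abs_def] by (intro Bochner_Integration.integrable_add integrable_mult_right ii wint_integrable tg vc sqx_cont pos)
  have ri: "integrable lborel rhs"
    unfolding rhs_def[abs_def] by (intro Bochner_Integration.integrable_add integrable_mult_right ii vc sqx_cont Fc)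
  note bi = integral_bracket[OF v N, of k]
  have bre: "integrable lborel (\<lambda>x. Re (bracket N k v x))" "integral\<^sup>L lborel (\<lambda>x. Re (bracket N k v x)) = 0"
    using bi by (auto simp: integral_Re)
  have "integral\<^sup>L lborel lhs \<le> integral\<^sup>L lborel (\<lambda>x. Re (bracket N k v x) + rhs x)"
  proof (rule integral_mono_AE[OF li Bochner_Integration.integrable_add[OF bre(1) ri]])
    show "AE x in lborel. lhs x \<le> Re (bracket N k v x) + rhs x"
      using AE_hyperplane[of k0 0]
    proof eventually_elim
      case (elim x)
      have e: "X x ^ (2 * N) * (cmod (F x))\<^sup>2 = X x ^ (2 * N) * (cmod (Lop v x + of_nat k * pd k0 v x))\<^sup>2"
      proof (cases "x \<in> wt_supp k0 r")
        case True then show ?thesis using F U by auto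
      next
        case False then show ?thesis using wt_power_zero[of x "2 * N"] N by simp
      qed
      then show ?case
        using bracket_lower_bound[OF v N k elim] unfolding lhs_def rhs_def cmod_sqx e by (simp only: add.assoc)
    qed
  qed
  also have "\<dots> = integral\<^sup>L lborel rhs" using bre ri by simp
  also have "\<dots> = 500 * c\<^sup>2 / l * real N ^ 3 * ((wnorm (2 * N - 2) v)\<^sup>2 + (wnorm (2 * N - 3) (sqx v))\<^sup>2) + 5 / real N * (wnorm (2 * N) F)\<^sup>2"
    unfolding rhs_def[abs_def] wnorm_sq wint_def
    by (subst Bochner_Integration.integral_add;
        (intro integrable_mult_right Bochner_Integration.integrable_add ii vc sqx_cont Fc)?)
      (simp add: Bochner_Integration.integral_add[OF ii(3)[OF vc(1)] ii(4)[OF sqx_cont[OF vc(1)]]])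
  also have "integral\<^sup>L lborel lhs = real N * (l / 2) * wint (2 * N - 1) (tgrad2 v) + real N / 2 * (wnorm (2 * N - 1) (sqx (pd k0 v)))\<^sup>2
      + (real k - (c + 3) - real N / 4) * (wnorm (2 * N) (pd k0 v))\<^sup>2"
    unfolding lhs_def[abs_def] wnorm_sq wint_def
    by (subst Bochner_Integration.integral_add;
        (intro integrable_mult_right Bochner_Integration.integrable_add ii wint_integrable tg vc sqx_cont pos)?)
      (subst Bochner_Integration.integral_add;
        (intro integrable_mult_right Bochner_Integration.integrable_add ii wint_integrable tg vc sqx_cont pos)?; simp)
  also have "wint (2 * N - 1) (tgrad2 v) = (\<Sum>j\<in>T. (wnorm (2 * N - 1) (pd j v))\<^sup>2)"
    unfolding wnorm_sq tgrad2_def[abs_def] wint_def sum_distrib_left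
    by (rule Bochner_Integration.integral_sum) (intro ii vc)
  finally show ?thesis .
qed

end

subsection \<open>Commutators\<close>

text \<open>Isolates the Leibniz term in which no derivative falls on the coefficient; that term
  reproduces the operator itself.\<close>

lemma sum_list_splits_Nil:
  fixes h :: "'a list \<Rightarrow> 'a list \<Rightarrow> 'b::comm_monoid_add"
  shows "(\<Sum>(ps, qs)\<leftarrow>splits is. h ps qs) = h [] is + (\<Sum>(ps, qs)\<leftarrow>filter (\<lambda>(ps, qs). ps \<noteq> []) (splits is). h ps qs)"
proof (induction "is" arbitrary: h)
  case (Cons i "is")
  have f1: "filter (\<lambda>p. fst p \<noteq> []) (map (\<lambda>p. (i # fst p, snd p)) L) = map (\<lambda>p. (i # fst p, snd p)) L" for L :: "('a list \<times> 'a list) list"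
    by (induction L) auto
  have f2: "filter (\<lambda>p. fst p \<noteq> []) (map (\<lambda>p. (fst p, i # snd p)) L) = map (\<lambda>p. (fst p, i # snd p)) (filter (\<lambda>p. fst p \<noteq> []) L)"
    for L :: "('a list \<times> 'a list) list"
    by (induction L) auto
  have "(\<Sum>(ps, qs)\<leftarrow>splits (i # is). h ps qs) = (\<Sum>(ps, qs)\<leftarrow>splits is. h (i # ps) qs) + (\<Sum>(ps, qs)\<leftarrow>splits is. h ps (i # qs))"
    by (simp add: o_def case_prod_unfold)
  also have "(\<Sum>(ps, qs)\<leftarrow>splits is. h ps (i # qs)) = h [] (i # is) + (\<Sum>(ps, qs)\<leftarrow>filter (\<lambda>(ps, qs). ps \<noteq> []) (splits is). h ps (i # qs))"
    by (rule Cons.IH)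
  finally show ?case by (simp add: f1 f2 o_def case_prod_unfold add_ac)
qed simp

lemma sum_sum_list_swap:
  fixes g :: "'a \<Rightarrow> 'b \<Rightarrow> 'c::comm_monoid_add"
  shows "(\<Sum>j\<in>S. \<Sum>y\<leftarrow>L. g j y) = (\<Sum>y\<leftarrow>L. \<Sum>j\<in>S. g j y)"
  by (induction L) (simp_all add: sum.distrib)

text \<open>The coordinate function has no second derivatives, so at most one derivative can fall on
  it, and the number of normal indices in the list becomes the coefficient. Applied to
  \<open>\<partial>\<^sub>1\<^sup>2 u\<close> this produces the favourable first order term.\<close>

lemma pds_coord_mult:
  assumes U: "open U" and g: "smooth_on U g"
  shows "x \<in> U \<Longrightarrow> pds is (\<lambda>x. complex_of_real (x $ k0) * g x) x
    = complex_of_real (x $ k0) * pds is g x + of_nat (count_list is k0) * pds (remove1 k0 is) g x"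
proof (induction "is" arbitrary: x)
  case (Cons i "is")
  have "pds (i # is) (\<lambda>x. complex_of_real (x $ k0) * g x) x
    = pd i (\<lambda>x. complex_of_real (x $ k0) * pds is g x + of_nat (count_list is k0) * pds (remove1 k0 is) g x) x"
    unfolding pds.simps by (rule pd_cong[OF U Cons.prems Cons.IH])
  also have "\<dots> = ((if i = k0 then 1 else 0) * pds is g x + complex_of_real (x $ k0) * pds (i # is) g x)
      + (0 * pds (remove1 k0 is) g x + of_nat (count_list is k0) * pds (i # remove1 k0 is) g x)"
    by (intro hpd_imp_pd hpd_add hpd_mult hpd_coord hpd_const smooth_on_hpd[OF g Cons.prems])
  also have "\<dots> = complex_of_real (x $ k0) * pds (i # is) g x + of_nat (count_list (i # is) k0) * pds (remove1 k0 (i # is)) g x"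
  proof (cases "i = k0")
    case True
    have "of_nat (count_list is k0) * pds (k0 # remove1 k0 is) g x = of_nat (count_list is k0) * pds is g x"
    proof (cases "k0 \<in> set is")
      case True
      have "pds (k0 # remove1 k0 is) g x = pds is g x"
        by (rule pds_perm[OF U g _ Cons.prems]) (use True in simp)
      then show ?thesis by simp
    qed (simp add: count_list_0_iff)
    then show ?thesis using True by (simp add: algebra_simps)
  qed simp
  finally show ?case .
qed simp

context lens_operator
begin

text \<open>The Leibniz term with \<open>ps\<close> on the coefficients and \<open>qs\<close> on
  \<open>u\<close>. The part \<open>x\<^sub>1 \<partial>\<^sub>1\<^sup>2\<close> is left out, since
  its commutator is computed exactly.\<close>

definition rterm :: "(real^'n \<Rightarrow> complex) \<Rightarrow> 'n list \<Rightarrow> 'n list \<Rightarrow> real^'n \<Rightarrow> complex" where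
  "rterm u ps qs x = (\<Sum>j\<in>T. \<Sum>k\<in>T. pds ps (Q j k) x * pds (j # k # qs) u x) + pds ps A x * pds (k0 # qs) u x
    + (\<Sum>j\<in>T. pds ps (B j) x * pds (j # qs) u x) + pds ps Cc x * pds qs u x"

definition rem :: "(real^'n \<Rightarrow> complex) \<Rightarrow> 'n list \<Rightarrow> real^'n \<Rightarrow> complex" where
  "rem u is x = (\<Sum>(ps, qs)\<leftarrow>filter (\<lambda>(ps, qs). ps \<noteq> []) (splits is). rterm u ps qs x)"

text \<open>The commutator with the degenerate part stays on the left as a modification of the
  operator, because its sign helps in the energy estimate; only terms that differentiate one of the
  remaining coefficients go to \<open>rem\<close>.\<close>

lemma Lop_pds:
  assumes u: "smooth_on U u" and x: "x \<in> U"
  shows "Lop (pds is u) x + of_nat (count_list is k0) * pd k0 (pds is u) x = pds is (Lop u) x - rem u is x"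
proof -
  note sm = smooth_intros u
  have perm: "pds (qs @ js) u x = pds (js @ qs) u x" for qs js
    by (rule pds_perm[OF U(1) u _ x]) simp
  have p2: "pds qs (pd j (pd k u)) x = pds (j # k # qs) u x" for qs j k
    using perm[of qs "[j, k]"] by (simp add: pds_append)
  have p1: "pds qs (pd j u) x = pds (j # qs) u x" for qs j
    using perm[of qs "[j]"] by (simp add: pds_append)
  have mult: "pds is (\<lambda>x. a x * g x) x = (\<Sum>(ps, qs)\<leftarrow>splits is. pds ps a x * pds qs g x)"
    if "smooth_on U a" "smooth_on U g" for a g by (rule pds_mult[OF U(1) that x])
  have "pds is (Lop u) x = pds is (\<lambda>x. complex_of_real (x $ k0) * pd k0 (pd k0 u) x) x
      + pds is (\<lambda>x. \<Sum>j\<in>T. \<Sum>k\<in>T. Q j k x * pd j (pd k u) x) x + pds is (\<lambda>x. A x * pd k0 u x) x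
      + pds is (\<lambda>x. \<Sum>j\<in>T. B j x * pd j u x) x + pds is (\<lambda>x. Cc x * u x) x"
    unfolding Lop_def[abs_def]
    by (subst pds_add[OF U(1) _ _ x], (intro sm)+)+ simp
  also have "pds is (\<lambda>x. complex_of_real (x $ k0) * pd k0 (pd k0 u) x) x
      = complex_of_real (x $ k0) * pd k0 (pd k0 (pds is u)) x + of_nat (count_list is k0) * pd k0 (pds is u) x"
  proof -
    have "of_nat (count_list is k0) * pds (remove1 k0 is) (pd k0 (pd k0 u)) x = of_nat (count_list is k0) * pds (k0 # is) u x"
    proof (cases "k0 \<in> set is")
      case True
      have "pds (k0 # k0 # remove1 k0 is) u x = pds (k0 # is) u x"
        by (rule pds_perm[OF U(1) u _ x]) (use True in simp)
      then show ?thesis by (simp only: p2)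
    qed (simp add: count_list_0_iff)
    moreover have "pds is (pd k0 (pd k0 u)) x = pd k0 (pd k0 (pds is u)) x" using p2[of "is" k0 k0] by simp
    ultimately show ?thesis
      using pds_coord_mult[OF U(1) smooth_on_pd[OF smooth_on_pd[OF u]] x, of "is" k0 k0 k0] by simp
  qed
  also have "pds is (\<lambda>x. \<Sum>j\<in>T. \<Sum>k\<in>T. Q j k x * pd j (pd k u) x) x
      = (\<Sum>(ps, qs)\<leftarrow>splits is. \<Sum>j\<in>T. \<Sum>k\<in>T. pds ps (Q j k) x * pds (j # k # qs) u x)"
    by (simp add: pds_sum[OF U(1) _ x] sm mult p2 sum_sum_list_swap case_prod_unfold del: pds.simps)
  also have "pds is (\<lambda>x. A x * pd k0 u x) x = (\<Sum>(ps, qs)\<leftarrow>splits is. pds ps A x * pds (k0 # qs) u x)"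
    by (simp add: mult sm p1 del: pds.simps)
  also have "pds is (\<lambda>x. \<Sum>j\<in>T. B j x * pd j u x) x = (\<Sum>(ps, qs)\<leftarrow>splits is. \<Sum>j\<in>T. pds ps (B j) x * pds (j # qs) u x)"
    by (simp add: pds_sum[OF U(1) _ x] sm mult p1 sum_sum_list_swap case_prod_unfold del: pds.simps)
  also have "pds is (\<lambda>x. Cc x * u x) x = (\<Sum>(ps, qs)\<leftarrow>splits is. pds ps Cc x * pds qs u x)"
    by (simp add: mult sm)
  finally have "pds is (Lop u) x = complex_of_real (x $ k0) * pd k0 (pd k0 (pds is u)) x + of_nat (count_list is k0) * pd k0 (pds is u) x
      + (\<Sum>(ps, qs)\<leftarrow>splits is. rterm u ps qs x)"
    by (simp add: rterm_def case_prod_unfold sum_list_addf del: pds.simps)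
  also have "(\<Sum>(ps, qs)\<leftarrow>splits is. rterm u ps qs x) = rterm u [] is x + rem u is x"
    unfolding rem_def by (rule sum_list_splits_Nil)
  finally have eq: "pds is (Lop u) x = complex_of_real (x $ k0) * pd k0 (pd k0 (pds is u)) x + of_nat (count_list is k0) * pd k0 (pds is u) x
      + (rterm u [] is x + rem u is x)" .
  show ?thesis unfolding eq by (simp add: Lop_def rterm_def)
qed

text \<open>Source of the smallness that absorbs the commutator terms of top order: an additional
  power of the weight is worth \<open>r\<^sup>2\<close> in the norm, as the weight is at most
  \<open>r ^ 4\<close>.\<close>

lemma wnorm_Suc_le:
  assumes g: "wcont g" and p: "0 < p"
  shows "wnorm (Suc p) g \<le> r\<^sup>2 * wnorm p g"
proof (rule wnorm_mono[OF g g])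
  fix x
  have "X x * (X x ^ p * (cmod (g x))\<^sup>2) \<le> r ^ 4 * (X x ^ p * (cmod (g x))\<^sup>2)"
    using wt_bounds(2)[OF \<sigma> r] wt_power by (intro mult_right_mono mult_nonneg_nonneg) auto
  moreover have "(r\<^sup>2)\<^sup>2 = r ^ 4" by simp
  ultimately show "X x ^ Suc p * (cmod (g x))\<^sup>2 \<le> (r\<^sup>2)\<^sup>2 * (X x ^ p * (cmod (g x))\<^sup>2)"
    by (simp only: power_Suc mult.assoc)
qed (use p in auto)

section \<open>Passing from order N to order N + 1\<close>

text \<open>In \<open>h2\<close>, \<open>\<eta>\<close> is any common bound on the derivatives of
  order \<open>N + 1\<close> with a tangential index, which the commutator contains \<open>N\<close>
  times. Taking for \<open>\<eta>\<close> their actual maximum closes the system: the energy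
  controls \<open>M * (l / 2)\<close> times its square and only \<open>M * (l / 8)\<close> times it
  returns on the right.\<close>

lemma energy_step:
  fixes g \<Gamma> :: real and N :: nat
  assumes u: "smooth_on U u" and N: "real N \<ge> 2 * c + 8" and g: "0 \<le> g" "0 \<le> \<Gamma>"
    and h1: "\<And>is. length is = N \<Longrightarrow> wnorm (2 * N + 2) (pds is u) \<le> g" "\<And>is. length is = N \<Longrightarrow> wnorm (2 * N + 1) (sqx (pds is u)) \<le> g"
    and h2: "\<And>is \<eta>. length is = N \<Longrightarrow> 0 \<le> \<eta> \<Longrightarrow> (\<And>qs j. length qs = N \<Longrightarrow> j \<in> T \<Longrightarrow> wnorm (2 * N + 3) (pds (j # qs) u) \<le> \<eta>)
      \<Longrightarrow> wnorm (2 * N + 4) (\<lambda>x. pds is (Lop u) x - rem u is x) \<le> real N * c * r\<^sup>2 * \<eta> + \<Gamma>"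
    and is': "length is' = Suc N"
  shows "wnorm (2 * N + 4) (pds is' u) \<le> 90 * c / l * (real (N + 2) * g + \<Gamma> / real (N + 2))"
    "wnorm (2 * N + 3) (sqx (pds is' u)) \<le> 90 * c / l * (real (N + 2) * g + \<Gamma> / real (N + 2))"
proof -
  define M where "M = real (N + 2)"
  have M: "M \<ge> 2 * c + 10" "M > 0" "real N \<le> M" "real N = M - 2" using N c by (auto simp: M_def)
  have pc: "wcont (pds js u)" for js using smooth_on_cont[OF u] U continuous_on_subset by blast
  \<comment> \<open>The 0 keeps the maximum defined in dimension one, where there is no tangential
    index.\<close>
  define S where "S = insert 0 ((\<lambda>(qs, j). wnorm (2 * N + 3) (pds (j # qs) u)) ` ({qs. length qs = N} \<times> T))"
  have fin: "finite S" unfolding S_def by (intro finite.insertI finite_imageI finite_cartesian_product finite_lists_length) auto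
  define \<eta> where "\<eta> = Max S"
  have \<eta>0: "0 \<le> \<eta>" unfolding \<eta>_def by (rule Max_ge[OF fin]) (simp add: S_def)
  have \<eta>: "wnorm (2 * N + 3) (pds (j # qs) u) \<le> \<eta>" if "length qs = N" "j \<in> T" for qs j
    unfolding \<eta>_def by (rule Max_ge[OF fin]) (use that in \<open>auto simp: S_def\<close>)
  define M0 where "M0 = 1000 * c\<^sup>2 / l * M ^ 3 * g\<^sup>2 + 10 * \<Gamma>\<^sup>2 / M"
  have r4: "r ^ 4 * c\<^sup>2 \<le> l / 96" "r ^ 4 \<le> l / 96"
  proof -
    have "r ^ 4 \<le> r ^ 1" using r by (intro power_decreasing) auto
    then have "r ^ 4 * c\<^sup>2 \<le> r * c\<^sup>2" by (intro mult_right_mono) auto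
    then show 1: "r ^ 4 * c\<^sup>2 \<le> l / 96" using rc by simp
    have "r ^ 4 * 1 \<le> r ^ 4 * c\<^sup>2" using c one_le_power[of c 2] by (intro mult_left_mono) auto
    then show "r ^ 4 \<le> l / 96" using 1 by simp
  qed
  have tr: "wnorm (2 * N + 4) (pds (j # qs) u) \<le> r\<^sup>2 * \<eta>" if "length qs = N" "j \<in> T" for qs j
  proof -
    have "wnorm (2 * N + 4) (pds (j # qs) u) \<le> r\<^sup>2 * wnorm (2 * N + 3) (pds (j # qs) u)"
      using wnorm_Suc_le[OF pc, of "2 * N + 3" "j # qs"] by (simp add: eval_nat_numeral)
    also have "\<dots> \<le> r\<^sup>2 * \<eta>" by (intro mult_left_mono \<eta> that) auto
    finally show ?thesis .
  qed
  have est: "M * (l / 2) * (\<Sum>j\<in>T. (wnorm (2 * N + 3) (pds (j # is) u))\<^sup>2) + M / 2 * (wnorm (2 * N + 3) (sqx (pds (k0 # is) u)))\<^sup>2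
      + (real (count_list is k0) - (c + 3) - M / 4) * (wnorm (2 * N + 4) (pds (k0 # is) u))\<^sup>2 \<le> M0 + M * (10 * (l / 96)) * \<eta>\<^sup>2"
    if len: "length is = N" for "is"
  proof -
    have Fc: "wcont (\<lambda>x. pds is (Lop u) x - rem u is x)"
    proof -
      have "continuous_on U (\<lambda>x. Lop (pds is u) x + of_nat (count_list is k0) * pd k0 (pds is u) x)"
      proof -
        have cs: "continuous_on U A" "continuous_on U Cc" "continuous_on U (Q j k)" "continuous_on U (B j)" for j k
          using smooth_on_cont[OF smooth(1), of "[]"] smooth_on_cont[OF smooth(2), of "[]"] smooth_on_cont[OF smooth(3)[of j k], of "[]"]
            smooth_on_cont[OF smooth(4)[of j], of "[]"] by auto
        have cu: "continuous_on U (pd j (pd k (pds is u)))" "continuous_on U (pd j (pds is u))" "continuous_on U (pds is u)" for j k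
          using smooth_on_cont[OF u, of "j # k # is"] smooth_on_cont[OF u, of "j # is"] smooth_on_cont[OF u, of "is"] by auto
        show ?thesis unfolding Lop_def by (intro continuous_intros cs cu)
      qed
      then have "continuous_on U (\<lambda>x. pds is (Lop u) x - rem u is x)"
        using Lop_pds[OF u] by (simp cong: continuous_on_cong)
      then show ?thesis using U continuous_on_subset by blast
    qed
    have kN: "count_list is k0 + 1 \<le> N + 2" using count_le_length[of "is" k0] len by simp
    have "real (N + 2) * (l / 2) * (\<Sum>j\<in>T. (wnorm (2 * (N + 2) - 1) (pd j (pds is u)))\<^sup>2)
        + real (N + 2) / 2 * (wnorm (2 * (N + 2) - 1) (sqx (pd k0 (pds is u))))\<^sup>2
        + (real (count_list is k0) - (c + 3) - real (N + 2) / 4) * (wnorm (2 * (N + 2)) (pd k0 (pds is u)))\<^sup>2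
      \<le> 500 * c\<^sup>2 / l * real (N + 2) ^ 3 * ((wnorm (2 * (N + 2) - 2) (pds is u))\<^sup>2 + (wnorm (2 * (N + 2) - 3) (sqx (pds is u)))\<^sup>2)
        + 5 / real (N + 2) * (wnorm (2 * (N + 2)) (\<lambda>x. pds is (Lop u) x - rem u is x))\<^sup>2"
      by (rule energy_estimate[OF smooth_on_pds[OF u] _ kN _ Fc]) (use Lop_pds[OF u] in simp_all)
    moreover have e: "2 * (N + 2) - 1 = 2 * N + 3" "2 * (N + 2) = 2 * N + 4" "2 * (N + 2) - 2 = 2 * N + 2" "2 * (N + 2) - 3 = 2 * N + 1" by auto
    ultimately have 1: "M * (l / 2) * (\<Sum>j\<in>T. (wnorm (2 * N + 3) (pds (j # is) u))\<^sup>2) + M / 2 * (wnorm (2 * N + 3) (sqx (pds (k0 # is) u)))\<^sup>2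
      + (real (count_list is k0) - (c + 3) - M / 4) * (wnorm (2 * N + 4) (pds (k0 # is) u))\<^sup>2
      \<le> 500 * c\<^sup>2 / l * M ^ 3 * ((wnorm (2 * N + 2) (pds is u))\<^sup>2 + (wnorm (2 * N + 1) (sqx (pds is u)))\<^sup>2)
        + 5 / M * (wnorm (2 * N + 4) (\<lambda>x. pds is (Lop u) x - rem u is x))\<^sup>2"
      unfolding e M_def pds.simps by (simp only:)
    have "(wnorm (2 * N + 2) (pds is u))\<^sup>2 \<le> g\<^sup>2" "(wnorm (2 * N + 1) (sqx (pds is u)))\<^sup>2 \<le> g\<^sup>2"
      by (intro power_mono h1 wnorm_nonneg len)+
    then have "500 * c\<^sup>2 / l * M ^ 3 * ((wnorm (2 * N + 2) (pds is u))\<^sup>2 + (wnorm (2 * N + 1) (sqx (pds is u)))\<^sup>2) \<le> 500 * c\<^sup>2 / l * M ^ 3 * (g\<^sup>2 + g\<^sup>2)"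
      using l M by (intro mult_left_mono add_mono) auto
    moreover have "5 / M * (wnorm (2 * N + 4) (\<lambda>x. pds is (Lop u) x - rem u is x))\<^sup>2 \<le> M * (10 * (l / 96)) * \<eta>\<^sup>2 + 10 * \<Gamma>\<^sup>2 / M"
    proof -
      have "(wnorm (2 * N + 4) (\<lambda>x. pds is (Lop u) x - rem u is x))\<^sup>2 \<le> (real N * c * r\<^sup>2 * \<eta> + \<Gamma>)\<^sup>2"
        by (intro power_mono h2 \<eta> wnorm_nonneg len \<eta>0)
      also have "\<dots> \<le> 2 * (real N * c * r\<^sup>2 * \<eta>)\<^sup>2 + 2 * \<Gamma>\<^sup>2"
        using sum_squares_bound[of "real N * c * r\<^sup>2 * \<eta>" \<Gamma>] by (simp add: power2_sum)
      also have "(real N * c * r\<^sup>2 * \<eta>)\<^sup>2 = (real N)\<^sup>2 * ((r ^ 4 * c\<^sup>2) * \<eta>\<^sup>2)" by (simp add: power_mult_distrib flip: power_mult)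
      also have "\<dots> \<le> M\<^sup>2 * ((l / 96) * \<eta>\<^sup>2)"
        using M r4 l by (intro mult_mono power_mono mult_right_mono) auto
      finally have "5 / M * (wnorm (2 * N + 4) (\<lambda>x. pds is (Lop u) x - rem u is x))\<^sup>2 \<le> 5 / M * (2 * (M\<^sup>2 * ((l / 96) * \<eta>\<^sup>2)) + 2 * \<Gamma>\<^sup>2)"
        using M by (intro mult_left_mono) auto
      also have "\<dots> = M * (10 * (l / 96)) * \<eta>\<^sup>2 + 10 * \<Gamma>\<^sup>2 / M" using M by (simp add: field_simps power2_eq_square)
      finally show ?thesis .
    qed
    moreover have "500 * c\<^sup>2 / l * M ^ 3 * (g\<^sup>2 + g\<^sup>2) = 1000 * c\<^sup>2 / l * M ^ 3 * g\<^sup>2" by (simp add: algebra_simps)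
    ultimately show ?thesis using 1 unfolding M0_def by linarith
  qed
  have main: "M * (l / 2) * (\<Sum>j\<in>T. (wnorm (2 * N + 3) (pds (j # is) u))\<^sup>2) + M / 2 * (wnorm (2 * N + 3) (sqx (pds (k0 # is) u)))\<^sup>2
      + (if set is \<subseteq> {k0} then M / 4 * (wnorm (2 * N + 4) (pds (k0 # is) u))\<^sup>2 else 0) \<le> M0 + M * (l / 8) * \<eta>\<^sup>2"
    if len: "length is = N" for "is"
  proof (cases "set is \<subseteq> {k0}")
    case True
    then have "is = replicate N k0" using len by (simp add: replicate_eqI subset_singleton_iff)
      (metis len replicate_eqI subsetD singletonD True)
    then have "count_list is k0 = N" by (simp add: count_list_eq_length_filter)
    \<comment> \<open>Here \<open>k = N = M - 2\<close>, and the coefficient is at least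
      \<open>M / 4\<close> as soon as \<open>M / 2 \<ge> c + 5\<close>; this is the origin of the
      threshold \<open>2 * c + 8\<close>.\<close>
    then have "(M / 4) * (wnorm (2 * N + 4) (pds (k0 # is) u))\<^sup>2 \<le> (real (count_list is k0) - (c + 3) - M / 4) * (wnorm (2 * N + 4) (pds (k0 # is) u))\<^sup>2"
      using M by (intro mult_right_mono) auto
    moreover have "M * (10 * (l / 96)) * \<eta>\<^sup>2 \<le> M * (l / 8) * \<eta>\<^sup>2"
      using M l by (intro mult_right_mono mult_left_mono) auto
    ultimately show ?thesis using est[OF len] True by simp
  next
    case False
    then obtain j where j: "j \<in> set is" "j \<in> T" by auto
    \<comment> \<open>A tangential index of \<open>is\<close> is moved to the front, so the normal
      derivative of order \<open>N + 1\<close> is itself among the quantities bounded by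
      \<open>\<eta>\<close>; the possibly negative coefficient, at least \<open>- M\<close>, is then
      harmless.\<close>
    have "pds (k0 # is) u x = pds (j # k0 # remove1 j is) u x" if "x \<in> U" for x
      by (rule pds_perm[OF U(1) u _ that]) (use j in simp)
    then have "wnorm (2 * N + 4) (pds (k0 # is) u) = wnorm (2 * N + 4) (pds (j # k0 # remove1 j is) u)"
      by (intro wnorm_cong) (use U in auto)
    also have "\<dots> \<le> r\<^sup>2 * \<eta>"
    proof (rule tr)
      show "length (k0 # remove1 j is) = N" using j(1) len length_pos_if_in_set[OF j(1)] by (simp add: length_remove1)
    qed (rule j(2))
    finally have "(wnorm (2 * N + 4) (pds (k0 # is) u))\<^sup>2 \<le> (r\<^sup>2 * \<eta>)\<^sup>2" by (intro power_mono wnorm_nonneg)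
    also have "\<dots> = r ^ 4 * \<eta>\<^sup>2" by (simp add: power_mult_distrib flip: power_mult)
    also have "\<dots> \<le> l / 96 * \<eta>\<^sup>2" by (intro mult_right_mono r4) auto
    finally have "M * (wnorm (2 * N + 4) (pds (k0 # is) u))\<^sup>2 \<le> M * (l / 96 * \<eta>\<^sup>2)" using M by (intro mult_left_mono) auto
    moreover have "- M * (wnorm (2 * N + 4) (pds (k0 # is) u))\<^sup>2 \<le> (real (count_list is k0) - (c + 3) - M / 4) * (wnorm (2 * N + 4) (pds (k0 # is) u))\<^sup>2"
      using M c by (intro mult_right_mono) auto
    moreover have "M * (10 * (l / 96)) * \<eta>\<^sup>2 + M * (l / 96 * \<eta>\<^sup>2) \<le> M * (l / 8) * \<eta>\<^sup>2"
    proof -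
      have "M * (10 * (l / 96)) * \<eta>\<^sup>2 + M * (l / 96 * \<eta>\<^sup>2) = (11 / 12) * (M * (l / 8) * \<eta>\<^sup>2)" by (simp add: field_simps)
      moreover have "0 \<le> M * (l / 8) * \<eta>\<^sup>2" using M l by simp
      ultimately show ?thesis by linarith
    qed
    ultimately show ?thesis using est[OF len] False by simp
  qed
  have nn: "0 \<le> M * (l / 2) * (\<Sum>j\<in>T. (wnorm (2 * N + 3) (pds (j # is) u))\<^sup>2)" "0 \<le> M / 2 * (wnorm (2 * N + 3) (sqx (pds (k0 # is) u)))\<^sup>2"
    "0 \<le> M / 4 * (wnorm (2 * N + 4) (pds (k0 # is) u))\<^sup>2" for "is"
    using M l by (intro mult_nonneg_nonneg sum_nonneg zero_le_power2; simp)+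
  have M0: "0 \<le> M0" using M l by (simp add: M0_def)
  have \<eta>M: "M * (l / 8) * \<eta>\<^sup>2 \<le> M0"
  proof -
    have "\<eta> \<in> S" unfolding \<eta>_def by (rule Max_in[OF fin]) (simp add: S_def)
    then consider "\<eta> = 0" | qs j where "length qs = N" "j \<in> T" "\<eta> = wnorm (2 * N + 3) (pds (j # qs) u)"
      unfolding S_def by auto
    then show ?thesis
    proof cases
      case 2
      have "\<eta>\<^sup>2 \<le> (\<Sum>j\<in>T. (wnorm (2 * N + 3) (pds (j # qs) u))\<^sup>2)"
        unfolding 2(3) by (rule member_le_sum) (use 2(2) in auto)
      then have "M * (l / 2) * \<eta>\<^sup>2 \<le> M * (l / 2) * (\<Sum>j\<in>T. (wnorm (2 * N + 3) (pds (j # qs) u))\<^sup>2)"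
        using M l by (intro mult_left_mono) auto
      then have "M * (l / 2) * \<eta>\<^sup>2 \<le> M0 + M * (l / 8) * \<eta>\<^sup>2"
        using main[OF 2(1)] nn[of qs] by (auto split: if_splits)
      moreover have "M * (l / 2) * \<eta>\<^sup>2 = 4 * (M * (l / 8) * \<eta>\<^sup>2)" by simp
      moreover have "0 \<le> M * (l / 8) * \<eta>\<^sup>2" using M l by simp
      ultimately show ?thesis by linarith
    qed (use M0 in simp)
  qed
  \<comment> \<open>\<open>8 * M0 / (l * M)\<close> contains
    \<open>8000 * c\<^sup>2 / l\<^sup>2\<close>, and 90 is a round number whose square exceeds
    8000.\<close>
  define R where "R = 90 * c / l * (M * g + \<Gamma> / M)"
  have R0: "0 \<le> R" using M c l g by (simp add: R_def)
  have R: "8 * M0 / (l * M) \<le> R\<^sup>2"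
  proof -
    have "8 * M0 / (l * M) = 8000 * c\<^sup>2 / l\<^sup>2 * (M * g)\<^sup>2 + 80 / l * (\<Gamma> / M)\<^sup>2"
      using M l by (simp add: M0_def field_simps power2_eq_square power3_eq_cube)
    also have "\<dots> \<le> (90 * c / l)\<^sup>2 * (M * g)\<^sup>2 + (90 * c / l)\<^sup>2 * (\<Gamma> / M)\<^sup>2"
    proof (intro add_mono mult_right_mono)
      show "8000 * c\<^sup>2 / l\<^sup>2 \<le> (90 * c / l)\<^sup>2" by (simp add: power_divide power_mult_distrib divide_right_mono)
      have "80 * l \<le> 8100 * c\<^sup>2" using l one_le_power[OF c(1), of 2] by linarith
      then have "80 / l * l \<le> 8100 * c\<^sup>2 / l * 1" using l by (simp add: le_divide_eq)
      then have "80 / l \<le> 8100 * c\<^sup>2 / l / l" using l by (simp add: le_divide_eq)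
      then show "80 / l \<le> (90 * c / l)\<^sup>2" by (simp add: power_divide power_mult_distrib power2_eq_square)
    qed auto
    also have "\<dots> \<le> R\<^sup>2"
    proof -
      have "0 \<le> (90 * c / l)\<^sup>2 * (2 * (M * g) * (\<Gamma> / M))" using M g by (intro mult_nonneg_nonneg divide_nonneg_nonneg) auto
      then show ?thesis unfolding R_def power_mult_distrib[of "90 * c / l"] power2_sum by (simp only: distrib_left)
    qed
    finally show ?thesis .
  qed
  have fin_le: "y \<le> R" if "0 \<le> y" "M * (l / 8) * y\<^sup>2 \<le> M0" for y
  proof -
    have "y\<^sup>2 \<le> 8 * M0 / (l * M)" using that(2) M l by (simp add: field_simps)
    then have "y\<^sup>2 \<le> R\<^sup>2" using R by linarith
    then show ?thesis using R0 by (rule power2_le_imp_le)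
  qed
  have \<eta>R: "\<eta> \<le> R" by (rule fin_le[OF \<eta>0 \<eta>M])
  have "wnorm (2 * N + 4) (pds is' u) \<le> R \<and> wnorm (2 * N + 3) (sqx (pds is' u)) \<le> R"
  proof (cases "set is' \<subseteq> {k0}")
    case True
    then obtain "is" where i: "is' = k0 # is" "length is = N" "set is \<subseteq> {k0}" using is' by (cases is') auto
    have m: "M / 2 * (wnorm (2 * N + 3) (sqx (pds (k0 # is) u)))\<^sup>2 \<le> 2 * M0" "M / 4 * (wnorm (2 * N + 4) (pds (k0 # is) u))\<^sup>2 \<le> 2 * M0"
      using main[OF i(2), unfolded if_P[OF i(3)]] nn[of "is"] \<eta>M by linarith+
    have small: "M * (l / 8) * y \<le> M / 8 * y" if "0 \<le> y" for y
      using M l that by (intro mult_right_mono) auto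
    show ?thesis unfolding i(1)
    proof (intro conjI fin_le wnorm_nonneg)
      show "M * (l / 8) * (wnorm (2 * N + 4) (pds (k0 # is) u))\<^sup>2 \<le> M0"
        using small[OF zero_le_power2, of "wnorm (2 * N + 4) (pds (k0 # is) u)"] m(2) by linarith
      show "M * (l / 8) * (wnorm (2 * N + 3) (sqx (pds (k0 # is) u)))\<^sup>2 \<le> M0"
        using small[OF zero_le_power2, of "wnorm (2 * N + 3) (sqx (pds (k0 # is) u))"] m(1) M0 by linarith
    qed
  next
    case False
    then obtain j where j: "j \<in> set is'" "j \<in> T" by auto
    define qs where "qs = remove1 j is'"
    have qs: "length qs = N" using j is' by (simp add: qs_def length_remove1)
    have eq: "pds is' u x = pds (j # qs) u x" if "x \<in> wt_supp k0 r" for x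
      by (rule pds_perm[OF U(1) u]) (use j that U in \<open>auto simp: qs_def\<close>)
    have "wnorm (2 * N + 4) (pds is' u) = wnorm (2 * N + 4) (pds (j # qs) u)" by (rule wnorm_cong) (use eq in auto)
    also have "\<dots> \<le> wnorm (2 * N + 3) (pds (j # qs) u)" by (rule wnorm_power_mono[OF pc]) auto
    finally have 1: "wnorm (2 * N + 4) (pds is' u) \<le> R" using \<eta>[OF qs j(2)] \<eta>R by linarith
    have "wnorm (2 * N + 3) (sqx (pds is' u)) = wnorm (2 * N + 3) (sqx (pds (j # qs) u))"
      by (rule wnorm_cong) (use eq in \<open>auto simp: sqx_def\<close>)
    also have "\<dots> \<le> 1 * wnorm (2 * N + 3) (pds (j # qs) u)"
    proof (rule wnorm_mono[OF sqx_cont[OF pc] pc])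
      fix x assume "x \<in> wt_supp k0 r"
      then have "\<bar>x $ k0\<bar> \<le> 1" using r power_le_one[of r 4] by (simp add: wt_supp_def)
      then have "\<bar>x $ k0\<bar> * (X x ^ (2 * N + 3) * (cmod (pds (j # qs) u x))\<^sup>2) \<le> 1 * (X x ^ (2 * N + 3) * (cmod (pds (j # qs) u x))\<^sup>2)"
        using wt_power by (intro mult_right_mono mult_nonneg_nonneg) auto
      then show "X x ^ (2 * N + 3) * (cmod (sqx (pds (j # qs) u) x))\<^sup>2 \<le> 1\<^sup>2 * (X x ^ (2 * N + 3) * (cmod (pds (j # qs) u x))\<^sup>2)"
        unfolding cmod_sqx by (simp only: mult_ac power_one)
    qed auto
    finally have 2: "wnorm (2 * N + 3) (sqx (pds is' u)) \<le> R" using \<eta>[OF qs j(2)] \<eta>R by linarith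
    show ?thesis using 1 2 by blast
  qed
  then show "wnorm (2 * N + 4) (pds is' u) \<le> 90 * c / l * (real (N + 2) * g + \<Gamma> / real (N + 2))"
    "wnorm (2 * N + 3) (sqx (pds is' u)) \<le> 90 * c / l * (real (N + 2) * g + \<Gamma> / real (N + 2))"
    unfolding R_def M_def by auto
qed

end

subsection \<open>Weighted Cauchy estimates\<close>

context lens_operator
begin

abbreviation "opcoeffs \<equiv> insert A (insert Cc (range B \<union> (\<Union>j. range (Q j))))"

lemma opcoeffs_smooth: "a \<in> opcoeffs \<Longrightarrow> smooth_on U a"
  using smooth by auto

lemma opcoeffs: "A \<in> opcoeffs" "Cc \<in> opcoeffs" "Q j k \<in> opcoeffs" "B j \<in> opcoeffs"
  by auto

lemma wnorm_coeff_mult: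
  assumes u: "smooth_on U u" and a: "a \<in> opcoeffs" and C: "0 \<le> C" "\<And>x. x \<in> wt_supp k0 r \<Longrightarrow> cmod (pds ps a x) \<le> C"
    and p: "0 < p" and w: "wnorm p (pds js u) \<le> w"
  shows "wnorm p (\<lambda>x. pds ps a x * pds js u x) \<le> C * w"
proof -
  have "wnorm p (\<lambda>x. pds ps a x * pds js u x) \<le> C * wnorm p (pds js u)"
    by (rule wnorm_mult_le)
      (use smooth_on_cont[OF u] smooth_on_cont[OF opcoeffs_smooth[OF a]] U continuous_on_subset C p in blast)+
  also have "\<dots> \<le> C * w" by (rule mult_left_mono[OF w C(1)])
  finally show ?thesis .
qed

lemma rterm_cont:
  assumes u: "smooth_on U u"
  shows "wcont (rterm u ps qs)"
proof -
  have 1: "wcont (pds js u)" for js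
    using smooth_on_cont[OF u] U continuous_on_subset by blast
  have 2: "wcont (pds ps a)" if "a \<in> opcoeffs" for a
    using smooth_on_cont[OF opcoeffs_smooth[OF that]] U continuous_on_subset by blast
  show ?thesis unfolding rterm_def[abs_def] by (intro continuous_intros 1 2 opcoeffs)
qed

text \<open>The second order tangential terms get their own bounds \<open>w2\<close> and
  \<open>C2\<close>, since they are the only ones that can reach an order not yet estimated.\<close>

lemma wnorm_rterm_split:
  assumes u: "smooth_on U u" and p: "0 < p" and C: "0 \<le> C" "\<And>a x. a \<in> opcoeffs \<Longrightarrow> x \<in> wt_supp k0 r \<Longrightarrow> cmod (pds ps a x) \<le> C"
    and w: "0 \<le> w2" "0 \<le> w1" "\<And>j k. j \<in> T \<Longrightarrow> k \<in> T \<Longrightarrow> wnorm p (pds (j # k # qs) u) \<le> w2"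
      "\<And>j. wnorm p (pds (j # qs) u) \<le> w1" "wnorm p (pds qs u) \<le> w1"
    and D: "0 \<le> C2" "\<And>j k x. x \<in> wt_supp k0 r \<Longrightarrow> cmod (pds ps (Q j k) x) \<le> C2"
  shows "wnorm p (rterm u ps qs) \<le> (real CARD('n))\<^sup>2 * (C2 * w2) + (real CARD('n) + 2) * (C * w1)"
proof -
  have pc: "wcont (pds js u)" for js
    using smooth_on_cont[OF u] U continuous_on_subset by blast
  have ac: "wcont (pds ps a)" if "a \<in> opcoeffs" for a
    using smooth_on_cont[OF opcoeffs_smooth[OF that]] U continuous_on_subset by blast
  have Tn: "real (card T) \<le> real CARD('n)" by (simp add: card_Diff_singleton)
  have cm: "wnorm p (\<lambda>x. pds ps a x * pds js u x) \<le> C * w" if "a \<in> opcoeffs" "wnorm p (pds js u) \<le> w" for a js w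
    by (rule wnorm_coeff_mult[OF u that(1) C(1) C(2)[OF that(1)] p that(2)])
  define t1 where "t1 x = (\<Sum>j\<in>T. \<Sum>k\<in>T. pds ps (Q j k) x * pds (j # k # qs) u x)" for x
  define t2 where "t2 x = pds ps A x * pds (k0 # qs) u x" for x
  define t3 where "t3 x = (\<Sum>j\<in>T. pds ps (B j) x * pds (j # qs) u x)" for x
  define t4 where "t4 x = pds ps Cc x * pds qs u x" for x
  have tc: "wcont t1" "wcont t2" "wcont t3" "wcont t4"
    unfolding t1_def[abs_def] t2_def[abs_def] t3_def[abs_def] t4_def[abs_def]
    by (intro continuous_intros pc ac opcoeffs)+
  have 1: "wnorm p t1 \<le> (real CARD('n))\<^sup>2 * (C2 * w2)"
  proof -
    have "wnorm p t1 \<le> (\<Sum>j\<in>T. wnorm p (\<lambda>x. \<Sum>k\<in>T. pds ps (Q j k) x * pds (j # k # qs) u x))"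
      unfolding t1_def[abs_def] by (rule wnorm_sum[OF _ p]) (intro continuous_intros pc ac opcoeffs)
    also have "\<dots> \<le> (\<Sum>j\<in>T. \<Sum>k\<in>T. C2 * w2)"
    proof (rule sum_mono)
      fix j assume j: "j \<in> T"
      have "wnorm p (\<lambda>x. \<Sum>k\<in>T. pds ps (Q j k) x * pds (j # k # qs) u x) \<le> (\<Sum>k\<in>T. wnorm p (\<lambda>x. pds ps (Q j k) x * pds (j # k # qs) u x))"
        by (rule wnorm_sum[OF _ p]) (intro continuous_intros pc ac opcoeffs)
      also have "\<dots> \<le> (\<Sum>k\<in>T. C2 * w2)"
        by (intro sum_mono wnorm_coeff_mult[OF u _ D(1) D(2) p w(3)[OF j]] opcoeffs) auto
      finally show "wnorm p (\<lambda>x. \<Sum>k\<in>T. pds ps (Q j k) x * pds (j # k # qs) u x) \<le> (\<Sum>k\<in>T. C2 * w2)" .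
    qed
    also have "\<dots> = (real (card T))\<^sup>2 * (C2 * w2)" by (simp add: power2_eq_square mult_ac)
    also have "\<dots> \<le> (real CARD('n))\<^sup>2 * (C2 * w2)"
      using Tn D(1) w(1) by (intro mult_right_mono power_mono mult_nonneg_nonneg) auto
    finally show ?thesis .
  qed
  have 2: "wnorm p t2 \<le> C * w1" unfolding t2_def[abs_def] by (rule cm[OF opcoeffs(1) w(4)])
  have 4: "wnorm p t4 \<le> C * w1" unfolding t4_def[abs_def] by (rule cm[OF opcoeffs(2) w(5)])
  have 3: "wnorm p t3 \<le> real CARD('n) * (C * w1)"
  proof -
    have "wnorm p t3 \<le> (\<Sum>j\<in>T. wnorm p (\<lambda>x. pds ps (B j) x * pds (j # qs) u x))"
      unfolding t3_def[abs_def] by (rule wnorm_sum[OF _ p]) (intro continuous_intros pc ac opcoeffs)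
    also have "\<dots> \<le> (\<Sum>j\<in>T. C * w1)"
      by (intro sum_mono cm w(4) opcoeffs)
    also have "\<dots> = real (card T) * (C * w1)" by simp
    also have "\<dots> \<le> real CARD('n) * (C * w1)"
      using Tn C(1) w(2) by (intro mult_right_mono mult_nonneg_nonneg) auto
    finally show ?thesis .
  qed
  have "rterm u ps qs = (\<lambda>x. t1 x + t2 x + t3 x + t4 x)"
    unfolding rterm_def[abs_def] t1_def t2_def t3_def t4_def ..
  moreover have "wnorm p (\<lambda>x. t1 x + t2 x + t3 x + t4 x) \<le> wnorm p (\<lambda>x. t1 x + t2 x + t3 x) + wnorm p t4"
    by (intro wnorm_triangle p tc continuous_intros)
  moreover have "wnorm p (\<lambda>x. t1 x + t2 x + t3 x) \<le> wnorm p (\<lambda>x. t1 x + t2 x) + wnorm p t3"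
    by (intro wnorm_triangle p tc continuous_intros)
  moreover have "wnorm p (\<lambda>x. t1 x + t2 x) \<le> wnorm p t1 + wnorm p t2"
    by (intro wnorm_triangle p tc continuous_intros)
  ultimately show ?thesis using 1 2 3 4 by (simp add: distrib_right)
qed

text \<open>With a single derivative on the coefficients the second order terms have order
  \<open>N + 1\<close>, where only \<open>\<eta>\<close> is available, and the spare power of the
  weight supplies \<open>r\<^sup>2\<close>. All other terms have order at most
  \<open>N + 2 - max (length ps) 2\<close>, attained by second order terms if
  \<open>length ps \<ge> 2\<close> and by first order ones if it is 1.\<close>

lemma wnorm_rterm_le:
  assumes u: "smooth_on U u" and len: "length ps + length qs = N" "ps \<noteq> []" and Ca: "0 \<le> Ca" "0 \<le> Ra"
    and C: "\<And>a ps x. a \<in> opcoeffs \<Longrightarrow> x \<in> wt_supp k0 r \<Longrightarrow> cmod (pds ps a x) \<le> Ca * Ra ^ length ps * fact (length ps)"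
    and \<gamma>: "mono \<gamma>" "0 \<le> \<gamma> 0" "\<And>js. length js \<le> N \<Longrightarrow> wnorm (2 * length js + 2) (pds js u) \<le> \<gamma> (length js)"
    and \<eta>: "0 \<le> \<eta>" "\<And>qs j. length qs = N \<Longrightarrow> j \<in> T \<Longrightarrow> wnorm (2 * N + 3) (pds (j # qs) u) \<le> \<eta>"
  shows "wnorm (2 * N + 4) (rterm u ps qs) \<le> (if length ps = 1 then c * r\<^sup>2 * \<eta> else 0)
    + Ca * Ra ^ length ps * fact (length ps) * ((real CARD('n))\<^sup>2 + real CARD('n) + 2) * \<gamma> (N + 2 - max (length ps) 2)"
proof -
  have pc: "wcont (pds js u)" for js
    using smooth_on_cont[OF u] U continuous_on_subset by blast
  have \<gamma>0: "0 \<le> \<gamma> m" for m using \<gamma>(1,2) monoD[OF \<gamma>(1), of 0 m] by linarith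
  have low: "wnorm (2 * N + 4) (pds js u) \<le> \<gamma> m" if "length js \<le> m" "m \<le> N" for js m
  proof -
    have "wnorm (2 * N + 4) (pds js u) \<le> wnorm (2 * length js + 2) (pds js u)"
      by (rule wnorm_power_mono[OF pc]) (use that in auto)
    also have "\<dots> \<le> \<gamma> (length js)" by (rule \<gamma>(3)) (use that in simp)
    also have "\<dots> \<le> \<gamma> m" by (rule monoD[OF \<gamma>(1) that(1)])
    finally show ?thesis .
  qed
  define E where "E = Ca * Ra ^ length ps * fact (length ps)"
  have E: "0 \<le> E" unfolding E_def using Ca by simp
  define m where "m = N + 2 - max (length ps) 2"
  have lp: "1 \<le> length ps" using len by (cases ps) auto
  have l1: "length qs + 1 \<le> m" "m \<le> N" using len lp by (auto simp: m_def)
  have lows: "wnorm (2 * N + 4) (pds (j # qs) u) \<le> \<gamma> m" "wnorm (2 * N + 4) (pds qs u) \<le> \<gamma> m" for j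
    by (rule low; use l1 in simp)+
  note sp = wnorm_rterm_split[OF u _ E, unfolded E_def, OF _ C, folded E_def, of "2 * N + 4" _ "\<gamma> m" qs]
  show ?thesis
  proof (cases "length ps = 1")
    case True
    then obtain i where i: "ps = [i]" by (cases ps) auto
    have "wnorm (2 * N + 4) (rterm u ps qs) \<le> (real CARD('n))\<^sup>2 * (C0 * (r\<^sup>2 * \<eta>)) + (real CARD('n) + 2) * (E * \<gamma> m)"
    proof (rule sp)
      show "wnorm (2 * N + 4) (pds (j # k # qs) u) \<le> r\<^sup>2 * \<eta>" if "j \<in> T" "k \<in> T" for j k
      proof -
        have "wnorm (Suc (2 * N + 3)) (pds (j # k # qs) u) \<le> r\<^sup>2 * wnorm (2 * N + 3) (pds (j # k # qs) u)"
          by (rule wnorm_Suc_le[OF pc]) simp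
        also have "\<dots> \<le> r\<^sup>2 * \<eta>" by (intro mult_left_mono \<eta>(2) that) (use len True in auto)
        finally show ?thesis by (simp add: eval_nat_numeral)
      qed
      show "cmod (pds ps (Q j k) x) \<le> C0" if "x \<in> wt_supp k0 r" for j k x using bounds(4)[OF that] i by simp
    qed (use C0_bounds \<gamma>0 \<eta>(1) lows in \<open>simp_all del: pds.simps\<close>)
    also have "(real CARD('n))\<^sup>2 * (C0 * (r\<^sup>2 * \<eta>)) = (real CARD('n) * real CARD('n) * C0) * (r\<^sup>2 * \<eta>)" by (simp add: power2_eq_square)
    also have "\<dots> \<le> c * (r\<^sup>2 * \<eta>)" using \<eta> by (intro mult_right_mono c) auto
    also have "(real CARD('n) + 2) * (E * \<gamma> m) \<le> ((real CARD('n))\<^sup>2 + real CARD('n) + 2) * (E * \<gamma> m)"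
      using E \<gamma>0 by (intro mult_right_mono mult_nonneg_nonneg) auto
    finally show ?thesis using True unfolding E_def m_def by (simp add: mult_ac)
  next
    case False
    have "wnorm (2 * N + 4) (rterm u ps qs) \<le> (real CARD('n))\<^sup>2 * (E * \<gamma> m) + (real CARD('n) + 2) * (E * \<gamma> m)"
    proof (rule sp)
      show "wnorm (2 * N + 4) (pds (j # k # qs) u) \<le> \<gamma> m" for j k
        by (rule low) (use False lp len l1 in \<open>auto simp: m_def\<close>)
      show "cmod (pds ps (Q j k) x) \<le> E" if "x \<in> wt_supp k0 r" for j k x unfolding E_def by (rule C) (use that in auto)
    qed (use \<gamma>0 E lows in \<open>simp_all del: pds.simps\<close>)
    also have "\<dots> = ((real CARD('n))\<^sup>2 + real CARD('n) + 2) * (E * \<gamma> m)" by (simp add: algebra_simps)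
    finally show ?thesis using False unfolding E_def m_def by (simp add: mult_ac)
  qed
qed

text \<open>The binomial coefficient and the factorials from the coefficient bounds and the
  induction hypothesis collapse into one factorial. The shift by 2 is the order of the operator;
  \<open>p = 1\<close> is separate because of the maximum.\<close>

lemma choose_fact_le:
  assumes "1 \<le> p" "p \<le> N"
  shows "real (N choose p) * fact p * fact (N + 2 - max p 2) \<le> fact (N + 2)"
proof (cases "p = 1")
  case True
  have "real (N choose p) * fact p * fact (N + 2 - max p 2) = real N * fact N" using True by simp
  also have "\<dots> \<le> real (N + 2) * (real (N + 1) * fact N)"
  proof (rule mult_mono)
    show "fact N \<le> real (N + 1) * fact N" by (simp add: distrib_right)
  qed auto
  also have "\<dots> = fact (N + 2)" by (simp add: algebra_simps)
  finally show ?thesis .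
next
  case False
  have "real (N choose p) * fact p * fact (N + 2 - max p 2) \<le> real ((N + 2) choose p) * fact p * fact (N + 2 - max p 2)"
    by (intro mult_right_mono of_nat_mono binomial_right_mono) auto
  also have "\<dots> = fact (N + 2)"
  proof -
    have "max p 2 = p" using assms False by simp
    moreover have "real (fact p * fact (N + 2 - p) * ((N + 2) choose p)) = real (fact (N + 2))"
      using binomial_fact_lemma[of p "N + 2"] assms by simp
    ultimately show ?thesis by (simp only: of_nat_mult of_nat_fact mult_ac)
  qed
  finally show ?thesis .
qed

lemma geometric_half_sum: "(\<Sum>p\<le>N. (1 / 2) ^ p) \<le> (2::real)"
  using sum_gp0[of "1/2::real" N] by simp

text \<open>Only \<open>N\<close> splittings put a single derivative on the coefficients, whence
  \<open>N\<close> times \<open>\<eta>\<close>. The rest sums up geometrically: as \<open>K\<close>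
  is at least \<open>2 * Ra\<close>, each further derivative on a coefficient gains a factor
  1/2.\<close>

lemma wnorm_rem_le:
  assumes u: "smooth_on U u" and len: "length is = N" and Ca: "0 \<le> Ca" "1 \<le> Ra"
    and C: "\<And>a ps x. a \<in> opcoeffs \<Longrightarrow> x \<in> wt_supp k0 r \<Longrightarrow> cmod (pds ps a x) \<le> Ca * Ra ^ length ps * fact (length ps)"
    and K: "2 * Ra \<le> K" and D: "0 \<le> D"
    and \<gamma>: "\<And>js. length js \<le> N \<Longrightarrow> wnorm (2 * length js + 2) (pds js u) \<le> D * K ^ length js * fact (length js)"
    and \<eta>: "0 \<le> \<eta>" "\<And>qs j. length qs = N \<Longrightarrow> j \<in> T \<Longrightarrow> wnorm (2 * N + 3) (pds (j # qs) u) \<le> \<eta>"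
  shows "wnorm (2 * N + 4) (rem u is) \<le> real N * c * r\<^sup>2 * \<eta>
    + 2 * (Ca * ((real CARD('n))\<^sup>2 + real CARD('n) + 2) * (2 * Ra)\<^sup>2) * (D * K ^ N * fact (N + 2))"
proof -
  define n2 where "n2 = (real CARD('n))\<^sup>2 + real CARD('n) + 2"
  have n2: "0 \<le> n2" by (simp add: n2_def)
  define \<gamma>' where "\<gamma>' m = D * K ^ m * fact m" for m
  have K1: "1 \<le> K" using K Ca by simp
  have mono: "mono \<gamma>'" unfolding \<gamma>'_def
    by (intro monoI mult_mono mult_left_mono power_increasing fact_mono mult_nonneg_nonneg) (use K1 D in auto)
  define \<psi> where "\<psi> p = (if p = 0 then 0 else (if p = 1 then c * r\<^sup>2 * \<eta> else 0)
    + Ca * Ra ^ p * fact p * n2 * \<gamma>' (N + 2 - max p 2))" for p :: nat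
  define L where "L = filter (\<lambda>(ps, qs). ps \<noteq> []) (splits is)"
  have "rem u is = (\<lambda>x. \<Sum>y\<leftarrow>L. rterm u (fst y) (snd y) x)"
    unfolding rem_def[abs_def] L_def by (simp add: case_prod_unfold)
  then have "wnorm (2 * N + 4) (rem u is) \<le> (\<Sum>y\<leftarrow>L. wnorm (2 * N + 4) (rterm u (fst y) (snd y)))"
    using wnorm_sum_list[of L "\<lambda>y. rterm u (fst y) (snd y)" "2 * N + 4"] rterm_cont[OF u] by simp
  also have "\<dots> \<le> (\<Sum>y\<leftarrow>L. \<psi> (length (fst y)))"
  proof (rule sum_list_mono)
    fix y assume "y \<in> set L"
    then have y: "fst y \<noteq> []" "length (fst y) + length (snd y) = N"
      using splits_length[of "fst y" "snd y" "is"] len by (auto simp: L_def case_prod_unfold)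
    have "wnorm (2 * N + 4) (rterm u (fst y) (snd y)) \<le> (if length (fst y) = 1 then c * r\<^sup>2 * \<eta> else 0)
      + Ca * Ra ^ length (fst y) * fact (length (fst y)) * n2 * \<gamma>' (N + 2 - max (length (fst y)) 2)"
      unfolding n2_def
      by (rule wnorm_rterm_le[OF u y(2,1) Ca(1) _ C mono _ _ \<eta>]) (use Ca D \<gamma> in \<open>auto simp: \<gamma>'_def\<close>)
    then show "wnorm (2 * N + 4) (rterm u (fst y) (snd y)) \<le> \<psi> (length (fst y))" using y(1) by (simp add: \<psi>_def)
  qed
  also have "\<dots> = (\<Sum>(ps, qs)\<leftarrow>splits is. \<psi> (length ps))"
    using sum_list_splits_Nil[of "\<lambda>ps qs. \<psi> (length ps)" "is"] by (simp add: L_def case_prod_unfold \<psi>_def)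
  also have "\<dots> = (\<Sum>p\<le>N. real (N choose p) * \<psi> p)"
    using sum_list_splits[of \<psi> "is"] len by simp
  also have "\<dots> \<le> (\<Sum>p\<le>N. (if p = 1 then real N * (c * r\<^sup>2 * \<eta>) else 0)
      + (1 / 2) ^ p * ((Ca * n2 * (2 * Ra)\<^sup>2) * (D * K ^ N * fact (N + 2))))"
  proof (rule sum_mono)
    fix p assume "p \<in> {..N}"
    then have p: "p \<le> N" by simp
    show "real (N choose p) * \<psi> p \<le> (if p = 1 then real N * (c * r\<^sup>2 * \<eta>) else 0)
      + (1 / 2) ^ p * ((Ca * n2 * (2 * Ra)\<^sup>2) * (D * K ^ N * fact (N + 2)))"
    proof (cases "p = 0")
      case True
      then show ?thesis using Ca n2 D K1 by (simp add: \<psi>_def)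
    next
      case False
      define q where "q = N + 2 - max p 2"
      \<comment> \<open>For \<open>p = 1\<close> the exponent \<open>q\<close> is \<open>N\<close>,
        and \<open>2 * Ra \<ge> 1\<close> suffices; otherwise all but two of the factors
        \<open>2 * Ra\<close> are exchanged for \<open>K\<close>.\<close>
      have pw: "Ra ^ p * K ^ q \<le> (1 / 2) ^ p * ((2 * Ra)\<^sup>2 * K ^ N)"
      proof -
        have "(2 * Ra) ^ p * K ^ q \<le> (2 * Ra)\<^sup>2 * K ^ N"
        proof (cases "p = 1")
          case True
          then show ?thesis using Ca K1 by (auto simp: q_def power2_eq_square intro!: mult_right_mono)
        next
          case p1: False
          have "(2 * Ra) ^ p * K ^ q = (2 * Ra)\<^sup>2 * ((2 * Ra) ^ (p - 2) * K ^ q)"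
          proof -
            have "p = 2 + (p - 2)" using False p1 by simp
            then have "(2 * Ra) ^ p = (2 * Ra)\<^sup>2 * (2 * Ra) ^ (p - 2)" by (metis power_add)
            then show ?thesis by (simp only: mult.assoc)
          qed
          also have "\<dots> \<le> (2 * Ra)\<^sup>2 * (K ^ (p - 2) * K ^ q)"
            using Ca K K1 by (intro mult_left_mono mult_right_mono power_mono) auto
          also have "K ^ (p - 2) * K ^ q = K ^ N"
          proof -
            have "p - 2 + q = N" using False p1 p by (simp add: q_def)
            then show ?thesis by (simp only: power_add[symmetric])
          qed
          finally show ?thesis .
        qed
        then have "(1 / 2) ^ p * ((2 * Ra) ^ p * K ^ q) \<le> (1 / 2) ^ p * ((2 * Ra)\<^sup>2 * K ^ N)" by (intro mult_left_mono) auto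
        moreover have "(1 / 2) ^ p * ((2 * Ra) ^ p * K ^ q) = Ra ^ p * K ^ q" by (simp add: power_mult_distrib power_divide)
        ultimately show ?thesis by (simp only:)
      qed
      have "real (N choose p) * (Ca * Ra ^ p * fact p * n2 * \<gamma>' q) = (Ca * n2 * D) * ((Ra ^ p * K ^ q) * (real (N choose p) * fact p * fact q))"
        by (simp add: \<gamma>'_def mult_ac)
      also have "\<dots> \<le> (Ca * n2 * D) * (((1 / 2) ^ p * ((2 * Ra)\<^sup>2 * K ^ N)) * fact (N + 2))"
      proof (rule mult_left_mono[OF mult_mono])
        show "Ra ^ p * K ^ q \<le> (1 / 2) ^ p * ((2 * Ra)\<^sup>2 * K ^ N)" by (rule pw)
        show "real (N choose p) * fact p * fact q \<le> fact (N + 2)" using choose_fact_le[of p N] False p by (simp add: q_def)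
        show "0 \<le> (1 / 2) ^ p * ((2 * Ra)\<^sup>2 * K ^ N)" using K1 by simp
        show "0 \<le> Ca * n2 * D" using Ca n2 D by simp
      qed simp
      finally have 1: "real (N choose p) * (Ca * Ra ^ p * fact p * n2 * \<gamma>' q) \<le> (1 / 2) ^ p * ((Ca * n2 * (2 * Ra)\<^sup>2) * (D * K ^ N * fact (N + 2)))"
        by (simp only: mult_ac)
      have "real (N choose p) * \<psi> p = (if p = 1 then real N * (c * r\<^sup>2 * \<eta>) else 0) + real (N choose p) * (Ca * Ra ^ p * fact p * n2 * \<gamma>' q)"
        using False by (simp add: \<psi>_def q_def distrib_left)
      then show ?thesis using 1 by linarith
    qed
  qed
  also have "\<dots> = (if 1 \<le> N then real N * (c * r\<^sup>2 * \<eta>) else 0)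
      + (\<Sum>p\<le>N. (1 / 2) ^ p) * ((Ca * n2 * (2 * Ra)\<^sup>2) * (D * K ^ N * fact (N + 2)))"
    by (simp add: sum.distrib sum_distrib_right sum.delta)
  also have "\<dots> \<le> real N * (c * r\<^sup>2 * \<eta>) + 2 * ((Ca * n2 * (2 * Ra)\<^sup>2) * (D * K ^ N * fact (N + 2)))"
    using Ca n2 D K1 \<eta>(1) c by (intro add_mono mult_right_mono geometric_half_sum) auto
  finally show ?thesis unfolding n2_def by (simp only: mult.assoc)
qed

text \<open>The induction carries both the plain norm and the one with the half power of the
  distance, as each order consumes both from the previous one.\<close>

proposition weighted_Cauchy_estimates:
  assumes u: "smooth_on U u" and Ca: "0 \<le> Ca" "1 \<le> Ra"
    and C: "\<And>a ps x. a \<in> opcoeffs \<Longrightarrow> x \<in> wt_supp k0 r \<Longrightarrow> cmod (pds ps a x) \<le> Ca * Ra ^ length ps * fact (length ps)"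
    and Cf: "0 \<le> Cf" "0 \<le> Rf"
    and F: "smooth_on U (Lop u)" "\<And>is x. x \<in> wt_supp k0 r \<Longrightarrow> cmod (pds is (Lop u) x) \<le> Cf * Rf ^ length is * fact (length is)"
  obtains D K where "0 < D" "1 \<le> K" "\<And>is. wnorm (2 * length is + 2) (pds is u) \<le> D * K ^ length is * fact (length is)"
proof -
  have pc: "wcont (pds js u)" for js
    using smooth_on_cont[OF u] U continuous_on_subset by blast
  define G where "G = 2 * (Ca * ((real CARD('n))\<^sup>2 + real CARD('n) + 2) * (2 * Ra)\<^sup>2)"
  have G: "0 \<le> G" using Ca by (simp add: G_def)
  \<comment> \<open>\<open>G\<close> depends on the dimension and the coefficient bounds only, not
    on \<open>D\<close> or \<open>K\<close>, so the choice is not circular. The last entry is the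
    loss per order from \<open>energy_step\<close>, as computed in \<open>bd\<close>.\<close>
  define K where "K = max (max (2 * Ra) Rf) (90 * c / l * (3 + G))"
  have K: "2 * Ra \<le> K" "Rf \<le> K" "90 * c / l * (3 + G) \<le> K" "1 \<le> K" using Ca by (auto simp: K_def)
  define N0 where "N0 = nat \<lceil>2 * c + 8\<rceil>"
  define W where "W = (\<Union>m\<le>N0. (\<lambda>is. wnorm (2 * m + 2) (pds is u) + wnorm (2 * m + 1) (sqx (pds is u))) ` {is. length is = m})"
  have fin: "finite W" unfolding W_def by (intro finite_UN_I finite_imageI finite_lists_length) auto
  define V where "V = wnorm 1 (\<lambda>_. 1)"
  \<comment> \<open>Orders up to \<open>N0\<close>, where \<open>energy_step\<close> is not yet
    available, are finitely many and enter through a maximum; \<open>Cf * V\<close> accounts for the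
    source.\<close>
  define D where "D = Max (insert 1 W) + Cf * V"
  have V: "0 \<le> Cf * V" using Cf wnorm_nonneg by (simp add: V_def)
  have M1: "1 \<le> Max (insert 1 W)" by (rule Max_ge) (use fin in auto)
  have DW: "y \<le> D" if "y \<in> W" for y
  proof -
    have "y \<le> Max (insert 1 W)" by (rule Max_ge) (use fin that in auto)
    then show ?thesis using V unfolding D_def by linarith
  qed
  have D1: "1 \<le> D" "Cf * V \<le> D" using M1 V unfolding D_def by linarith+
  define \<gamma> where "\<gamma> m = D * K ^ m * fact m" for m
  have main: "wnorm (2 * m + 2) (pds is u) \<le> \<gamma> m \<and> wnorm (2 * m + 1) (sqx (pds is u)) \<le> \<gamma> m" if "length is = m" for m "is"
    using that
  proof (induction m arbitrary: "is" rule: less_induct)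
    case (less m)
    show ?case
    proof (cases "m \<le> N0")
      case True
      have "wnorm (2 * m + 2) (pds is u) + wnorm (2 * m + 1) (sqx (pds is u)) \<le> D"
        by (rule DW) (use True less.prems in \<open>auto simp: W_def\<close>)
      moreover have "D * 1 * 1 \<le> \<gamma> m" unfolding \<gamma>_def
        using D1 K(4) by (intro mult_mono one_le_power fact_ge_1) auto
      ultimately show ?thesis using wnorm_nonneg[of "2 * m + 2" "pds is u"] wnorm_nonneg[of "2 * m + 1" "sqx (pds is u)"] by linarith
    next
      case False
      then obtain N where N: "m = Suc N" "N0 \<le> N" by (cases m) auto
      have "2 * c + 8 \<le> real N0" using c unfolding N0_def by linarith
      then have Nc: "2 * c + 8 \<le> real N" using N(2) by linarith
      have IH: "wnorm (2 * length js + 2) (pds js u) \<le> \<gamma> (length js)" "wnorm (2 * length js + 1) (sqx (pds js u)) \<le> \<gamma> (length js)"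
        if "length js \<le> N" for js
        using less.IH[of "length js" js] that N(1) by auto
      define P where "P = D * K ^ N"
      have P: "0 \<le> P" using D1 K(4) by (simp add: P_def)
      define \<Gamma> where "\<Gamma> = (G + 1) * (P * fact (N + 2))"
      have gN: "\<gamma> N = P * fact N" by (simp add: \<gamma>_def P_def)
      have h2: "wnorm (2 * N + 4) (\<lambda>x. pds is (Lop u) x - rem u is x) \<le> real N * c * r\<^sup>2 * \<eta> + \<Gamma>"
        if len: "length is = N" and \<eta>: "0 \<le> \<eta>" "\<And>qs j. length qs = N \<Longrightarrow> j \<in> T \<Longrightarrow> wnorm (2 * N + 3) (pds (j # qs) u) \<le> \<eta>" for "is" \<eta>
      proof -
        have cF: "wcont (pds is (Lop u))" using smooth_on_cont[OF F(1)] U continuous_on_subset by blast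
        have cR: "wcont (rem u is)" unfolding rem_def[abs_def] case_prod_unfold by (intro continuous_on_sum_list rterm_cont[OF u])
        have "wnorm (2 * N + 4) (\<lambda>x. pds is (Lop u) x - rem u is x) \<le> wnorm (2 * N + 4) (pds is (Lop u)) + wnorm (2 * N + 4) (\<lambda>x. - rem u is x)"
          using wnorm_triangle[OF cF continuous_on_minus[OF cR], of "2 * N + 4"] by simp
        moreover have "wnorm (2 * N + 4) (\<lambda>x. - rem u is x) = wnorm (2 * N + 4) (rem u is)" unfolding wnorm_def by simp
        moreover have "wnorm (2 * N + 4) (rem u is) \<le> real N * c * r\<^sup>2 * \<eta> + G * (P * fact (N + 2))"
          unfolding G_def P_def
          by (rule wnorm_rem_le[OF u len Ca C K(1) _ IH(1)[unfolded \<gamma>_def] \<eta>]) (use D1 in auto)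
        moreover have "wnorm (2 * N + 4) (pds is (Lop u)) \<le> P * fact (N + 2)"
        proof -
          have "wnorm (2 * N + 4) (\<lambda>x. pds is (Lop u) x * 1) \<le> (Cf * Rf ^ N * fact N) * wnorm (2 * N + 4) (\<lambda>_. 1)"
            by (rule wnorm_mult_le[OF cF]) (use F(2)[of _ "is"] len Cf in auto)
          also have "\<dots> \<le> (Cf * Rf ^ N * fact N) * V" unfolding V_def
            using Cf by (intro mult_left_mono wnorm_power_mono) auto
          also have "\<dots> = (Cf * V) * Rf ^ N * fact N" by (simp only: mult_ac)
          also have "\<dots> \<le> D * K ^ N * fact (N + 2)"
            using D1 K Cf by (intro mult_mono power_mono fact_mono mult_nonneg_nonneg) auto
          finally show ?thesis by (simp add: P_def)
        qed
        ultimately show ?thesis unfolding \<Gamma>_def by (simp only: distrib_right mult_1_left)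
      qed
      \<comment> \<open>The previous order contributes 2 and \<open>\<Gamma>\<close> contributes
        \<open>G + 1\<close> times \<open>P * fact (N + 1)\<close>, which explains
        \<open>3 + G\<close>.\<close>
      have bd: "90 * c / l * (real (N + 2) * (P * fact N) + \<Gamma> / real (N + 2)) \<le> \<gamma> m"
      proof -
        have "\<Gamma> / real (N + 2) = (G + 1) * (P * fact (N + 1))"
          unfolding \<Gamma>_def using fact_reduce[of "N + 2", where ?'a = real] by simp
        moreover have "real (N + 2) * (P * fact N) \<le> 2 * (P * fact (N + 1))"
        proof -
          have "(real (N + 2) * fact N) * P \<le> (2 * fact (N + 1)) * P" by (intro mult_right_mono P) (simp add: algebra_simps)
          then show ?thesis by (simp only: mult_ac)
        qed
        ultimately have "real (N + 2) * (P * fact N) + \<Gamma> / real (N + 2) \<le> (3 + G) * (P * fact (N + 1))"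
          by (simp only: distrib_right)
        then have "90 * c / l * (real (N + 2) * (P * fact N) + \<Gamma> / real (N + 2)) \<le> 90 * c / l * ((3 + G) * (P * fact (N + 1)))"
          using c l by (intro mult_left_mono) auto
        also have "\<dots> = (90 * c / l * (3 + G)) * (P * fact (N + 1))" by (simp only: mult.assoc)
        also have "\<dots> \<le> K * (P * fact (N + 1))" using K(3) P by (intro mult_right_mono) auto
        also have "\<dots> = \<gamma> m" by (simp add: \<gamma>_def P_def N(1) mult_ac)
        finally show ?thesis .
      qed
      have len: "length is = Suc N" using less.prems N(1) by simp
      have g: "0 \<le> P * fact N" "0 \<le> \<Gamma>" using P G by (auto simp: \<Gamma>_def)
      have h1: "wnorm (2 * N + 2) (pds js u) \<le> P * fact N" "wnorm (2 * N + 1) (sqx (pds js u)) \<le> P * fact N" if "length js = N" for js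
        using IH[of js] that gN by auto
      note es = energy_step[OF u Nc g h1 h2 len]
      have e: "2 * m + 2 = 2 * N + 4" "2 * m + 1 = 2 * N + 3" using N(1) by auto
      show ?thesis unfolding e by (rule conjI[OF order.trans[OF es(1) bd] order.trans[OF es(2) bd]])
    qed
  qed
  show thesis
    by (rule that[of D K]) (use D1 K(4) main in \<open>auto simp: \<gamma>_def\<close>)
qed

end

subsection \<open>Pointwise estimates and analyticity\<close>

lemma fact_add_le: "fact (N + n) \<le> (2::real) ^ (N + n) * (fact N * fact n)"
proof -
  have "fact n * fact (N + n - n) * ((N + n) choose n) = (fact (N + n) :: nat)"
    by (rule binomial_fact_lemma) simp
  then have "(fact (N + n) :: real) = fact n * fact N * real ((N + n) choose n)"
    by (metis add_diff_cancel_right' of_nat_fact of_nat_mult)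
  also have "\<dots> \<le> fact n * fact N * 2 ^ (N + n)"
    using of_nat_mono[OF binomial_le_pow2[of "N + n" n], where ?'a = real] by (intro mult_left_mono) auto
  finally show ?thesis by (simp only: mult_ac)
qed

context lens_operator
begin

text \<open>On the cube the weight is bounded below, so the weighted L2 bound controls an L1 norm.
  The price is a power of \<open>1 / \<eta>\<close> that grows geometrically with the order, which
  analyticity tolerates.\<close>

lemma cube_integral_le:
  assumes w: "wcont w" and \<eta>: "0 < \<eta>" and Q: "cube x \<delta> \<subseteq> {y. \<eta> < X y}" and g: "0 < g" "wnorm (2 * m + 2) w \<le> g"
  shows "integral\<^sup>L lborel (\<lambda>y. indicator (cube x \<delta>) y * cmod (w y)) \<le> (1 + measure lborel (wt_supp k0 r)) * (g / \<eta> ^ (m + 1))"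
proof -
  \<comment> \<open>The splitting parameter of the arithmetic-geometric mean; with this value the
    weighted integral contributes at most \<open>h\<close> as well.\<close>
  define h where "h = g / \<eta> ^ (m + 1)"
  have h: "0 < h" using g \<eta> by (simp add: h_def)
  have supp: "cube x \<delta> \<subseteq> wt_supp k0 r" using Q wt_pos(1)[OF \<sigma> r] \<eta> by (fastforce dest: less_trans)
  have iw: "integrable lborel (\<lambda>y. X y ^ (2 * m + 2) * (cmod (w y))\<^sup>2)"
    by (rule wint_integrable[OF cont_sq[OF w]]) simp
  have ii: "integrable lborel (indicator (wt_supp k0 r) :: _ \<Rightarrow> real)"
    using emeasure_lborel_cbox_finite emeasure_compact_finite[OF compact_wt_supp]
    by (intro integrable_real_indicator) (auto intro: borel_compact compact_wt_supp)
  have "integral\<^sup>L lborel (\<lambda>y. indicator (cube x \<delta>) y * cmod (w y))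
    \<le> integral\<^sup>L lborel (\<lambda>y. (1 / (\<eta> ^ (2 * m + 2) * h)) * (X y ^ (2 * m + 2) * (cmod (w y))\<^sup>2) + h * indicator (wt_supp k0 r) y)"
  proof (rule integral_mono)
    show "integrable lborel (\<lambda>y. indicator (cube x \<delta>) y * cmod (w y))"
      by (rule integrable_cube) (use w supp continuous_on_subset in blast)
    show "integrable lborel (\<lambda>y. (1 / (\<eta> ^ (2 * m + 2) * h)) * (X y ^ (2 * m + 2) * (cmod (w y))\<^sup>2) + h * indicator (wt_supp k0 r) y)"
      by (intro Bochner_Integration.integrable_add integrable_mult_right iw ii)
    fix y
    show "indicator (cube x \<delta>) y * cmod (w y) \<le> (1 / (\<eta> ^ (2 * m + 2) * h)) * (X y ^ (2 * m + 2) * (cmod (w y))\<^sup>2) + h * indicator (wt_supp k0 r) y"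
    proof (cases "y \<in> cube x \<delta>")
      case True
      have "2 * 1 * cmod (w y) \<le> h * 1\<^sup>2 + (cmod (w y))\<^sup>2 / h" by (rule amgm_weighted[OF h])
      moreover have "(cmod (w y))\<^sup>2 / h \<le> (1 / (\<eta> ^ (2 * m + 2) * h)) * (X y ^ (2 * m + 2) * (cmod (w y))\<^sup>2)"
      proof -
        have "\<eta> ^ (2 * m + 2) \<le> X y ^ (2 * m + 2)" using True Q \<eta> by (intro power_mono) auto
        then have "\<eta> ^ (2 * m + 2) * (cmod (w y))\<^sup>2 \<le> X y ^ (2 * m + 2) * (cmod (w y))\<^sup>2" by (rule mult_right_mono) simp
        then have "(1 / (\<eta> ^ (2 * m + 2) * h)) * (\<eta> ^ (2 * m + 2) * (cmod (w y))\<^sup>2) \<le> (1 / (\<eta> ^ (2 * m + 2) * h)) * (X y ^ (2 * m + 2) * (cmod (w y))\<^sup>2)"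
          using h \<eta> by (intro mult_left_mono) auto
        then show ?thesis using \<eta> by simp
      qed
      moreover have "0 \<le> (cmod (w y))\<^sup>2 / h" using h by simp
      moreover have "indicator (cube x \<delta>) y = (1::real)" "indicator (wt_supp k0 r) y = (1::real)" using True supp by auto
      ultimately show ?thesis using h by (simp only: mult_1_left mult_1_right one_power2)
    next
      case False
      then have "indicator (cube x \<delta>) y * cmod (w y) = 0" by simp
      also have "0 \<le> (1 / (\<eta> ^ (2 * m + 2) * h)) * (X y ^ (2 * m + 2) * (cmod (w y))\<^sup>2) + h * indicator (wt_supp k0 r) y"
        using h \<eta> by (intro add_nonneg_nonneg mult_nonneg_nonneg divide_nonneg_nonneg wt_power(1)) auto
      finally show ?thesis .
    qed
  qed
  also have "\<dots> = (1 / (\<eta> ^ (2 * m + 2) * h)) * (wnorm (2 * m + 2) w)\<^sup>2 + h * measure lborel (wt_supp k0 r)"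
    using iw ii by (subst Bochner_Integration.integral_add) (auto simp: wnorm_sq wint_def)
  also have "\<dots> \<le> (1 / (\<eta> ^ (2 * m + 2) * h)) * g\<^sup>2 + h * measure lborel (wt_supp k0 r)"
    using h \<eta> g wnorm_nonneg by (intro add_right_mono mult_left_mono power_mono) auto
  also have "(1 / (\<eta> ^ (2 * m + 2) * h)) * g\<^sup>2 = h"
  proof -
    have "\<eta> ^ (2 * m + 2) = (\<eta> ^ (m + 1))\<^sup>2" unfolding power_mult[symmetric] by (rule arg_cong[of _ _ "power \<eta>"]) simp
    moreover have "(1 / (P\<^sup>2 * (g / P))) * g\<^sup>2 = g / P" if "0 < P" for P :: real
      using g that by (simp add: power2_eq_square field_simps)
    ultimately show ?thesis using \<eta> unfolding h_def by simp
  qed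
  also have "h + h * measure lborel (wt_supp k0 r) = (1 + measure lborel (wt_supp k0 r)) * h" by (simp add: algebra_simps)
  finally show ?thesis unfolding h_def .
qed

text \<open>The Sobolev inequality loses \<open>n\<close> derivatives, but
  \<open>fact (N + n)\<close> is at most \<open>2 ^ (N + n)\<close> times the product of the two
  factorials, so the loss is absorbed by enlarging the constants.\<close>

theorem real_analytic_wt_pos:
  assumes u: "smooth_on U u" and Ca: "0 \<le> Ca" "1 \<le> Ra"
    and C: "\<And>a ps x. a \<in> opcoeffs \<Longrightarrow> x \<in> wt_supp k0 r \<Longrightarrow> cmod (pds ps a x) \<le> Ca * Ra ^ length ps * fact (length ps)"
    and Cf: "0 \<le> Cf" "0 \<le> Rf"
    and F: "smooth_on U (Lop u)" "\<And>is x. x \<in> wt_supp k0 r \<Longrightarrow> cmod (pds is (Lop u) x) \<le> Cf * Rf ^ length is * fact (length is)"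
  shows "real_analytic_on {x. 0 < X x} u"
proof (rule real_analytic_onI_bounds[OF U(1) u])
  fix x0 assume "x0 \<in> {x. 0 < X x}"
  then have x0: "0 < X x0" by simp
  obtain D K where DK: "0 < D" "1 \<le> K" "\<And>is. wnorm (2 * length is + 2) (pds is u) \<le> D * K ^ length is * fact (length is)"
    using weighted_Cauchy_estimates[OF u Ca C Cf F] by blast
  \<comment> \<open>Half the value at \<open>x0\<close> bounds the weight from below on a whole
    ball, the same ball for all orders of differentiation.\<close>
  define \<eta> where "\<eta> = X x0 / 2"
  have \<eta>: "0 < \<eta>" "\<eta> \<le> 1" "\<eta> < X x0" using x0 wt_bounds(3)[OF \<sigma> r, of k0 x0] by (auto simp: \<eta>_def)
  have "open {x. \<eta> < X x}" by (intro open_Collect_less continuous_on_const wt_cont)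
  then obtain e where e: "0 < e" "ball x0 e \<subseteq> {x. \<eta> < X x}" using \<eta>(3) open_contains_ball by blast
  have inU: "{x. \<eta> < X x} \<subseteq> U" using wt_pos(1)[OF \<sigma> r] \<eta> U(2) by (fastforce dest: less_trans)
  define n where "n = CARD('n)"
  have n: "0 < n" by (simp add: n_def)
  \<comment> \<open>A cube of this side stays within l1 distance \<open>e / 2\<close> of its corner,
    so cubes with corner in the half ball remain in the ball.\<close>
  define \<delta> where "\<delta> = e / (2 * real n)"
  have \<delta>: "0 < \<delta>" using e n by (simp add: \<delta>_def)
  have cube: "cube x \<delta> \<subseteq> {x. \<eta> < X x}" if x: "x \<in> ball x0 (e / 2)" for x
  proof
    fix y assume y: "y \<in> cube x \<delta>"
    have "norm (y - x) \<le> (\<Sum>i\<in>UNIV. \<bar>(y - x) $ i\<bar>)" by (rule norm_le_l1_cart)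
    also have "\<dots> \<le> (\<Sum>i\<in>(UNIV::'n set). \<delta>)"
    proof (rule sum_mono)
      fix i :: 'n
      have "x $ i \<le> y $ i" "y $ i \<le> x $ i + \<delta>" using y by (auto simp: cube_def)
      then show "\<bar>(y - x) $ i\<bar> \<le> \<delta>" by simp
    qed
    also have "\<dots> = e / 2" using n by (simp add: \<delta>_def n_def)
    finally have "dist x y \<le> e / 2" by (simp add: dist_norm norm_minus_commute)
    then have "dist x0 y < e" using x dist_triangle[of x0 y x] by simp
    then show "y \<in> {x. \<eta> < X x}" using e(2) by auto
  qed
  define V where "V = 1 + measure lborel (wt_supp k0 r)"
  have V: "1 \<le> V" by (simp add: V_def)
  define H where "H = 2 * K / \<eta>"
  define C1 where "C1 = (1 + 2 / \<delta>) ^ n * (V * D / \<eta> * H ^ n * fact n)"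
  have bd: "cmod (pds is u x) \<le> C1 * H ^ length is * fact (length is)" if x: "x \<in> ball x0 (e / 2)" for x "is"
  proof -
    define N where "N = length is"
    define \<beta> where "\<beta> = V * D / \<eta> * H ^ (N + n) * (fact N * fact n)"
    have "cmod (pds is u x) \<le> (1 + 2 / \<delta>) ^ CARD('n) * \<beta>"
    proof (rule sobolev_cube[OF U(1) order.trans[OF cube[OF x] inU] \<delta> smooth_on_pds[OF u]])
      fix js :: "'n list" assume js: "length js \<le> CARD('n)"
      define m where "m = length (js @ is)"
      have m: "m \<le> N + n" using js by (simp add: m_def N_def n_def)
      have wc: "wcont (pds (js @ is) u)" using smooth_on_cont[OF u] U continuous_on_subset by blast
      have "integral\<^sup>L lborel (\<lambda>y. indicator (cube x \<delta>) y * cmod (pds (js @ is) u y)) \<le> V * (D * K ^ m * fact m / \<eta> ^ (m + 1))"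
        unfolding V_def
      proof (rule cube_integral_le[OF wc \<eta>(1) cube[OF x]])
        show "0 < D * K ^ m * fact m" using DK(1,2) by simp
        show "wnorm (2 * m + 2) (pds (js @ is) u) \<le> D * K ^ m * fact m" unfolding m_def by (rule DK(3))
      qed
      also have "\<dots> \<le> V * (D * K ^ (N + n) * fact (N + n) / \<eta> ^ (N + n + 1))"
        using V DK m \<eta> by (intro mult_left_mono frac_le mult_mono power_increasing fact_mono power_decreasing mult_nonneg_nonneg) auto
      also have "\<dots> \<le> V * (D * K ^ (N + n) * (2 ^ (N + n) * (fact N * fact n)) / \<eta> ^ (N + n + 1))"
        using V DK \<eta> by (intro mult_left_mono divide_right_mono fact_add_le) auto
      also have "\<dots> = \<beta>" unfolding \<beta>_def H_def by (simp add: power_mult_distrib power_divide)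
      finally show "integral\<^sup>L lborel (\<lambda>y. indicator (cube x \<delta>) y * cmod (pds js (pds is u) y)) \<le> \<beta>"
        by (simp add: pds_append)
    qed
    also have "\<dots> = C1 * H ^ N * fact N" unfolding \<beta>_def C1_def n_def by (simp only: power_add mult_ac)
    finally show ?thesis by (simp add: N_def)
  qed
  show "\<exists>\<rho>>0. \<exists>C K. ball x0 \<rho> \<subseteq> U \<and> (\<forall>is. \<forall>x\<in>ball x0 \<rho>. cmod (pds is u x) \<le> C * K ^ length is * fact (length is))"
  proof (intro exI conjI allI ballI)
    show "0 < e / 2" using e by simp
    show "ball x0 (e / 2) \<subseteq> U" using subset_ball[of "e / 2" e x0] e inU by auto
  qed (rule bd)
qed

end

section \<open>Stability of Cauchy bounds under linear combinations\<close>

lemma pds_cmult: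
  assumes U: "open U" and f: "smooth_on U f"
  shows "x \<in> U \<Longrightarrow> pds is (\<lambda>x. a * f x) x = a * pds is f x"
proof (induction "is" arbitrary: x)
  case (Cons i "is")
  have "pds (i # is) (\<lambda>x. a * f x) x = pd i (\<lambda>x. a * pds is f x) x"
    unfolding pds.simps by (rule pd_cong[OF U Cons.prems Cons.IH])
  also have "\<dots> = 0 * pds is f x + a * pds (i # is) f x"
    by (intro hpd_imp_pd hpd_mult hpd_const smooth_on_hpd[OF f Cons.prems])
  finally show ?case by simp
qed simp

lemma cauchy_bound_mono: "0 \<le> C \<Longrightarrow> C \<le> C' \<Longrightarrow> 0 \<le> R \<Longrightarrow> R \<le> R' \<Longrightarrow> C * R ^ n * fact n \<le> C' * R' ^ n * (fact n :: real)"
  by (intro mult_right_mono mult_mono power_mono) auto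

lemma cauchy_bounded_cmult:
  assumes U: "open U" "K \<subseteq> U" and f: "smooth_on U f" "cauchy_bounded K f"
  shows "cauchy_bounded K (\<lambda>x. a * f x)"
proof -
  obtain C R where C: "0 < C" "0 < R" "\<And>is x. x \<in> K \<Longrightarrow> cmod (pds is f x) \<le> C * R ^ length is * fact (length is)"
    using f(2) unfolding cauchy_bounded_def by blast
  have "cmod (pds is (\<lambda>x. a * f x) x) \<le> ((cmod a + 1) * C) * R ^ length is * fact (length is)" if "x \<in> K" for "is" x
  proof -
    have "cmod (pds is (\<lambda>x. a * f x) x) = cmod a * cmod (pds is f x)"
      using pds_cmult[OF U(1) f(1)] that U(2) by (simp add: norm_mult subset_iff)
    also have "\<dots> \<le> (cmod a + 1) * (C * R ^ length is * fact (length is))"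
      using C(3)[OF that] by (intro mult_mono) auto
    finally show ?thesis by (simp only: mult.assoc)
  qed
  moreover have "0 < (cmod a + 1) * C" using C(1) by (intro mult_pos_pos) (auto intro: add_nonneg_pos)
  ultimately show ?thesis unfolding cauchy_bounded_def using C(2) by blast
qed

lemma cauchy_bounded_add:
  assumes U: "open U" "K \<subseteq> U" and f: "smooth_on U f" "cauchy_bounded K f" and g: "smooth_on U g" "cauchy_bounded K g"
  shows "cauchy_bounded K (\<lambda>x. f x + g x)"
proof -
  obtain C R where C: "0 < C" "0 < R" "\<And>is x. x \<in> K \<Longrightarrow> cmod (pds is f x) \<le> C * R ^ length is * fact (length is)"
    using f(2) unfolding cauchy_bounded_def by blast
  obtain C' R' where C': "0 < C'" "0 < R'" "\<And>is x. x \<in> K \<Longrightarrow> cmod (pds is g x) \<le> C' * R' ^ length is * fact (length is)"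
    using g(2) unfolding cauchy_bounded_def by blast
  have "cmod (pds is (\<lambda>x. f x + g x) x) \<le> (C + C') * max R R' ^ length is * fact (length is)" if "x \<in> K" for "is" x
  proof -
    have "cmod (pds is (\<lambda>x. f x + g x) x) \<le> cmod (pds is f x) + cmod (pds is g x)"
      using pds_add[OF U(1) f(1) g(1)] that U(2) by (simp add: norm_triangle_ineq subset_iff)
    also have "\<dots> \<le> C * max R R' ^ length is * fact (length is) + C' * max R R' ^ length is * fact (length is)"
      by (rule add_mono[OF order.trans[OF C(3)[OF that] cauchy_bound_mono] order.trans[OF C'(3)[OF that] cauchy_bound_mono]])
        (use C C' in auto)
    finally show ?thesis by (simp only: distrib_right)
  qed
  moreover have "0 < C + C'" "0 < max R R'" using C C' by auto
  ultimately show ?thesis unfolding cauchy_bounded_def by blast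
qed

lemma cauchy_bounded_uniform:
  assumes "finite S" "\<And>f. f \<in> S \<Longrightarrow> cauchy_bounded K f"
  obtains C R where "0 \<le> C" "1 \<le> R"
    "\<And>f is x. f \<in> S \<Longrightarrow> x \<in> K \<Longrightarrow> cmod (pds is f x) \<le> C * R ^ length is * fact (length is)"
proof -
  have "\<exists>C R. 0 \<le> C \<and> 1 \<le> R \<and> (\<forall>f\<in>S. \<forall>is. \<forall>x\<in>K. cmod (pds is f x) \<le> C * R ^ length is * fact (length is))"
    using assms
  proof (induction S)
    case (insert f S)
    obtain C R where C: "0 \<le> C" "1 \<le> R" "\<And>f is x. f \<in> S \<Longrightarrow> x \<in> K \<Longrightarrow> cmod (pds is f x) \<le> C * R ^ length is * fact (length is)"
      using insert.IH[OF insert.prems] by auto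
    obtain C' R' where C': "0 < C'" "0 < R'" "\<And>is x. x \<in> K \<Longrightarrow> cmod (pds is f x) \<le> C' * R' ^ length is * fact (length is)"
      using insert.prems[of f] unfolding cauchy_bounded_def by blast
    have "cmod (pds is g x) \<le> max C C' * max R R' ^ length is * fact (length is)" if "g \<in> insert f S" "x \<in> K" for g "is" x
    proof (cases "g = f")
      case True
      show ?thesis unfolding True by (rule order.trans[OF C'(3)[OF that(2)] cauchy_bound_mono]) (use C' in auto)
    next
      case False
      then show ?thesis using that by (intro order.trans[OF C(3) cauchy_bound_mono]) (use C in auto)
    qed
    moreover have "0 \<le> max C C'" "1 \<le> max R R'" using C by auto
    ultimately show ?case by blast
  qed (auto intro!: exI[of _ 1])
  then show thesis using that by blast
qed

section \<open>From a nonvanishing form to a definite one\<close>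

text \<open>Two unit vectors with opposite signs are joined by a segment in \<open>S\<close> on
  which the form must vanish somewhere. If it does so at the origin, the two vectors are
  antiparallel, and evenness of the form gives them the same sign. Segments also cover a
  one-dimensional \<open>S\<close>, whose unit sphere is disconnected.\<close>

lemma definite_of_nonvanishing:
  fixes \<Phi> :: "'a::euclidean_space \<Rightarrow> real"
  assumes S: "subspace S" and hom: "\<And>s \<xi>. \<Phi> (s *\<^sub>R \<xi>) = s\<^sup>2 * \<Phi> \<xi>" and cont: "continuous_on UNIV \<Phi>"
    and nz: "\<And>\<xi>. \<xi> \<in> S \<Longrightarrow> \<xi> \<noteq> 0 \<Longrightarrow> \<Phi> \<xi> \<noteq> 0"
  obtains \<sigma> l where "\<sigma> = 1 \<or> \<sigma> = -1" "0 < l" "\<And>\<xi>. \<xi> \<in> S \<Longrightarrow> l * (norm \<xi>)\<^sup>2 \<le> \<sigma> * \<Phi> \<xi>"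
proof -
  define C where "C = sphere 0 1 \<inter> S"
  have C: "compact C" unfolding C_def using S by (intro compact_Int_closed compact_sphere closed_subspace)
  have scale: "l * (norm \<xi>)\<^sup>2 \<le> \<sigma> * \<Phi> \<xi>" if "\<xi> \<in> S" "\<And>\<eta>. \<eta> \<in> C \<Longrightarrow> l \<le> \<sigma> * \<Phi> \<eta>" for \<xi> l \<sigma>
  proof (cases "\<xi> = 0")
    case True
    then show ?thesis using hom[of 0 0] by simp
  next
    case False
    define \<eta> where "\<eta> = (1 / norm \<xi>) *\<^sub>R \<xi>"
    have "\<eta> \<in> C" using False that(1) subspace_scale[OF S] by (auto simp: \<eta>_def C_def)
    moreover have "\<xi> = norm \<xi> *\<^sub>R \<eta>" using False by (simp add: \<eta>_def)
    then have "\<Phi> \<xi> = (norm \<xi>)\<^sup>2 * \<Phi> \<eta>" by (metis hom)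
    ultimately show ?thesis using mult_left_mono[OF that(2), of \<eta> "(norm \<xi>)\<^sup>2"] by (simp add: mult_ac)
  qed
  show thesis
  proof (cases "C = {}")
    \<comment> \<open>\<open>S\<close> is trivial, as happens in dimension one; any sign
      works.\<close>
    case True
    then show thesis using that[of 1 1] scale[of _ 1 1] by auto
  next
    case False
    then obtain \<xi>0 where \<xi>0: "\<xi>0 \<in> C" by blast
    define \<sigma> where "\<sigma> = sgn (\<Phi> \<xi>0)"
    have nzC: "\<Phi> \<xi> \<noteq> 0" if "\<xi> \<in> C" for \<xi> by (rule nz) (use that in \<open>auto simp: C_def\<close>)
    have \<sigma>: "\<sigma> = 1 \<or> \<sigma> = -1" "0 < \<sigma> * \<Phi> \<xi>0" using nzC[OF \<xi>0] by (auto simp: \<sigma>_def sgn_if)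
    have pos: "0 < \<sigma> * \<Phi> \<eta>" if \<eta>: "\<eta> \<in> C" for \<eta>
    proof (rule ccontr)
      assume "\<not> ?thesis"
      then have neg: "\<sigma> * \<Phi> \<eta> < 0" using nzC[OF \<eta>] \<sigma>(1) by (auto simp: not_less le_less)
      define g where "g t = \<sigma> * \<Phi> ((1 - t) *\<^sub>R \<xi>0 + t *\<^sub>R \<eta>)" for t
      have "continuous_on {0..1} g" unfolding g_def
        by (intro continuous_intros continuous_on_compose2[OF cont]) auto
      then obtain t where t: "0 \<le> t" "t \<le> 1" "g t = 0"
        using IVT2'[of g 1 0 0] neg \<sigma>(2) by (auto simp: g_def)
      have "(1 - t) *\<^sub>R \<xi>0 + t *\<^sub>R \<eta> \<in> S"
        using \<xi>0 \<eta> by (intro subspace_add[OF S] subspace_scale[OF S]) (auto simp: C_def)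
      then have "(1 - t) *\<^sub>R \<xi>0 + t *\<^sub>R \<eta> = 0" using t(3) nz \<sigma>(1) by (auto simp: g_def)
      then have "(1 - t) *\<^sub>R \<xi>0 = (- t) *\<^sub>R \<eta>" by (simp add: eq_neg_iff_add_eq_0)
      \<comment> \<open>Since \<open>(- t)\<^sup>2 = t\<^sup>2\<close>, the two values are compared
        with nonnegative factors that are not both 0.\<close>
      then have e: "(1 - t)\<^sup>2 * \<Phi> \<xi>0 = t\<^sup>2 * \<Phi> \<eta>" by (metis hom power2_minus)
      then have "(1 - t)\<^sup>2 * (\<sigma> * \<Phi> \<xi>0) = t\<^sup>2 * (\<sigma> * \<Phi> \<eta>)" by (simp add: mult.left_commute)
      moreover have "0 \<le> (1 - t)\<^sup>2 * (\<sigma> * \<Phi> \<xi>0)" "t\<^sup>2 * (\<sigma> * \<Phi> \<eta>) \<le> 0"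
        using \<sigma>(2) neg by (auto simp: mult_nonneg_nonpos)
      ultimately have "(1 - t)\<^sup>2 * (\<sigma> * \<Phi> \<xi>0) = 0" "t\<^sup>2 * (\<sigma> * \<Phi> \<eta>) = 0" by linarith+
      then show False using \<sigma>(2) neg by auto
    qed
    obtain \<eta>0 where \<eta>0: "\<eta>0 \<in> C" "\<And>\<eta>. \<eta> \<in> C \<Longrightarrow> \<sigma> * \<Phi> \<eta>0 \<le> \<sigma> * \<Phi> \<eta>"
      using continuous_attains_inf[OF C False, of "\<lambda>\<eta>. \<sigma> * \<Phi> \<eta>"] cont
      by (auto intro: continuous_on_mult_left continuous_on_subset)
    show thesis by (rule that[OF \<sigma>(1) pos[OF \<eta>0(1)] scale[OF _ \<eta>0(2)]])
  qed
qed

subsection \<open>Reduction to the symmetric operator\<close>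

text \<open>Symmetrisation changes neither the symbol nor the action on smooth functions. The
  entries with index \<open>k0\<close> are set to 0 so that symmetry and reality hold for all
  indices, as the locale demands.\<close>

definition sym_coeff :: "'n \<Rightarrow> ('n \<Rightarrow> 'n \<Rightarrow> real^'n::finite \<Rightarrow> complex) \<Rightarrow> 'n \<Rightarrow> 'n \<Rightarrow> real^'n \<Rightarrow> complex" where
  "sym_coeff k0 q j k = (if j = k0 \<or> k = k0 then (\<lambda>x. 0) else (\<lambda>x. (1 / 2) * (q j k x + q k j x)))"

lemma sum_sym_coeff:
  assumes "\<And>j k. j \<in> UNIV - {k0} \<Longrightarrow> k \<in> UNIV - {k0} \<Longrightarrow> h j k = h k j"
  shows "(\<Sum>j\<in>UNIV - {k0}. \<Sum>k\<in>UNIV - {k0}. sym_coeff k0 q j k x * h j k) = (\<Sum>j\<in>UNIV - {k0}. \<Sum>k\<in>UNIV - {k0}. q j k x * h j k)"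
proof -
  let ?T = "UNIV - {k0}"
  have "(\<Sum>j\<in>?T. \<Sum>k\<in>?T. sym_coeff k0 q j k x * h j k) = (\<Sum>j\<in>?T. \<Sum>k\<in>?T. (1 / 2) * (q j k x * h j k) + (1 / 2) * (q k j x * h k j))"
    by (intro sum.cong refl) (auto simp: sym_coeff_def algebra_simps assms)
  also have "\<dots> = (1 / 2) * (\<Sum>j\<in>?T. \<Sum>k\<in>?T. q j k x * h j k) + (1 / 2) * (\<Sum>j\<in>?T. \<Sum>k\<in>?T. q k j x * h k j)"
    by (simp only: sum.distrib sum_distrib_left)
  also have "(\<Sum>j\<in>?T. \<Sum>k\<in>?T. q k j x * h k j) = (\<Sum>j\<in>?T. \<Sum>k\<in>?T. q j k x * h j k)"
    by (rule sum.swap)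
  finally show ?thesis by simp
qed

lemma prin_symbol_sym_coeff: "prin_symbol k0 (sym_coeff k0 q) x \<xi> = prin_symbol k0 q x \<xi>"
  unfolding prin_symbol_def by (rule sum_sym_coeff) (simp add: mult.commute)

lemma prin_symbol_axis:
  assumes "j \<noteq> k0" "k \<noteq> k0"
  shows "prin_symbol k0 q x (axis j s + axis k t) = q j j x * of_real (s * s) + q k k x * of_real (t * t) + (q j k x + q k j x) * of_real (s * t)"
proof -
  have ax: "(axis j s + axis k t) $ i = (if i = j then s else 0) + (if i = k then t else 0)" for i :: 'a
    by (simp add: axis_def)
  show ?thesis unfolding prin_symbol_def ax using assms
    by (simp add: algebra_simps sum.distrib if_distrib[of complex_of_real] if_distrib[of "\<lambda>y. _ * y"] sum.delta' cong: if_cong)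
qed

text \<open>Polarisation: the values of the symbol at \<open>e\<^sub>j + e\<^sub>k\<close> and
  \<open>e\<^sub>j - e\<^sub>k\<close> differ by twice the sum of the two mixed coefficients. That
  sum is real although each coefficient by itself may be complex.\<close>

lemma sym_coeff_real:
  assumes "\<And>\<xi>. Im (prin_symbol k0 q x \<xi>) = 0"
  shows "Im (sym_coeff k0 q j k x) = 0"
proof (cases "j = k0 \<or> k = k0")
  case False
  then have jk: "j \<noteq> k0" "k \<noteq> k0" by auto
  show ?thesis
    using assms[of "axis j 1 + axis k 1"] assms[of "axis j 1 + axis k (-1)"] jk
    by (simp add: sym_coeff_def prin_symbol_axis)
qed (simp add: sym_coeff_def)

text \<open>Transfers ellipticity from real covectors to complex gradients: products of a real with
  an imaginary part are imaginary and drop out. Both covectors have entry 0 at \<open>k0\<close>,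
  where the ellipticity bound applies.\<close>

lemma Re_hermitian_form:
  assumes "\<And>j k. Im (Q j k x) = 0"
  shows "Re (\<Sum>j\<in>UNIV - {k0}. \<Sum>k\<in>UNIV - {k0}. Q j k x * z k * cnj (z j))
    = Re (prin_symbol k0 Q x (vec_lambda (\<lambda>j. if j = k0 then 0 else Re (z j))))
      + Re (prin_symbol k0 Q x (vec_lambda (\<lambda>j. if j = k0 then 0 else Im (z j))))"
  unfolding prin_symbol_def Re_sum sum.distrib[symmetric]
  by (intro sum.cong refl) (auto simp: assms algebra_simps)

text \<open>\<open>Dop\<close> is \<open>- \<i>\<close> times \<open>pd\<close>, so two factors give
  a minus sign and one gives \<open>- \<i>\<close>. The overall sign is reversed to let the second
  order part read \<open>x\<^sub>1 \<partial>\<^sub>1\<^sup>2 + Q\<close> in plain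
  derivatives.\<close>

lemma Pop_eq:
  assumes U: "open U" and u: "smooth_on U u" and x: "x \<in> U"
  shows "complex_of_real (x $ k0) * pd k0 (pd k0 u) x + (\<Sum>j\<in>UNIV - {k0}. \<Sum>k\<in>UNIV - {k0}. sym_coeff k0 q j k x * pd j (pd k u) x)
     + (\<i> * a x) * pd k0 u x + (\<Sum>j\<in>UNIV - {k0}. (\<i> * b j x) * pd j u x) + (-1 * c x) * u x = - 1 * Pop k0 a q b c u x"
proof -
  have D1: "Dop i f = (\<lambda>x. - \<i> * pd i f x)" for i f by (rule ext) (simp add: Dop_def)
  have D2: "Dop i (Dop j u) x = - pd i (pd j u) x" for i j
  proof -
    have "pd i (\<lambda>x. - \<i> * pd j u x) x = - \<i> * pd i (pd j u) x"
      using pds_cmult[OF U smooth_on_pd[OF u] x, of "[i]" "- \<i>" j] by simp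
    then show ?thesis unfolding D1 by simp
  qed
  have "(\<Sum>j\<in>UNIV - {k0}. \<Sum>k\<in>UNIV - {k0}. sym_coeff k0 q j k x * pd j (pd k u) x)
    = (\<Sum>j\<in>UNIV - {k0}. \<Sum>k\<in>UNIV - {k0}. q j k x * pd j (pd k u) x)"
    by (rule sum_sym_coeff) (rule pd_commute[OF U u x])
  then show ?thesis
    unfolding Pop_def D2 by (simp add: D1 sum_negf mult_ac)
qed

lemma norm_sq_split: "(norm x)\<^sup>2 = (x $ k0)\<^sup>2 + (\<Sum>j\<in>UNIV - {k0}. (x $ j)\<^sup>2)" for x :: "real^'n::finite"
proof -
  have "(norm x)\<^sup>2 = (\<Sum>i\<in>UNIV. (x $ i)\<^sup>2)"
    by (simp add: norm_vec_def L2_set_def sum_nonneg)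
  also have "\<dots> = (x $ k0)\<^sup>2 + (\<Sum>j\<in>UNIV - {k0}. (x $ j)\<^sup>2)" by (rule sum.remove) auto
  finally show ?thesis .
qed

lemma wt_supp_subset_cball:
  assumes "0 < r" "r \<le> 1"
  shows "wt_supp k0 r \<subseteq> cball 0 (2 * r)"
proof
  fix x assume x: "x \<in> wt_supp k0 r"
  have "(norm x)\<^sup>2 = (x $ k0)\<^sup>2 + (\<Sum>j\<in>UNIV - {k0}. (x $ j)\<^sup>2)" by (rule norm_sq_split)
  also have "\<dots> \<le> r\<^sup>2 + r\<^sup>2"
  proof (rule add_mono)
    have "\<bar>x $ k0\<bar> \<le> r ^ 4" using x by (simp add: wt_supp_def)
    also have "\<dots> \<le> r ^ 1" using assms by (intro power_decreasing) auto
    finally show "(x $ k0)\<^sup>2 \<le> r\<^sup>2" using assms by (simp add: abs_le_square_iff[symmetric])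
  qed (use x in \<open>simp add: wt_supp_def\<close>)
  also have "\<dots> \<le> (2 * r)\<^sup>2" by (simp add: power_mult_distrib)
  finally have "norm x \<le> 2 * r" using assms by (intro power2_le_imp_le[of "norm x"]) auto
  then show "x \<in> cball 0 (2 * r)" by simp
qed

text \<open>Definiteness is extracted at 0 alone, and half of the constant is given away to the
  variation of the coefficients on a small ball. The cap at 1 is what the energy inequality assumes
  about \<open>l\<close>.\<close>

lemma elliptic_near_0:
  fixes U :: "(real^'n::finite) set"
  assumes U: "open U" "0 \<in> U" and q: "\<And>j k. continuous_on U (q j k)"
    and re: "\<And>\<xi>. Im (prin_symbol k0 q 0 \<xi>) = 0"
    and nz: "\<And>\<xi>. \<xi> $ k0 = 0 \<Longrightarrow> \<xi> \<noteq> 0 \<Longrightarrow> prin_symbol k0 q 0 \<xi> \<noteq> 0"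
  obtains \<sigma> l \<rho> where "\<sigma> = 1 \<or> \<sigma> = -1" "0 < l" "l \<le> 1" "0 < \<rho>" "cball 0 \<rho> \<subseteq> U"
    "\<And>x \<xi>. x \<in> cball 0 \<rho> \<Longrightarrow> \<xi> $ k0 = 0 \<Longrightarrow> l * (norm \<xi>)\<^sup>2 \<le> \<sigma> * Re (prin_symbol k0 q x \<xi>)"
proof -
  define \<Phi> where "\<Phi> \<xi> = Re (prin_symbol k0 q 0 \<xi>)" for \<xi>
  have "subspace {\<xi>::real^'n. \<xi> $ k0 = 0}" by (auto simp: subspace_def)
  moreover have "\<Phi> (s *\<^sub>R \<xi>) = s\<^sup>2 * \<Phi> \<xi>" for s \<xi>
    by (simp add: \<Phi>_def prin_symbol_def sum_distrib_left power2_eq_square mult_ac)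
  moreover have "continuous_on UNIV \<Phi>" unfolding \<Phi>_def prin_symbol_def by (intro continuous_intros)
  moreover have "\<Phi> \<xi> \<noteq> 0" if "\<xi> \<in> {\<xi>. \<xi> $ k0 = 0}" "\<xi> \<noteq> 0" for \<xi>
    using re[of \<xi>] nz[of \<xi>] that by (auto simp: \<Phi>_def complex_eq_iff)
  ultimately obtain \<sigma> l where \<sigma>: "\<sigma> = 1 \<or> \<sigma> = -1" and l: "0 < l"
    and ell: "\<And>\<xi>. \<xi> \<in> {\<xi>. \<xi> $ k0 = 0} \<Longrightarrow> l * (norm \<xi>)\<^sup>2 \<le> \<sigma> * \<Phi> \<xi>"
    using definite_of_nonvanishing[of "{\<xi>. \<xi> $ k0 = 0}" \<Phi>] by blast
  define E where "E x = (\<Sum>j\<in>UNIV - {k0}. \<Sum>k\<in>UNIV - {k0}. cmod (q j k x - q j k 0))" for x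
  have "continuous_on U E" unfolding E_def by (intro continuous_intros q)
  then have "isCont E 0" using U by (simp add: continuous_on_eq_continuous_at)
  then obtain d where d: "0 < d" "\<And>x. dist x 0 < d \<Longrightarrow> dist (E x) (E 0) < l / 2"
    using l unfolding continuous_at_eps_delta by (meson half_gt_zero)
  obtain e where e: "0 < e" "ball 0 e \<subseteq> U" using U open_contains_ball by blast
  define \<rho> where "\<rho> = min d e / 2"
  have \<rho>: "0 < \<rho>" "\<rho> < d" "\<rho> < e" using d e by (auto simp: \<rho>_def)
  show thesis
  proof (rule that[OF \<sigma>, of "min 1 (l / 2)" \<rho>])
    show "cball 0 \<rho> \<subseteq> U" using \<rho>(3) e(2) by (auto simp: subset_iff)
    fix x \<xi> :: "real^'n" assume x: "x \<in> cball 0 \<rho>" and \<xi>: "\<xi> $ k0 = 0"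
    have "E x < l / 2" using d(2)[of x] x \<rho>(2) by (simp add: E_def dist_norm)
    have "\<bar>Re (prin_symbol k0 q x \<xi>) - \<Phi> \<xi>\<bar> \<le> cmod (prin_symbol k0 q x \<xi> - prin_symbol k0 q 0 \<xi>)"
      unfolding \<Phi>_def minus_complex.sel[symmetric] by (rule abs_Re_le_cmod)
    also have "prin_symbol k0 q x \<xi> - prin_symbol k0 q 0 \<xi>
      = (\<Sum>j\<in>UNIV - {k0}. \<Sum>k\<in>UNIV - {k0}. (q j k x - q j k 0) * complex_of_real (\<xi> $ j * \<xi> $ k))"
      unfolding prin_symbol_def by (simp only: sum_subtractf left_diff_distrib)
    also have "cmod \<dots> \<le> (\<Sum>j\<in>UNIV - {k0}. \<Sum>k\<in>UNIV - {k0}. cmod (q j k x - q j k 0) * (norm \<xi>)\<^sup>2)"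
    proof (intro sum_norm_le)
      fix j k
      have "\<bar>\<xi> $ j\<bar> * \<bar>\<xi> $ k\<bar> \<le> norm \<xi> * norm \<xi>" by (intro mult_mono component_le_norm_cart) auto
      then show "cmod ((q j k x - q j k 0) * complex_of_real (\<xi> $ j * \<xi> $ k)) \<le> cmod (q j k x - q j k 0) * (norm \<xi>)\<^sup>2"
        unfolding norm_mult norm_of_real abs_mult power2_eq_square by (intro mult_left_mono) auto
    qed
    also have "\<dots> = E x * (norm \<xi>)\<^sup>2" by (simp only: E_def sum_distrib_right)
    also have "\<dots> \<le> l / 2 * (norm \<xi>)\<^sup>2" using \<open>E x < l / 2\<close> by (intro mult_right_mono) auto
    finally have "\<bar>Re (prin_symbol k0 q x \<xi>) - \<Phi> \<xi>\<bar> \<le> l / 2 * (norm \<xi>)\<^sup>2" .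
    moreover have "l * (norm \<xi>)\<^sup>2 \<le> \<sigma> * \<Phi> \<xi>" using ell \<xi> by simp
    moreover have "l * (norm \<xi>)\<^sup>2 = l / 2 * (norm \<xi>)\<^sup>2 + l / 2 * (norm \<xi>)\<^sup>2" by simp
    moreover have "min 1 (l / 2) * (norm \<xi>)\<^sup>2 \<le> l / 2 * (norm \<xi>)\<^sup>2" by (intro mult_right_mono) auto
    ultimately show "min 1 (l / 2) * (norm \<xi>)\<^sup>2 \<le> \<sigma> * Re (prin_symbol k0 q x \<xi>)"
      using \<sigma> by (elim disjE) (simp_all only: mult_1_left mult_minus1 abs_le_iff; linarith)+
  qed (use l \<rho> in auto)
qed

theorem theorem1:
  fixes U :: "(real^'n::finite) set" and k0 :: 'n
    and a :: "real^'n \<Rightarrow> complex"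
    and q :: "'n \<Rightarrow> 'n \<Rightarrow> real^'n \<Rightarrow> complex"
    and b :: "'n \<Rightarrow> real^'n \<Rightarrow> complex"
    and c :: "real^'n \<Rightarrow> complex"
  assumes "open U" and "0 \<in> U"
    and "real_analytic_on U a"
    and "\<And>j k. real_analytic_on U (q j k)"
    and "\<And>j. real_analytic_on U (b j)"
    and "real_analytic_on U c"
    and "\<And>x \<xi>. x \<in> U \<Longrightarrow> Im (prin_symbol k0 q x \<xi>) = 0"
    and "\<And>x \<xi>. x \<in> U \<Longrightarrow> \<xi>$k0 = 0 \<Longrightarrow> \<xi> \<noteq> 0 \<Longrightarrow> prin_symbol k0 q x \<xi> \<noteq> 0"
  shows "\<exists>U'. open U' \<and> 0 \<in> U' \<and> U' \<subseteq> U \<and>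
           (\<forall>u. smooth_on U u \<and> real_analytic_on U (Pop k0 a q b c u)
                \<longrightarrow> real_analytic_on U' u)"
proof -
  note opU = assms(1)
  note an = assms(3-6)
  note sm = an[THEN real_analytic_imp_smooth[OF opU]]
  have "continuous_on U (q j k)" for j k using smooth_on_cont[OF sm(2), of "[]"] by simp
  from elliptic_near_0[OF opU assms(2) this assms(7)[OF assms(2)] assms(8)[OF assms(2)]]
  obtain \<sigma> l \<rho> where \<sigma>: "\<sigma> = 1 \<or> \<sigma> = -1" and l: "0 < l" "l \<le> 1" and \<rho>: "0 < \<rho>" "cball 0 \<rho> \<subseteq> U"
    and ell: "\<And>x \<xi>. x \<in> cball 0 \<rho> \<Longrightarrow> \<xi> $ k0 = 0 \<Longrightarrow> l * (norm \<xi>)\<^sup>2 \<le> \<sigma> * Re (prin_symbol k0 q x \<xi>)"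
    by blast
  define A where "A = (\<lambda>x. \<i> * a x)"
  define B where "B = (\<lambda>j x. \<i> * b j x)"
  define Cc where "Cc = (\<lambda>x. -1 * c x)"
  define Q where "Q = sym_coeff k0 q"
  note cm = smooth_on_mult[OF opU smooth_on_const]
  have smooth: "smooth_on U A" "smooth_on U Cc" "smooth_on U (Q j k)" "smooth_on U (B j)" for j k
  proof -
    show "smooth_on U A" "smooth_on U Cc" "smooth_on U (B j)" unfolding A_def B_def Cc_def by (intro cm sm)+
    have "smooth_on U (\<lambda>x. (1 / 2) * (q j k x + q k j x))" by (intro cm sm smooth_on_add[OF opU])
    then show "smooth_on U (Q j k)" unfolding Q_def sym_coeff_def using smooth_on_const[of U 0] by presburger
  qed
  have cb: "cauchy_bounded (cball 0 \<rho>) f" if "real_analytic_on U f" for f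
    using real_analytic_imp_cauchy_bounded[OF that compact_cball \<rho>(2)] .
  define S where "S = insert A (insert Cc (range B \<union> (\<Union>j. range (Q j))))"
  have "cauchy_bounded (cball 0 \<rho>) f" if "f \<in> S" for f
  proof -
    note cbi = cauchy_bounded_cmult[OF opU \<rho>(2)] cauchy_bounded_add[OF opU \<rho>(2)] sm smooth_on_add[OF opU] cb[OF an(1)] cb[OF an(2)] cb[OF an(3)] cb[OF an(4)]
    have "cauchy_bounded (cball 0 \<rho>) A" "cauchy_bounded (cball 0 \<rho>) Cc" "cauchy_bounded (cball 0 \<rho>) (B j)" for j
      unfolding A_def B_def Cc_def by (intro cbi)+
    moreover have "cauchy_bounded (cball 0 \<rho>) (Q j k)" for j k
    proof -
      \<comment> \<open>The entries with index \<open>k0\<close> are the zero function, obtained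
        here as a multiple of \<open>c\<close>.\<close>
      have "cauchy_bounded (cball 0 \<rho>) (\<lambda>x. 0 * c x)" "cauchy_bounded (cball 0 \<rho>) (\<lambda>x. (1 / 2) * (q j k x + q k j x))" by (intro cbi)+
      then show ?thesis unfolding Q_def sym_coeff_def mult_zero_left by presburger
    qed
    ultimately show ?thesis using that unfolding S_def by blast
  qed
  moreover have "finite S" by (simp add: S_def)
  ultimately obtain Ca Ra where Ca: "0 \<le> Ca" "1 \<le> Ra"
    and C: "\<And>f is x. f \<in> S \<Longrightarrow> x \<in> cball 0 \<rho> \<Longrightarrow> cmod (pds is f x) \<le> Ca * Ra ^ length is * fact (length is)"
    using cauchy_bounded_uniform by blast
  \<comment> \<open>\<open>Ca * Ra\<close> covers lists of length 0 and 1 together, since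
    \<open>Ra \<ge> 1\<close>; the locale also bounds the first derivatives of \<open>Q\<close> by
    this constant.\<close>
  define C0 where "C0 = Ca * Ra"
  define cc where "cc = max 1 (real CARD('n) * real CARD('n) * C0)"
  have cc: "1 \<le> cc" by (simp add: cc_def)
  \<comment> \<open>Chosen after \<open>l\<close> and \<open>cc\<close>, which are tied to the ball
    of radius \<open>\<rho>\<close>: a smaller lens only shrinks the set on which those bounds are
    used. The bound \<open>\<rho> / 2\<close> is due to the support lying in the ball of radius
    \<open>2 * r\<close>.\<close>
  define r where "r = min (min 1 (\<rho> / 2)) (l / (96 * cc\<^sup>2))"
  have r: "0 < r" "r \<le> 1" using \<rho> l cc by (auto simp: r_def)
  have rc: "96 * r * cc\<^sup>2 \<le> l"
  proof -
    have "r * (96 * cc\<^sup>2) \<le> l / (96 * cc\<^sup>2) * (96 * cc\<^sup>2)" by (intro mult_right_mono) (auto simp: r_def)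
    then show ?thesis using cc by (simp add: mult_ac)
  qed
  have supp: "wt_supp k0 r \<subseteq> cball 0 \<rho>"
  proof -
    have "2 * r \<le> \<rho>" by (simp add: r_def)
    then show ?thesis using wt_supp_subset_cball[OF r, of k0] by auto
  qed
  have C0: "cmod (f x) \<le> C0" "cmod (pd i f x) \<le> C0" if "f \<in> S" "x \<in> wt_supp k0 r" for f i x
  proof -
    have "Ca * 1 \<le> C0" unfolding C0_def using Ca by (intro mult_left_mono) auto
    then show "cmod (f x) \<le> C0" "cmod (pd i f x) \<le> C0"
      using C[OF that(1), of x "[]"] C[OF that(1), of x "[i]"] supp that(2) by (auto simp: C0_def)
  qed
  have inS: "A \<in> S" "Cc \<in> S" "Q j k \<in> S" "B j \<in> S" for j k by (auto simp: S_def)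
  note Cs = C0(1)[OF inS(1)] C0(1)[OF inS(2)] C0(1)[OF inS(3)] C0(2)[OF inS(3)] C0(1)[OF inS(4)]
  have Qreal: "Im (Q j k x) = 0" if "x \<in> U" for j k x
    unfolding Q_def by (rule sym_coeff_real) (rule assms(7)[OF that])
  interpret lens_operator U k0 \<sigma> r l cc C0 A Cc Q B
  proof
    fix x :: "real^'n" and z :: "'n \<Rightarrow> complex" assume x: "x \<in> wt_supp k0 r"
    define v where "v = vec_lambda (\<lambda>j. if j = k0 then 0 else Re (z j))"
    define w where "w = vec_lambda (\<lambda>j. if j = k0 then 0 else Im (z j))"
    have "(norm v)\<^sup>2 + (norm w)\<^sup>2 = (\<Sum>j\<in>UNIV - {k0}. (cmod (z j))\<^sup>2)"
      by (simp add: v_def w_def norm_sq_split[of _ k0] cmod_power2 sum.distrib)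
    moreover have "Re (\<Sum>j\<in>UNIV - {k0}. \<Sum>k\<in>UNIV - {k0}. Q j k x * z k * cnj (z j))
        = Re (prin_symbol k0 q x v) + Re (prin_symbol k0 q x w)"
    proof -
      have "x \<in> U" using x supp \<rho>(2) by blast
      then show ?thesis
        using Re_hermitian_form[where Q = Q and x = x and ?k0.0 = k0 and z = z] Qreal
        unfolding v_def w_def Q_def prin_symbol_sym_coeff by blast
    qed
    moreover have "l * (norm v)\<^sup>2 \<le> \<sigma> * Re (prin_symbol k0 q x v)" "l * (norm w)\<^sup>2 \<le> \<sigma> * Re (prin_symbol k0 q x w)"
      using x supp by (auto intro!: ell simp: v_def w_def)
    ultimately show "l * (\<Sum>j\<in>UNIV - {k0}. (cmod (z j))\<^sup>2) \<le> \<sigma> * Re (\<Sum>j\<in>UNIV - {k0}. \<Sum>k\<in>UNIV - {k0}. Q j k x * z k * cnj (z j))"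
      by (simp only: distrib_left flip: \<open>(norm v)\<^sup>2 + (norm w)\<^sup>2 = _\<close>)
  next
    show "Q j k = Q k j" for j k by (simp add: Q_def sym_coeff_def add.commute)
  next
    show "wt_supp k0 r \<subseteq> U" using supp \<rho>(2) by blast
    show "real CARD('n) * real CARD('n) * C0 \<le> cc" by (simp add: cc_def)
  qed (rule opU \<sigma> r smooth Qreal Cs l cc rc; assumption?)+
  \<comment> \<open>The neighbourhood depends on the operator only and is fixed before
    \<open>u\<close> is given.\<close>
  define U' where "U' = {x. 0 < wt k0 \<sigma> r x}"
  have "open U'" unfolding U'_def by (intro open_Collect_less continuous_on_const wt_cont)
  moreover have "0 \<in> U'" using r by (simp add: U'_def wt_def lens_def tang_def)
  moreover have "U' \<subseteq> U" using wt_pos(1)[OF \<sigma> r] supp \<rho>(2) by (auto simp: U'_def)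
  moreover have "real_analytic_on U' u" if u: "smooth_on U u" and P: "real_analytic_on U (Pop k0 a q b c u)" for u
  proof -
    have sP: "smooth_on U (Pop k0 a q b c u)" by (rule real_analytic_imp_smooth[OF opU P])
    have eq: "- 1 * Pop k0 a q b c u x = Lop u x" if "x \<in> U" for x
      unfolding Lop_def unfolding A_def B_def Cc_def Q_def by (rule Pop_eq[OF opU u that, symmetric])
    have sL: "smooth_on U (Lop u)" by (rule smooth_on_cong[OF opU cm[OF sP] eq])
    have "cauchy_bounded (cball 0 \<rho>) (\<lambda>x. - 1 * Pop k0 a q b c u x)"
      by (rule cauchy_bounded_cmult[OF opU \<rho>(2) sP cb[OF P]])
    then obtain Cf Rf where Cf: "0 < Cf" "0 < Rf"
      "\<And>is x. x \<in> cball 0 \<rho> \<Longrightarrow> cmod (pds is (\<lambda>x. - 1 * Pop k0 a q b c u x) x) \<le> Cf * Rf ^ length is * fact (length is)"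
      unfolding cauchy_bounded_def by blast
    have F: "cmod (pds is (Lop u) x) \<le> Cf * Rf ^ length is * fact (length is)" if "x \<in> wt_supp k0 r" for "is" x
    proof -
      have "x \<in> U" using that supp \<rho>(2) by blast
      then have "pds is (\<lambda>x. - 1 * Pop k0 a q b c u x) x = pds is (Lop u) x" by (intro pds_cong[OF opU eq])
      then show ?thesis using Cf(3)[of x "is"] that supp by auto
    qed
    show ?thesis unfolding U'_def
      by (rule real_analytic_wt_pos[OF u Ca C _ _ sL F]) (use supp Cf in \<open>auto simp: S_def\<close>)
  qed
  ultimately show ?thesis by blast
qed

end
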